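(* Let $k\ge1$ and $n\ge 4$ be integers. If $[n]^{*k+1}$ embeds into a $2k$-manifold $M$, then $$\beta_k(M)\ \ge\ \frac{(n-3)^2}{2^k}.$$ In particular, $\beta_k(M)\gtrsim \frac{n^2}{2^k}$ as $n\to\infty$ for fixed $k\ge1$.
   Context: $[n]=\{1,\dots,n\}$. $[n]^{*k+1}$ is the $k$-dimensional simplicial complex with vertex set $[k+1]\times[n]$ in which every set of $k+1$ vertices $(1,a_1),\dots,(k+1,a_{k+1})$ (one vertex from each "line" $\{i\}\times[n]$) spans a $k$-face (together with all its subfaces); for $k=1$ this is $K_{n,n}$. Manifolds are PL and may have boundary; embeddings are PL. $\beta_k(M):=\dim_{\mathbb{Z}_2}H_k(M;\mathbb{Z}_2)$. *)

theory Defs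
  imports "HOL-Analysis.Analysis" "HOL-Homology.Homology" "HOL-Library.Z2"
begin

text \<open>An abstract simplicial complex is given by its set of nonempty finite faces; points of the
  realization are written in barycentric coordinates, indexed by the vertices.\<close>

definition geometric_realization :: "'v set set \<Rightarrow> ('v \<Rightarrow> real) set" where
  "geometric_realization K =
     {x. \<exists>\<sigma>\<in>K. (\<forall>v\<in>\<sigma>. 0 \<le> x v) \<and> (\<forall>v. v \<notin> \<sigma> \<longrightarrow> x v = 0) \<and> (\<Sum>v\<in>\<sigma>. x v) = 1}"

text \<open>The complex \<open>[n]\<^sup>*\<^sup>k\<^sup>+\<^sup>1\<close>.\<close>

definition join_power :: "nat \<Rightarrow> nat \<Rightarrow> (nat \<times> nat) set set" where
  "join_power n k =
     {\<sigma>. \<sigma> \<noteq> {} \<and> (\<exists>a \<in> {1..k+1} \<rightarrow> {1..n}. \<sigma> \<subseteq> (\<lambda>i. (i, a i)) ` {1..k+1})}"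

text \<open>Every point of \<open>S\<close> has a neighbourhood in \<open>S\<close> covered by finitely many (possibly degenerate)
  affine simplices contained in \<open>S\<close>, on each of which \<open>f\<close> is affine.\<close>

definition piecewise_linear_on ::
    "('i \<Rightarrow> real) set \<Rightarrow> (('i \<Rightarrow> real) \<Rightarrow> ('j \<Rightarrow> real)) \<Rightarrow> bool" where
  "piecewise_linear_on S f \<longleftrightarrow>
     (\<forall>x\<in>S. \<exists>N L. openin (subtopology (powertop_real UNIV) S) N \<and> x \<in> N \<and>
        finite L \<and> N \<subseteq> (\<Union>(p,l)\<in>L. oriented_simplex p l ` standard_simplex p) \<and>
        (\<forall>(p,l)\<in>L. oriented_simplex p l ` standard_simplex p \<subseteq> S \<and>
           (\<forall>t\<in>standard_simplex p. f (oriented_simplex p l t) = oriented_simplex p (f \<circ> l) t)))"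

definition half_space :: "nat \<Rightarrow> (nat \<Rightarrow> real) topology" where
  "half_space m = subtopology (Euclidean_space m) {x. 0 \<le> x 0}"

definition is_chart :: "nat \<Rightarrow> 'a topology \<Rightarrow> 'a set \<times> ('a \<Rightarrow> nat \<Rightarrow> real) \<Rightarrow> bool" where
  "is_chart m X = (\<lambda>(U, \<phi>). openin X U \<and> openin (half_space m) (\<phi> ` U) \<and>
     homeomorphic_map (subtopology X U) (subtopology (half_space m) (\<phi> ` U)) \<phi>)"

text \<open>No compactness or connectedness is assumed.  The atlas need not be maximal.\<close>

definition PL_manifold :: "nat \<Rightarrow> 'a topology \<Rightarrow> ('a set \<times> ('a \<Rightarrow> nat \<Rightarrow> real)) set \<Rightarrow> bool" where
  "PL_manifold m X \<A> \<longleftrightarrow>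
     Hausdorff_space X \<and> second_countable X \<and>
     (\<forall>c\<in>\<A>. is_chart m X c) \<and> (\<Union>(U,\<phi>)\<in>\<A>. U) = topspace X \<and>
     (\<forall>(U,\<phi>)\<in>\<A>. \<forall>(V,\<psi>)\<in>\<A>. piecewise_linear_on (\<phi> ` (U \<inter> V)) (\<psi> \<circ> inv_into U \<phi>))"

definition PL_embedding :: "'v set set \<Rightarrow> 'a topology \<Rightarrow>
    ('a set \<times> ('a \<Rightarrow> nat \<Rightarrow> real)) set \<Rightarrow> (('v \<Rightarrow> real) \<Rightarrow> 'a) \<Rightarrow> bool" where
  "PL_embedding K X \<A> f \<longleftrightarrow>
     embedding_map (subtopology (powertop_real UNIV) (geometric_realization K)) X f \<and>
     (\<forall>(U,\<phi>)\<in>\<A>. piecewise_linear_on {x \<in> geometric_realization K. f x \<in> U} (\<phi> \<circ> f))"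

definition PL_embeds :: "'v set set \<Rightarrow> 'a topology \<Rightarrow>
    ('a set \<times> ('a \<Rightarrow> nat \<Rightarrow> real)) set \<Rightarrow> bool" where
  "PL_embeds K X \<A> \<longleftrightarrow> (\<exists>f. PL_embedding K X \<A> f)"

type_synonym 'a chain2 = "((nat \<Rightarrow> real) \<Rightarrow> 'a) \<Rightarrow>\<^sub>0 bit"

definition scale2 :: "bit \<Rightarrow> ('b \<Rightarrow>\<^sub>0 bit) \<Rightarrow> ('b \<Rightarrow>\<^sub>0 bit)" where
  "scale2 a = Poly_Mapping.map ((*) a)"

definition singular_chain2 :: "nat \<Rightarrow> 'a topology \<Rightarrow> 'a chain2 \<Rightarrow> bool" where
  "singular_chain2 p X c \<longleftrightarrow> Poly_Mapping.keys c \<subseteq> singular_simplex_set p X"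

text \<open>Over the field with two elements every key has coefficient 1, and signs play no role.\<close>

definition chain_boundary2 :: "nat \<Rightarrow> 'a chain2 \<Rightarrow> 'a chain2" where
  "chain_boundary2 p c =
     (if p = 0 then 0
      else \<Sum>f\<in>Poly_Mapping.keys c. \<Sum>i\<le>p. Poly_Mapping.single (singular_face p i f) 1)"

definition cycles2 :: "nat \<Rightarrow> 'a topology \<Rightarrow> 'a chain2 set" where
  "cycles2 p X = {c. singular_chain2 p X c \<and> chain_boundary2 p c = 0}"

definition boundaries2 :: "nat \<Rightarrow> 'a topology \<Rightarrow> 'a chain2 set" where
  "boundaries2 p X = chain_boundary2 (Suc p) ` {d. singular_chain2 (Suc p) X d}"

text \<open>The dimension, in \<open>{0, 1, \<dots>, \<infinity>}\<close>, of the homology space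
  \<open>cycles2 p X / boundaries2 p X\<close>: the supremum of the sizes of finite sets of cycles whose
  homology classes form a linearly independent family (a linear combination of classes is zero
  in the quotient iff the same combination of representatives is a boundary).\<close>

definition homology_independent2 :: "nat \<Rightarrow> 'a topology \<Rightarrow> 'a chain2 set \<Rightarrow> bool" where
  "homology_independent2 p X S \<longleftrightarrow> S \<subseteq> cycles2 p X \<and>
     (\<forall>u. (\<Sum>c\<in>S. scale2 (u c) c) \<in> boundaries2 p X \<longrightarrow> (\<forall>c\<in>S. u c = 0))"

definition betti2 :: "nat \<Rightarrow> 'a topology \<Rightarrow> enat" where
  "betti2 p X = (SUP S \<in> {S. finite S \<and> homology_independent2 p X S}. enat (card S))"

end

theory Submission
  imports Defs
begin

text \<open>
  Only the topological embedding \<open>f\<close> matters. Let \<open>m = n - 1\<close>. For two points \<open>x = (a, b)\<close>, \<open>y = (c, d)\<close> of \<open>[m]\<^sup>2\<close>, take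
  on the two last lines the \<open>0\<close>-cycles \<open>{*, a}\<close>, \<open>{*, b}\<close> on the first factor and \<open>{*, c}\<close>, \<open>{*, d}\<close> on the second, and
  on each other line the symmetric tensor \<open>u \<otimes> v + v \<otimes> u\<close> with \<open>u = {1, 2}\<close>, \<open>v = {1, 3}\<close>. The image of this
  \<open>2k\<close>-cycle of pairs in \<open>M \<times> M\<close> has a value \<open>B x y\<close> under the Thom class modulo two of the diagonal. This class is
  built on finite unions of boxes in charts by a Mayer-Vietoris argument.

  Cycles of pairs of disjoint simplices have value \<open>0\<close>, which gives \<open>B x y = s a c + t b d\<close> whenever \<open>a \<noteq> c\<close> and
  \<open>b \<noteq> d\<close>. Moreover \<open>t b d + t d b = 1\<close>: shrinking towards the one vertex that the two factors share, this is
  the degree of an antipodal map of a sphere, which is odd by Borsuk's theorem.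

  Expanding the symmetric tensors writes \<open>B\<close> as a sum of \<open>2\<^sup>k\<^sup>-\<^sup>1\<close> forms that factor through \<open>H\<^sub>k(M)\<close>, so \<open>B\<close> has
  rank at most \<open>r = 2\<^sup>k\<^sup>-\<^sup>1 \<beta>\<close>. A form as above satisfies \<open>m\<^sup>2 \<le> 2 r + 2 m\<close>. Otherwise some nonzero polynomial vector
  \<open>x\<close> over the field with two elements, in variables \<open>\<lambda>\<^sub>b\<close>, has zero row and column sums and is annihilated by the
  \<open>r\<close> right factors of \<open>B\<close>, and by the left ones after multiplication by \<open>\<lambda>\<close>. The resulting relation for
  \<open>B\<close> weighted by \<open>\<lambda>\<^sub>b + \<lambda>\<^sub>d\<close> becomes \<open>\<Sum>\<^sub>b \<lambda>\<^sub>b x\<^sub>a\<^sub>b\<^sup>2 = 0\<close> for every \<open>a\<close>, which forces \<open>x = 0\<close>.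
\<close>

section \<open>Chains modulo two\<close>

text \<open>The entries of \<open>B\<close> with \<open>a = c\<close> or \<open>b = d\<close> depend
  on the embedding, so its rank must be bounded without knowing them. Each condition in the rank
  argument removes one kind of term: the weight is zero for \<open>b = d\<close>, symmetry cancels
  the terms with \<open>a = c\<close>, zero row sums remove \<open>s\<close>, and zero column sums
  turn what remains into a quadratic expression in the single row \<open>a\<close>. The tensors on
  the lower lines are symmetric so that the pairs sharing the top vertex form a chain invariant
  under exchange of the factors. This turns the local number at that vertex into the degree of an
  odd map, without any general position argument. Coefficients modulo two avoid orientations and
  signs: the cross product is then strictly symmetric. A Thom class on finite unions of boxes is
  enough, because all chains involved have compact support. The constant: \<open>2 * r\<close> is
  \<open>2 ^ k\<close> times the Betti number, and \<open>m * m - 2 * m = (n - 1) * (n - 3)\<close>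
  is at least the square of \<open>n - 3\<close>.\<close>

lemma chain2_add_self [simp]: "(a :: 'b \<Rightarrow>\<^sub>0 bit) + a = 0"
  by (rule poly_mapping_eqI) (simp add: lookup_add)

lemma chain2_add_self_left [simp]: "(a :: 'b \<Rightarrow>\<^sub>0 bit) + (a + b) = b"
  by (metis add.assoc add_0 chain2_add_self)

lemma chain2_eq_iff: "(a :: 'b \<Rightarrow>\<^sub>0 bit) = b \<longleftrightarrow> a + b = 0"
  by (metis add.right_neutral chain2_add_self chain2_add_self_left)

section \<open>Linear extension to chains modulo two, a chain being the sum of its support\<close>

definition lext :: "('a \<Rightarrow> 'b::comm_monoid_add) \<Rightarrow> ('a \<Rightarrow>\<^sub>0 bit) \<Rightarrow> 'b" where
  "lext h c = (\<Sum>x\<in>Poly_Mapping.keys c. h x)"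

abbreviation sgl :: "'a \<Rightarrow> 'a \<Rightarrow>\<^sub>0 bit" where "sgl x \<equiv> Poly_Mapping.single x 1"

lemma lext_0 [simp]: "lext h 0 = 0"
  by (simp add: lext_def)

lemma lext_single [simp]: "lext h (sgl x) = h x"
  by (simp add: lext_def)

lemma keys_add_bit:
  "Poly_Mapping.keys (c + d :: 'a \<Rightarrow>\<^sub>0 bit) =
     (Poly_Mapping.keys c - Poly_Mapping.keys d) \<union> (Poly_Mapping.keys d - Poly_Mapping.keys c)"
  by (auto simp: in_keys_iff lookup_add)

text \<open>A simplex in both supports drops out of \<open>c + d\<close> and is counted twice on the
  right, where \<open>h x + h x = 0\<close> removes it.\<close>

lemma lext_add_gen:
  fixes h :: "'a \<Rightarrow> 'b::comm_monoid_add"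
  assumes "\<And>x. h x + h x = 0"
  shows "lext h (c + d) = lext h c + lext h d"
proof -
  let ?C = "Poly_Mapping.keys c" and ?D = "Poly_Mapping.keys d"
  have f: "finite ?C" "finite ?D" by auto
  have "sum h ?C = sum h (?C - ?D) + sum h (?C \<inter> ?D)"
    using sum.Int_Diff[OF f(1), of h ?D] by (simp add: add.commute)
  moreover have "sum h ?D = sum h (?D - ?C) + sum h (?C \<inter> ?D)"
    using sum.Int_Diff[OF f(2), of h ?C] by (simp add: add.commute Int_commute)
  moreover have "sum h (?C \<inter> ?D) + sum h (?C \<inter> ?D) = 0"
    by (simp add: assms flip: sum.distrib)
  moreover have "lext h (c + d) = sum h (?C - ?D) + sum h (?D - ?C)"
    unfolding lext_def keys_add_bit by (rule sum.union_disjoint) auto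
  ultimately show ?thesis unfolding lext_def
    by (metis (no_types, lifting) ab_semigroup_add_class.add_ac(1) add.commute add.right_neutral)
qed

lemma lext_add: "lext h (c + d) = lext h c + lext h d" for h :: "'a \<Rightarrow> ('b \<Rightarrow>\<^sub>0 bit)"
  by (rule lext_add_gen) simp

lemma additive_sum:
  assumes "\<And>a b. T (a + b) = T a + T b" "T 0 = 0"
  shows "T (sum f I) = (\<Sum>i\<in>I. T (f i))"
  by (induction I rule: infinite_finite_induct) (auto simp: assms)

lemma lext_sum: "lext h (sum f I) = (\<Sum>i\<in>I. lext h (f i))" for h :: "'a \<Rightarrow> ('b \<Rightarrow>\<^sub>0 bit)"
  by (rule additive_sum) (auto simp: lext_add)

lemma chain2_sum_single: "c = (\<Sum>x\<in>Poly_Mapping.keys c. sgl x)" for c :: "'a \<Rightarrow>\<^sub>0 bit"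
proof (rule poly_mapping_eqI)
  fix k
  have "Poly_Mapping.lookup (\<Sum>x\<in>Poly_Mapping.keys c. sgl x) k = (\<Sum>x\<in>Poly_Mapping.keys c. if x = k then 1 else 0)"
    by (subst lookup_sum) (auto simp: lookup_single when_def intro!: sum.cong)
  also have "\<dots> = Poly_Mapping.lookup c k" by (auto simp: in_keys_iff)
  finally show "Poly_Mapping.lookup c k = Poly_Mapping.lookup (\<Sum>x\<in>Poly_Mapping.keys c. sgl x) k" by simp
qed

lemma lext_sgl [simp]: "lext sgl c = c"
  unfolding lext_def by (rule chain2_sum_single[symmetric])

lemma chain2_induct [case_names zero single add]:
  assumes "P 0" "\<And>x. x \<in> Poly_Mapping.keys c \<Longrightarrow> P (sgl x)" "\<And>a b. P a \<Longrightarrow> P b \<Longrightarrow> P (a + b)"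
  shows "P (c :: 'a \<Rightarrow>\<^sub>0 bit)"
proof -
  have "P (\<Sum>x\<in>A. sgl x)" if "finite A" "A \<subseteq> Poly_Mapping.keys c" for A
    using that by (induction A rule: finite_induct) (auto intro: assms)
  from this[of "Poly_Mapping.keys c"] show ?thesis using chain2_sum_single[of c] by simp
qed

lemma lext_lext:
  "lext h (lext g c) = lext (\<lambda>x. lext h (g x)) c" for h :: "'a \<Rightarrow> ('b \<Rightarrow>\<^sub>0 bit)"
  unfolding lext_def[of g] lext_def[of "\<lambda>x. lext h (g x)"] by (rule lext_sum)

lemma lext_cong: "(\<And>x. x \<in> Poly_Mapping.keys c \<Longrightarrow> h x = g x) \<Longrightarrow> lext h c = lext g c"
  by (simp add: lext_def)

lemma lext_add_fun: "lext (\<lambda>x. h x + g x) c = lext h c + lext g c"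
  by (simp add: lext_def sum.distrib)

lemma lext_swap: "lext (\<lambda>x. lext (\<lambda>y. h x y) d) c = lext (\<lambda>y. lext (\<lambda>x. h x y) c) d"
  unfolding lext_def by (rule sum.swap)

lemma keys_lext: "Poly_Mapping.keys (lext h c) \<subseteq> (\<Union>x\<in>Poly_Mapping.keys c. Poly_Mapping.keys (h x))"
  for h :: "'a \<Rightarrow> ('b \<Rightarrow>\<^sub>0 bit)"
  unfolding lext_def by (rule keys_sum)

section \<open>Reduction of integral chains modulo two\<close>

definition red :: "('a \<Rightarrow>\<^sub>0 int) \<Rightarrow> ('a \<Rightarrow>\<^sub>0 bit)" where
  "red = Poly_Mapping.map of_int"

text \<open>A section of \<open>red\<close> with coefficients 0 and 1; it is not additive. An
  operator \<open>T\<close> on integral chains is carried over to chains modulo two as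
  \<open>red (T (lft c))\<close>.\<close>

definition lft :: "('a \<Rightarrow>\<^sub>0 bit) \<Rightarrow> ('a \<Rightarrow>\<^sub>0 int)" where
  "lft = Poly_Mapping.map (\<lambda>b. if b = 0 then 0 else 1)"

lemma lookup_red: "Poly_Mapping.lookup (red c) x = of_int (Poly_Mapping.lookup c x)"
  by (simp add: red_def Poly_Mapping.map.rep_eq when_def)

lemma lookup_lft: "Poly_Mapping.lookup (lft c) x = (if Poly_Mapping.lookup c x = 0 then 0 else 1)"
  by (simp add: lft_def Poly_Mapping.map.rep_eq when_def)

lemma red_lft [simp]: "red (lft c) = c"
  by (rule poly_mapping_eqI) (auto simp: lookup_red lookup_lft)

lemma red_add: "red (a + b) = red a + red b"
  by (rule poly_mapping_eqI) (simp add: lookup_red lookup_add)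

lemma red_0 [simp]: "red 0 = 0"
  by (rule poly_mapping_eqI) (simp add: lookup_red)

lemma red_uminus: "red (- a) = red a"
  by (rule poly_mapping_eqI) (simp add: lookup_red)

lemma red_diff: "red (a - b) = red a + red b"
  by (metis diff_conv_add_uminus red_add red_uminus)

lemma red_frag_of [simp]: "red (frag_of x) = sgl x"
  by (rule poly_mapping_eqI) (simp add: lookup_red lookup_single when_def)

lemma of_int_minus_one_power_bit: "of_int ((-1) ^ k) = (1::bit)"
  by (induction k) auto

lemma red_cmul_sign: "red (frag_cmul ((-1) ^ k) a) = red a"
  by (rule poly_mapping_eqI)
     (simp add: lookup_red of_int_minus_one_power_bit del: of_int_power)

lemma red_eq_0: "red c = 0 \<Longrightarrow> \<exists>w. c = w + w"
proof
  assume "red c = 0"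
  then have of0: "of_int (Poly_Mapping.lookup c x) = (0::bit)" for x
    by (metis lookup_red lookup_zero)
  have ev: "even (Poly_Mapping.lookup c x)" for x
  proof (rule ccontr)
    assume "odd (Poly_Mapping.lookup c x)"
    then obtain q where "Poly_Mapping.lookup c x = q + q + 1" by (metis mult_2 oddE)
    with of0[of x] show False by simp
  qed
  show "c = Poly_Mapping.map (\<lambda>n. n div 2) c + Poly_Mapping.map (\<lambda>n. n div 2) c"
    using ev by (intro poly_mapping_eqI) (simp add: lookup_add Poly_Mapping.map.rep_eq when_def)
qed

text \<open>The chains \<open>lft (red c)\<close> and \<open>c\<close> differ by some
  \<open>w + w\<close>, and an additive \<open>T\<close> makes a double of it again. After reduction
  the choice of the lift is therefore irrelevant, which restores additivity in
  \<open>red_lft_add\<close>.\<close>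

lemma red_transfer:
  fixes T :: "('a \<Rightarrow>\<^sub>0 int) \<Rightarrow> ('b \<Rightarrow>\<^sub>0 int)"
  assumes T: "\<And>a b. T (a - b) = T a - T b"
  shows "red (T (lft (red c))) = red (T c)"
proof -
  have T0: "T 0 = 0" using T[of 0 0] by simp
  have Tm: "T (- b) = - T b" for b using T[of 0 b] T0 by simp
  have Ta: "T (a + b) = T a + T b" for a b using T[of a "- b"] Tm by simp
  have "red (lft (red c) - c) = 0" by (simp add: red_diff)
  then obtain w where "lft (red c) - c = w + w" using red_eq_0 by blast
  then have "T (lft (red c)) = T c + (T w + T w)"
    by (metis Ta add.commute diff_add_cancel)
  then show ?thesis by (simp add: red_add)
qed

lemma red_lft_add:
  fixes T :: "('a \<Rightarrow>\<^sub>0 int) \<Rightarrow> ('b \<Rightarrow>\<^sub>0 int)"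
  assumes T: "\<And>a b. T (a - b) = T a - T b"
  shows "red (T (lft (a + b))) = red (T (lft a)) + red (T (lft b))"
proof -
  have "red (T (lft (a + b))) = red (T (lft (red (lft a - lft b))))"
    by (simp add: red_diff)
  also have "\<dots> = red (T (lft a)) + red (T (lft b))"
    by (simp only: red_transfer[where T = T, OF T]) (simp only: T red_diff)
  finally show ?thesis .
qed

section \<open>The singular chain complex modulo two\<close>

abbreviation bd :: "nat \<Rightarrow> 'a chain2 \<Rightarrow> 'a chain2" where "bd \<equiv> chain_boundary2"

abbreviation ch :: "nat \<Rightarrow> 'a topology \<Rightarrow> 'a chain2 \<Rightarrow> bool" where "ch \<equiv> singular_chain2"

lemma bd_lext: "bd p c = (if p = 0 then 0 else lext (\<lambda>f. \<Sum>i\<le>p. sgl (singular_face p i f)) c)"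
  by (simp add: chain_boundary2_def lext_def)

lemma bd_0 [simp]: "bd p 0 = 0" and bd_zero_dim [simp]: "bd 0 c = 0"
  by (auto simp: bd_lext)

lemma bd_add: "bd p (a + b) = bd p a + bd p b"
  by (auto simp: bd_lext lext_add)

lemma bd_single: "p > 0 \<Longrightarrow> bd p (sgl f) = (\<Sum>i\<le>p. sgl (singular_face p i f))"
  by (simp add: bd_lext)

lemma red_sum: "red (sum f I) = (\<Sum>i\<in>I. red (f i))"
  by (rule additive_sum) (auto simp: red_add)

lemma red_chain_boundary: "red (chain_boundary p c) = bd p (red c)"
proof -
  have "Poly_Mapping.keys c \<subseteq> UNIV" by simp
  then show ?thesis
  proof (induction c rule: frag_induction)
    case (one f)
    then show ?case
      by (cases "p = 0") (simp_all add: chain_boundary_of red_sum red_cmul_sign bd_single)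
  qed (auto simp: chain_boundary_diff red_diff bd_add)
qed

lemma ch_0 [simp]: "ch p X 0" by (simp add: singular_chain2_def)

lemma ch_add [intro]: "ch p X a \<Longrightarrow> ch p X b \<Longrightarrow> ch p X (a + b)"
  by (auto simp: singular_chain2_def keys_add_bit)

lemma ch_sum: "(\<And>i. i \<in> I \<Longrightarrow> ch p X (f i)) \<Longrightarrow> ch p X (sum f I)"
  by (induction I rule: infinite_finite_induct) auto

lemma ch_single: "ch p X (sgl f) \<longleftrightarrow> singular_simplex p X f"
  by (simp add: singular_chain2_def)

lemma ch_keys: "ch p X c \<Longrightarrow> f \<in> Poly_Mapping.keys c \<Longrightarrow> singular_simplex p X f"
  by (auto simp: singular_chain2_def)

lemma ch_lext: "(\<And>f. f \<in> Poly_Mapping.keys c \<Longrightarrow> ch p X (h f)) \<Longrightarrow> ch p X (lext h c)"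
  unfolding lext_def by (rule ch_sum)

lemma ch_lft: "ch p X c \<longleftrightarrow> singular_chain p X (lft c)"
proof -
  have "Poly_Mapping.keys (lft c) = Poly_Mapping.keys c"
    by (auto simp: in_keys_iff lookup_lft split: if_splits)
  then show ?thesis by (simp add: singular_chain2_def singular_chain_def)
qed

lemma ch_red: "singular_chain p X c \<Longrightarrow> ch p X (red c)"
  unfolding singular_chain2_def singular_chain_def
  by (rule order_trans[of _ "Poly_Mapping.keys c"]) (auto simp: in_keys_iff lookup_red)

lemma ch_mono: "ch p (subtopology X T) c \<Longrightarrow> T \<subseteq> S \<Longrightarrow> ch p (subtopology X S) c"
  unfolding singular_chain2_def using singular_simplex_mono[of p X T _ S] by blast

lemma ch_subtopology:
  "ch p (subtopology X S) c \<longleftrightarrow>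
     ch p X c \<and> (\<forall>f\<in>Poly_Mapping.keys c. f ` standard_simplex p \<subseteq> S)"
  by (fastforce simp: singular_chain2_def singular_simplex_subtopology)

lemma ch_bd: "ch p X c \<Longrightarrow> ch (p - Suc 0) X (bd p c)"
  using ch_red[OF singular_chain_boundary, of p X "lft c"]
  by (simp add: ch_lft[symmetric] red_chain_boundary)

lemma ch_bd_Suc: "ch (Suc p) X c \<Longrightarrow> ch p X (bd (Suc p) c)"
  using ch_bd by fastforce

lemma bd_bd: "ch p X c \<Longrightarrow> bd (p - Suc 0) (bd p c) = 0"
  using chain_boundary_boundary[of p X "lft c"] red_chain_boundary
  by (metis One_nat_def ch_lft red_0 red_lft)

lemma bd_bd_Suc: "ch (Suc p) X c \<Longrightarrow> bd p (bd (Suc p) c) = 0"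
  using bd_bd by fastforce

definition cmap :: "nat \<Rightarrow> ('b \<Rightarrow> 'a) \<Rightarrow> 'b chain2 \<Rightarrow> 'a chain2" where
  "cmap p g = lext (\<lambda>s. sgl (simplex_map p g s))"

lemma cmap_0 [simp]: "cmap p g 0 = 0" by (simp add: cmap_def)
lemma cmap_add: "cmap p g (a + b) = cmap p g a + cmap p g b" by (simp add: cmap_def lext_add)
lemma cmap_single [simp]: "cmap p g (sgl s) = sgl (simplex_map p g s)" by (simp add: cmap_def)
lemma ch_cmap: "ch p X c \<Longrightarrow> continuous_map X Y g \<Longrightarrow> ch p Y (cmap p g c)"
  unfolding cmap_def by (rule ch_lext) (metis ch_single ch_keys singular_simplex_simplex_map)

lemma red_chain_map: "red (chain_map p g c) = cmap p g (red c)"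
proof -
  have "Poly_Mapping.keys c \<subseteq> UNIV" by simp
  then show ?thesis
    by (induction c rule: frag_induction) (auto simp: chain_map_diff red_diff cmap_add)
qed

lemma bd_cmap: "ch p X c \<Longrightarrow> bd p (cmap p g c) = cmap (p - Suc 0) g (bd p c)"
  using chain_boundary_chain_map[of p X "lft c" g] red_chain_boundary red_chain_map
  by (metis ch_lft red_lft)

lemma bd_cmap_Suc: "ch (Suc p) X c \<Longrightarrow> bd (Suc p) (cmap (Suc p) g c) = cmap p g (bd (Suc p) c)"
  using bd_cmap by fastforce

lemma cmap_cong:
  "ch p X c \<Longrightarrow> (\<And>x. x \<in> topspace X \<Longrightarrow> f x = g x) \<Longrightarrow> cmap p f c = cmap p g c"
  unfolding cmap_def
  by (rule lext_cong) (metis ch_keys simplex_map_eq)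

lemma cmap_id: "ch p X c \<Longrightarrow> (\<And>x. x \<in> topspace X \<Longrightarrow> f x = x) \<Longrightarrow> cmap p f c = c"
  unfolding cmap_def
  by (subst lext_cong[where g = sgl]) (auto simp: ch_keys simplex_map_id_gen dest: ch_keys)

lemma cmap_cmap: "cmap p h (cmap p g c) = cmap p (h \<circ> g) c"
  by (simp add: cmap_def lext_lext simplex_map_compose)

text \<open>The summand of a chain on the simplices that satisfy \<open>P\<close>; it serves to cut
  up chains that are subordinate to a cover.\<close>

definition part :: "('a \<Rightarrow> bool) \<Rightarrow> ('a \<Rightarrow>\<^sub>0 bit) \<Rightarrow> ('a \<Rightarrow>\<^sub>0 bit)" where
  "part P = lext (\<lambda>x. if P x then sgl x else 0)"

lemma lookup_part: "Poly_Mapping.lookup (part P c) x = (if P x then Poly_Mapping.lookup c x else 0)"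
proof -
  have "part P c = (\<Sum>y\<in>Poly_Mapping.keys c. if P y then sgl y else 0)"
    by (simp add: part_def lext_def)
  then have "Poly_Mapping.lookup (part P c) x = (\<Sum>y\<in>Poly_Mapping.keys c. if y = x \<and> P x then 1 else 0)"
    by (simp add: lookup_sum) (auto simp: lookup_single when_def intro!: sum.cong)
  also have "\<dots> = (if P x then Poly_Mapping.lookup c x else 0)" by (auto simp: in_keys_iff)
  finally show ?thesis .
qed

lemma keys_part [simp]: "Poly_Mapping.keys (part P c) = {x \<in> Poly_Mapping.keys c. P x}"
  by (auto simp: in_keys_iff lookup_part split: if_splits)

lemma part_add_part: "part P c + part (\<lambda>x. \<not> P x) c = c"
  by (rule poly_mapping_eqI) (auto simp: lookup_add lookup_part)

lemma ch_part: "ch p X c \<Longrightarrow> ch p X (part P c)"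
  by (auto simp: singular_chain2_def)

section \<open>Subdivision and small chains\<close>

text \<open>\<open>T\<close> is an iterated barycentric subdivision and \<open>H\<close> its chain
  homotopy to the identity. The number of iterations is chosen for the one chain \<open>c\<close>;
  all other properties hold for every space \<open>Y\<close>, so both operators respect subspaces,
  as relative arguments require.\<close>

lemma small_chain_operators:
  fixes c :: "'a chain2"
  assumes cov: "\<And>U. U \<in> \<C> \<Longrightarrow> openin X U" "topspace X \<subseteq> \<Union>\<C>"
    and c: "ch p X c"
  obtains T H :: "nat \<Rightarrow> 'a chain2 \<Rightarrow> 'a chain2" where
    "\<And>q a b. T q (a + b) = T q a + T q b" "\<And>q a b. H q (a + b) = H q a + H q b"
    "\<And>q Y a. ch q Y a \<Longrightarrow> ch q Y (T q a)"
    "\<And>q Y a. ch q Y a \<Longrightarrow> ch (Suc q) Y (H q a)"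
    "\<And>q Y a. ch q Y a \<Longrightarrow> bd (Suc q) (H q a) + H (q - Suc 0) (bd q a) = T q a + a"
    "\<And>q Y a. ch q Y a \<Longrightarrow> bd q (T q a) = T (q - Suc 0) (bd q a)"
    "\<And>f. f \<in> Poly_Mapping.keys (T p c) \<Longrightarrow> \<exists>V\<in>\<C>. f ` standard_simplex p \<subseteq> V"
proof -
  have lc: "singular_chain p X (lft c)" using c by (simp add: ch_lft)
  from sufficient_iterated_singular_subdivision_exists[OF cov this]
  obtain n where n: "\<And>m f. \<lbrakk>n \<le> m; f \<in> Poly_Mapping.keys ((singular_subdivision p ^^ m) (lft c))\<rbrakk>
                      \<Longrightarrow> \<exists>V \<in> \<C>. f \<in> (standard_simplex p) \<rightarrow> V" by blast
  define S where "S = (\<lambda>q. (singular_subdivision q ^^ n) :: 'a chain \<Rightarrow> 'a chain)"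
  obtain h where h:
        "\<And>p. h p 0 = (0 :: 'a chain)"
        "\<And>p c1 c2. h p (c1-c2) = h p c1 - h p c2"
        "\<And>p X c. singular_chain p X c \<Longrightarrow> singular_chain (Suc p) X (h p c)"
        "\<And>p X c. singular_chain p X c
                 \<Longrightarrow> chain_boundary (Suc p) (h p c) + h (p - Suc 0) (chain_boundary p c)
                   = (singular_subdivision p ^^ n) c - c"
    using chain_homotopic_iterated_singular_subdivision by metis
  have Sd: "S q (a - b) = S q a - S q b" for q a b
    unfolding S_def by (rule singular_subdivision_power_diff)
  have Sch: "singular_chain q Y a \<Longrightarrow> singular_chain q Y (S q a)" for q Y and a :: "'a chain"
    unfolding S_def by (induction n) (auto simp: singular_chain_singular_subdivision)
  have Sbd: "singular_chain q Y a \<Longrightarrow> chain_boundary q (S q a) = S (q - Suc 0) (chain_boundary q a)"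
    for q Y and a :: "'a chain"
  proof -
    assume a: "singular_chain q Y a"
    have "singular_chain q Y ((singular_subdivision q ^^ m) a) \<and>
      chain_boundary q ((singular_subdivision q ^^ m) a) = (singular_subdivision (q - Suc 0) ^^ m) (chain_boundary q a)" for m
      using a by (induction m) (auto simp: singular_chain_singular_subdivision chain_boundary_singular_subdivision)
    then show ?thesis by (simp add: S_def)
  qed
  define T where "T = (\<lambda>q a. red (S q (lft a)))"
  define H where "H = (\<lambda>q a. red (h q (lft a)))"
  show thesis
  proof (rule that[of T H])
    show "T q (a + b) = T q a + T q b" for q a b
      unfolding T_def by (rule red_lft_add) (rule Sd)
    show "H q (a + b) = H q a + H q b" for q a b
      unfolding H_def by (rule red_lft_add) (rule h)
    show "ch q Y (T q a)" if "ch q Y a" for q Y a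
      using that unfolding T_def ch_lft by (metis Sch ch_lft ch_red)
    show "ch (Suc q) Y (H q a)" if "ch q Y a" for q Y a
      using that unfolding H_def ch_lft by (metis h(3) ch_lft ch_red)
    \<comment> \<open>Lifting does not commute with the boundary, but the two results agree modulo
      two, which is all that survives \<open>red\<close> by \<open>red_transfer\<close>.\<close>
    have bdl: "red (G (lft (bd q a))) = red (G (chain_boundary q (lft a)))"
      if "\<And>x y. G (x - y) = G x - G y" for G :: "'a chain \<Rightarrow> 'a chain" and q a
      using red_transfer[where T = G and c = "chain_boundary q (lft a)", OF that]
      by (simp add: red_chain_boundary)
    show "bd (Suc q) (H q a) + H (q - Suc 0) (bd q a) = T q a + a" if a: "ch q Y a" for q Y a
    proof -
      have "H (q - Suc 0) (bd q a) = red (h (q - Suc 0) (chain_boundary q (lft a)))"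
        unfolding H_def by (rule bdl) (rule h)
      moreover have "bd (Suc q) (H q a) = red (chain_boundary (Suc q) (h q (lft a)))"
        unfolding H_def by (simp add: red_chain_boundary)
      ultimately have "bd (Suc q) (H q a) + H (q - Suc 0) (bd q a)
          = red (chain_boundary (Suc q) (h q (lft a)) + h (q - Suc 0) (chain_boundary q (lft a)))"
        by (simp add: red_add)
      also have "\<dots> = red (S q (lft a) - lft a)"
        unfolding S_def using h(4)[of q Y "lft a"] a by (simp add: ch_lft)
      finally show ?thesis by (simp add: T_def red_diff)
    qed
    show "bd q (T q a) = T (q - Suc 0) (bd q a)" if a: "ch q Y a" for q Y a
    proof -
      have "T (q - Suc 0) (bd q a) = red (S (q - Suc 0) (chain_boundary q (lft a)))"
        unfolding T_def by (rule bdl) (rule Sd)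
      also have "\<dots> = red (chain_boundary q (S q (lft a)))"
        using Sbd[of q Y "lft a"] a by (simp add: ch_lft)
      finally show ?thesis by (simp add: T_def red_chain_boundary)
    qed
    show "\<exists>V\<in>\<C>. f ` standard_simplex p \<subseteq> V" if "f \<in> Poly_Mapping.keys (T p c)" for f
    proof -
      have "f \<in> Poly_Mapping.keys (S p (lft c))"
        using that by (auto simp: T_def in_keys_iff lookup_red)
      then obtain V where "V \<in> \<C>" "f \<in> standard_simplex p \<rightarrow> V"
        using n[of n f] unfolding S_def by blast
      then show ?thesis by (auto simp: Pi_iff)
    qed
  qed
qed

section \<open>Relative cycles and boundaries\<close>

text \<open>Relative cycles of the pair \<open>(P, Q)\<close> of subspaces. In degree 0 the
  truncated subtraction is harmless, because \<open>bd 0\<close> is zero.\<close>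

definition relcyc :: "nat \<Rightarrow> 'a topology \<Rightarrow> 'a set \<Rightarrow> 'a set \<Rightarrow> 'a chain2 \<Rightarrow> bool" where
  "relcyc p X P Q z \<longleftrightarrow> ch p (subtopology X P) z \<and> ch (p - Suc 0) (subtopology X Q) (bd p z)"

definition relnull :: "nat \<Rightarrow> 'a topology \<Rightarrow> 'a set \<Rightarrow> 'a set \<Rightarrow> 'a chain2 \<Rightarrow> bool" where
  "relnull p X P Q z \<longleftrightarrow> (\<exists>d e. ch (Suc p) (subtopology X P) d \<and> ch p (subtopology X Q) e \<and> z = bd (Suc p) d + e)"

lemma relcyc_0 [simp]: "relcyc p X P Q 0" by (simp add: relcyc_def)

lemma relcyc_add: "relcyc p X P Q a \<Longrightarrow> relcyc p X P Q b \<Longrightarrow> relcyc p X P Q (a + b)"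
  by (auto simp: relcyc_def bd_add)

lemma relcyc_sum: "(\<And>i. i \<in> I \<Longrightarrow> relcyc p X P Q (f i)) \<Longrightarrow> relcyc p X P Q (sum f I)"
  by (induction I rule: infinite_finite_induct) (auto intro: relcyc_add)

lemma relcyc_mono: "relcyc p X P Q a \<Longrightarrow> P \<subseteq> P' \<Longrightarrow> Q \<subseteq> Q' \<Longrightarrow> relcyc p X P' Q' a"
  unfolding relcyc_def using ch_mono by metis

lemma relnull_0 [simp]: "relnull p X P Q 0"
  unfolding relnull_def by (rule exI[of _ 0], rule exI[of _ 0]) simp

lemma relnull_add:
  assumes "relnull p X P Q a" "relnull p X P Q b" shows "relnull p X P Q (a + b)"
proof -
  obtain d e d' e' where "ch (Suc p) (subtopology X P) d" "ch p (subtopology X Q) e" "a = bd (Suc p) d + e"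
     "ch (Suc p) (subtopology X P) d'" "ch p (subtopology X Q) e'" "b = bd (Suc p) d' + e'"
    using assms unfolding relnull_def by blast
  then show ?thesis unfolding relnull_def
    by (intro exI[of _ "d + d'"] exI[of _ "e + e'"]) (auto simp: bd_add ac_simps)
qed

lemma relnull_cancel: "relnull p X P Q (a + b) \<Longrightarrow> relnull p X P Q b \<Longrightarrow> relnull p X P Q a"
  using relnull_add[of p X P Q "a + b" b] by (simp add: add.assoc)

lemma relnull_mono: "relnull p X P Q a \<Longrightarrow> P \<subseteq> P' \<Longrightarrow> Q \<subseteq> Q' \<Longrightarrow> relnull p X P' Q' a"
  unfolding relnull_def by (metis ch_mono)

lemma relnull_sub: "ch p (subtopology X Q) e \<Longrightarrow> relnull p X P Q e"
  unfolding relnull_def by (intro exI[of _ 0] exI[of _ e]) auto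

lemma relnull_bd: "ch (Suc p) (subtopology X P) d \<Longrightarrow> relnull p X P Q (bd (Suc p) d)"
  unfolding relnull_def by (intro exI[of _ d] exI[of _ 0]) auto

lemma relnull_cmap:
  assumes z: "relnull p X P Q z" and f: "continuous_map (subtopology X P) Y f" "f ` P \<subseteq> P'" "f ` Q \<subseteq> Q'" "Q \<subseteq> P"
  shows "relnull p Y P' Q' (cmap p f z)"
proof -
  obtain d e where d: "ch (Suc p) (subtopology X P) d" "ch p (subtopology X Q) e" "z = bd (Suc p) d + e"
    using z unfolding relnull_def by blast
  have "cmap p f z = bd (Suc p) (cmap (Suc p) f d) + cmap p f e"
    using d by (simp add: cmap_add bd_cmap_Suc)
  moreover have "continuous_map (subtopology X P) (subtopology Y P') f" "continuous_map (subtopology X Q) (subtopology Y Q') f"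
    using f by (auto simp: continuous_map_in_subtopology intro: continuous_map_from_subtopology_mono)
  ultimately show ?thesis using d unfolding relnull_def by (metis ch_cmap)
qed

lemma relcyc_cmap:
  assumes z: "relcyc p X P Q z" and f: "continuous_map (subtopology X P) Y f" "f ` P \<subseteq> P'" "f ` Q \<subseteq> Q'" "Q \<subseteq> P"
  shows "relcyc p Y P' Q' (cmap p f z)"
proof -
  have "continuous_map (subtopology X P) (subtopology Y P') f" "continuous_map (subtopology X Q) (subtopology Y Q') f"
    using f by (auto simp: continuous_map_in_subtopology intro: continuous_map_from_subtopology_mono)
  then show ?thesis using z unfolding relcyc_def
    by (metis bd_cmap ch_cmap)
qed

lemma relcyc_bd_add: 
  assumes "relcyc p X P Q z" "ch (Suc p) (subtopology X P) d" "ch p (subtopology X Q) e" "Q \<subseteq> P"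
  shows "relcyc p X P Q (z + bd (Suc p) d + e)"
proof -
  have "bd p (bd (Suc p) d) = 0" using assms(2) by (rule bd_bd_Suc)
  moreover have "ch p (subtopology X P) (bd (Suc p) d)" using assms(2) by (rule ch_bd_Suc)
  moreover have "ch p (subtopology X P) e" using assms ch_mono by blast
  moreover have "ch (p - Suc 0) (subtopology X Q) (bd p e)" using assms(3) by (rule ch_bd)
  ultimately show ?thesis using assms(1) unfolding relcyc_def by (auto simp: bd_add)
qed

lemma relnull_relcyc: "relnull p X P Q z \<Longrightarrow> Q \<subseteq> P \<Longrightarrow> relcyc p X P Q z"
  unfolding relnull_def using relcyc_bd_add[of p X P Q 0] by (metis add_0 relcyc_0)

section \<open>Cross products\<close>

definition lcone :: "'a \<Rightarrow> ('a list \<Rightarrow>\<^sub>0 bit) \<Rightarrow> ('a list \<Rightarrow>\<^sub>0 bit)" where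
  "lcone v = lext (\<lambda>l. sgl (v # l))"

text \<open>The boundary is augmented: the boundary of a single vertex is the empty list.\<close>

primrec lbd :: "'a list \<Rightarrow> ('a list \<Rightarrow>\<^sub>0 bit)" where
  "lbd [] = 0"
| "lbd (x # xs) = sgl xs + lcone x (lbd xs)"

text \<open>The staircase triangulation of a product of two simplices: the sum of all monotone lattice paths.\<close>

fun stair :: "'a list \<Rightarrow> 'b list \<Rightarrow> (('a \<times> 'b) list \<Rightarrow>\<^sub>0 bit)" where
  "stair [] ys = 0"
| "stair (x # xs) [] = 0"
| "stair (x # xs) (y # ys) = (if xs = [] \<and> ys = [] then sgl [(x, y)]
     else lcone (x, y) (stair xs (y # ys) + stair (x # xs) ys))"

lemma lcone_0 [simp]: "lcone v 0 = 0" by (simp add: lcone_def)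
lemma lcone_single [simp]: "lcone v (sgl l) = sgl (v # l)" by (simp add: lcone_def)
lemma lcone_add: "lcone v (a + b) = lcone v a + lcone v b" by (simp add: lcone_def lext_add)
lemma lcone_sum: "lcone v (sum f I) = (\<Sum>i\<in>I. lcone v (f i))" by (simp add: lcone_def lext_sum)
lemma lcone_lext: "lcone v (lext f c) = lext (\<lambda>l. lcone v (f l)) c" by (simp add: lcone_def lext_lext)
lemma lext_lcone: "lext h (lcone v c) = lext (\<lambda>l. h (v # l)) c" for h :: "_ \<Rightarrow> ('b \<Rightarrow>\<^sub>0 bit)"
  by (simp add: lcone_def lext_lext)

lemma stair_Nil2 [simp]: "stair xs [] = 0" by (cases xs) auto

lemma lext_zero_fun [simp]: "lext (\<lambda>x. 0) c = 0" by (simp add: lext_def)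

lemma keys_lbd: "l \<in> Poly_Mapping.keys (lbd xs) \<Longrightarrow> Suc (length l) = length xs"
proof (induction xs arbitrary: l)
  case (Cons x xs)
  then have "l = xs \<or> (\<exists>l'\<in>Poly_Mapping.keys (lbd xs). l = x # l')"
    using keys_lext[of "\<lambda>l. sgl (x # l)" "lbd xs"] by (auto simp: keys_add_bit lcone_def)
  then show ?case using Cons.IH by auto
qed simp

lemma lbd_lcone: "lext lbd (lcone v w) = w + lcone v (lext lbd w)"
  by (simp add: lext_lcone lext_add_fun lcone_lext)

text \<open>The cone recursion of \<open>stair\<close> fails only for two singletons. In the sum
  over \<open>lbd xs\<close> this happens when \<open>xs\<close> has one element and
  \<open>ys\<close> is empty; the last summand puts the missing point back.\<close>

lemma stair_lbd_aux1:
  "lext (\<lambda>l. stair (x # l) (y # ys)) (lbd xs) =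
   lcone (x, y) (lext (\<lambda>l. stair l (y # ys)) (lbd xs) + lext (\<lambda>l. stair (x # l) ys) (lbd xs))
     + (if length xs = 1 \<and> ys = [] then sgl [(x, y)] else 0)"
proof (cases "length xs = 1")
  case True
  then obtain a where "xs = [a]" by (auto simp: length_Suc_conv)
  then show ?thesis by simp
next
  case False
  have "lext (\<lambda>l. stair (x # l) (y # ys)) (lbd xs) =
      lext (\<lambda>l. lcone (x, y) (stair l (y # ys) + stair (x # l) ys)) (lbd xs)"
    using False by (intro lext_cong) (auto dest!: keys_lbd)
  then show ?thesis using False by (auto simp: lcone_lext lext_add_fun[symmetric] simp flip: lcone_add)
qed

lemma stair_lbd_aux2:
  "lext (\<lambda>l. stair (x # xs) (y # l)) (lbd ys) =
   lcone (x, y) (lext (\<lambda>l. stair xs (y # l)) (lbd ys) + lext (\<lambda>l. stair (x # xs) l) (lbd ys))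
     + (if length ys = 1 \<and> xs = [] then sgl [(x, y)] else 0)"
proof (cases "length ys = 1")
  case True
  then obtain a where "ys = [a]" by (auto simp: length_Suc_conv)
  then show ?thesis by simp
next
  case False
  have "lext (\<lambda>l. stair (x # xs) (y # l)) (lbd ys) =
      lext (\<lambda>l. lcone (x, y) (stair xs (y # l) + stair (x # xs) l)) (lbd ys)"
    using False by (intro lext_cong) (auto dest!: keys_lbd)
  then show ?thesis using False by (auto simp: lcone_lext lext_add_fun[symmetric] simp flip: lcone_add)
qed

text \<open>The Leibniz rule, from the cone formula for \<open>lbd\<close>. For two points the
  product is a point, whose augmented boundary is the empty list, while \<open>stair\<close> is zero
  on an empty list; hence the last summand.\<close>

lemma stair_lbd:
  "lext lbd (stair xs ys) = lext (\<lambda>l. stair l ys) (lbd xs) + lext (\<lambda>l. stair xs l) (lbd ys)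
     + (if length xs = 1 \<and> length ys = 1 then sgl [] else 0)"
proof (induction xs ys rule: stair.induct)
  case (3 x xs y ys)
  show ?case
  proof (cases "xs = [] \<and> ys = []")
    case True
    then show ?thesis by simp
  next
    case False
    have A: "lext lbd (stair xs (y # ys)) = lext (\<lambda>l. stair l (y # ys)) (lbd xs)
        + (stair xs ys + lext (\<lambda>l. stair xs (y # l)) (lbd ys))
        + (if length xs = 1 \<and> ys = [] then sgl [] else 0)"
      using 3(1)[OF False] by (simp add: lext_add lext_lcone)
    have C: "lext lbd (stair (x # xs) ys) = (stair xs ys + lext (\<lambda>l. stair (x # l) ys) (lbd xs))
        + lext (\<lambda>l. stair (x # xs) l) (lbd ys) + (if xs = [] \<and> length ys = 1 then sgl [] else 0)"
      using 3(2)[OF False] by (simp add: lext_add lext_lcone)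
    have "stair (x # xs) (y # ys) = lcone (x, y) (stair xs (y # ys) + stair (x # xs) ys)"
      using False by auto
    then have "lext lbd (stair (x # xs) (y # ys)) = stair xs (y # ys) + stair (x # xs) ys
       + lcone (x, y) (lext lbd (stair xs (y # ys)) + lext lbd (stair (x # xs) ys))"
      by (simp only: lbd_lcone lext_add)
    also have "lcone (x, y) (lext lbd (stair xs (y # ys)) + lext lbd (stair (x # xs) ys))
       = lext (\<lambda>l. stair (x # l) (y # ys)) (lbd xs) + lext (\<lambda>l. stair (x # xs) (y # l)) (lbd ys)"
      unfolding stair_lbd_aux1 stair_lbd_aux2 A C by (auto simp: lcone_add ac_simps)
    finally show ?thesis
      using False by (auto simp: lext_add lext_lcone ac_simps simp del: stair.simps(3))
  qed
qed auto

lemma stair_map: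
  "stair (map f xs) (map g ys) = lext (\<lambda>w. sgl (map (map_prod f g) w)) (stair xs ys)"
proof (induction xs ys rule: stair.induct)
  case (3 x xs y ys)
  then show ?case
    by (cases "xs = [] \<and> ys = []") (auto simp: lext_lcone lcone_add lcone_lext lext_add)
qed auto

text \<open>Exchanging the factors permutes the lattice paths, and modulo two there is no sign. The
  strict symmetry of the cross product rests on this.\<close>

lemma stair_swap: "stair ys xs = lext (\<lambda>w. sgl (map prod.swap w)) (stair xs ys)"
proof (induction xs ys rule: stair.induct)
  case (3 x xs y ys)
  then show ?case
    by (cases "xs = [] \<and> ys = []") (auto simp: lext_lcone lcone_add lcone_lext lext_add ac_simps)
qed auto

lemma keys_stair:
  "w \<in> Poly_Mapping.keys (stair xs ys) \<Longrightarrow> Suc (length w) = length xs + length ys \<and> set w \<subseteq> set xs \<times> set ys"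
proof (induction xs ys arbitrary: w rule: stair.induct)
  case (3 x xs y ys)
  show ?case
  proof (cases "xs = [] \<and> ys = []")
    case False
    then have "w \<in> Poly_Mapping.keys (lcone (x, y) (stair xs (y # ys) + stair (x # xs) ys))"
      using 3(3) by auto
    then obtain w' where "w = (x, y) # w'" "w' \<in> Poly_Mapping.keys (stair xs (y # ys) + stair (x # xs) ys)"
      using keys_lext[of "\<lambda>l. sgl ((x, y) # l)"] by (auto simp: lcone_def)
    then show ?thesis using 3(1,2)[OF False, of w'] by (auto simp: keys_add_bit)
  qed (use 3 in auto)
qed auto

lemma stair_singleton: "xs \<noteq> [] \<Longrightarrow> stair xs [y] = sgl (map (\<lambda>x. (x, y)) xs)"
proof (induction xs)
  case (Cons x xs)
  then show ?case by (cases xs) auto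
qed simp

text \<open>The affine map with vertex list \<open>l\<close>: the weight of coordinate
  \<open>j\<close> goes to \<open>l ! j\<close>. Weights on repeated vertices add up, so the
  degenerate lists that occur along lattice paths are allowed.\<close>

definition vm :: "'a list \<Rightarrow> (nat \<Rightarrow> real) \<Rightarrow> 'a \<Rightarrow> real" where
  "vm l u = (\<lambda>i. \<Sum>j<length l. if l ! j = i then u j else 0)"

definition del :: "nat \<Rightarrow> 'a list \<Rightarrow> 'a list" where
  "del i l = take i l @ drop (Suc i) l"

definition skip :: "nat \<Rightarrow> nat \<Rightarrow> nat" where
  "skip i j = (if j < i then j else Suc j)"

lemma length_del [simp]: "i < length l \<Longrightarrow> length (del i l) = length l - 1"
  by (auto simp: del_def)

lemma nth_del: "i < length l \<Longrightarrow> j < length l - 1 \<Longrightarrow> del i l ! j = l ! skip i j"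
  by (auto simp: del_def skip_def nth_append min_def)

lemma map_del: "map f (del i l) = del i (map f l)"
  by (simp add: del_def take_map drop_map)

lemma del_upt: "i \<le> p \<Longrightarrow> del i [0..<Suc p] = map (skip i) [0..<p]"
  by (rule nth_equalityI) (auto simp: nth_del skip_def simp del: upt_Suc)

lemma sum_skip:
  assumes "i \<le> m"
  shows "(\<Sum>j<Suc m. G j) = G i + (\<Sum>j<m. G (skip i j))"
proof -
  have eq: "{..<Suc m} - {i} = skip i ` {..<m}"
  proof
    show "{..<Suc m} - {i} \<subseteq> skip i ` {..<m}"
    proof
      fix j assume j: "j \<in> {..<Suc m} - {i}"
      show "j \<in> skip i ` {..<m}"
        by (rule image_eqI[of _ _ "if j < i then j else j - 1"]) (use j assms in \<open>auto simp: skip_def\<close>)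
    qed
  qed (auto simp: skip_def)
  have "inj_on (skip i) {..<m}" by (auto simp: inj_on_def skip_def split: if_splits)
  then have "sum G ({..<Suc m} - {i}) = (\<Sum>j<m. G (skip i j))" by (simp add: eq sum.reindex)
  then show ?thesis using sum.remove[of "{..<Suc m}" i G] assms by auto
qed

lemma lbd_del: "lbd l = (\<Sum>i<length l. sgl (del i l))"
proof (induction l)
  case (Cons x xs)
  have "lbd (x # xs) = sgl (del 0 (x # xs)) + (\<Sum>i<length xs. sgl (x # del i xs))"
    by (simp add: Cons lcone_sum) (simp add: del_def)
  also have "\<dots> = (\<Sum>i<length (x # xs). sgl (del i (x # xs)))"
    by (simp only: length_Cons sum.lessThan_Suc_shift) (simp add: del_def)
  finally show ?case .
qed simp

lemma simplical_face_skip [simp]: "simplical_face i u i = 0" "simplical_face i u (skip i j) = u j"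
  by (auto simp: simplical_face_def skip_def)

lemma vm_face:
  assumes "i < length l" shows "vm l (simplical_face i u) = vm (del i l) u"
proof
  fix x
  obtain m where m: "length l = Suc m" using assms by (cases "length l") auto
  have "vm l (simplical_face i u) x = (\<Sum>j<m. if l ! skip i j = x then u j else 0)"
    unfolding vm_def m using assms m by (subst sum_skip[of i]) (auto cong: if_cong)
  also have "\<dots> = vm (del i l) u x"
    unfolding vm_def using assms m by (auto simp: nth_del intro!: sum.cong)
  finally show "vm l (simplical_face i u) x = vm (del i l) u x" .
qed

lemma vm_skip: "vm (map (skip i) l) u = simplical_face i (vm l u)"
proof
  fix x
  have "(skip i y = x) \<longleftrightarrow> (if x < i then y = x else if x = i then False else y = x - 1)" for y
    by (auto simp: skip_def)
  then show "vm (map (skip i) l) u x = simplical_face i (vm l u) x"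
    by (auto simp: vm_def simplical_face_def intro!: sum.cong)
qed

lemma vm_simplex:
  assumes u: "u \<in> standard_simplex m" and l: "length l = Suc m" "set l \<subseteq> {..p}"
  shows "vm l u \<in> standard_simplex p"
proof -
  have u0: "0 \<le> u i" and us: "(\<Sum>i\<le>m. u i) = 1" for i using u by (auto simp: standard_simplex_def)
  have lin: "l ! j \<le> p" if "j \<le> m" for j using l that by (metis atMost_iff le_imp_less_Suc nth_mem subsetD)
  have nn: "0 \<le> vm l u i" for i unfolding vm_def by (rule sum_nonneg) (auto simp: u0)
  have "(\<Sum>i\<le>p. vm l u i) = (\<Sum>j<Suc m. \<Sum>i\<le>p. if l ! j = i then u j else 0)"
    unfolding vm_def l by (rule sum.swap)
  also have "\<dots> = (\<Sum>j<Suc m. u j)" using lin by (intro sum.cong) auto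
  finally have s: "(\<Sum>i\<le>p. vm l u i) = 1" using us by (simp add: lessThan_Suc_atMost)
  have z: "vm l u i = 0" if "i > p" for i
    unfolding vm_def using lin that l
    by (intro sum.neutral) (metis (full_types) lessThan_iff less_Suc_eq_le not_le)
  have "vm l u i \<le> 1" for i
  proof (cases "i \<le> p")
    case True
    then show ?thesis using s member_le_sum[of i "{..p}" "vm l u"] nn by auto
  qed (simp add: z)
  then show ?thesis using nn z s by (simp add: standard_simplex_def)
qed

lemma vm_upt: "u \<in> standard_simplex p \<Longrightarrow> vm [0..<Suc p] u = u"
  by (rule ext) (auto simp: vm_def standard_simplex_def simp del: upt_Suc)

lemma continuous_map_vm: "continuous_map (powertop_real UNIV) (powertop_real UNIV) (vm l)"
proof -
  have "continuous_map (powertop_real UNIV) euclideanreal (\<lambda>x. vm l x i)" for i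
    unfolding vm_def
  proof (intro continuous_map_sum)
    fix j assume "j \<in> {..<length l}"
    show "continuous_map (powertop_real UNIV) euclideanreal (\<lambda>x. if l ! j = i then x j else 0)"
      by (cases "l ! j = i") (auto intro: continuous_map_product_projection)
  qed auto
  then show ?thesis by (simp add: continuous_map_componentwise_UNIV)
qed

text \<open>The simplex of the product that belongs to a lattice path \<open>w\<close>: its two
  coordinate lists, in general with repetitions, reparametrise \<open>s\<close> and
  \<open>t\<close>.\<close>

definition rz :: "((nat \<Rightarrow> real) \<Rightarrow> 'a) \<Rightarrow> ((nat \<Rightarrow> real) \<Rightarrow> 'b) \<Rightarrow> (nat \<times> nat) list \<Rightarrow> (nat \<Rightarrow> real) \<Rightarrow> 'a \<times> 'b" where
  "rz s t w = restrict (\<lambda>u. (s (vm (map fst w) u), t (vm (map snd w) u))) (standard_simplex (length w - 1))"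

lemma singular_face_rz:
  assumes "length w = Suc (Suc m)" "i \<le> Suc m"
  shows "singular_face (Suc m) i (rz s t w) = rz s t (del i w)"
proof -
  have "simplical_face i x \<in> standard_simplex (Suc m)" if "x \<in> standard_simplex m" for x
    using simplical_face_in_standard_simplex[of "Suc m" i x] that assms by simp
  then show ?thesis using assms
    by (auto simp: singular_face_def rz_def fun_eq_iff restrict_def vm_face map_del)
qed

text \<open>The Eilenberg-Zilber product of two singular simplices, modulo two.\<close>

definition crs :: "nat \<Rightarrow> nat \<Rightarrow> ((nat \<Rightarrow> real) \<Rightarrow> 'a) \<Rightarrow> ((nat \<Rightarrow> real) \<Rightarrow> 'b) \<Rightarrow> ('a \<times> 'b) chain2" where
  "crs p q s t = lext (\<lambda>w. sgl (rz s t w)) (stair [0..<Suc p] [0..<Suc q])"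

lemma bd_rz:
  assumes "\<And>w. w \<in> Poly_Mapping.keys c \<Longrightarrow> length w = Suc (Suc m)"
  shows "bd (Suc m) (lext (\<lambda>w. sgl (rz s t w)) c) = lext (\<lambda>w. sgl (rz s t w)) (lext lbd c)"
proof -
  have "bd (Suc m) (lext (\<lambda>w. sgl (rz s t w)) c) = lext (\<lambda>w. \<Sum>i\<le>Suc m. sgl (singular_face (Suc m) i (rz s t w))) c"
    by (simp add: bd_lext lext_lext del: sum.atMost_Suc)
  also have "\<dots> = lext (\<lambda>w. \<Sum>i\<le>Suc m. sgl (rz s t (del i w))) c"
    by (intro lext_cong sum.cong) (auto simp: singular_face_rz assms)
  also have "\<dots> = lext (\<lambda>w. lext (\<lambda>w. sgl (rz s t w)) (lbd w)) c"
    by (intro lext_cong) (simp add: lbd_del lext_sum assms lessThan_Suc_atMost del: sum.atMost_Suc sum.lessThan_Suc)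
  finally show ?thesis by (simp add: lext_lext)
qed

lemma lbd_upt: "lbd [0..<Suc p] = (\<Sum>i\<le>p. sgl (map (skip i) [0..<p]))"
  by (simp add: lbd_del lessThan_Suc_atMost del_upt del: upt_Suc sum.atMost_Suc sum.lessThan_Suc)

lemma keys_stair_upt:
  assumes "w \<in> Poly_Mapping.keys (stair [0..<Suc p] [0..<Suc q])"
  shows "length w = Suc (p + q)" "set (map fst w) \<subseteq> {..p}" "set (map snd w) \<subseteq> {..q}"
  using keys_stair[OF assms] by (auto simp: less_Suc_eq_le simp del: upt_Suc)

lemma crs_face1:
  "lext (\<lambda>w. sgl (rz s t w)) (stair (map (skip i) [0..<Suc p]) [0..<Suc q]) = crs p q (singular_face (Suc p) i s) t"
proof -
  have "stair (map (skip i) [0..<Suc p]) [0..<Suc q] = 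
     lext (\<lambda>w. sgl (map (map_prod (skip i) id) w)) (stair [0..<Suc p] [0..<Suc q])"
    using stair_map[of "skip i" "[0..<Suc p]" id "[0..<Suc q]"] by simp
  note m1 = this
  have m2: "rz s t (map (map_prod (skip i) id) w) = rz (singular_face (Suc p) i s) t w"
    if "w \<in> Poly_Mapping.keys (stair [0..<Suc p] [0..<Suc q])" for w
  proof -
    have e: "map fst (map (map_prod (skip i) id) w) = map (skip i) (map fst w)"
      "map snd (map (map_prod (skip i) id) w) = map snd w" by auto
    have "vm (map fst w) u \<in> standard_simplex p" if "u \<in> standard_simplex (p + q)" for u
      using vm_simplex[OF that, of "map fst w" p] keys_stair_upt[OF \<open>w \<in> _\<close>] by auto
    then show ?thesis unfolding rz_def e using keys_stair_upt[OF \<open>w \<in> _\<close>]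
      by (auto simp: vm_skip singular_face_def restrict_def fun_eq_iff simp del: map_map)
  qed
  show ?thesis
    unfolding crs_def m1 lext_lext by (rule lext_cong) (simp add: m2 del: upt_Suc)
qed

lemma crs_face2:
  "lext (\<lambda>w. sgl (rz s t w)) (stair [0..<Suc p] (map (skip i) [0..<Suc q])) = crs p q s (singular_face (Suc q) i t)"
proof -
  have "stair [0..<Suc p] (map (skip i) [0..<Suc q]) = 
     lext (\<lambda>w. sgl (map (map_prod id (skip i)) w)) (stair [0..<Suc p] [0..<Suc q])"
    using stair_map[of id "[0..<Suc p]" "skip i" "[0..<Suc q]"] by simp
  note m1 = this
  have m2: "rz s t (map (map_prod id (skip i)) w) = rz s (singular_face (Suc q) i t) w"
    if "w \<in> Poly_Mapping.keys (stair [0..<Suc p] [0..<Suc q])" for w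
  proof -
    have e: "map snd (map (map_prod id (skip i)) w) = map (skip i) (map snd w)"
      "map fst (map (map_prod id (skip i)) w) = map fst w" by auto
    have "vm (map snd w) u \<in> standard_simplex q" if "u \<in> standard_simplex (p + q)" for u
      using vm_simplex[OF that, of "map snd w" q] keys_stair_upt[OF \<open>w \<in> _\<close>] by auto
    then show ?thesis unfolding rz_def e using keys_stair_upt[OF \<open>w \<in> _\<close>]
      by (auto simp: vm_skip singular_face_def restrict_def fun_eq_iff simp del: map_map)
  qed
  show ?thesis
    unfolding crs_def m1 lext_lext by (rule lext_cong) (simp add: m2 del: upt_Suc)
qed

text \<open>In dimension 0 the augmented boundary of a factor is the empty list, which
  \<open>stair\<close> sends to zero; the conditionals record this.\<close>

lemma bd_crs:
  "bd (p + q) (crs p q s t) = (if p = 0 then 0 else \<Sum>i\<le>p. crs (p - Suc 0) q (singular_face p i s) t)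
     + (if q = 0 then 0 else \<Sum>i\<le>q. crs p (q - Suc 0) s (singular_face q i t))"
proof (cases "p + q")
  case (Suc m)
  let ?r = "lext (\<lambda>w. sgl (rz s t w))"
  have "bd (p + q) (crs p q s t) = ?r (lext lbd (stair [0..<Suc p] [0..<Suc q]))"
    unfolding Suc crs_def using keys_stair_upt(1)[of _ p q] Suc by (intro bd_rz) auto
  also have "lext lbd (stair [0..<Suc p] [0..<Suc q]) = 
     (\<Sum>i\<le>p. stair (map (skip i) [0..<p]) [0..<Suc q]) + (\<Sum>i\<le>q. stair [0..<Suc p] (map (skip i) [0..<q]))"
    using Suc by (subst stair_lbd) (auto simp: lbd_upt lext_sum simp del: upt_Suc sum.atMost_Suc)
  also have "?r \<dots> = (\<Sum>i\<le>p. ?r (stair (map (skip i) [0..<p]) [0..<Suc q])) + (\<Sum>i\<le>q. ?r (stair [0..<Suc p] (map (skip i) [0..<q])))"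
    by (simp add: lext_add lext_sum del: upt_Suc sum.atMost_Suc)
  also have "(\<Sum>i\<le>p. ?r (stair (map (skip i) [0..<p]) [0..<Suc q])) = 
      (if p = 0 then 0 else \<Sum>i\<le>p. crs (p - Suc 0) q (singular_face p i s) t)"
    by (cases p) (auto simp: crs_face1 simp del: upt_Suc sum.atMost_Suc)
  also have "(\<Sum>i\<le>q. ?r (stair [0..<Suc p] (map (skip i) [0..<q]))) = 
      (if q = 0 then 0 else \<Sum>i\<le>q. crs p (q - Suc 0) s (singular_face q i t))"
    by (cases q) (auto simp: crs_face2 simp del: upt_Suc sum.atMost_Suc)
  finally show ?thesis .
qed simp

definition cross :: "nat \<Rightarrow> nat \<Rightarrow> 'a chain2 \<Rightarrow> 'b chain2 \<Rightarrow> ('a \<times> 'b) chain2" where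
  "cross p q c d = lext (\<lambda>s. lext (\<lambda>t. crs p q s t) d) c"

lemma cross_add1: "cross p q (a + b) d = cross p q a d + cross p q b d"
  by (simp add: cross_def lext_add)

lemma cross_add2: "cross p q c (a + b) = cross p q c a + cross p q c b"
  by (simp add: cross_def lext_add lext_add_fun)

lemma cross_0 [simp]: "cross p q 0 d = 0" "cross p q c 0 = 0"
  by (simp_all add: cross_def)

lemma cross_single: "cross p q (sgl s) (sgl t) = crs p q s t"
  by (simp add: cross_def)

lemma cross_sum1: "cross p q (sum f I) d = (\<Sum>i\<in>I. cross p q (f i) d)"
  by (rule additive_sum) (auto simp: cross_add1)

lemma cross_sum2: "cross p q c (sum f I) = (\<Sum>i\<in>I. cross p q c (f i))"
  by (rule additive_sum) (auto simp: cross_add2)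

lemma bd_cross:
  "bd (p + q) (cross p q c d) = cross (p - Suc 0) q (bd p c) d + cross p (q - Suc 0) c (bd q d)"
proof (induction c rule: chain2_induct)
  case (single s)
  show ?case
  proof (induction d rule: chain2_induct)
    case (single t)
    show ?case
      using bd_crs[of p q s t]
      by (cases "p = 0"; cases "q = 0")
         (auto simp: cross_single bd_single cross_sum1 cross_sum2 simp del: sum.atMost_Suc)
  qed (auto simp: bd_add cross_add2 ac_simps)
qed (auto simp: bd_add cross_add1 ac_simps)

lemma singular_simplex_rz:
  assumes "singular_simplex p X s" "singular_simplex q Y t" 
    and w: "length w = Suc m" "set (map fst w) \<subseteq> {..p}" "set (map snd w) \<subseteq> {..q}"
  shows "singular_simplex m (prod_topology X Y) (rz s t w)"
proof -
  let ?D = "\<lambda>m. subtopology (powertop_real UNIV) (standard_simplex m)"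
  have c: "continuous_map (?D m) (?D r) (vm l)" if "length l = Suc m" "set l \<subseteq> {..r}" for l r
    using vm_simplex[of _ m l r] that continuous_map_vm
    by (auto simp: continuous_map_in_subtopology intro: continuous_map_from_subtopology)
  have "continuous_map (?D m) X (\<lambda>u. s (vm (map fst w) u))" "continuous_map (?D m) Y (\<lambda>u. t (vm (map snd w) u))"
    using assms continuous_map_compose[OF c[of "map fst w" p], of X s]
      continuous_map_compose[OF c[of "map snd w" q], of Y t] by (auto simp: singular_simplex_def o_def)
  then have "continuous_map (?D m) (prod_topology X Y) (\<lambda>u. (s (vm (map fst w) u), t (vm (map snd w) u)))"
    by (simp add: continuous_map_pairedI)
  then have "continuous_map (?D m) (prod_topology X Y) (rz s t w)"
    by (rule continuous_map_eq) (simp add: rz_def w)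
  then show ?thesis by (simp add: singular_simplex_def rz_def w)
qed

lemma ch_cross:
  assumes "ch p X c" "ch q Y d"
  shows "ch (p + q) (prod_topology X Y) (cross p q c d)"
  unfolding cross_def crs_def
proof (intro ch_lext)
  fix s t w assume "s \<in> Poly_Mapping.keys c" "t \<in> Poly_Mapping.keys d"
    and w: "w \<in> Poly_Mapping.keys (stair [0..<Suc p] [0..<Suc q])"
  then have "singular_simplex p X s" "singular_simplex q Y t"
    using assms by (auto simp: singular_chain2_def)
  then show "ch (p + q) (prod_topology X Y) (sgl (rz s t w))"
    using singular_simplex_rz[OF _ _ keys_stair_upt[OF w]] by (simp add: ch_single)
qed

lemma cmap_lext: "cmap p g (lext h c) = lext (\<lambda>x. cmap p g (h x)) c"
  by (simp add: cmap_def lext_lext)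

lemma cmap_swap_cross:
  fixes c :: "'a chain2" and d :: "'b chain2"
  shows "cmap (p + q) prod.swap (cross p q c d) = cross q p d c"
proof -
  have "cmap (p + q) prod.swap (crs p q s t) = crs q p t s" for s :: "(nat \<Rightarrow> real) \<Rightarrow> 'a" and t :: "(nat \<Rightarrow> real) \<Rightarrow> 'b"
  proof -
    have "simplex_map (p + q) prod.swap (rz s t w) = rz t s (map prod.swap w)"
      if "w \<in> Poly_Mapping.keys (stair [0..<Suc p] [0..<Suc q])" for w
      using keys_stair_upt[OF that] by (auto simp: simplex_map_def rz_def fun_eq_iff o_def)
    then show ?thesis
      unfolding crs_def cmap_def stair_swap[of "[0..<Suc q]" "[0..<Suc p]"]
      by (simp add: lext_lext cong: lext_cong del: upt_Suc)
  qed
  then have "cmap (p + q) prod.swap (cross p q c d) = lext (\<lambda>s. lext (\<lambda>t. crs q p t s) d) c"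
    by (simp add: cross_def cmap_lext)
  also have "\<dots> = cross q p d c" unfolding cross_def by (rule lext_swap)
  finally show ?thesis .
qed

lemma cross_cmap: "cross p q (cmap p f c) (cmap q g d) = cmap (p + q) (map_prod f g) (cross p q c d)"
proof -
  have "crs p q (simplex_map p f s) (simplex_map q g t) = cmap (p + q) (map_prod f g) (crs p q s t)" for s t
  proof -
    have "rz (simplex_map p f s) (simplex_map q g t) w = simplex_map (p + q) (map_prod f g) (rz s t w)"
      if w: "w \<in> Poly_Mapping.keys (stair [0..<Suc p] [0..<Suc q])" for w
    proof -
      have "vm (map fst w) u \<in> standard_simplex p" "vm (map snd w) u \<in> standard_simplex q"
        if "u \<in> standard_simplex (p + q)" for u
        using vm_simplex[OF that, of "map fst w" p] vm_simplex[OF that, of "map snd w" q] keys_stair_upt[OF w] by auto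
      then show ?thesis using keys_stair_upt[OF w] by (auto simp: simplex_map_def rz_def fun_eq_iff o_def)
    qed
    then show ?thesis unfolding crs_def cmap_def by (simp add: lext_lext cong: lext_cong del: upt_Suc)
  qed
  then show ?thesis unfolding cross_def by (simp add: cmap_def lext_lext)
qed

section \<open>Homotopy invariance\<close>

definition iota :: "(nat \<Rightarrow> real) \<Rightarrow> real" where
  "iota = restrict (\<lambda>u. u 1) (standard_simplex 1)"

text \<open>The usual prism operator, obtained by crossing with the identity simplex of the
  interval.\<close>

definition prism :: "nat \<Rightarrow> ('a \<times> real \<Rightarrow> 'b) \<Rightarrow> 'a chain2 \<Rightarrow> 'b chain2" where
  "prism p h c = cmap (Suc p) h (cross p 1 c (sgl iota))"

lemma prism_add: "prism p h (a + b) = prism p h a + prism p h b"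
  by (simp add: prism_def cross_add1 cmap_add)

lemma prism_0 [simp]: "prism p h 0 = 0"
  by (simp add: prism_def)

lemma bd_iota: "bd 1 (sgl iota) = sgl (restrict (\<lambda>_. 0) (standard_simplex 0)) + sgl (restrict (\<lambda>_. 1) (standard_simplex 0))"
proof -
  have "singular_face 1 0 iota = restrict (\<lambda>_. 1) (standard_simplex 0)"
    "singular_face 1 1 iota = restrict (\<lambda>_. 0) (standard_simplex 0)"
    using simplical_face_in_standard_simplex[of 1 0] simplical_face_in_standard_simplex[of 1 1]
    by (auto simp: singular_face_def iota_def fun_eq_iff restrict_def simplical_face_def standard_simplex_0)
  then show ?thesis by (simp add: bd_single ac_simps)
qed

lemma ch_iota: "ch 1 (top_of_set {0..1::real}) (sgl iota)"
proof -
  let ?D = "subtopology (powertop_real UNIV) (standard_simplex 1)"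
  have "continuous_map ?D euclideanreal (\<lambda>u. u 1)"
    by (intro continuous_map_from_subtopology continuous_map_product_projection) simp
  then have "continuous_map ?D (top_of_set {0..1}) (\<lambda>u. u 1)"
    by (auto simp: continuous_map_in_subtopology standard_simplex_def)
  then have "continuous_map ?D (top_of_set {0..1}) iota"
    by (rule continuous_map_eq) (auto simp: iota_def)
  then show ?thesis by (simp add: ch_single singular_simplex_def iota_def)
qed

text \<open>With a single vertex in the second factor there is just one lattice path.\<close>

lemma cross_point:
  assumes "ch p X c"
  shows "cross p 0 c (sgl (restrict (\<lambda>_. v) (standard_simplex 0))) = cmap p (\<lambda>x. (x, v)) c"
  unfolding cross_def cmap_def
proof (rule lext_cong)
  fix s assume "s \<in> Poly_Mapping.keys c"
  let ?w = "map (\<lambda>x. (x, 0::nat)) [0..<Suc p]"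
  have "rz s (restrict (\<lambda>_. v) (standard_simplex 0)) ?w = simplex_map p (\<lambda>x. (x, v)) s"
  proof -
    have e: "map fst ?w = [0..<Suc p]" "set (map snd ?w) \<subseteq> {..0}" "length ?w = Suc p"
      by (auto simp: o_def simp del: upt_Suc)
    have "vm (map snd ?w) u \<in> standard_simplex 0" if "u \<in> standard_simplex p" for u
      using vm_simplex[OF that, of "map snd ?w" 0] e by (simp del: upt_Suc)
    then show ?thesis unfolding rz_def e simplex_map_def
      by (auto simp: fun_eq_iff restrict_def vm_upt simp del: upt_Suc)
  qed
  then show "lext (crs p 0 s) (sgl (restrict (\<lambda>_. v) (standard_simplex 0))) = sgl (simplex_map p (\<lambda>x. (x, v)) s)"
    using stair_singleton[of "[0..<Suc p]" "0::nat"] by (simp add: crs_def del: upt_Suc add: upt_rec[of 0 "Suc 0"])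
qed

lemma bd_prism:
  assumes h: "continuous_map (prod_topology X (top_of_set {0..1})) Y h" and c: "ch p X c"
  shows "bd (Suc p) (prism p h c) + prism (p - Suc 0) h (bd p c) = cmap p (\<lambda>x. h (x, 0)) c + cmap p (\<lambda>x. h (x, 1)) c"
proof -
  have ch: "ch (Suc p) (prod_topology X (top_of_set {0..1})) (cross p 1 c (sgl iota))"
    using ch_cross[OF c ch_iota] by simp
  have "bd (Suc p) (prism p h c) = cmap p h (bd (Suc p) (cross p 1 c (sgl iota)))"
    unfolding prism_def using bd_cmap_Suc[OF ch] by blast
  also have "bd (Suc p) (cross p 1 c (sgl iota)) = cross (p - Suc 0) 1 (bd p c) (sgl iota) + cross p 0 c (bd 1 (sgl iota))"
    using bd_cross[of p 1 c "sgl iota"] by simp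
  also have "cross p 0 c (bd 1 (sgl iota)) = cmap p (\<lambda>x. (x, 0)) c + cmap p (\<lambda>x. (x, 1)) c"
    unfolding bd_iota by (simp add: cross_add2 cross_point[OF c])
  also have "cmap p h (cross (p - Suc 0) 1 (bd p c) (sgl iota) + \<dots>) =
     cmap p h (cross (p - Suc 0) 1 (bd p c) (sgl iota)) + (cmap p (\<lambda>x. h (x, 0)) c + cmap p (\<lambda>x. h (x, 1)) c)"
    by (simp add: cmap_add cmap_cmap o_def)
  also have "cmap p h (cross (p - Suc 0) 1 (bd p c) (sgl iota)) = prism (p - Suc 0) h (bd p c)"
    by (cases p) (auto simp: prism_def)
  finally show ?thesis by (simp add: ac_simps)
qed

lemma ch_prism:
  assumes h: "continuous_map (prod_topology X (top_of_set {0..1})) Y h"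
    and c: "ch p (subtopology X R) c" and R: "h ` ((topspace X \<inter> R) \<times> {0..1}) \<subseteq> S"
  shows "ch (Suc p) (subtopology Y S) (prism p h c)"
proof -
  let ?P = "prod_topology (subtopology X R) (top_of_set {0..1::real})"
  have "?P = subtopology (prod_topology X (top_of_set {0..1})) (R \<times> UNIV)"
    by (simp add: subtopology_Times)
  then have "continuous_map ?P Y h" using h by (simp add: continuous_map_from_subtopology)
  then have "continuous_map ?P (subtopology Y S) h"
    using R by (auto simp: continuous_map_in_subtopology)
  moreover have "ch (Suc p) ?P (cross p 1 c (sgl iota))" using ch_cross[OF c ch_iota] by simp
  ultimately show ?thesis unfolding prism_def by (rule ch_cmap[rotated])
qed

text \<open>The prism over \<open>z\<close> bounds the sum of the two ends up to the prism over
  \<open>bd p z\<close>, and the latter stays in \<open>Q'\<close>.\<close>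

lemma homotopy_relnull:
  fixes h :: "'a \<times> real \<Rightarrow> 'b"
  assumes h: "continuous_map (prod_topology (subtopology X P) (top_of_set {0..1})) Y h"
    and z: "relcyc p X P Q z" and "Q \<subseteq> P" "P \<subseteq> topspace X"
    and P: "\<And>x t. x \<in> P \<Longrightarrow> 0 \<le> t \<Longrightarrow> t \<le> 1 \<Longrightarrow> h (x, t) \<in> P'"
    and Q: "\<And>x t. x \<in> Q \<Longrightarrow> 0 \<le> t \<Longrightarrow> t \<le> 1 \<Longrightarrow> h (x, t) \<in> Q'"
  shows "relnull p Y P' Q' (cmap p (\<lambda>x. h (x, 0)) z + cmap p (\<lambda>x. h (x, 1)) z)"
proof -
  have zP: "ch p (subtopology X P) z" and zQ: "ch (p - Suc 0) (subtopology X Q) (bd p z)"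
    using z by (auto simp: relcyc_def)
  have "ch (Suc p) (subtopology Y P') (prism p h z)"
  proof (rule ch_prism[OF h])
    show "h ` ((topspace (subtopology X P) \<inter> P) \<times> {0..1}) \<subseteq> P'" using P by auto
  qed (use zP in \<open>simp add: subtopology_subtopology\<close>)
  moreover have "ch p (subtopology Y Q') (prism (p - Suc 0) h (bd p z))"
  proof (cases p)
    case (Suc r)
    have "ch (Suc r) (subtopology Y Q') (prism r h (bd p z))"
    proof (rule ch_prism[OF h])
      show "h ` ((topspace (subtopology X P) \<inter> Q) \<times> {0..1}) \<subseteq> Q'" using Q by auto
    qed (use zQ Suc \<open>Q \<subseteq> P\<close> in \<open>simp add: subtopology_subtopology inf.absorb2\<close>)
    then show ?thesis using Suc by simp
  qed simp
  ultimately show ?thesis unfolding relnull_def using bd_prism[OF h zP] by metis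
qed

text \<open>What is kept of iterated subdivision once the number of iterations is forgotten: a
  natural chain map and a natural homotopy to the identity.\<close>

definition subdivision :: "(nat \<Rightarrow> 'a chain2 \<Rightarrow> 'a chain2) \<Rightarrow> (nat \<Rightarrow> 'a chain2 \<Rightarrow> 'a chain2) \<Rightarrow> bool" where
  "subdivision T H \<longleftrightarrow>
     (\<forall>q a b. T q (a + b) = T q a + T q b) \<and> (\<forall>q a b. H q (a + b) = H q a + H q b) \<and>
     (\<forall>q Y a. ch q Y a \<longrightarrow> ch q Y (T q a) \<and> ch (Suc q) Y (H q a) \<and>
        bd (Suc q) (H q a) + H (q - Suc 0) (bd q a) = T q a + a \<and>
        bd q (T q a) = T (q - Suc 0) (bd q a))"

lemma subdivisionD:
  assumes "subdivision T H"
  shows "T q (a + b) = T q a + T q b" "H q (a + b) = H q a + H q b"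
    "T q 0 = 0" "H q 0 = 0"
    "ch q Y a \<Longrightarrow> ch q Y (T q a)" "ch q Y a \<Longrightarrow> ch (Suc q) Y (H q a)"
    "ch q Y a \<Longrightarrow> bd (Suc q) (H q a) = T q a + a + H (q - Suc 0) (bd q a)"
    "ch q Y a \<Longrightarrow> bd q (T q a) = T (q - Suc 0) (bd q a)"
proof -
  show add: "T q (a + b) = T q a + T q b" "H q (a + b) = H q a + H q b" for q a b
    using assms unfolding subdivision_def by blast+
  show "T q 0 = 0" "H q 0 = 0" using add(1)[of q 0 0] add(2)[of q 0 0] by simp_all
  assume a: "ch q Y a"
  then show "ch q Y (T q a)" "ch (Suc q) Y (H q a)" "bd q (T q a) = T (q - Suc 0) (bd q a)"
    using assms unfolding subdivision_def by blast+
  have "bd (Suc q) (H q a) + H (q - Suc 0) (bd q a) = T q a + a"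
    using assms a unfolding subdivision_def by blast
  then show "bd (Suc q) (H q a) = T q a + a + H (q - Suc 0) (bd q a)"
    by (metis add.commute chain2_add_self_left)
qed

lemma small_chain:
  fixes c :: "'a chain2"
  assumes "\<And>U. U \<in> \<C> \<Longrightarrow> openin X U" "topspace X \<subseteq> \<Union>\<C>" "ch p X c"
  obtains T H :: "nat \<Rightarrow> 'a chain2 \<Rightarrow> 'a chain2" where "subdivision T H"
    "\<And>f. f \<in> Poly_Mapping.keys (T p c) \<Longrightarrow> \<exists>V\<in>\<C>. f ` standard_simplex p \<subseteq> V"
proof (rule small_chain_operators[OF assms])
  fix T H :: "nat \<Rightarrow> 'a chain2 \<Rightarrow> 'a chain2"
  assume TH: "\<And>q a b. T q (a + b) = T q a + T q b" "\<And>q a b. H q (a + b) = H q a + H q b"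
    "\<And>q Y a. ch q Y a \<Longrightarrow> ch q Y (T q a)"
    "\<And>q Y a. ch q Y a \<Longrightarrow> ch (Suc q) Y (H q a)"
    "\<And>q Y a. ch q Y a \<Longrightarrow> bd (Suc q) (H q a) + H (q - Suc 0) (bd q a) = T q a + a"
    "\<And>q Y a. ch q Y a \<Longrightarrow> bd q (T q a) = T (q - Suc 0) (bd q a)"
    and f: "\<And>f. f \<in> Poly_Mapping.keys (T p c) \<Longrightarrow> \<exists>V\<in>\<C>. f ` standard_simplex p \<subseteq> V"
  have "subdivision T H" unfolding subdivision_def
    by (intro conjI allI impI; (rule TH(1) | rule TH(2) | erule TH(3) | erule TH(4) | erule TH(5) | erule TH(6)))
  then show thesis using f by (rule that)
qed

section \<open>Euclidean space relative to the complement of the origin\<close>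

abbreviation PT :: "(nat \<Rightarrow> real) topology" where "PT \<equiv> powertop_real UNIV"

text \<open>Euclidean spaces are nested subsets of one product, so that suspension from dimension
  \<open>n\<close> only touches coordinate \<open>n\<close>.\<close>

definition En :: "nat \<Rightarrow> (nat \<Rightarrow> real) set" where
  "En n = {x. \<forall>i\<ge>n. x i = 0}"

definition Ep :: "nat \<Rightarrow> (nat \<Rightarrow> real) set" where
  "Ep n = En n - {\<lambda>_. 0}"

abbreviation rcE :: "nat \<Rightarrow> nat \<Rightarrow> (nat \<Rightarrow> real) chain2 \<Rightarrow> bool" where
  "rcE n j \<equiv> relcyc j PT (En n) (Ep n)"

abbreviation rnE :: "nat \<Rightarrow> nat \<Rightarrow> (nat \<Rightarrow> real) chain2 \<Rightarrow> bool" where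
  "rnE n j \<equiv> relnull j PT (En n) (Ep n)"

lemma Ep_subset: "Ep n \<subseteq> En n" by (auto simp: Ep_def)

lemma Ep_iff: "x \<in> Ep n \<longleftrightarrow> x \<in> En n \<and> (\<exists>i<n. x i \<noteq> 0)"
  by (auto simp: Ep_def En_def fun_eq_iff) (meson not_le)

lemma continuous_map_PT_component [intro]: "continuous_map PT euclideanreal (\<lambda>x. x i)"
  by (rule continuous_map_product_projection) simp

lemma continuous_map_prod_components [intro]:
  "continuous_map (prod_topology PT euclideanreal) euclideanreal (\<lambda>z. fst z i)"
  "continuous_map (prod_topology PT euclideanreal) euclideanreal snd"
  using continuous_map_compose[OF continuous_map_fst continuous_map_PT_component, of euclideanreal i]
  by (auto simp: o_def continuous_map_snd)

lemma continuous_map_homotopy: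
  assumes "\<And>i. continuous_map (prod_topology PT euclideanreal) euclideanreal (\<lambda>z. h z i)"
  shows "continuous_map (prod_topology (subtopology PT P) (top_of_set S)) PT h"
proof -
  have "continuous_map (subtopology (prod_topology PT euclideanreal) (P \<times> S)) PT h"
    using assms by (intro continuous_map_from_subtopology) (simp add: continuous_map_componentwise_UNIV)
  then show ?thesis by (simp add: subtopology_Times)
qed

lemma split_chain:
  assumes c: "ch p X c" and f: "\<And>f. f \<in> Poly_Mapping.keys c \<Longrightarrow> f ` standard_simplex p \<subseteq> A \<or> f ` standard_simplex p \<subseteq> B"
  obtains a b where "c = a + b" "ch p (subtopology X A) a" "ch p (subtopology X B) b"
proof -
  let ?P = "\<lambda>f. f ` standard_simplex p \<subseteq> A"
  have "ch p (subtopology X A) (part ?P c)" "ch p (subtopology X B) (part (\<lambda>f. \<not> ?P f) c)"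
    using f c by (auto simp: ch_subtopology ch_part)
  then show ?thesis using that part_add_part by metis
qed

lemma ch_subtopology_Int:
  "ch p (subtopology X A) c \<Longrightarrow> ch p (subtopology X B) c \<Longrightarrow> ch p (subtopology X (A \<inter> B)) c"
  by (auto simp: ch_subtopology)

definition push :: "nat \<Rightarrow> real \<Rightarrow> (nat \<Rightarrow> real) \<times> real \<Rightarrow> (nat \<Rightarrow> real)" where
  "push n s = (\<lambda>z i. if i = n then fst z i + snd z * s else fst z i)"

text \<open>The product of \<open>q\<close> with the interval from -1 to 1 in coordinate
  \<open>n\<close>. It induces the isomorphism from degree \<open>j\<close> for \<open>En n\<close>
  to degree \<open>Suc j\<close> for \<open>En (Suc n)\<close>, both relative to the complement of
  the origin.\<close>

definition susp :: "nat \<Rightarrow> nat \<Rightarrow> (nat \<Rightarrow> real) chain2 \<Rightarrow> (nat \<Rightarrow> real) chain2" where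
  "susp n j q = prism j (push n 1) q + prism j (push n (-1)) q"

lemma susp_add: "susp n j (a + b) = susp n j a + susp n j b"
  by (simp add: susp_def prism_add ac_simps)

lemma susp_0 [simp]: "susp n j 0 = 0" by (simp add: susp_def)

lemma continuous_map_push:
  "continuous_map (prod_topology (subtopology PT P) (top_of_set S)) PT (push n s)"
proof (rule continuous_map_homotopy)
  fix i
  show "continuous_map (prod_topology PT euclideanreal) euclideanreal (\<lambda>z. push n s z i)"
    by (cases "i = n") (auto simp: push_def intro!: continuous_intros)
qed

lemma continuous_map_push0: "continuous_map (prod_topology PT (top_of_set S)) PT (push n s)"
  using continuous_map_push[of UNIV] by simp

lemma continuous_map_push1: "continuous_map PT PT (\<lambda>x. push n s (x, 1))"
proof -
  have "continuous_map PT euclideanreal (\<lambda>x. push n s (x, 1) i)" for i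
    by (cases "i = n") (auto simp: push_def intro!: continuous_intros)
  then show ?thesis by (simp add: continuous_map_componentwise_UNIV)
qed

lemma ch_image:
  assumes "ch p (subtopology PT P) c" "continuous_map PT PT f" "\<And>x. x \<in> P \<Longrightarrow> f x \<in> Q"
  shows "ch p (subtopology PT Q) (cmap p f c)"
  using ch_cmap[OF assms(1), of "subtopology PT Q" f] assms
  by (auto simp: continuous_map_in_subtopology intro: continuous_map_from_subtopology)

lemma ch_prism_push:
  assumes "ch p (subtopology PT P) c" "\<And>x t. x \<in> P \<Longrightarrow> 0 \<le> t \<Longrightarrow> t \<le> 1 \<Longrightarrow> push n s (x, t) \<in> Q"
  shows "ch (Suc p) (subtopology PT Q) (prism p (push n s) c)"
proof (rule ch_prism[OF continuous_map_push0 assms(1)])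
  show "push n s ` ((topspace PT \<inter> P) \<times> {0..1}) \<subseteq> Q" using assms(2) by auto
qed

lemma ch_prism_push_bd:
  assumes "ch (p - Suc 0) (subtopology PT P) (bd p c)" "\<And>x t. x \<in> P \<Longrightarrow> 0 \<le> t \<Longrightarrow> t \<le> 1 \<Longrightarrow> push n s (x, t) \<in> Q"
  shows "ch p (subtopology PT Q) (prism (p - Suc 0) (push n s) (bd p c))"
  using ch_prism_push[OF assms] by (cases p) auto

lemma push_0 [simp]: "push n s (x, 0) = x"
  by (auto simp: push_def)

lemma cmap_ident: "ch p X c \<Longrightarrow> cmap p (\<lambda>x. x) c = c"
  by (rule cmap_id) auto

lemma bd_prism_push:
  assumes "ch p PT c"
  shows "bd (Suc p) (prism p (push n s) c) = c + cmap p (\<lambda>x. push n s (x, 1)) c + prism (p - Suc 0) (push n s) (bd p c)"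
proof -
  have "bd (Suc p) (prism p (push n s) c) + prism (p - Suc 0) (push n s) (bd p c)
      = c + cmap p (\<lambda>x. push n s (x, 1)) c"
    using bd_prism[OF continuous_map_push0 assms, of n s] by (simp add: cmap_ident[OF assms])
  then show ?thesis by (metis add.commute chain2_add_self_left)
qed

lemma Ep_Suc: "Ep (Suc n) = {x \<in> En (Suc n). (\<exists>i<n. x i \<noteq> 0) \<or> x n \<noteq> 0}"
  by (auto simp: Ep_iff less_Suc_eq)

text \<open>For \<open>s = 1\<close> or \<open>s = -1\<close>, the complement of the closed half of
  axis \<open>n\<close> opposite to \<open>s\<close>. The two sets cover \<open>Ep (Suc n)\<close>
  and meet in \<open>flat n\<close>, the complement of the whole axis, which projects onto
  \<open>Ep n\<close>.\<close>

definition upper :: "nat \<Rightarrow> real \<Rightarrow> (nat \<Rightarrow> real) set" where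
  "upper n s = {x \<in> En (Suc n). (\<exists>i<n. x i \<noteq> 0) \<or> s * x n > 0}"

lemma open_nonzero: "openin PT {x. \<exists>i<n. x i \<noteq> 0}"
proof -
  have "openin PT {x. x i \<noteq> 0}" for i
    using openin_continuous_map_preimage[OF continuous_map_PT_component[of i], of "- {0}"] open_Compl[OF closed_singleton[of "0::real"]] by simp
  then have "openin PT (\<Union>i\<in>{..<n}. {x. x i \<noteq> 0})" by (intro openin_Union) auto
  also have "(\<Union>i\<in>{..<n}. {x. x i \<noteq> 0}) = {x. \<exists>i<n. x i \<noteq> 0}" by auto
  finally show ?thesis .
qed

lemma open_upper: "openin (subtopology PT (Ep (Suc n))) (upper n s)"
proof -
  have "openin PT {x. s * x n > 0}"
    using openin_continuous_map_preimage[of PT euclideanreal "\<lambda>x. s * x n" "{0<..}"]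
    by (simp add: continuous_intros continuous_map_PT_component)
  then have "openin PT ({x. \<exists>i<n. x i \<noteq> 0} \<union> {x. s * x n > 0})"
    using open_nonzero by blast
  moreover have "upper n s = ({x. \<exists>i<n. x i \<noteq> 0} \<union> {x. s * x n > 0}) \<inter> Ep (Suc n)"
    by (auto simp: upper_def Ep_Suc)
  ultimately show ?thesis unfolding openin_subtopology by blast
qed

lemma Ep_upper: "Ep (Suc n) = upper n 1 \<union> upper n (-1)"
  by (auto simp: upper_def Ep_Suc)

definition flat :: "nat \<Rightarrow> (nat \<Rightarrow> real) set" where
  "flat n = {x \<in> En (Suc n). \<exists>i<n. x i \<noteq> 0}"

lemma upper_Int: "upper n 1 \<inter> upper n (-1) = flat n"
  by (auto simp: upper_def flat_def)

lemma flat_subset: "flat n \<subseteq> upper n s" "upper n s \<subseteq> En (Suc n)"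
  by (auto simp: upper_def flat_def)

lemma upper_subset: "upper n s \<subseteq> Ep (Suc n)"
  by (auto simp: upper_def Ep_Suc)

lemma push_Ep: "x \<in> Ep n \<Longrightarrow> push n s (x, t) \<in> flat n"
  by (auto simp: Ep_iff flat_def push_def En_def intro: exI[of _ "_::nat"])

lemma push_En: "x \<in> En n \<Longrightarrow> push n s (x, t) \<in> En (Suc n)"
  by (auto simp: En_def push_def)

lemma push1_En: "x \<in> En n \<Longrightarrow> s \<noteq> 0 \<Longrightarrow> push n s (x, 1) \<in> upper n s"
  by (auto simp: En_def push_def upper_def)

text \<open>Raising coordinate \<open>n\<close> by \<open>\<bar>x n\<bar> + 1\<close> makes it
  positive. This deforms the whole space into \<open>upper n 1\<close> and never leaves that set
  when starting in it.\<close>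

lemma relnull_upper:
  assumes "relcyc p PT (En (Suc n)) (upper n 1) w"
  shows "relnull p PT (En (Suc n)) (upper n 1) w"
proof -
  define h :: "(nat \<Rightarrow> real) \<times> real \<Rightarrow> nat \<Rightarrow> real"
    where "h = (\<lambda>z i. if i = n then fst z i + snd z * (\<bar>fst z i\<bar> + 1) else fst z i)"
  have ch: "continuous_map (prod_topology (subtopology PT (En (Suc n))) (top_of_set {0..1})) PT h"
  proof (rule continuous_map_homotopy)
    show "continuous_map (prod_topology PT euclideanreal) euclideanreal (\<lambda>z. h z i)" for i
      by (cases "i = n") (auto simp: h_def intro!: continuous_intros)
  qed
  have c1: "continuous_map PT PT (\<lambda>x. h (x, 1))"
  proof -
    have "continuous_map PT euclideanreal (\<lambda>x. h (x, 1) i)" for i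
      by (cases "i = n") (auto simp: h_def intro!: continuous_intros)
    then show ?thesis by (simp add: continuous_map_componentwise_UNIV)
  qed
  have "relnull p PT (En (Suc n)) (upper n 1) (cmap p (\<lambda>x. h (x, 0)) w + cmap p (\<lambda>x. h (x, 1)) w)"
  proof (rule homotopy_relnull[OF ch assms])
    fix x and t :: real assume t: "0 \<le> t" "t \<le> 1"
    show "h (x, t) \<in> En (Suc n)" if "x \<in> En (Suc n)" using that by (auto simp: h_def En_def)
    have "0 \<le> t * (\<bar>x n\<bar> + 1)" using t by auto
    then show "h (x, t) \<in> upper n 1" if "x \<in> upper n 1"
      using that by (auto simp: h_def upper_def En_def)
  qed (auto simp: flat_subset)
  moreover have wP: "ch p (subtopology PT (En (Suc n))) w" using assms by (simp add: relcyc_def)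
  moreover have "cmap p (\<lambda>x. h (x, 0)) w = w" using wP by (rule cmap_id) (auto simp: h_def)
  moreover have "ch p (subtopology PT (upper n 1)) (cmap p (\<lambda>x. h (x, 1)) w)"
    using wP c1 by (rule ch_image) (auto simp: h_def upper_def En_def)
  ultimately show ?thesis using relnull_cancel relnull_sub by fastforce
qed

lemma ch_PT: "ch p (subtopology PT P) c \<Longrightarrow> ch p PT c"
  by (simp add: ch_subtopology)

lemma bd_susp:
  assumes "ch j PT q"
  shows "bd (Suc j) (susp n j q) = cmap j (\<lambda>x. push n 1 (x, 1)) q + cmap j (\<lambda>x. push n (-1) (x, 1)) q
     + susp n (j - Suc 0) (bd j q)"
  by (simp add: susp_def bd_add bd_prism_push[OF assms] ac_simps)

lemma ch_susp_flat: "ch j (subtopology PT (Ep n)) q \<Longrightarrow> ch (Suc j) (subtopology PT (flat n)) (susp n j q)"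
  unfolding susp_def by (intro ch_add ch_prism_push) (auto simp: push_Ep)

lemma ch_susp_bd_flat:
  "ch (j - Suc 0) (subtopology PT (Ep n)) (bd j q) \<Longrightarrow> ch j (subtopology PT (flat n)) (susp n (j - Suc 0) (bd j q))"
  using ch_susp_flat[of "j - Suc 0" n "bd j q"] by (cases j) auto

lemma ch_susp: "ch j (subtopology PT (En n)) q \<Longrightarrow> ch (Suc j) (subtopology PT (En (Suc n))) (susp n j q)"
  unfolding susp_def by (intro ch_add ch_prism_push) (auto simp: push_En)

lemma ch_push1:
  "ch j (subtopology PT (En n)) q \<Longrightarrow> s \<noteq> 0 \<Longrightarrow> ch j (subtopology PT (upper n s)) (cmap j (\<lambda>x. push n s (x, 1)) q)"
  by (rule ch_image[OF _ continuous_map_push1]) (auto simp: push1_En)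

text \<open>The bounding chain is suspended as well. Its two end faces avoid the origin, since
  coordinate \<open>n\<close> is 1 or -1 there.\<close>

lemma susp_relnull:
  assumes "rnE n j q" shows "rnE (Suc n) (Suc j) (susp n j q)"
proof -
  obtain d e where d: "ch (Suc j) (subtopology PT (En n)) d" and e: "ch j (subtopology PT (Ep n)) e"
    and q: "q = bd (Suc j) d + e" using assms unfolding relnull_def by blast
  let ?k = "\<lambda>s. cmap (Suc j) (\<lambda>x. push n s (x, 1)) d"
  have "bd (Suc (Suc j)) (susp n (Suc j) d) = ?k 1 + ?k (-1) + susp n j (bd (Suc j) d)"
    using bd_susp[OF ch_PT[OF d]] by simp
  then have "susp n j q = bd (Suc (Suc j)) (susp n (Suc j) d) + (?k 1 + ?k (-1) + susp n j e)"
    by (simp add: q susp_add ac_simps)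
  moreover have "ch (Suc j) (subtopology PT (Ep (Suc n))) (?k 1 + ?k (-1) + susp n j e)"
    using ch_mono[OF ch_push1[OF d, of 1] upper_subset] ch_mono[OF ch_push1[OF d, of "-1"] upper_subset]
      ch_mono[OF ch_susp_flat[OF e] order_trans[OF flat_subset(1) upper_subset]]
    by (intro ch_add) auto
  ultimately show ?thesis unfolding relnull_def using ch_susp[OF d] by blast
qed

definition proj0 :: "nat \<Rightarrow> (nat \<Rightarrow> real) \<Rightarrow> nat \<Rightarrow> real" where
  "proj0 n x = (\<lambda>i. if i = n then 0 else x i)"

lemma continuous_map_proj0: "continuous_map PT PT (proj0 n)"
proof -
  have "continuous_map PT euclideanreal (\<lambda>x. proj0 n x i)" for i
    by (cases "i = n") (auto simp: proj0_def)
  then show ?thesis by (simp add: continuous_map_componentwise_UNIV)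
qed

lemma proj0_in: "x \<in> En (Suc n) \<Longrightarrow> proj0 n x \<in> En n" "x \<in> flat n \<Longrightarrow> proj0 n x \<in> Ep n"
  by (auto simp: proj0_def En_def flat_def Ep_iff le_less_Suc_eq dest: Suc_leI)

text \<open>Injectivity of suspension. The part \<open>e\<close> of the relation that avoids the
  origin is cut along the two sets \<open>upper\<close>. This exhibits the lower end of the
  suspension as null relative to \<open>flat n\<close>, and forgetting coordinate \<open>n\<close>
  turns that end back into \<open>q\<close>.\<close>

lemma susp_relnull_D:
  assumes q: "rcE n j q" and s: "rnE (Suc n) (Suc j) (susp n j q)"
  shows "rnE n j q"
proof -
  let ?k = "\<lambda>s. cmap j (\<lambda>x. push n s (x, 1)) q"
  let ?R = "susp n (j - Suc 0) (bd j q)"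
  let ?A = "upper n 1" and ?B = "upper n (-1)"
  have qE: "ch j (subtopology PT (En n)) q" and bq: "ch (j - Suc 0) (subtopology PT (Ep n)) (bd j q)"
    using q by (auto simp: relcyc_def)
  obtain d e where d: "ch (Suc (Suc j)) (subtopology PT (En (Suc n))) d"
    and e: "ch (Suc j) (subtopology PT (Ep (Suc n))) e"
    and de: "susp n j q = bd (Suc (Suc j)) d + e" using s unfolding relnull_def by blast
  have "bd (Suc j) (susp n j q) = bd (Suc j) e"
    unfolding de by (simp add: bd_add bd_bd_Suc[OF d])
  then have bde: "bd (Suc j) e = ?k 1 + ?k (-1) + ?R"
    using bd_susp[OF ch_PT[OF qE]] by simp
  have cov: "\<And>U. U \<in> {?A, ?B} \<Longrightarrow> openin (subtopology PT (Ep (Suc n))) U"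
    "topspace (subtopology PT (Ep (Suc n))) \<subseteq> \<Union>{?A, ?B}"
    using open_upper Ep_upper by auto
  obtain T H where sd: "subdivision T H"
    and small: "\<And>f. f \<in> Poly_Mapping.keys (T (Suc j) e) \<Longrightarrow> \<exists>V\<in>{?A, ?B}. f ` standard_simplex (Suc j) \<subseteq> V"
    using small_chain[OF cov e] by blast
  note TH = subdivisionD[OF sd]
  obtain eA eB where eAB: "T (Suc j) e = eA + eB" "ch (Suc j) (subtopology PT ?A) eA" "ch (Suc j) (subtopology PT ?B) eB"
    using split_chain[OF ch_PT[OF TH(5)[OF e]], of ?A ?B] small by blast
  have kA: "ch j (subtopology PT ?A) (?k 1)" and kB: "ch j (subtopology PT ?B) (?k (-1))"
    and RC: "ch j (subtopology PT (flat n)) ?R"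
    using ch_push1[OF qE] ch_susp_bd_flat[OF bq] by auto
  \<comment> \<open>By definition \<open>\<kappa>\<close> lies in the lower piece; by the boundary
    relation it also lies in the upper one, hence in their intersection
    \<open>flat n\<close>.\<close>
  define \<kappa> where "\<kappa> = bd (Suc j) eB + T j (?k (-1))"
  have "bd (Suc j) eA + bd (Suc j) eB = T j (bd (Suc j) e)"
    using TH(8)[OF e] by (simp add: eAB bd_add)
  also have "\<dots> = T j (?k 1) + T j (?k (-1)) + T j ?R"
    by (simp add: bde TH(1))
  finally have E: "bd (Suc j) eA + bd (Suc j) eB = T j (?k 1) + T j (?k (-1)) + T j ?R" .
  have "\<kappa> = bd (Suc j) eA + (bd (Suc j) eA + bd (Suc j) eB) + T j (?k (-1))"
    by (simp add: \<kappa>_def add.assoc)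
  also have "\<dots> = bd (Suc j) eA + T j (?k 1) + T j ?R" by (simp add: E ac_simps)
  finally have "\<kappa> = bd (Suc j) eA + T j (?k 1) + T j ?R" .
  then have "ch j (subtopology PT ?A) \<kappa>"
    using ch_bd_Suc[OF eAB(2)] TH(5)[OF kA] TH(5)[OF ch_mono[OF RC]] flat_subset by auto
  moreover have "ch j (subtopology PT ?B) \<kappa>"
    unfolding \<kappa>_def using ch_bd_Suc[OF eAB(3)] TH(5)[OF kB] by auto
  ultimately have \<kappa>: "ch j (subtopology PT (flat n)) \<kappa>"
    using ch_subtopology_Int upper_Int by metis
  have bk: "bd j (?k (-1)) = cmap (j - Suc 0) (\<lambda>x. push n (-1) (x, 1)) (bd j q)"
    using bd_cmap[OF ch_PT[OF qE]] by blast
  have "ch (j - Suc 0) (subtopology PT (flat n)) (bd j (?k (-1)))"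
    unfolding bk using bq continuous_map_push1 by (rule ch_image) (rule push_Ep)
  then have Hb: "ch j (subtopology PT (flat n)) (H (j - Suc 0) (bd j (?k (-1))))"
    using TH(6)[of "j - Suc 0"] TH(4) by (cases j) auto
  have "?k (-1) = bd (Suc j) (eB + H j (?k (-1))) + (\<kappa> + H (j - Suc 0) (bd j (?k (-1))))"
    using TH(7)[OF kB] unfolding \<kappa>_def by (simp add: bd_add ac_simps)
  moreover have "ch (Suc j) (subtopology PT ?B) (eB + H j (?k (-1)))"
    using eAB(3) TH(6)[OF kB] by auto
  ultimately have "relnull j PT ?B (flat n) (?k (-1))"
    unfolding relnull_def using \<kappa> Hb by blast
  then have "relnull j PT (En n) (Ep n) (cmap j (proj0 n) (?k (-1)))"
    by (rule relnull_cmap) (use flat_subset(1) in \<open>auto simp: continuous_map_from_subtopology continuous_map_proj0 intro!: proj0_in flat_subset(2)[THEN subsetD]\<close>)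
  moreover have "cmap j (proj0 n) (?k (-1)) = q"
    unfolding cmap_cmap using qE by (rule cmap_id) (auto simp: proj0_def push_def En_def)
  ultimately show ?thesis by simp
qed

text \<open>Surjectivity of suspension. The lower part of the boundary of \<open>z\<close>,
  projected along coordinate \<open>n\<close>, is \<open>q\<close>. Up to a chain in the lower
  piece, \<open>z + susp n j q\<close> then has its boundary in \<open>upper n 1\<close>, where
  \<open>relnull_upper\<close> applies.\<close>

lemma susp_surj:
  assumes z: "rcE (Suc n) (Suc j) z"
  obtains q where "rcE n j q" "rnE (Suc n) (Suc j) (z + susp n j q)"
proof -
  let ?A = "upper n 1" and ?B = "upper n (-1)"
  have zE: "ch (Suc j) (subtopology PT (En (Suc n))) z" and bz: "ch j (subtopology PT (Ep (Suc n))) (bd (Suc j) z)"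
    using z by (auto simp: relcyc_def)
  have cov: "\<And>U. U \<in> {?A, ?B} \<Longrightarrow> openin (subtopology PT (Ep (Suc n))) U"
    "topspace (subtopology PT (Ep (Suc n))) \<subseteq> \<Union>{?A, ?B}"
    using open_upper Ep_upper by auto
  obtain T H where sd: "subdivision T H"
    and small: "\<And>f. f \<in> Poly_Mapping.keys (T j (bd (Suc j) z)) \<Longrightarrow> \<exists>V\<in>{?A, ?B}. f ` standard_simplex j \<subseteq> V"
    using small_chain[OF cov bz] by blast
  note TH = subdivisionD[OF sd]
  define z1 where "z1 = T (Suc j) z"
  have z1E: "ch (Suc j) (subtopology PT (En (Suc n))) z1" unfolding z1_def by (rule TH(5)[OF zE])
  have zz1: "rnE (Suc n) (Suc j) (z + z1)"
    unfolding relnull_def z1_def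
    using TH(7)[OF zE] TH(6)[OF zE] TH(6)[OF bz]
    by (intro exI[of _ "H (Suc j) z"] exI[of _ "H j (bd (Suc j) z)"]) (auto simp: add.commute)
  obtain gA gB where g: "T j (bd (Suc j) z) = gA + gB" "ch j (subtopology PT ?A) gA" "ch j (subtopology PT ?B) gB"
    using split_chain[OF ch_PT[OF TH(5)[OF bz]], of ?A ?B] small by blast
  have bz1: "bd (Suc j) z1 = gA + gB" unfolding z1_def using TH(8)[OF zE] g by simp
  have "bd j gA + bd j gB = 0" using bd_bd_Suc[OF z1E] by (simp add: bz1 bd_add)
  then have "bd j gA = bd j gB" by (rule chain2_eq_iff[THEN iffD2])
  then have bgB: "ch (j - Suc 0) (subtopology PT (flat n)) (bd j gB)"
    using ch_subtopology_Int[of "j - Suc 0" PT ?A "bd j gB" ?B] ch_bd[OF g(2)] ch_bd[OF g(3)] unfolding upper_Int by metis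
  have gBrc: "relcyc j PT ?B (flat n) gB" using g(3) bgB by (simp add: relcyc_def)
  define q where "q = cmap j (proj0 n) gB"
  have q: "rcE n j q" unfolding q_def
    by (rule relcyc_cmap[OF gBrc]) (use flat_subset(1) in \<open>auto simp: continuous_map_from_subtopology continuous_map_proj0 intro!: proj0_in flat_subset(2)[THEN subsetD]\<close>)
  have qE: "ch j (subtopology PT (En n)) q" and bq: "ch (j - Suc 0) (subtopology PT (Ep n)) (bd j q)"
    using q by (auto simp: relcyc_def)
  let ?k = "\<lambda>s. cmap j (\<lambda>x. push n s (x, 1)) q"
  let ?R = "susp n (j - Suc 0) (bd j q)"
  \<comment> \<open>Coordinate \<open>n\<close> slides linearly to -1. A negative value stays
    negative and the other coordinates do not move, so both sets of the pair are preserved; the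
    final map is the lower end of the suspension.\<close>
  define h :: "(nat \<Rightarrow> real) \<times> real \<Rightarrow> nat \<Rightarrow> real"
    where "h = (\<lambda>z i. if i = n then (1 - snd z) * fst z i - snd z else fst z i)"
  have ch: "continuous_map (prod_topology (subtopology PT ?B) (top_of_set {0..1})) PT h"
  proof (rule continuous_map_homotopy)
    show "continuous_map (prod_topology PT euclideanreal) euclideanreal (\<lambda>z. h z i)" for i
      by (cases "i = n") (auto simp: h_def intro!: continuous_intros)
  qed
  have "relnull j PT ?B (flat n) (cmap j (\<lambda>x. h (x, 0)) gB + cmap j (\<lambda>x. h (x, 1)) gB)"
  proof (rule homotopy_relnull[OF ch gBrc])
    fix x and t :: real assume t: "0 \<le> t" "t \<le> 1"
    show "h (x, t) \<in> flat n" if "x \<in> flat n"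
      using that by (auto simp: h_def flat_def En_def)
    have "(1 - t) * x n - t < 0" if "x n < 0"
    proof (cases "t = 1")
      case False
      then have "(1 - t) * x n < 0" using t that by (simp add: mult_pos_neg)
      then show ?thesis using t by simp
    qed simp
    then have "h (x, t) n < 0" if "x n < 0" using that by (simp add: h_def)
    moreover have "h (x, t) i = x i" if "i \<noteq> n" for i using that by (simp add: h_def)
    ultimately show "h (x, t) \<in> ?B" if "x \<in> ?B"
      using that unfolding upper_def En_def by force
  qed (auto simp: flat_subset)
  moreover have "cmap j (\<lambda>x. h (x, 0)) gB = gB" using g(3) by (rule cmap_id) (auto simp: h_def)
  moreover have "cmap j (\<lambda>x. h (x, 1)) gB = ?k (-1)"
    unfolding q_def cmap_cmap using g(3) by (rule cmap_cong) (auto simp: h_def proj0_def push_def)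
  ultimately have "relnull j PT ?B (flat n) (gB + ?k (-1))" by simp
  then obtain G e where G: "ch (Suc j) (subtopology PT ?B) G" "ch j (subtopology PT (flat n)) e"
    "gB + ?k (-1) = bd (Suc j) G + e" unfolding relnull_def by blast
  define y where "y = z1 + susp n j q + G"
  have "bd (Suc j) y = gA + gB + (?k 1 + ?k (-1) + ?R) + bd (Suc j) G"
    by (simp add: y_def bd_add bz1 bd_susp[OF ch_PT[OF qE]])
  also have "bd (Suc j) G = gB + ?k (-1) + e" using G(3) by (simp add: add.assoc)
  also have "gA + gB + (?k 1 + ?k (-1) + ?R) + (gB + ?k (-1) + e) = gA + ?k 1 + ?R + e"
    by (simp add: ac_simps)
  finally have bdy: "bd (Suc j) y = gA + ?k 1 + ?R + e" .
  have "ch j (subtopology PT ?A) (bd (Suc j) y)"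
    unfolding bdy
    using g(2) ch_push1[OF qE, of 1] ch_mono[OF ch_susp_bd_flat[OF bq] flat_subset(1)] ch_mono[OF G(2) flat_subset(1)]
    by (intro ch_add) auto
  moreover have "ch (Suc j) (subtopology PT (En (Suc n))) y"
    unfolding y_def using z1E ch_susp[OF qE] ch_mono[OF G(1) flat_subset(2)] by auto
  ultimately have "relcyc (Suc j) PT (En (Suc n)) ?A y" by (simp add: relcyc_def)
  then have "relnull (Suc j) PT (En (Suc n)) ?A y" by (rule relnull_upper)
  then have "rnE (Suc n) (Suc j) y" by (rule relnull_mono) (auto simp: upper_subset[THEN subsetD])
  moreover have "rnE (Suc n) (Suc j) G"
    using ch_mono[OF G(1) upper_subset] by (rule relnull_sub)
  ultimately have "rnE (Suc n) (Suc j) (z1 + susp n j q)"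
    unfolding y_def by (rule relnull_cancel)
  from relnull_add[OF zz1 this] have "rnE (Suc n) (Suc j) (z + susp n j q)"
    by (simp add: add.assoc)
  with q show thesis by (rule that)
qed


section \<open>Antipodal chains\<close>

definition ng :: "nat \<Rightarrow> (nat \<Rightarrow> real) chain2 \<Rightarrow> (nat \<Rightarrow> real) chain2" where
  "ng p = cmap p (\<lambda>x i. - x i)"

definition pt0 :: "(nat \<Rightarrow> real) chain2" where
  "pt0 = sgl (restrict (\<lambda>_. (\<lambda>_. 0)) (standard_simplex 0))"

text \<open>In degree 0 the chain is the origin, its own mirror image, and is counted once.\<close>

definition tr :: "nat \<Rightarrow> (nat \<Rightarrow> real) chain2 \<Rightarrow> (nat \<Rightarrow> real) chain2" where
  "tr i c = (if i = 0 then c else c + ng i c)"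

text \<open>Model: \<open>b i\<close> is a half of Euclidean \<open>i\<close>-space and
  \<open>tr i (b i)\<close> is the whole of it. The boundary of a half is the whole space of one
  dimension less, up to chains that avoid the origin.\<close>

definition hemi :: "nat \<Rightarrow> (nat \<Rightarrow> (nat \<Rightarrow> real) chain2) \<Rightarrow> bool" where
  "hemi n b \<longleftrightarrow> (\<forall>i\<le>n. ch i (subtopology PT (En n)) (b i)) \<and> b 0 = pt0 \<and>
     (\<forall>i<n. ch i (subtopology PT (Ep n)) (bd (Suc i) (b (Suc i)) + tr i (b i)))"

lemma ng_add: "ng p (a + b) = ng p a + ng p b" by (simp add: ng_def cmap_add)
lemma ng_0 [simp]: "ng p 0 = 0" by (simp add: ng_def)

lemma continuous_map_neg: "continuous_map PT PT (\<lambda>x i. - x i)"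
  by (simp add: continuous_map_componentwise_UNIV continuous_map_PT_component continuous_map_minus)

lemma ch_ng:
  "ch p (subtopology PT (En n)) c \<Longrightarrow> ch p (subtopology PT (En n)) (ng p c)"
  "ch p (subtopology PT (Ep n)) c \<Longrightarrow> ch p (subtopology PT (Ep n)) (ng p c)"
  unfolding ng_def by (erule ch_image[OF _ continuous_map_neg]; force simp: En_def Ep_iff)+

lemma ng_ng: "ch p PT c \<Longrightarrow> ng p (ng p c) = c"
  unfolding ng_def cmap_cmap by (rule cmap_id) auto

lemma bd_ng: "ch (Suc p) PT c \<Longrightarrow> bd (Suc p) (ng (Suc p) c) = ng p (bd (Suc p) c)"
  unfolding ng_def by (rule bd_cmap_Suc)

lemma ng_pt0: "ng 0 pt0 = pt0"
  by (simp add: ng_def pt0_def simplex_map_def o_def restrict_def cong: if_cong)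

lemma ng_tr: "ch i PT c \<Longrightarrow> (i = 0 \<Longrightarrow> c = pt0) \<Longrightarrow> ng i (tr i c) = tr i c"
  by (auto simp: tr_def ng_pt0 ng_add ng_ng add.commute)

lemma rnE_ng: "rnE n p c \<Longrightarrow> rnE n p (ng p c)"
  unfolding ng_def
  by (rule relnull_cmap) (auto simp: continuous_map_from_subtopology continuous_map_neg Ep_iff En_def)

lemma rcE_ng: "rcE n p c \<Longrightarrow> rcE n p (ng p c)"
  unfolding ng_def
  by (rule relcyc_cmap) (auto simp: continuous_map_from_subtopology continuous_map_neg Ep_iff En_def)

lemma hemiD:
  assumes "hemi n b"
  shows "i \<le> n \<Longrightarrow> ch i (subtopology PT (En n)) (b i)" "b 0 = pt0"
    "i < n \<Longrightarrow> ch i (subtopology PT (Ep n)) (bd (Suc i) (b (Suc i)) + tr i (b i))"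
    "i \<le> n \<Longrightarrow> ch i PT (b i)" "i \<le> n \<Longrightarrow> ng i (tr i (b i)) = tr i (b i)"
  using assms by (auto simp: hemi_def intro!: ng_tr intro: ch_PT)

lemma ch_tr: "ch i (subtopology PT (En n)) c \<Longrightarrow> ch i (subtopology PT (En n)) (tr i c)"
  by (auto simp: tr_def ch_ng)

text \<open>The boundary of \<open>b n\<close> is an invariant chain plus an error off the origin;
  adding the mirror image cancels the invariant chain.\<close>

lemma hemi_relcyc:
  assumes "hemi n b" shows "rcE n n (tr n (b n))"
proof (cases n)
  case 0
  then show ?thesis using ch_tr[OF hemiD(1)[OF assms order_refl]] by (simp add: relcyc_def)
next
  case (Suc i)
  define e where "e = bd (Suc i) (b (Suc i)) + tr i (b i)"
  have e: "ch i (subtopology PT (Ep n)) e" unfolding e_def using hemiD(3)[OF assms, of i] Suc by simp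
  have "bd n (tr n (b n)) = bd (Suc i) (b (Suc i)) + ng i (bd (Suc i) (b (Suc i)))"
    using hemiD(4)[OF assms, of n] Suc by (simp add: tr_def bd_add bd_ng)
  also have "bd (Suc i) (b (Suc i)) = e + tr i (b i)" by (simp add: e_def add.assoc)
  also have "e + tr i (b i) + ng i (e + tr i (b i)) = e + ng i e"
    using hemiD(5)[OF assms, of i] Suc by (simp add: ng_add ac_simps)
  finally show ?thesis
    using ch_tr[OF hemiD(1)[OF assms order_refl]] ch_add[OF e ch_ng(2)[OF e]] Suc by (simp add: relcyc_def)
qed

text \<open>The antipode exchanges upward and downward prisms. The suspension of an invariant chain
  is thus one prism plus its mirror image.\<close>

lemma ng_prism: "ng (Suc p) (prism p (push n 1) q) = prism p (push n (-1)) (ng p q)"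
proof -
  have "sgl iota = cmap 1 id (sgl iota)"
    by (simp add: iota_def simplex_map_def o_def restrict_def cong: if_cong)
  then have "cross p 1 (ng p q) (sgl iota) = cmap (Suc p) (map_prod (\<lambda>x i. - x i) id) (cross p 1 q (sgl iota))"
    using cross_cmap[of p 1 "\<lambda>x i. - x i" q id "sgl iota"] by (simp add: ng_def)
  moreover have "push n (-1) \<circ> map_prod (\<lambda>x i. - x i) id = (\<lambda>x i. - x i) \<circ> push n 1"
    by (auto simp: fun_eq_iff push_def)
  ultimately show ?thesis by (simp add: ng_def prism_def cmap_cmap)
qed

lemma singleton_chain:
  assumes "ch p (subtopology X {a}) c"
  shows "c = 0 \<or> c = sgl (restrict (\<lambda>x. a) (standard_simplex p))"
proof -
  let ?s = "restrict (\<lambda>x. a) (standard_simplex p)"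
  have k: "Poly_Mapping.keys c \<subseteq> {?s}"
  proof
    fix f assume "f \<in> Poly_Mapping.keys c"
    then have "singular_simplex p (subtopology X {a}) f" using assms ch_keys by blast
    then have "f ` standard_simplex p \<subseteq> {a}" "f \<in> extensional (standard_simplex p)"
      by (simp_all add: singular_simplex_subtopology) (simp add: singular_simplex_def)
    then show "f \<in> {?s}" by (auto simp: fun_eq_iff extensional_def restrict_def)
  qed
  show ?thesis
  proof (cases "Poly_Mapping.keys c = {}")
    case False
    then have "Poly_Mapping.keys c = {?s}" using k by blast
    then show ?thesis using chain2_sum_single[of c] by simp
  qed auto
qed

lemma sgl_neq_0 [simp]: "sgl x \<noteq> 0"
proof
  assume "sgl x = 0"
  then have "Poly_Mapping.lookup (sgl x) x = 0" by (simp only: lookup_zero)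
  then show False by simp
qed

lemma sphere_base:
  "rcE 0 0 z \<Longrightarrow> z = 0 \<or> z = pt0" "\<not> rnE 0 0 pt0"
proof -
  have E: "En 0 = {\<lambda>_. 0}" "Ep 0 = {}" by (auto simp: En_def Ep_def)
  show "rcE 0 0 z \<Longrightarrow> z = 0 \<or> z = pt0"
    unfolding relcyc_def E pt0_def using singleton_chain[of 0 PT "\<lambda>_. 0" z] by blast
  show "\<not> rnE 0 0 pt0"
  proof
    assume "rnE 0 0 pt0"
    then obtain d e where d: "ch (Suc 0) (subtopology PT {\<lambda>_. 0}) d" "ch 0 (subtopology PT {}) e" "pt0 = bd (Suc 0) d + e"
      unfolding relnull_def E by auto
    have e: "e = 0"
    proof (rule ccontr)
      assume "e \<noteq> 0"
      then obtain f where "f \<in> Poly_Mapping.keys e" by (metis all_not_in_conv keys_eq_empty)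
      then have "singular_simplex 0 (subtopology PT {}) f" using d(2) ch_keys by blast
      then show False using singular_simplex_empty[of "subtopology PT {}" 0 f] by simp
    qed
    have "singular_face (Suc 0) i (restrict (\<lambda>x. \<lambda>_. 0) (standard_simplex (Suc 0))) = restrict (\<lambda>x. \<lambda>_::nat. 0::real) (standard_simplex 0)"
      if "i \<le> 1" for i
      using that simplical_face_in_standard_simplex[of 1 i] by (auto simp: singular_face_def fun_eq_iff restrict_def)
    then have "bd (Suc 0) d = 0"
      using singleton_chain[OF d(1)] by (auto simp: bd_single simp del: singular_face_restrict)
    with e d(3) show False by (simp add: pt0_def)
  qed
qed

lemma rcE_0_null: "rcE (Suc n) 0 z \<Longrightarrow> rnE (Suc n) 0 z"
  using relnull_upper[of 0 n z] relnull_mono[of 0 PT "En (Suc n)" "upper n 1" z "En (Suc n)" "Ep (Suc n)"] upper_subset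
  by (simp add: relcyc_def)

text \<open>Both claims pass from \<open>n\<close> to \<open>Suc n\<close> because suspension is
  bijective on classes. The generator is carried along as the top of a sequence satisfying
  \<open>hemi\<close>, the form in which \<open>odd_degree\<close> can compare it with other such
  sequences.\<close>

theorem euclidean_homology:
  "(\<forall>j<n. \<forall>z. rcE n j z \<longrightarrow> rnE n j z) \<and>
   (\<exists>b. hemi n b \<and> \<not> rnE n n (tr n (b n)) \<and> (\<forall>z. rcE n n z \<longrightarrow> rnE n n z \<or> rnE n n (z + tr n (b n))))"
proof (induction n)
  case 0
  have "hemi 0 (\<lambda>_. pt0)"
    by (auto simp: hemi_def pt0_def ch_single singular_simplex_subtopology singular_simplex_def En_def)
  moreover have "tr 0 pt0 = pt0" by (simp add: tr_def)
  moreover have "rnE 0 0 z \<or> rnE 0 0 (z + pt0)" if "rcE 0 0 z" for z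
    using sphere_base(1)[OF that] by auto
  ultimately show ?case using sphere_base(2) by (intro conjI exI[of _ "\<lambda>_. pt0"]) auto
next
  case (Suc n)
  then obtain b where b: "hemi n b" and nn: "\<not> rnE n n (tr n (b n))"
    and gen: "\<And>z. rcE n n z \<Longrightarrow> rnE n n z \<or> rnE n n (z + tr n (b n))" by blast
  define q where "q = tr n (b n)"
  \<comment> \<open>The next half-space is the upward prism over the full space
    \<open>q\<close>.\<close>
  define b' where "b' = (\<lambda>i. if i \<le> n then b i else prism n (push n 1) q)"
  have q: "rcE n n q" unfolding q_def by (rule hemi_relcyc[OF b])
  have qE: "ch n (subtopology PT (En n)) q" and bq: "ch (n - Suc 0) (subtopology PT (Ep n)) (bd n q)"
    using q by (auto simp: relcyc_def)
  have EE: "En n \<subseteq> En (Suc n)" "Ep n \<subseteq> Ep (Suc n)" by (auto simp: En_def Ep_def)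
  have "hemi (Suc n) b'"
    unfolding hemi_def
  proof (intro conjI allI impI)
    show "b' 0 = pt0" using hemiD(2)[OF b] by (simp add: b'_def)
    show "ch i (subtopology PT (En (Suc n))) (b' i)" if "i \<le> Suc n" for i
    proof (cases "i \<le> n")
      case True
      then show ?thesis using ch_mono[OF hemiD(1)[OF b] EE(1)] by (simp add: b'_def)
    next
      case False
      then have "i = Suc n" using that by simp
      then show ?thesis using ch_prism_push[OF qE, of n 1] push_En by (simp add: b'_def)
    qed
    show "ch i (subtopology PT (Ep (Suc n))) (bd (Suc i) (b' (Suc i)) + tr i (b' i))" if "i < Suc n" for i
    proof (cases "i < n")
      case True
      then show ?thesis using ch_mono[OF hemiD(3)[OF b] EE(2)] by (simp add: b'_def)
    next
      case False
      then have "i = n" using that by simp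
      have "bd (Suc n) (prism n (push n 1) q) + q = cmap n (\<lambda>x. push n 1 (x, 1)) q + prism (n - Suc 0) (push n 1) (bd n q)"
        by (simp add: bd_prism_push[OF ch_PT[OF qE]] ac_simps)
      moreover have "ch n (subtopology PT (Ep (Suc n))) (cmap n (\<lambda>x. push n 1 (x, 1)) q)"
        using ch_mono[OF ch_push1[OF qE, of 1] upper_subset] by simp
      moreover have "ch n (subtopology PT (flat n)) (prism (n - Suc 0) (push n 1) (bd n q))"
        using bq by (rule ch_prism_push_bd) (rule push_Ep)
      then have "ch n (subtopology PT (Ep (Suc n))) (prism (n - Suc 0) (push n 1) (bd n q))"
        using flat_subset upper_subset by (meson ch_mono order_trans)
      ultimately show ?thesis using \<open>i = n\<close> by (simp add: b'_def q_def[symmetric] ch_add)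
    qed
  qed
  moreover have tq: "tr (Suc n) (b' (Suc n)) = susp n n q"
    unfolding tr_def susp_def b'_def using ng_prism[of n n q] hemiD(5)[OF b, of n] by (simp add: q_def)
  moreover have "\<not> rnE (Suc n) (Suc n) (susp n n q)"
    using susp_relnull_D[OF q] nn by (auto simp: q_def)
  moreover have "rnE (Suc n) (Suc n) z \<or> rnE (Suc n) (Suc n) (z + susp n n q)" if zz: "rcE (Suc n) (Suc n) z" for z
  proof -
    obtain r where r: "rcE n n r" "rnE (Suc n) (Suc n) (z + susp n n r)" by (rule susp_surj[OF zz])
    show ?thesis
    proof (cases "rnE n n r")
      case True
      then show ?thesis using relnull_cancel[OF r(2) susp_relnull] by blast
    next
      case False
      then have "rnE n n (r + q)" using gen[OF r(1)] by (simp add: q_def)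
      from relnull_add[OF r(2) susp_relnull[OF this]] show ?thesis by (simp add: susp_add ac_simps)
    qed
  qed
  moreover have "rnE (Suc n) j z" if jz: "j < Suc n" "rcE (Suc n) j z" for j z
  proof (cases j)
    case 0
    then show ?thesis using that rcE_0_null by blast
  next
    case (Suc j')
    then obtain r where r: "rcE n j' r" "rnE (Suc n) (Suc j') (z + susp n j' r)"
      using susp_surj[of j' n z] jz by metis
    have "rnE n j' r" using \<open>(\<forall>j<n. \<forall>z. rcE n j z \<longrightarrow> rnE n j z) \<and> _\<close> r(1) that Suc by auto
    then show ?thesis using relnull_cancel[OF r(2) susp_relnull] Suc by blast
  qed
  ultimately show ?case by (intro conjI exI[of _ b']) auto
qed

text \<open>A chain-level form of Borsuk's theorem that odd maps of spheres have odd degree.\<close>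

theorem odd_degree:
  assumes a: "hemi n a"
  shows "\<not> rnE n n (tr n (a n))"
proof -
  obtain b where b: "hemi n b" and nn: "\<not> rnE n n (tr n (b n))"
    and gen: "\<And>z. rcE n n z \<Longrightarrow> rnE n n z \<or> rnE n n (z + tr n (b n))"
    and low_null: "\<And>j z. j < n \<Longrightarrow> rcE n j z \<Longrightarrow> rnE n j z"
    using euclidean_homology[of n] by blast
  show ?thesis
  proof (cases "n = 0")
    case True
    then show ?thesis using nn hemiD(2)[OF a] hemiD(2)[OF b] by simp
  next
    case False
    \<comment> \<open>The two sequences differ by a symmetric correction \<open>g + ng i g\<close>
      and a relative cycle. Below degree \<open>n\<close> this cycle bounds, and the bounding chain
      \<open>d\<close> is the correction in the next degree.\<close>
    have step: "\<exists>g. ch i (subtopology PT (En n)) g \<and> rcE n i (a i + b i + g + ng i g)" if "1 \<le> i" "i \<le> n" for i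
      using that
    proof (induction i rule: nat_induct_at_least)
      case base
      have "bd 1 (a 1 + b 1) = (bd (Suc 0) (a (Suc 0)) + tr 0 (a 0)) + (bd (Suc 0) (b (Suc 0)) + tr 0 (b 0))"
        using hemiD(2)[OF a] hemiD(2)[OF b] by (simp add: bd_add tr_def ac_simps)
      moreover have "ch 0 (subtopology PT (Ep n)) \<dots>"
        by (rule ch_add) (use hemiD(3)[OF a, of 0] hemiD(3)[OF b, of 0] base in simp_all)
      ultimately have "rcE n 1 (a 1 + b 1)"
        unfolding relcyc_def using hemiD(1)[OF a, of 1] hemiD(1)[OF b, of 1] base by auto
      then show ?case by (intro exI[of _ 0]) auto
    next
      case (Suc i)
      then obtain g where g: "ch i (subtopology PT (En n)) g" "rcE n i (a i + b i + g + ng i g)" by auto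
      then have "rnE n i (a i + b i + g + ng i g)" using low_null Suc by simp
      then obtain d e where d: "ch (Suc i) (subtopology PT (En n)) d" "ch i (subtopology PT (Ep n)) e"
        and eq: "a i + b i + g + ng i g = bd (Suc i) d + e" unfolding relnull_def by blast
      define A where "A = bd (Suc i) (a (Suc i)) + tr i (a i)"
      define B where "B = bd (Suc i) (b (Suc i)) + tr i (b i)"
      have AB: "ch i (subtopology PT (Ep n)) A" "ch i (subtopology PT (Ep n)) B"
        unfolding A_def B_def using hemiD(3)[OF a, of i] hemiD(3)[OF b, of i] Suc by auto
      have "bd (Suc i) d = (bd (Suc i) d + e) + e" by (simp add: add.assoc)
      then have bdd: "bd (Suc i) d = a i + b i + g + ng i g + e" unfolding eq .
      have "bd (Suc i) (a (Suc i) + b (Suc i) + d + ng (Suc i) d)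
         = (A + tr i (a i)) + (B + tr i (b i)) + bd (Suc i) d + ng i (bd (Suc i) d)"
        by (simp add: bd_add bd_ng[OF ch_PT[OF d(1)]] A_def B_def add.assoc)
      also have "\<dots> = A + B + e + ng i e"
        unfolding bdd using Suc(1) by (simp add: tr_def ng_add ng_ng[OF ch_PT[OF g(1)]] ac_simps)
      finally have "ch i (subtopology PT (Ep n)) (bd (Suc i) (a (Suc i) + b (Suc i) + d + ng (Suc i) d))"
        using AB d(2) ch_ng(2)[OF d(2)] by auto
      moreover have "ch (Suc i) (subtopology PT (En n)) (a (Suc i) + b (Suc i) + d + ng (Suc i) d)"
        using hemiD(1)[OF a, of "Suc i"] hemiD(1)[OF b, of "Suc i"] d(1) ch_ng(1)[OF d(1)] Suc by auto
      ultimately show ?case using d(1) by (intro exI[of _ d]) (auto simp: relcyc_def)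
    qed
    obtain g where g: "ch n (subtopology PT (En n)) g" and \<zeta>: "rcE n n (a n + b n + g + ng n g)"
      using step[of n] False by auto
    let ?z = "a n + b n + g + ng n g"
    have "?z + ng n ?z = tr n (a n) + tr n (b n)"
      using False by (simp add: tr_def ng_add ng_ng[OF ch_PT[OF g]] ac_simps)
    \<comment> \<open>The antipode acts trivially on a group of order two, whatever the class of
      \<open>?z\<close> is.\<close>
    moreover have "rnE n n (?z + ng n ?z)"
    proof (cases "rnE n n ?z")
      case True
      then show ?thesis using relnull_add rnE_ng by blast
    next
      case False
      have "ch n PT ?z" using \<zeta> ch_PT by (auto simp: relcyc_def)
      then have "\<not> rnE n n (ng n ?z)" using False rnE_ng ng_ng by metis
      then have "rnE n n (ng n ?z + tr n (b n))" "rnE n n (?z + tr n (b n))"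
        using gen[OF \<zeta>] gen[OF rcE_ng[OF \<zeta>]] False by auto
      from relnull_add[OF this] show ?thesis by (simp add: ac_simps)
    qed
    ultimately have "rnE n n (tr n (a n) + tr n (b n))" by simp
    then show ?thesis using nn relnull_cancel[of n PT "En n" "Ep n" "tr n (b n)" "tr n (a n)"] by (auto simp: add.commute)
  qed
qed

section \<open>Charts and boxes\<close>

definition Hn :: "nat \<Rightarrow> (nat \<Rightarrow> real) set" where
  "Hn n = {x \<in> En n. 0 \<le> x 0}"

text \<open>A box may reach the boundary of the half-space and is cut off there. It stays convex,
  and intersections of boxes are boxes.\<close>

definition hbox :: "nat \<Rightarrow> (nat \<Rightarrow> real) \<Rightarrow> (nat \<Rightarrow> real) \<Rightarrow> (nat \<Rightarrow> real) set" where
  "hbox n a b = {x \<in> Hn n. \<forall>i<n. a i < x i \<and> x i < b i}"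

lemma half_space_eq: "half_space n = subtopology PT (Hn n)"
  by (simp add: half_space_def Euclidean_space_def subtopology_subtopology Hn_def En_def Collect_conj_eq)

text \<open>A basic neighbourhood constrains only finitely many coordinates, so one radius serves
  for all of them.\<close>

lemma PT_neighbourhood:
  fixes x :: "'i \<Rightarrow> real"
  assumes T: "openin (powertop_real UNIV) T" and x: "x \<in> T"
  obtains e where "e > 0" "\<And>y. (\<And>i. \<bar>y i - x i\<bar> < e) \<Longrightarrow> y \<in> T"
proof -
  obtain V where finV: "finite {i. V i \<noteq> UNIV}" and openV: "\<And>i. open (V i)"
    and xV: "x \<in> Pi\<^sub>E UNIV V" and VT: "Pi\<^sub>E UNIV V \<subseteq> T"
    using T x unfolding openin_product_topology_alt by force
  have "\<exists>e>0. \<forall>x'. \<bar>x' - x i\<bar> < e \<longrightarrow> x' \<in> V i" for i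
    by (rule openV[unfolded open_real, rule_format]) (use xV in auto)
  then obtain d where d: "\<And>i. d i > 0" and dV: "\<And>i x'. \<bar>x' - x i\<bar> < d i \<Longrightarrow> x' \<in> V i" by metis
  define e where "e = Min (insert 1 (d ` {i. V i \<noteq> UNIV}))"
  have "e > 0" using finV d by (simp add: e_def)
  moreover have "y \<in> T" if y: "\<And>i. \<bar>y i - x i\<bar> < e" for y
  proof -
    have "y i \<in> V i" for i
    proof (cases "V i = UNIV")
      case False
      then have "e \<le> d i" using finV by (auto simp: e_def)
      then show ?thesis using dV[of "y i" i] y[of i] by linarith
    qed auto
    then show ?thesis using VT by auto
  qed
  ultimately show thesis by (rule that)
qed

lemma openin_box:
  shows "openin (half_space n) (hbox n a b)"
proof -
  have "openin PT {x. a i < x i \<and> x i < b i}" for i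
    using openin_continuous_map_preimage[OF continuous_map_PT_component[of i], of "{a i<..<b i}"] by simp
  then have "openin PT (\<Inter>i\<in>{..<n}. {x. a i < x i \<and> x i < b i})" if "n \<noteq> 0"
    using that by (intro openin_Inter) auto
  then have "openin PT {x. \<forall>i<n. a i < x i \<and> x i < b i}"
    using openin_topspace[of PT] by (cases "n = 0") (auto simp: lessThan_def Inter_eq)
  moreover have "hbox n a b = {x. \<forall>i<n. a i < x i \<and> x i < b i} \<inter> Hn n" by (auto simp: hbox_def)
  ultimately show ?thesis unfolding half_space_eq openin_subtopology by blast
qed

lemma box_Int: "hbox n a b \<inter> hbox n c d = hbox n (\<lambda>i. max (a i) (c i)) (\<lambda>i. min (b i) (d i))"
  by (auto simp: hbox_def)

lemma half_space_box:
  assumes S: "openin (half_space n) S" and x: "x \<in> S"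
  obtains e where "e > 0" "hbox n (\<lambda>i. x i - e) (\<lambda>i. x i + e) \<subseteq> S" "x \<in> hbox n (\<lambda>i. x i - e) (\<lambda>i. x i + e)"
proof -
  obtain T where T: "openin PT T" "S = T \<inter> Hn n" using S unfolding half_space_eq openin_subtopology by blast
  obtain e where e: "e > 0" "\<And>y. (\<And>i. \<bar>y i - x i\<bar> < e) \<Longrightarrow> y \<in> T"
    using PT_neighbourhood[OF T(1), of x] x T by blast
  have xH: "x \<in> Hn n" using x T by blast
  have "y \<in> S" if y: "y \<in> hbox n (\<lambda>i. x i - e) (\<lambda>i. x i + e)" for y
  proof -
    have "\<bar>y i - x i\<bar> < e" for i
      by (cases "i < n") (use y xH e(1) in \<open>auto simp: hbox_def abs_less_iff Hn_def En_def\<close>)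
    then show ?thesis using e(2) T y by (auto simp: hbox_def)
  qed
  moreover have "x \<in> hbox n (\<lambda>i. x i - e) (\<lambda>i. x i + e)" using xH e(1) by (auto simp: hbox_def)
  ultimately show thesis using that e(1) by blast
qed

lemma half_space_interior_point:
  assumes S: "openin (half_space n) S" "S \<noteq> {}" and n: "n \<ge> 1"
  obtains x where "x \<in> S" "x 0 > 0"
proof -
  obtain x where x: "x \<in> S" using S by blast
  obtain e where e: "e > 0" "hbox n (\<lambda>i. x i - e) (\<lambda>i. x i + e) \<subseteq> S" "x \<in> hbox n (\<lambda>i. x i - e) (\<lambda>i. x i + e)"
    using half_space_box[OF S(1) x] .
  have "x(0 := x 0 + e / 2) \<in> hbox n (\<lambda>i. x i - e) (\<lambda>i. x i + e)"
    using e(1,3) n by (auto simp: hbox_def Hn_def En_def)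
  moreover have "x 0 + e / 2 > 0" using e(1,3) by (auto simp: hbox_def Hn_def)
  ultimately show thesis using that[of "x(0 := x 0 + e / 2)"] e(2) by auto
qed

definition chart_inv :: "'a set \<Rightarrow> ('a \<Rightarrow> nat \<Rightarrow> real) \<Rightarrow> (nat \<Rightarrow> real) \<Rightarrow> 'a" where
  "chart_inv U \<phi> = inv_into U \<phi>"

lemma is_chartD:
  assumes "is_chart n X (U, \<phi>)"
  shows "openin X U" "inj_on \<phi> U" "\<phi> ` U \<subseteq> Hn n" "openin (half_space n) (\<phi> ` U)"
    "continuous_map (subtopology X U) PT \<phi>"
    "continuous_map (subtopology PT (\<phi> ` U)) (subtopology X U) (chart_inv U \<phi>)"
    "\<And>S. openin X S \<Longrightarrow> S \<subseteq> U \<Longrightarrow> openin (half_space n) (\<phi> ` S)"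
    "\<And>S. openin (half_space n) S \<Longrightarrow> openin X {p \<in> U. \<phi> p \<in> S}"
proof -
  show U: "openin X U" and oU: "openin (half_space n) (\<phi> ` U)" using assms by (auto simp: is_chart_def)
  have hm: "homeomorphic_map (subtopology X U) (subtopology (half_space n) (\<phi> ` U)) \<phi>"
    using assms by (auto simp: is_chart_def)
  have tU: "topspace (subtopology X U) = U" using openin_subset[OF U] by auto
  show inj: "inj_on \<phi> U" using hm tU by (metis homeomorphic_imp_injective_map)
  show sub: "\<phi> ` U \<subseteq> Hn n" using oU openin_subset by (fastforce simp: half_space_eq)
  have st: "subtopology (half_space n) (\<phi> ` U) = subtopology PT (\<phi> ` U)"
    using sub by (simp add: half_space_eq subtopology_subtopology inf.absorb2)
  have cm: "continuous_map (subtopology X U) (subtopology PT (\<phi> ` U)) \<phi>"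
    using hm st homeomorphic_imp_continuous_map by metis
  then show "continuous_map (subtopology X U) PT \<phi>" by (simp add: continuous_map_in_subtopology)
  obtain g where g: "homeomorphic_maps (subtopology X U) (subtopology PT (\<phi> ` U)) \<phi> g"
    using hm st homeomorphic_map_maps by metis
  have "chart_inv U \<phi> y = g y" if "y \<in> \<phi> ` U" for y
    using that g inj openin_subset[OF U] by (auto simp: chart_inv_def homeomorphic_maps_def)
  moreover have "continuous_map (subtopology PT (\<phi> ` U)) (subtopology X U) g"
    using g by (simp add: homeomorphic_maps_def)
  ultimately show "continuous_map (subtopology PT (\<phi> ` U)) (subtopology X U) (chart_inv U \<phi>)"
    by (metis (no_types, lifting) IntD2 continuous_map_eq topspace_subtopology)
  show "openin (half_space n) (\<phi> ` S)" if "openin X S" "S \<subseteq> U" for S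
  proof -
    have "openin (subtopology X U) S" using that U by (simp add: openin_open_subtopology)
    then have "openin (subtopology (half_space n) (\<phi> ` U)) (\<phi> ` S)"
      using homeomorphic_imp_open_map[OF hm] unfolding open_map_def by blast
    then show ?thesis using oU by (simp add: openin_open_subtopology)
  qed
  show "openin X {p \<in> U. \<phi> p \<in> S}" if oS: "openin (half_space n) S" for S
  proof -
    obtain T where "openin PT T" "S = T \<inter> Hn n" using oS unfolding half_space_eq openin_subtopology by blast
    then have "{p \<in> U. \<phi> p \<in> S} = {p \<in> topspace (subtopology X U). \<phi> p \<in> T}" using sub tU by auto
    moreover have "openin (subtopology X U) {p \<in> topspace (subtopology X U). \<phi> p \<in> T}"
      using cm \<open>openin PT T\<close> by (intro openin_continuous_map_preimage) (auto simp: continuous_map_in_subtopology)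
    ultimately show ?thesis using U by (simp add: openin_open_subtopology)
  qed
qed

lemma chart_inv_chart: "inj_on \<phi> U \<Longrightarrow> p \<in> U \<Longrightarrow> chart_inv U \<phi> (\<phi> p) = p"
  by (simp add: chart_inv_def)

section \<open>Pairs of points modulo the complement of the diagonal\<close>

definition sq :: "'a set \<Rightarrow> ('a \<times> 'a) set" where "sq V = V \<times> V"
definition od :: "'a set \<Rightarrow> ('a \<times> 'a) set" where "od V = {z \<in> V \<times> V. fst z \<noteq> snd z}"

lemma od_subset: "od V \<subseteq> sq V" by (auto simp: od_def sq_def)
lemma sq_mono: "V \<subseteq> V' \<Longrightarrow> sq V \<subseteq> sq V'" by (auto simp: sq_def)
lemma od_mono: "V \<subseteq> V' \<Longrightarrow> od V \<subseteq> od V'" by (auto simp: od_def)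
lemma sq_Int: "sq V \<inter> sq V' = sq (V \<inter> V')" by (auto simp: sq_def)
lemma od_sq: "od V \<inter> sq V' = od (V \<inter> V')" by (auto simp: od_def sq_def)

abbreviation rcV :: "'a topology \<Rightarrow> 'a set \<Rightarrow> nat \<Rightarrow> ('a \<times> 'a) chain2 \<Rightarrow> bool" where
  "rcV X V j \<equiv> relcyc j (prod_topology X X) (sq V) (od V)"

abbreviation rnV :: "'a topology \<Rightarrow> 'a set \<Rightarrow> nat \<Rightarrow> ('a \<times> 'a) chain2 \<Rightarrow> bool" where
  "rnV X V j \<equiv> relnull j (prod_topology X X) (sq V) (od V)"

lemma rcV_mono: "rcV X V j z \<Longrightarrow> V \<subseteq> V' \<Longrightarrow> rcV X V' j z"
  by (erule relcyc_mono) (auto simp: sq_mono od_mono)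

lemma rnV_mono: "rnV X V j z \<Longrightarrow> V \<subseteq> V' \<Longrightarrow> rnV X V' j z"
  by (erule relnull_mono) (auto simp: sq_mono od_mono)

lemma rnV_rcV: "rnV X V j z \<Longrightarrow> rcV X V j z"
  by (erule relnull_relcyc) (rule od_subset)

definition chart_box :: "nat \<Rightarrow> 'a topology \<Rightarrow> 'a set \<Rightarrow> ('a \<Rightarrow> nat \<Rightarrow> real) \<Rightarrow> 'a set \<Rightarrow> (nat \<Rightarrow> real) \<Rightarrow> (nat \<Rightarrow> real) \<Rightarrow> bool" where
  "chart_box n X U \<phi> W a b \<longleftrightarrow> is_chart n X (U, \<phi>) \<and> W \<subseteq> U \<and> W \<noteq> {} \<and> \<phi> ` W = hbox n a b"

lemma chart_boxD:
  assumes "chart_box n X U \<phi> W a b"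
  shows "is_chart n X (U, \<phi>)" "W \<subseteq> U" "W \<noteq> {}" "\<phi> ` W = hbox n a b" "W \<subseteq> topspace X"
    "inj_on \<phi> W" "continuous_map (subtopology X W) PT \<phi>"
    "continuous_map (subtopology PT (hbox n a b)) X (chart_inv U \<phi>)"
    "y \<in> hbox n a b \<Longrightarrow> chart_inv U \<phi> y \<in> W" "y \<in> hbox n a b \<Longrightarrow> \<phi> (chart_inv U \<phi> y) = y"
    "p \<in> W \<Longrightarrow> chart_inv U \<phi> (\<phi> p) = p" "p \<in> W \<Longrightarrow> \<phi> p \<in> hbox n a b" "openin X W"
proof -
  show c: "is_chart n X (U, \<phi>)" "W \<subseteq> U" "W \<noteq> {}" and im: "\<phi> ` W = hbox n a b" using assms by (auto simp: chart_box_def)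
  note D = is_chartD[OF c(1)]
  show "W \<subseteq> topspace X" using c(2) D(1) openin_subset by blast
  show inj: "inj_on \<phi> W" using D(2) c(2) inj_on_subset by blast
  show "continuous_map (subtopology X W) PT \<phi>" using D(5) c(2) continuous_map_from_subtopology_mono by blast
  have sub: "hbox n a b \<subseteq> \<phi> ` U" using im c(2) by blast
  have "continuous_map (subtopology PT (\<phi> ` U)) X (chart_inv U \<phi>)" using D(6) by (simp add: continuous_map_in_subtopology)
  then show "continuous_map (subtopology PT (hbox n a b)) X (chart_inv U \<phi>)"
    using sub continuous_map_from_subtopology_mono by blast
  show pW: "chart_inv U \<phi> (\<phi> p) = p" if "p \<in> W" for p using chart_inv_chart[OF D(2)] that c(2) by blast
  show "\<phi> p \<in> hbox n a b" if "p \<in> W" using that im by blast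
  show "chart_inv U \<phi> y \<in> W" "\<phi> (chart_inv U \<phi> y) = y" if y: "y \<in> hbox n a b" for y
  proof -
    obtain p where "p \<in> W" "y = \<phi> p" using y im by blast
    then show "chart_inv U \<phi> y \<in> W" "\<phi> (chart_inv U \<phi> y) = y" using pW by auto
  qed
  have "p \<in> W" if pU: "p \<in> U" "\<phi> p \<in> hbox n a b" for p
  proof -
    obtain q where "q \<in> W" "\<phi> p = \<phi> q" using pU(2) unfolding im[symmetric] by blast
    then show ?thesis using D(2) c(2) pU by (metis inj_onD subsetD)
  qed
  then have "W = {p \<in> U. \<phi> p \<in> hbox n a b}" using c(2) im by blast
  then show "openin X W" using D(8)[OF openin_box] by metis
qed

text \<open>The difference of chart coordinates. On a box it vanishes exactly on the diagonal, and
  exchanging the two points negates it.\<close>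

definition dl :: "('a \<Rightarrow> nat \<Rightarrow> real) \<Rightarrow> 'a \<times> 'a \<Rightarrow> nat \<Rightarrow> real" where
  "dl \<phi> z = (\<lambda>i. \<phi> (snd z) i - \<phi> (fst z) i)"

lemma continuous_map_chart_components:
  assumes "continuous_map (subtopology X W) PT \<phi>"
  shows "continuous_map (subtopology (prod_topology X X) (sq W)) euclideanreal (\<lambda>z. \<phi> (fst z) i)"
    "continuous_map (subtopology (prod_topology X X) (sq W)) euclideanreal (\<lambda>z. \<phi> (snd z) i)"
proof -
  have c: "continuous_map (subtopology X W) euclideanreal (\<lambda>p. \<phi> p i)"
    using continuous_map_compose[OF assms continuous_map_PT_component[of i]] by (simp add: o_def)
  have eq: "subtopology (prod_topology X X) (sq W) = prod_topology (subtopology X W) (subtopology X W)"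
    by (simp add: sq_def subtopology_Times)
  show "continuous_map (subtopology (prod_topology X X) (sq W)) euclideanreal (\<lambda>z. \<phi> (fst z) i)"
    "continuous_map (subtopology (prod_topology X X) (sq W)) euclideanreal (\<lambda>z. \<phi> (snd z) i)"
    unfolding eq using continuous_map_compose[OF continuous_map_fst c] continuous_map_compose[OF continuous_map_snd c]
    by (auto simp: o_def)
qed

lemma continuous_map_dl:
  assumes "continuous_map (subtopology X W) PT \<phi>"
  shows "continuous_map (subtopology (prod_topology X X) (sq W)) PT (dl \<phi>)"
  using continuous_map_chart_components[OF assms]
  by (simp add: continuous_map_componentwise_UNIV dl_def continuous_map_diff)

lemma dl_in:
  assumes "chart_box n X U \<phi> W a b"
  shows "dl \<phi> ` sq W \<subseteq> En n" "dl \<phi> ` od W \<subseteq> Ep n"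
proof -
  note D = chart_boxD[OF assms]
  have b: "\<phi> p \<in> En n" if "p \<in> W" for p using D(12)[OF that] by (auto simp: hbox_def Hn_def)
  show *: "dl \<phi> ` sq W \<subseteq> En n" using b by (auto simp: dl_def sq_def En_def)
  show "dl \<phi> ` od W \<subseteq> Ep n"
  proof
    fix v assume "v \<in> dl \<phi> ` od W"
    then obtain p q where pq: "p \<in> W" "q \<in> W" "p \<noteq> q" "v = dl \<phi> (p, q)" by (auto simp: od_def)
    then have "\<phi> p \<noteq> \<phi> q" using D(6) by (auto simp: inj_on_def)
    moreover have "\<phi> p = \<phi> q" if "v = (\<lambda>_. 0)" using that pq(4) by (auto simp: dl_def fun_eq_iff)
    ultimately have "v \<noteq> (\<lambda>_. 0)" by blast
    moreover have "v \<in> En n" using * pq by (auto simp: sq_def)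
    ultimately show "v \<in> Ep n" by (simp add: Ep_def)
  qed
qed

lemma cmap_dl:
  assumes "chart_box n X U \<phi> W a b"
  shows "rnV X W j z \<Longrightarrow> rnE n j (cmap j (dl \<phi>) z)" "rcV X W j z \<Longrightarrow> rcE n j (cmap j (dl \<phi>) z)"
  using relnull_cmap[OF _ continuous_map_dl[OF chart_boxD(7)[OF assms]] dl_in[OF assms] od_subset]
    relcyc_cmap[OF _ continuous_map_dl[OF chart_boxD(7)[OF assms]] dl_in[OF assms] od_subset] by auto

text \<open>Makes an arbitrary vector bounded without changing small vectors and without sending a
  nonzero coordinate to zero.\<close>

definition clamp :: "real \<Rightarrow> real \<Rightarrow> real" where "clamp R v = max (- R) (min R v)"

lemma clamp_simps: "R > 0 \<Longrightarrow> \<bar>clamp R v\<bar> \<le> R" "R > 0 \<Longrightarrow> clamp R v = 0 \<longleftrightarrow> v = 0" "\<bar>v\<bar> \<le> R \<Longrightarrow> clamp R v = v"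
  by (auto simp: clamp_def)

text \<open>Moving coordinate 0 halfway towards \<open>b 0\<close> leaves the boundary of the
  half-space. Around the new point there is room in all directions, also for a box that touches the
  boundary.\<close>

lemma box_center:
  assumes "x \<in> hbox n a b" "n \<ge> 1" "R > 0"
  obtains c e where "c \<in> hbox n a b" "e > 0"
    "\<And>w. w \<in> En n \<Longrightarrow> (\<And>i. \<bar>w i\<bar> \<le> R) \<Longrightarrow> (\<lambda>i. c i + e * w i) \<in> hbox n a b"
proof -
  define c where "c = x(0 := (x 0 + b 0) / 2)"
  have c: "a i < c i" "c i < b i" if "i < n" for i using assms that by (auto simp: c_def hbox_def)
  have c0: "c 0 > 0" using assms by (auto simp: c_def hbox_def Hn_def)
  have cE: "c \<in> En n" using assms by (auto simp: c_def hbox_def Hn_def En_def)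
  \<comment> \<open>With this choice \<open>e * R\<close> is half the distance from \<open>c\<close>
    to the nearest wall.\<close>
  define e where "e = Min (insert (c 0) ((\<lambda>i. min (c i - a i) (b i - c i)) ` {..<n})) / (2 * R)"
  have m: "Min (insert (c 0) ((\<lambda>i. min (c i - a i) (b i - c i)) ` {..<n})) > 0"
    using c0 c by auto
  have e: "e > 0" using m assms(3) by (simp add: e_def)
  have eR: "e * R < min (c i - a i) (b i - c i)" "e * R < c 0" if "i < n" for i
  proof -
    have "e * R = Min (insert (c 0) ((\<lambda>i. min (c i - a i) (b i - c i)) ` {..<n})) / 2"
      using assms(3) by (simp add: e_def)
    also have "\<dots> < Min (insert (c 0) ((\<lambda>i. min (c i - a i) (b i - c i)) ` {..<n}))" using m by simp
    finally have *: "e * R < Min (insert (c 0) ((\<lambda>i. min (c i - a i) (b i - c i)) ` {..<n}))" .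
    show "e * R < min (c i - a i) (b i - c i)" "e * R < c 0"
      by (rule less_le_trans[OF *]; rule Min_le; use that in auto)+
  qed
  show thesis
  proof (rule that[OF _ e])
    show "c \<in> hbox n a b" using c c0 cE by (auto simp: hbox_def Hn_def)
    fix w assume w: "w \<in> En n" "\<And>i. \<bar>w i\<bar> \<le> R"
    have "\<bar>e * w i\<bar> \<le> e * R" for i using w(2)[of i] e by (simp add: abs_mult)
    then have b: "- (e * R) \<le> e * w i" "e * w i \<le> e * R" for i using abs_le_D1 abs_le_D2 by (metis minus_le_iff)+
    have "a i < c i + e * w i \<and> c i + e * w i < b i" if "i < n" for i
      using eR(1)[OF that] b[of i] by linarith
    moreover have "0 \<le> c 0 + e * w 0" using eR(2)[of 0] b[of 0] assms(2) by linarith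
    ultimately show "(\<lambda>i. c i + e * w i) \<in> hbox n a b" using w(1) cE by (auto simp: hbox_def Hn_def En_def)
  qed
qed

lemma box_convex:
  assumes "x \<in> hbox n a b" "y \<in> hbox n a b" "0 \<le> t" "t \<le> 1"
  shows "(\<lambda>i. (1 - t) * x i + t * y i) \<in> hbox n a b"
proof -
  have "a i < (1 - t) * x i + t * y i \<and> (1 - t) * x i + t * y i < b i" if "i < n" for i
  proof -
    have xy: "a i < x i" "x i < b i" "a i < y i" "y i < b i" using assms that by (auto simp: hbox_def)
    have "(1 - t) * a i + t * a i < (1 - t) * x i + t * y i"
      using assms xy by (cases "t = 0") (auto intro!: add_le_less_mono mult_left_mono mult_strict_left_mono)
    moreover have "(1 - t) * x i + t * y i < (1 - t) * b i + t * b i"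
      using assms xy by (cases "t = 0") (auto intro!: add_le_less_mono mult_left_mono mult_strict_left_mono)
    ultimately show ?thesis by (auto simp: algebra_simps)
  qed
  then show ?thesis using assms by (auto simp: hbox_def Hn_def En_def)
qed

text \<open>\<open>dl \<phi>\<close> is a homotopy equivalence of pairs. The inverse
  \<open>s\<close> puts one point at a centre \<open>c\<close> and the other at a small multiple of
  the given vector from it. Along the straight-line homotopy the difference is a positive multiple
  of the original one, so distinct points stay distinct.\<close>

lemma relnull_from_dl:
  assumes W: "chart_box n X U \<phi> W a b" and n: "n \<ge> 1" and z: "rcV X W j z"
    and null: "rnE n j (cmap j (dl \<phi>) z)"
  shows "rnV X W j z"
proof -
  note D = chart_boxD[OF W]
  let ?g = "chart_inv U \<phi>" and ?B = "hbox n a b"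
  define R where "R = (\<Sum>i<n. \<bar>b i - a i\<bar>) + 1"
  have R: "R > 0" unfolding R_def by (simp add: sum_nonneg add_nonneg_pos)
  have Rd: "\<bar>\<phi> q i - \<phi> p i\<bar> \<le> R" if "p \<in> W" "q \<in> W" for p q i
  proof (cases "i < n")
    case True
    have "\<bar>b i - a i\<bar> \<le> (\<Sum>i<n. \<bar>b i - a i\<bar>)" by (rule member_le_sum) (use True in auto)
    moreover have "a i < \<phi> p i" "\<phi> p i < b i" "a i < \<phi> q i" "\<phi> q i < b i"
      using D(12)[OF that(1)] D(12)[OF that(2)] True by (auto simp: hbox_def)
    ultimately show ?thesis unfolding R_def by linarith
  next
    case False
    then have "\<phi> p i = 0" "\<phi> q i = 0" using D(12)[OF that(1)] D(12)[OF that(2)] by (auto simp: hbox_def Hn_def En_def)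
    then show ?thesis using R by simp
  qed
  obtain x where "x \<in> ?B" using D(3,4) by blast
  then obtain c e where c: "c \<in> ?B" and e: "e > 0" and
    ce: "\<And>w. w \<in> En n \<Longrightarrow> (\<And>i. \<bar>w i\<bar> \<le> R) \<Longrightarrow> (\<lambda>i. c i + e * w i) \<in> ?B"
    by (rule box_center[OF _ n R]) blast
  define s where "s = (\<lambda>v::nat \<Rightarrow> real. (?g c, ?g (\<lambda>i. c i + e * clamp R (v i))))"
  have clE: "(\<lambda>i. clamp R (v i)) \<in> En n" if "v \<in> En n" for v
    using that clamp_simps(2)[OF R] by (auto simp: En_def)
  have cv: "(\<lambda>i. c i + e * clamp R (v i)) \<in> ?B" if "v \<in> En n" for v
    using ce[OF clE[OF that]] clamp_simps(1)[OF R] by blast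
  have s1: "continuous_map (subtopology PT (En n)) (prod_topology X X) s"
  proof -
    have "continuous_map PT euclideanreal (\<lambda>v. c i + e * clamp R (v i))" for i
      unfolding clamp_def by (intro continuous_intros continuous_map_real_max continuous_map_real_min) auto
    then have "continuous_map (subtopology PT (En n)) PT (\<lambda>v i. c i + e * clamp R (v i))"
      by (intro continuous_map_from_subtopology) (simp add: continuous_map_componentwise_UNIV)
    then have "continuous_map (subtopology PT (En n)) (subtopology PT ?B) (\<lambda>v i. c i + e * clamp R (v i))"
      using cv by (auto simp: continuous_map_in_subtopology)
    from continuous_map_compose[OF this D(8)]
    have "continuous_map (subtopology PT (En n)) X (\<lambda>v. ?g (\<lambda>i. c i + e * clamp R (v i)))" by (simp add: o_def)
    moreover have "?g c \<in> topspace X" using D(9)[OF c] D(5) by blast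
    ultimately show ?thesis unfolding s_def by (intro continuous_map_pairedI) auto
  qed
  have s2: "s ` En n \<subseteq> sq W" using D(9) c cv by (auto simp: s_def sq_def)
  have s3: "s ` Ep n \<subseteq> od W"
  proof
    fix y assume "y \<in> s ` Ep n"
    then obtain v where v: "v \<in> Ep n" "y = s v" by blast
    then obtain i where i: "v i \<noteq> 0" "v \<in> En n" by (auto simp: Ep_iff)
    have "?g c \<noteq> ?g (\<lambda>i. c i + e * clamp R (v i))"
    proof
      assume "?g c = ?g (\<lambda>i. c i + e * clamp R (v i))"
      then have "c = (\<lambda>i. c i + e * clamp R (v i))" using D(10)[OF c] D(10)[OF cv[OF i(2)]] by metis
      then have "c i = c i + e * clamp R (v i)" by (rule fun_cong)
      then show False using e i clamp_simps(2)[OF R] by auto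
    qed
    then show "y \<in> od W" using s2 i(2) v(2) by (auto simp: od_def sq_def s_def)
  qed
  have nl: "rnV X W j (cmap j (s \<circ> dl \<phi>) z)"
    using relnull_cmap[OF null s1 s2 s3 Ep_subset] by (simp add: cmap_cmap)
  define H1 where "H1 = (\<lambda>(zt::('a \<times> 'a) \<times> real) i. (1 - snd zt) * \<phi> (fst (fst zt)) i + snd zt * c i)"
  define H2 where "H2 = (\<lambda>(zt::('a \<times> 'a) \<times> real) i. (1 - snd zt) * \<phi> (snd (fst zt)) i + snd zt * (c i + e * dl \<phi> (fst zt) i))"
  define h where "h = (\<lambda>zt. (?g (H1 zt), ?g (H2 zt)))"
  let ?T = "prod_topology (subtopology (prod_topology X X) (sq W)) (top_of_set {0..1::real})"
  have dlE: "dl \<phi> (p, q) \<in> En n" if "p \<in> W" "q \<in> W" for p q using dl_in(1)[OF W] that by (auto simp: sq_def)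
  have H1B: "H1 (z, t) \<in> ?B" and H2B: "H2 (z, t) \<in> ?B" if zs: "z \<in> sq W" and t01: "0 \<le> t" "t \<le> 1" for z t
  proof -
    obtain p q where pq: "z = (p, q)" "p \<in> W" "q \<in> W" using zs by (cases z) (auto simp: sq_def)
    show "H1 (z, t) \<in> ?B" unfolding H1_def using box_convex[OF D(12)[OF pq(2)] c t01] pq by simp
    have "(\<lambda>i. c i + e * dl \<phi> (p, q) i) \<in> ?B"
      using ce[OF dlE[OF pq(2,3)]] Rd[OF pq(2,3)] by (simp add: dl_def)
    then show "H2 (z, t) \<in> ?B" unfolding H2_def using box_convex[OF D(12)[OF pq(3)] _ t01] pq by simp
  qed
  have ct: "continuous_map ?T euclideanreal snd"
    using continuous_map_snd[of "subtopology (prod_topology X X) (sq W)" "top_of_set {0..1::real}"]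
    by (auto simp: continuous_map_in_subtopology)
  have cf: "continuous_map ?T euclideanreal (\<lambda>zt. \<phi> (fst (fst zt)) i)" "continuous_map ?T euclideanreal (\<lambda>zt. \<phi> (snd (fst zt)) i)" for i
    using continuous_map_compose[OF continuous_map_fst continuous_map_chart_components(1)[OF D(7), of i]]
      continuous_map_compose[OF continuous_map_fst continuous_map_chart_components(2)[OF D(7), of i]]
    by (auto simp: o_def)
  have c1: "continuous_map ?T PT H1"
    unfolding continuous_map_componentwise_UNIV H1_def using ct cf by (auto intro!: continuous_intros)
  have c2: "continuous_map ?T PT H2"
    unfolding continuous_map_componentwise_UNIV H2_def dl_def using ct cf by (auto intro!: continuous_intros)
  have tT: "topspace ?T \<subseteq> sq W \<times> {0..1}" by auto
  have c3: "continuous_map ?T (subtopology PT ?B) H1" "continuous_map ?T (subtopology PT ?B) H2"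
    using c1 c2 H1B H2B tT by (auto simp: continuous_map_in_subtopology)
  have ch: "continuous_map ?T (prod_topology X X) h"
    unfolding h_def using continuous_map_compose[OF c3(1) D(8)] continuous_map_compose[OF c3(2) D(8)]
    by (intro continuous_map_pairedI) (auto simp: o_def)
  have "rnV X W j (cmap j (\<lambda>x. h (x, 0)) z + cmap j (\<lambda>x. h (x, 1)) z)"
  proof (rule homotopy_relnull[OF ch z od_subset])
    show "sq W \<subseteq> topspace (prod_topology X X)" using D(5) by (auto simp: sq_def)
    fix x and t :: real assume t: "0 \<le> t" "t \<le> 1"
    show sqh: "h (x, t) \<in> sq W" if "x \<in> sq W"
      using H1B[OF that t] H2B[OF that t] D(9) by (auto simp: h_def sq_def)
    show "h (x, t) \<in> od W" if x: "x \<in> od W"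
    proof -
      have xs: "x \<in> sq W" using x od_subset by blast
      obtain p q where pq: "x = (p, q)" "p \<in> W" "q \<in> W" "p \<noteq> q" using x by (auto simp: od_def)
      have "dl \<phi> (p, q) \<in> Ep n" using dl_in(2)[OF W] x pq(1) by blast
      then obtain i where i: "dl \<phi> (p, q) i \<noteq> 0" by (auto simp: Ep_iff)
      have "H2 (x, t) i - H1 (x, t) i = ((1 - t) + t * e) * dl \<phi> (p, q) i"
        by (simp add: H1_def H2_def dl_def pq(1) algebra_simps)
      moreover have "(1 - t) + t * e > 0"
      proof (cases "t = 1")
        case False
        then show ?thesis using t e by (simp add: add_pos_nonneg)
      qed (use e in simp)
      ultimately have "H1 (x, t) \<noteq> H2 (x, t)" using i by (metis mult_eq_0_iff less_irrefl right_minus_eq)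
      then have "?g (H1 (x, t)) \<noteq> ?g (H2 (x, t))" using D(10) H1B[OF xs t] H2B[OF xs t] by metis
      then show ?thesis using sqh[OF xs] by (auto simp: h_def od_def sq_def)
    qed
  qed
  moreover have zc: "ch j (subtopology (prod_topology X X) (sq W)) z" using z by (simp add: relcyc_def)
  moreover have "cmap j (\<lambda>x. h (x, 0)) z = z"
    using zc by (rule cmap_id) (auto simp: h_def H1_def H2_def sq_def D(11))
  moreover have "cmap j (\<lambda>x. h (x, 1)) z = cmap j (s \<circ> dl \<phi>) z"
    using zc by (rule cmap_cong) (auto simp: h_def H1_def H2_def s_def sq_def dl_def clamp_simps(3)[OF Rd])
  ultimately show ?thesis using relnull_cancel nl by metis
qed

lemma chart_box_null:
  assumes W: "chart_box n X U \<phi> W a b" and n: "n \<ge> 1" and z: "rcV X W j z"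
  shows "rnV X W j z \<longleftrightarrow> rnE n j (cmap j (dl \<phi>) z)" "j < n \<Longrightarrow> rnV X W j z"
proof -
  show *: "rnV X W j z \<longleftrightarrow> rnE n j (cmap j (dl \<phi>) z)"
    using cmap_dl[OF W] relnull_from_dl[OF W n z] by blast
  show "j < n \<Longrightarrow> rnV X W j z"
    unfolding * using euclidean_homology[of n] cmap_dl(2)[OF W z] by blast
qed

lemma chart_box_two:
  assumes W: "chart_box n X U \<phi> W a b" and n: "n \<ge> 1" and z: "rcV X W n z" "rcV X W n z'"
    and nn: "\<not> rnV X W n z" "\<not> rnV X W n z'"
  shows "rnV X W n (z + z')"
proof -
  obtain w where w: "\<And>z. rcE n n z \<Longrightarrow> rnE n n z \<or> rnE n n (z + w)" using euclidean_homology[of n] by blast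
  have "rnE n n (cmap n (dl \<phi>) z + w)" "rnE n n (cmap n (dl \<phi>) z' + w)"
    using w[OF cmap_dl(2)[OF W z(1)]] w[OF cmap_dl(2)[OF W z(2)]] nn chart_box_null(1)[OF W n] z by blast+
  from relnull_add[OF this] have "rnE n n (cmap n (dl \<phi>) (z + z'))" by (simp add: cmap_add ac_simps)
  then show ?thesis using chart_box_null(1)[OF W n relcyc_add[OF z]] by blast
qed

lemma chart_box_of:
  assumes "is_chart n X (U, \<phi>)" "hbox n a b \<subseteq> \<phi> ` U" "hbox n a b \<noteq> {}"
  shows "chart_box n X U \<phi> {p \<in> U. \<phi> p \<in> hbox n a b} a b"
  using assms unfolding chart_box_def by blast

text \<open>The bounding chain is subdivided against the cover by \<open>D\<close> and
  \<open>Ep n\<close>. Its part in \<open>D\<close> does the bounding, and the error lies in both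
  sets.\<close>

lemma excision_En:
  assumes D: "D \<subseteq> En n" "openin (subtopology PT (En n)) D" "(\<lambda>_. 0) \<in> D"
    and z: "relcyc p PT D (D \<inter> Ep n) z" and null: "rnE n p z"
  shows "relnull p PT D (D \<inter> Ep n) z"
proof -
  obtain d e where d: "ch (Suc p) (subtopology PT (En n)) d" "ch p (subtopology PT (Ep n)) e"
    and eq: "z = bd (Suc p) d + e" using null unfolding relnull_def by blast
  have zD: "ch p (subtopology PT D) z" and bz: "ch (p - Suc 0) (subtopology PT (D \<inter> Ep n)) (bd p z)"
    using z by (auto simp: relcyc_def)
  have op: "openin (subtopology PT (En n)) (Ep n)"
  proof -
    have "Ep n = {x. \<exists>i<n. x i \<noteq> 0} \<inter> En n" by (auto simp: Ep_iff)
    then show ?thesis using open_nonzero unfolding openin_subtopology by blast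
  qed
  have cov: "\<And>U. U \<in> {D, Ep n} \<Longrightarrow> openin (subtopology PT (En n)) U"
    "topspace (subtopology PT (En n)) \<subseteq> \<Union>{D, Ep n}"
    using D op by (auto simp: Ep_def)
  obtain T H where sd: "subdivision T H"
    and small: "\<And>f. f \<in> Poly_Mapping.keys (T (Suc p) d) \<Longrightarrow> \<exists>V\<in>{D, Ep n}. f ` standard_simplex (Suc p) \<subseteq> V"
    using small_chain[OF cov d(1)] by blast
  note TH = subdivisionD[OF sd]
  obtain d1 d2 where dd: "T (Suc p) d = d1 + d2" "ch (Suc p) (subtopology PT D) d1" "ch (Suc p) (subtopology PT (Ep n)) d2"
    using split_chain[OF ch_PT[OF TH(5)[OF d(1)]], of D "Ep n"] small by blast
  define f where "f = bd (Suc p) d2 + T p e"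
  have Tz: "T p z = bd (Suc p) d1 + f"
    using TH(8)[OF d(1)] by (simp add: eq TH(1) dd bd_add f_def add.assoc)
  have "ch p (subtopology PT (Ep n)) f" unfolding f_def using ch_bd_Suc[OF dd(3)] TH(5)[OF d(2)] by auto
  moreover have "f = T p z + bd (Suc p) d1" by (simp add: Tz ac_simps)
  then have "ch p (subtopology PT D) f" using TH(5)[OF zD] ch_bd_Suc[OF dd(2)] by auto
  ultimately have f: "ch p (subtopology PT (D \<inter> Ep n)) f" using ch_subtopology_Int by metis
  have Hb: "ch p (subtopology PT (D \<inter> Ep n)) (H (p - Suc 0) (bd p z))"
    using TH(6)[OF bz] TH(4) by (cases p) auto
  have "z = bd (Suc p) (d1 + H p z) + (f + H (p - Suc 0) (bd p z))"
    using TH(7)[OF zD] by (simp add: bd_add Tz ac_simps)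
  then show ?thesis unfolding relnull_def using ch_add[OF dd(2) TH(6)[OF zD]] ch_add[OF f Hb] by blast
qed

text \<open>The class is a small disc of pairs \<open>(x0, p)\<close>, drawn in the chart
  \<open>\<phi>'\<close>. Seen in \<open>\<phi>\<close> it is the image of a standard disc under a
  homeomorphism \<open>g\<close> onto a neighbourhood \<open>Dm\<close> of the origin. Were it null,
  excision to \<open>Dm\<close> followed by the inverse \<open>k\<close> would make the standard
  generator null.\<close>

lemma chart_box_fibre_class:
  assumes W: "chart_box n X U \<phi> W a b" and W': "chart_box n X U' \<phi>' W' a' b'" and sub: "W' \<subseteq> W" and n: "n \<ge> 1"
  obtains z where "rcV X W' n z" "\<not> rnV X W n z"
proof -
  note D = chart_boxD[OF W] and D' = chart_boxD[OF W']
  have pos: "openin (half_space n) {x \<in> Hn n. 0 < x 0}"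
  proof -
    have "openin PT {x. 0 < x 0}"
      using openin_continuous_map_preimage[OF continuous_map_PT_component[of 0], of "{0<..}"] by simp
    moreover have "{x \<in> Hn n. 0 < x 0} = {x. 0 < x 0} \<inter> Hn n" by auto
    ultimately show ?thesis unfolding half_space_eq openin_subtopology by blast
  qed
  have BH: "x \<in> Hn n" if "x \<in> hbox n c d" for x c d using that by (auto simp: hbox_def)
  \<comment> \<open>The point \<open>x0\<close> must be interior in both charts. Positivity of
    coordinate 0 is arranged in \<open>\<phi>\<close> by \<open>O1\<close>, and afterwards in
    \<open>\<phi>'\<close> inside \<open>O1\<close>.\<close>
  define O1 where "O1 = {p \<in> W'. 0 < \<phi> p 0}"
  have "openin X (W' \<inter> {p \<in> U. \<phi> p \<in> {x \<in> Hn n. 0 < x 0}})"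
    using D'(13) is_chartD(8)[OF D(1) pos] by (rule openin_Int)
  moreover have "W' \<inter> {p \<in> U. \<phi> p \<in> {x \<in> Hn n. 0 < x 0}} = O1"
    using sub D(2) BH[OF D(12)] by (auto simp: O1_def)
  ultimately have O1: "openin X O1" by simp
  have "openin (half_space n) (\<phi> ` W')" using is_chartD(7)[OF D(1) D'(13)] sub D(2) by auto
  then obtain y where "y \<in> \<phi> ` W'" "0 < y 0" using half_space_interior_point[OF _ _ n] D'(3) by blast
  then have "O1 \<noteq> {}" by (auto simp: O1_def)
  have O1U: "O1 \<subseteq> U'" using D'(2) by (auto simp: O1_def)
  have oO1: "openin (half_space n) (\<phi>' ` O1)" using is_chartD(7)[OF D'(1) O1 O1U] .
  then obtain y' where y': "y' \<in> \<phi>' ` O1" "0 < y' 0"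
    using half_space_interior_point[OF _ _ n] \<open>O1 \<noteq> {}\<close> by blast
  then obtain x0 where x0: "x0 \<in> O1" "\<phi>' x0 = y'" by blast
  obtain e1 where e1: "e1 > 0" "hbox n (\<lambda>i. y' i - e1) (\<lambda>i. y' i + e1) \<subseteq> \<phi>' ` O1"
    using half_space_box[OF oO1 y'(1)] by blast
  \<comment> \<open>The bound by \<open>y' 0\<close> keeps the cube around \<open>y'\<close> off the
    boundary of the half-space, so that it is a full cube.\<close>
  define e where "e = min e1 (y' 0)"
  have e: "e > 0" "e \<le> y' 0" "e \<le> e1" using e1 y' by (auto simp: e_def)
  let ?B = "hbox n (\<lambda>i. y' i - e) (\<lambda>i. y' i + e)"
  have "?B \<subseteq> hbox n (\<lambda>i. y' i - e1) (\<lambda>i. y' i + e1)" using e by (force simp: hbox_def)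
  then have BO: "?B \<subseteq> \<phi>' ` O1" using e1 by blast
  have yH: "y' \<in> Hn n" using x0 D'(12)[of x0] BH by (auto simp: O1_def)
  have yB: "y' \<in> ?B" using yH e by (auto simp: hbox_def)
  define W2 where "W2 = {p \<in> U'. \<phi>' p \<in> ?B}"
  have W2: "chart_box n X U' \<phi>' W2 (\<lambda>i. y' i - e) (\<lambda>i. y' i + e)"
    unfolding W2_def using chart_box_of[OF D'(1)] BO O1U yB by blast
  note D2 = chart_boxD[OF W2]
  have W2O: "W2 \<subseteq> O1"
  proof
    fix p assume p: "p \<in> W2"
    then obtain q where "q \<in> O1" "\<phi>' p = \<phi>' q" using BO unfolding W2_def by blast
    then show "p \<in> O1" using is_chartD(2)[OF D'(1)] O1U p unfolding W2_def by (metis (mono_tags, lifting) inj_onD mem_Collect_eq subsetD)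
  qed
  have W2W: "W2 \<subseteq> W'" "W2 \<subseteq> W" "W2 \<subseteq> U" using W2O sub D(2) by (auto simp: O1_def)
  have x0W: "x0 \<in> W2" "x0 \<in> W'" "x0 \<in> W" using x0 yB O1U sub by (auto simp: W2_def O1_def)
  define B1 where "B1 = {v \<in> En n. \<forall>i<n. \<bar>v i\<bar> < 1}"
  define \<tau> where "\<tau> = (\<lambda>v. chart_inv U' \<phi>' (\<lambda>i. y' i + e * v i))"
  have yE: "y' \<in> En n" using yH by (simp add: Hn_def)
  have evB: "(\<lambda>i. y' i + e * v i) \<in> ?B" if v: "v \<in> B1" for v
  proof -
    have *: "- e < e * v i" "e * v i < e" if "i < n" for i
    proof -
      have "\<bar>v i\<bar> < 1" using v that by (simp add: B1_def)
      then have "e * v i < e * 1" "e * (-1) < e * v i" using e(1) by (intro mult_strict_left_mono; simp add: abs_less_iff)+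
      then show "- e < e * v i" "e * v i < e" by simp_all
    qed
    have "0 \<le> y' 0 + e * v 0" using *[of 0] e(2) n by auto
    then show ?thesis using * v yE by (auto simp: hbox_def Hn_def En_def B1_def)
  qed
  have \<tau>W: "\<tau> v \<in> W2" and \<phi>\<tau>: "\<phi>' (\<tau> v) = (\<lambda>i. y' i + e * v i)" if "v \<in> B1" for v
    using D2(9,10)[OF evB[OF that]] by (auto simp: \<tau>_def)
  have \<tau>0: "\<tau> (\<lambda>_. 0) = x0" using D2(11)[OF x0W(1)] by (simp add: \<tau>_def x0)
  have z1: "(\<lambda>_. 0) \<in> B1" by (simp add: B1_def En_def)
  have \<tau>inj: "v = v'" if "v \<in> B1" "v' \<in> B1" "\<tau> v = \<tau> v'" for v v'
  proof
    fix i
    have "(\<lambda>i. y' i + e * v i) i = (\<lambda>i. y' i + e * v' i) i" using \<phi>\<tau>[OF that(1)] \<phi>\<tau>[OF that(2)] that(3) by metis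
    then show "v i = v' i" using e by simp
  qed
  have c\<tau>: "continuous_map (subtopology PT B1) X \<tau>"
  proof -
    have "continuous_map (subtopology PT B1) PT (\<lambda>v i. y' i + e * v i)"
      by (intro continuous_map_from_subtopology) (auto simp: continuous_map_componentwise_UNIV intro!: continuous_intros)
    then have "continuous_map (subtopology PT B1) (subtopology PT ?B) (\<lambda>v i. y' i + e * v i)"
      using evB by (auto simp: continuous_map_in_subtopology)
    from continuous_map_compose[OF this D2(8)] show ?thesis by (simp add: \<tau>_def o_def)
  qed
  define g where "g = (\<lambda>v i. \<phi> (\<tau> v) i - \<phi> x0 i)"
  define Dm where "Dm = g ` B1"
  have \<phi>E: "\<phi> p \<in> En n" if "p \<in> W" for p using D(12)[OF that] by (auto simp: hbox_def Hn_def)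
  have gE: "g v \<in> En n" if "v \<in> B1" for v
    using \<phi>E[OF x0W(3)] \<phi>E[of "\<tau> v"] \<tau>W[OF that] W2W by (auto simp: g_def En_def)
  have g0: "g (\<lambda>_. 0) = (\<lambda>_. 0)" by (simp add: g_def \<tau>0)
  have DmE: "Dm \<subseteq> En n" using gE by (auto simp: Dm_def)
  have \<tau>im: "\<tau> ` B1 = W2"
  proof
    show "\<tau> ` B1 \<subseteq> W2" using \<tau>W by auto
    show "W2 \<subseteq> \<tau> ` B1"
    proof
      fix p assume p: "p \<in> W2"
      let ?v = "\<lambda>i. (\<phi>' p i - y' i) / e"
      have pb: "\<phi>' p \<in> ?B" using p by (simp add: W2_def)
      have "\<bar>?v i\<bar> < 1" if "i < n" for i
      proof -
        have "\<bar>\<phi>' p i - y' i\<bar> < e" using pb that by (auto simp: hbox_def abs_less_iff)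
        then show ?thesis using e(1) by (simp add: abs_divide)
      qed
      then have "?v \<in> B1" using pb yE by (auto simp: B1_def hbox_def Hn_def En_def)
      moreover have "(\<lambda>i. y' i + e * ?v i) = \<phi>' p" using e(1) by auto
      then have "\<tau> ?v = p" unfolding \<tau>_def using D2(11)[OF p] by (simp only:)
      ultimately show "p \<in> \<tau> ` B1" by (intro image_eqI[of _ _ ?v]) simp_all
    qed
  qed
  have Dmo: "openin (subtopology PT (En n)) Dm"
  proof -
    have o1: "openin (half_space n) (\<phi> ` W2)" using is_chartD(7)[OF D(1) D2(13) W2W(3)] .
    then obtain T where T: "openin PT T" "\<phi> ` W2 = T \<inter> Hn n" unfolding half_space_eq openin_subtopology by blast
    define S where "S = {w. (\<lambda>i. w i + \<phi> x0 i) \<in> T} \<inter> {w. 0 < w 0 + \<phi> x0 0}"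
    have "continuous_map PT PT (\<lambda>w i. w i + \<phi> x0 i)"
      by (auto simp: continuous_map_componentwise_UNIV intro!: continuous_intros)
    from openin_continuous_map_preimage[OF this T(1)] have "openin PT {w. (\<lambda>i. w i + \<phi> x0 i) \<in> T}" by simp
    moreover have "openin PT {w. 0 < w 0 + \<phi> x0 0}"
      using openin_continuous_map_preimage[of PT euclideanreal "\<lambda>w. w 0 + \<phi> x0 0" "{0<..}"]
      by (auto simp: continuous_intros continuous_map_PT_component)
    ultimately have "openin PT S" unfolding S_def by (rule openin_Int)
    moreover have "Dm = S \<inter> En n"
    proof
      show "Dm \<subseteq> S \<inter> En n"
      proof
        fix w assume "w \<in> Dm"
        then obtain v where v: "v \<in> B1" "w = g v" by (auto simp: Dm_def)
        have "(\<lambda>i. w i + \<phi> x0 i) = \<phi> (\<tau> v)" by (simp add: v g_def)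
        moreover have "\<phi> (\<tau> v) \<in> T" using \<tau>W[OF v(1)] T(2) by blast
        moreover have "0 < \<phi> (\<tau> v) 0" using \<tau>W[OF v(1)] W2O by (auto simp: O1_def)
        ultimately show "w \<in> S \<inter> En n" using gE[OF v(1)] v by (auto simp: S_def g_def)
      qed
      show "S \<inter> En n \<subseteq> Dm"
      proof
        fix w assume w: "w \<in> S \<inter> En n"
        have "(\<lambda>i. w i + \<phi> x0 i) \<in> Hn n" using w \<phi>E[OF x0W(3)] by (auto simp: S_def Hn_def En_def)
        then have "(\<lambda>i. w i + \<phi> x0 i) \<in> \<phi> ` W2" using w T(2) by (auto simp: S_def)
        then obtain v where v: "v \<in> B1" "(\<lambda>i. w i + \<phi> x0 i) = \<phi> (\<tau> v)" using \<tau>im by blast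
        have "w = g v"
        proof
          fix i show "w i = g v i" using fun_cong[OF v(2), of i] by (simp add: g_def)
        qed
        then show "w \<in> Dm" using v by (auto simp: Dm_def)
      qed
    qed
    ultimately show ?thesis unfolding openin_subtopology by blast
  qed
  have cg: "continuous_map (subtopology PT B1) PT g"
  proof -
    have "continuous_map (subtopology PT B1) (subtopology X W) \<tau>"
      using c\<tau> \<tau>W W2W by (auto simp: continuous_map_in_subtopology)
    from continuous_map_compose[OF this D(7)] have "continuous_map (subtopology PT B1) PT (\<lambda>v. \<phi> (\<tau> v))" by (simp add: o_def)
    then show ?thesis unfolding g_def continuous_map_componentwise_UNIV by (intro allI continuous_intros) auto
  qed
  define k where "k = (\<lambda>w i. (\<phi>' (chart_inv U \<phi> (\<lambda>i. w i + \<phi> x0 i)) i - y' i) / e)"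
  have kg: "k (g v) = v" if "v \<in> B1" for v
  proof -
    have "(\<lambda>i. g v i + \<phi> x0 i) = \<phi> (\<tau> v)" by (simp add: g_def)
    moreover have "chart_inv U \<phi> (\<phi> (\<tau> v)) = \<tau> v" using D(11) \<tau>W[OF that] W2W by blast
    ultimately show ?thesis using \<phi>\<tau>[OF that] e(1) by (simp add: k_def)
  qed
  have ck: "continuous_map (subtopology PT Dm) PT k"
  proof -
    have "continuous_map (subtopology PT Dm) PT (\<lambda>w i. w i + \<phi> x0 i)"
      by (intro continuous_map_from_subtopology) (auto simp: continuous_map_componentwise_UNIV intro!: continuous_intros)
    moreover have b: "(\<lambda>i. w i + \<phi> x0 i) \<in> hbox n a b" "chart_inv U \<phi> (\<lambda>i. w i + \<phi> x0 i) \<in> W2" if wD: "w \<in> Dm" for w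
    proof -
      obtain v where v: "v \<in> B1" "w = g v" using wD by (auto simp: Dm_def)
      have "(\<lambda>i. w i + \<phi> x0 i) = \<phi> (\<tau> v)" by (simp add: v g_def)
      then show "(\<lambda>i. w i + \<phi> x0 i) \<in> hbox n a b" "chart_inv U \<phi> (\<lambda>i. w i + \<phi> x0 i) \<in> W2"
        using D(11,12)[of "\<tau> v"] \<tau>W[OF v(1)] W2W by auto
    qed
    ultimately have "continuous_map (subtopology PT Dm) (subtopology PT (hbox n a b)) (\<lambda>w i. w i + \<phi> x0 i)"
      by (auto simp: continuous_map_in_subtopology)
    from continuous_map_compose[OF this D(8)]
    have "continuous_map (subtopology PT Dm) (subtopology X W2) (\<lambda>w. chart_inv U \<phi> (\<lambda>i. w i + \<phi> x0 i))"
      using b by (auto simp: continuous_map_in_subtopology o_def)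
    from continuous_map_compose[OF this D2(7)]
    have "continuous_map (subtopology PT Dm) PT (\<lambda>w. \<phi>' (chart_inv U \<phi> (\<lambda>i. w i + \<phi> x0 i)))" by (simp add: o_def)
    then show ?thesis unfolding k_def continuous_map_componentwise_UNIV
      using e(1) by (intro allI continuous_intros) auto
  qed
  obtain \<omega> where \<omega>: "rcE n n \<omega>" "\<not> rnE n n \<omega>"
    using euclidean_homology[of n] hemi_relcyc by blast
  \<comment> \<open>Compresses Euclidean space into the open cube \<open>B1\<close>. The
    straight-line homotopy from the identity never sends a nonzero vector to the origin, so the
    generator can be represented in the cube.\<close>
  define sc where "sc = (\<lambda>v::nat \<Rightarrow> real. \<lambda>i. v i / (1 + \<bar>v i\<bar>))"
  have scB: "sc v \<in> B1" if "v \<in> En n" for v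
    using that by (auto simp: sc_def B1_def En_def abs_divide)
  have scP: "sc v \<in> B1 \<inter> Ep n" if vE: "v \<in> Ep n" for v
  proof -
    have v: "v \<in> En n" using vE Ep_subset by blast
    obtain i where i: "i < n" "v i \<noteq> 0" using vE by (auto simp: Ep_iff)
    then have "sc v i \<noteq> 0" by (simp add: sc_def add_nonneg_eq_0_iff)
    moreover have "sc v \<in> En n" using scB[OF v] by (simp add: B1_def)
    ultimately show ?thesis using scB[OF v] i(1) Ep_iff[of "sc v" n] by blast
  qed
  have csc: "continuous_map PT PT sc"
    unfolding continuous_map_componentwise_UNIV sc_def
    by (intro allI continuous_intros) (auto simp: add_nonneg_eq_0_iff)
  define h where "h = (\<lambda>(z::(nat \<Rightarrow> real) \<times> real) i. (1 - snd z) * fst z i + snd z * (fst z i / (1 + \<bar>fst z i\<bar>)))"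
  have hc: "continuous_map (prod_topology (subtopology PT (En n)) (top_of_set {0..1})) PT h"
  proof (rule continuous_map_homotopy)
    show "continuous_map (prod_topology PT euclideanreal) euclideanreal (\<lambda>z. h z i)" for i
      unfolding h_def by (intro continuous_intros) (auto simp: add_nonneg_eq_0_iff)
  qed
  have "rnE n n (cmap n (\<lambda>x. h (x, 0)) \<omega> + cmap n (\<lambda>x. h (x, 1)) \<omega>)"
  proof (rule homotopy_relnull[OF hc \<omega>(1) Ep_subset])
    fix x and t :: real assume t: "0 \<le> t" "t \<le> 1"
    show hE: "h (x, t) \<in> En n" if "x \<in> En n" using that by (auto simp: h_def En_def)
    show "h (x, t) \<in> Ep n" if "x \<in> Ep n"
    proof -
      obtain i where i: "i < n" "x i \<noteq> 0" "x \<in> En n" using \<open>x \<in> Ep n\<close> by (auto simp: Ep_iff)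
      have "h (x, t) i = ((1 - t) + t / (1 + \<bar>x i\<bar>)) * x i" by (simp add: h_def algebra_simps)
      moreover have "(1 - t) + t / (1 + \<bar>x i\<bar>) > 0"
      proof (cases "t = 1")
        case False
        then show ?thesis using t by (simp add: add_pos_nonneg)
      qed (simp add: add_pos_nonneg)
      ultimately have "h (x, t) i \<noteq> 0" using i by simp
      then show ?thesis using hE[OF i(3)] i(1) by (auto simp: Ep_iff)
    qed
  qed auto
  moreover have \<omega>E: "ch n (subtopology PT (En n)) \<omega>" using \<omega> by (simp add: relcyc_def)
  moreover have "cmap n (\<lambda>x. h (x, 0)) \<omega> = \<omega>" using \<omega>E by (rule cmap_id) (auto simp: h_def)
  moreover have "cmap n (\<lambda>x. h (x, 1)) \<omega> = cmap n sc \<omega>" using \<omega>E by (rule cmap_cong) (auto simp: h_def sc_def)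
  ultimately have \<omega>1: "\<not> rnE n n (cmap n sc \<omega>)" using \<omega>(2) relnull_cancel by metis
  have rc1: "relcyc n PT B1 (B1 \<inter> Ep n) (cmap n sc \<omega>)"
    by (rule relcyc_cmap[OF \<omega>(1)]) (use csc scB scP Ep_subset in \<open>auto simp: continuous_map_from_subtopology\<close>)
  define z0 where "z0 = cmap n (\<lambda>v. (x0, \<tau> v)) (cmap n sc \<omega>)"
  have x0X: "x0 \<in> topspace X" using x0W D(5) by blast
  have c0: "continuous_map (subtopology PT B1) (prod_topology X X) (\<lambda>v. (x0, \<tau> v))"
    using c\<tau> x0X by (intro continuous_map_pairedI) auto
  have "rcV X W' n z0" unfolding z0_def
  proof (rule relcyc_cmap[OF rc1 c0])
    show "(\<lambda>v. (x0, \<tau> v)) ` B1 \<subseteq> sq W'" using \<tau>W W2W x0W by (auto simp: sq_def)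
    show "(\<lambda>v. (x0, \<tau> v)) ` (B1 \<inter> Ep n) \<subseteq> od W'"
      using \<tau>W W2W x0W \<tau>inj[OF z1] \<tau>0 by (force simp: od_def Ep_def)
  qed auto
  moreover have "\<not> rnV X W n z0"
  proof
    assume "rnV X W n z0"
    then have "rnE n n (cmap n (dl \<phi>) z0)" by (rule cmap_dl(1)[OF W])
    moreover have "dl \<phi> \<circ> (\<lambda>v. (x0, \<tau> v)) = g" by (auto simp: dl_def g_def fun_eq_iff)
    then have "cmap n (dl \<phi>) z0 = cmap n g (cmap n sc \<omega>)"
      unfolding z0_def cmap_cmap[of n "dl \<phi>" "\<lambda>v. (x0, \<tau> v)"] by (simp only:)
    ultimately have null: "rnE n n (cmap n g (cmap n sc \<omega>))" by simp
    have gP: "g v \<in> Ep n" if "v \<in> B1 \<inter> Ep n" for v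
    proof -
      have "g v \<noteq> (\<lambda>_. 0)"
      proof
        assume "g v = (\<lambda>_. 0)"
        then have "v = (\<lambda>_. 0)" using kg[of v] kg[OF z1] g0 that by auto
        then show False using that by (simp add: Ep_def)
      qed
      then show ?thesis using gE that by (simp add: Ep_def)
    qed
    have rc2: "relcyc n PT Dm (Dm \<inter> Ep n) (cmap n g (cmap n sc \<omega>))"
      by (rule relcyc_cmap[OF rc1 cg]) (use gP in \<open>auto simp: Dm_def\<close>)
    have z2: "(\<lambda>_. 0) \<in> Dm" using g0 z1 unfolding Dm_def by (metis image_eqI)
    have "relnull n PT Dm (Dm \<inter> Ep n) (cmap n g (cmap n sc \<omega>))"
      by (rule excision_En[OF DmE Dmo z2 rc2 null])
    then have "rnE n n (cmap n k (cmap n g (cmap n sc \<omega>)))"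
    proof (rule relnull_cmap[OF _ ck])
      show "k ` Dm \<subseteq> En n" using kg by (auto simp: Dm_def B1_def)
      show "k ` (Dm \<inter> Ep n) \<subseteq> Ep n"
      proof
        fix v assume "v \<in> k ` (Dm \<inter> Ep n)"
        then obtain u where u: "u \<in> B1" "g u \<in> Ep n" "v = u" using kg by (auto simp: Dm_def)
        have "u \<noteq> (\<lambda>_. 0)" using u(2) g0 by (auto simp: Ep_def)
        then show "v \<in> Ep n" using u by (auto simp: Ep_def B1_def)
      qed
    qed auto
    moreover have "cmap n k (cmap n g (cmap n sc \<omega>)) = cmap n sc \<omega>"
      unfolding cmap_cmap[of n k g] using rc1 kg by (intro cmap_id[of n "subtopology PT B1"]) (auto simp: relcyc_def)
    ultimately show False using \<omega>1 by simp
  qed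
  ultimately show thesis by (rule that)
qed

text \<open>In degree \<open>n\<close> both groups have order two, and
  \<open>chart_box_fibre_class\<close> provides a class of the smaller box that survives in the
  larger one.\<close>

lemma chart_box_compat:
  assumes W: "chart_box n X U \<phi> W a b" and W': "chart_box n X U' \<phi>' W' a' b'" and sub: "W' \<subseteq> W" and n: "n \<ge> 1"
    and z: "rcV X W' n z"
  shows "rnV X W' n z \<longleftrightarrow> rnV X W n z"
proof
  show "rnV X W' n z \<Longrightarrow> rnV X W n z" using rnV_mono[OF _ sub] .
  assume null: "rnV X W n z"
  obtain z0 where z0: "rcV X W' n z0" "\<not> rnV X W n z0" using chart_box_fibre_class[OF W W' sub n] .
  have "\<not> rnV X W' n z0" using z0(2) rnV_mono[OF _ sub] by blast
  show "rnV X W' n z"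
  proof (rule ccontr)
    assume "\<not> rnV X W' n z"
    then have "rnV X W' n (z0 + z)" using chart_box_two[OF W' n z0(1) z] \<open>\<not> rnV X W' n z0\<close> by blast
    then have "rnV X W n (z0 + z)" using rnV_mono[OF _ sub] by blast
    then show False using relnull_cancel null z0(2) by blast
  qed
qed

section \<open>The Thom class modulo two\<close>

definition good :: "nat \<Rightarrow> 'a topology \<Rightarrow> 'a set \<Rightarrow> bool" where
  "good n X W \<longleftrightarrow> (\<exists>U \<phi> a b. chart_box n X U \<phi> W a b)"

text \<open>The value of the Thom class on a relative cycle of \<open>V \<times> V\<close> modulo the complement of the diagonal.
  On a good set it only records whether the cycle bounds; existence and uniqueness of the value on a
  finite union of good sets are the properties \<open>thom_exists\<close> and \<open>thom_unique\<close> below.\<close>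

inductive dg :: "nat \<Rightarrow> 'a topology \<Rightarrow> 'a set \<Rightarrow> ('a \<times> 'a) chain2 \<Rightarrow> bit \<Rightarrow> bool"
  for n :: nat and X :: "'a topology" and V :: "'a set" where
  dg_null: "rnV X V n z \<Longrightarrow> dg n X V z 0"
| dg_good: "good n X W \<Longrightarrow> W \<subseteq> V \<Longrightarrow> rcV X W n z \<Longrightarrow> dg n X V z (if rnV X W n z then 0 else 1)"
| dg_add: "dg n X V z b \<Longrightarrow> dg n X V z' b' \<Longrightarrow> dg n X V (z + z') (b + b')"

text \<open>In degree \<open>n - 1\<close> on an overlap, this removes the obstruction to splitting
  a cycle of a union.\<close>

definition low_null :: "nat \<Rightarrow> 'a topology \<Rightarrow> 'a set \<Rightarrow> bool" where
  "low_null n X V \<longleftrightarrow> (\<forall>j<n. \<forall>z. rcV X V j z \<longrightarrow> rnV X V j z)"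

definition thom_exists :: "nat \<Rightarrow> 'a topology \<Rightarrow> 'a set \<Rightarrow> bool" where
  "thom_exists n X V \<longleftrightarrow> (\<forall>z. rcV X V n z \<longrightarrow> (\<exists>b. dg n X V z b))"

text \<open>This already gives uniqueness: values add, so two different values of one cycle would
  give the zero cycle the value 1.\<close>

definition thom_unique :: "nat \<Rightarrow> 'a topology \<Rightarrow> 'a set \<Rightarrow> bool" where
  "thom_unique n X V \<longleftrightarrow> (\<forall>z. dg n X V z 1 \<longrightarrow> \<not> rnV X V n z)"

lemma dg_rcV: "dg n X V z b \<Longrightarrow> rcV X V n z"
  by (induction rule: dg.induct) (auto intro: rnV_rcV rcV_mono relcyc_add)

lemma dg_mono: "dg n X V z b \<Longrightarrow> V \<subseteq> V' \<Longrightarrow> dg n X V' z b"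
proof (induction rule: dg.induct)
  case (dg_good W z)
  then show ?case by (intro dg.dg_good) auto
next
  case (dg_add z b z' b')
  then show ?case by (intro dg.dg_add)
qed (blast intro: dg.dg_null rnV_mono)

lemma dg_relnull: "dg n X V z b \<Longrightarrow> rnV X V n (z + z') \<Longrightarrow> dg n X V z' b"
proof -
  assume "dg n X V z b" "rnV X V n (z + z')"
  then have "dg n X V ((z + z') + z) (0 + b)" by (intro dg_add dg_null)
  moreover have "(z + z') + z = z'" by (simp add: ac_simps)
  ultimately show ?thesis by (simp only: add_0)
qed

lemma thom_uniqueD: "thom_unique n X V \<Longrightarrow> dg n X V z b \<Longrightarrow> rnV X V n z \<Longrightarrow> b = 0"
  unfolding thom_unique_def using bit_not_zero_iff by metis

lemma dg_unique:
  assumes "thom_unique n X V" "dg n X V z b" "dg n X V z' b'" "rnV X V n (z + z')"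
  shows "b = b'"
proof -
  have "b + b' = 0" using thom_uniqueD[OF assms(1) dg_add[OF assms(2,3)] assms(4)] .
  then show ?thesis by (cases b; cases b') auto
qed

lemma good_open: "good n X W \<Longrightarrow> openin X W"
  unfolding good_def using chart_boxD(13) by blast

text \<open>Smaller good sets give the same answer by \<open>chart_box_compat\<close>. The rule for
  sums is respected because there is only one nonzero class.\<close>

lemma good_dg:
  assumes "good n X W" "n \<ge> 1" "dg n X W z b"
  shows "b = (if rnV X W n z then 0 else 1)"
  using assms(3)
proof (induction rule: dg.induct)
  case (dg_good W' z)
  obtain U \<phi> a b U' \<phi>' a' b' where "chart_box n X U \<phi> W a b" "chart_box n X U' \<phi>' W' a' b'"
    using assms(1) dg_good(1) unfolding good_def by blast
  from chart_box_compat[OF this dg_good(2) assms(2) dg_good(3)] show ?case by simp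
next
  case (dg_add z b z' b')
  obtain U \<phi> a c where W: "chart_box n X U \<phi> W a c" using assms(1) unfolding good_def by blast
  have "rnV X W n (z + z') \<longleftrightarrow> (rnV X W n z \<longleftrightarrow> rnV X W n z')"
    using chart_box_two[OF W assms(2) dg_rcV[OF dg_add(1)] dg_rcV[OF dg_add(2)]] relnull_add
      relnull_cancel[of n _ _ _ z z'] relnull_cancel[of n _ _ _ z' z] by (metis add.commute)
  then show ?case using dg_add(3,4) by auto
qed auto

lemma good_thom_unique: "good n X W \<Longrightarrow> n \<ge> 1 \<Longrightarrow> thom_unique n X W"
  unfolding thom_unique_def using good_dg by fastforce

lemma good_low_null: "good n X W \<Longrightarrow> n \<ge> 1 \<Longrightarrow> low_null n X W"
  unfolding low_null_def good_def using chart_box_null(2) by blast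

lemma good_thom_exists: "good n X W \<Longrightarrow> thom_exists n X W"
  unfolding thom_exists_def using dg_good by blast

section \<open>Relative Mayer-Vietoris arguments for pairs of points\<close>

lemma open_sq: "openin X V \<Longrightarrow> openin (prod_topology X X) (sq V)"
  by (simp add: sq_def openin_prod_Times_iff)

lemma open_od:
  assumes "Hausdorff_space X" "openin X V"
  shows "openin (prod_topology X X) (od V)"
proof -
  have "openin (prod_topology X X) (sq V - (\<lambda>x. (x, x)) ` topspace X)"
    using assms open_sq by (intro openin_diff) (auto simp: Hausdorff_space_closedin_diagonal)
  moreover have "sq V - (\<lambda>x. (x, x)) ` topspace X = od V"
    using openin_subset[OF assms(2)] by (auto simp: sq_def od_def)
  ultimately show ?thesis by simp
qed

lemma chain2_swap:
  fixes a b c d :: "'b \<Rightarrow>\<^sub>0 bit"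
  assumes "a + b = c + d" shows "a + c = b + d"
proof -
  have "a + c = (a + b) + (b + c)" by (simp add: add.assoc)
  also have "\<dots> = b + d" unfolding assms by (simp add: ac_simps)
  finally show ?thesis .
qed

text \<open>The squares of \<open>V1\<close> and \<open>V2\<close> do not cover the square of the
  union, but they contain its diagonal. The missing pairs lie in the third open set, whose chains do
  not count in relative homology.\<close>

lemma small_split:
  assumes X: "Hausdorff_space X" and V: "openin X V1" "openin X V2"
    and d: "ch p (subtopology (prod_topology X X) (sq (V1 \<union> V2))) d"
  obtains T H d1 d2 d3 where "subdivision T H" "T p d = d1 + d2 + d3"
    "ch p (subtopology (prod_topology X X) (sq V1)) d1" "ch p (subtopology (prod_topology X X) (sq V2)) d2"
    "ch p (subtopology (prod_topology X X) (od (V1 \<union> V2))) d3"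
proof -
  let ?XX = "prod_topology X X" and ?V = "V1 \<union> V2"
  have oV: "openin X ?V" using V by blast
  have sub: "sq V1 \<subseteq> sq ?V" "sq V2 \<subseteq> sq ?V" "od ?V \<subseteq> sq ?V" by (auto simp: sq_def od_def)
  have cov: "\<And>U. U \<in> {sq V1, sq V2, od ?V} \<Longrightarrow> openin (subtopology ?XX (sq ?V)) U"
    using sub open_sq V open_od[OF X oV] by (auto simp: openin_open_subtopology open_sq[OF oV])
  have cov2: "topspace (subtopology ?XX (sq ?V)) \<subseteq> \<Union>{sq V1, sq V2, od ?V}"
    by (auto simp: sq_def od_def)
  obtain T H where sd: "subdivision T H"
    and small: "\<And>f. f \<in> Poly_Mapping.keys (T p d) \<Longrightarrow> \<exists>V\<in>{sq V1, sq V2, od ?V}. f ` standard_simplex p \<subseteq> V"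
    using small_chain[OF cov cov2 d] by blast
  have Td: "ch p ?XX (T p d)" using subdivisionD(5)[OF sd d] by (simp add: ch_subtopology)
  let ?P = "\<lambda>f. f ` standard_simplex p \<subseteq> sq V1"
  have 1: "ch p (subtopology ?XX (sq V1)) (part ?P (T p d))" using Td by (auto simp: ch_subtopology ch_part)
  have "f ` standard_simplex p \<subseteq> sq V2 \<or> f ` standard_simplex p \<subseteq> od ?V"
    if "f \<in> Poly_Mapping.keys (part (\<lambda>f. \<not> ?P f) (T p d))" for f
    using small[of f] that by auto
  then obtain d2 d3 where "part (\<lambda>f. \<not> ?P f) (T p d) = d2 + d3"
    "ch p (subtopology ?XX (sq V2)) d2" "ch p (subtopology ?XX (od ?V)) d3"
    by (rule split_chain[OF ch_part[OF Td]])
  then show thesis using that[OF sd _ 1, of d2 d3] part_add_part[of ?P "T p d"] by (simp add: add.assoc)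
qed

text \<open>Simplices of \<open>u\<close> that are not off the diagonal must cancel against
  \<open>v\<close>. They lie in both squares, and \<open>h\<close> is their sum.\<close>

lemma overlap:
  assumes u: "ch q (subtopology (prod_topology X X) (sq V1)) u" and v: "ch q (subtopology (prod_topology X X) (sq V2)) v"
    and uv: "ch q (subtopology (prod_topology X X) (od (V1 \<union> V2))) (u + v)"
  obtains h e1 e2 where "u = h + e1" "v = h + e2" "ch q (subtopology (prod_topology X X) (sq (V1 \<inter> V2))) h"
    "ch q (subtopology (prod_topology X X) (od V1)) e1" "ch q (subtopology (prod_topology X X) (od V2)) e2"
proof -
  let ?XX = "prod_topology X X" and ?V = "V1 \<union> V2"
  let ?P = "\<lambda>f. f ` standard_simplex q \<subseteq> od ?V"
  define e1 where "e1 = part ?P u"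
  define h where "h = part (\<lambda>f. \<not> ?P f) u"
  define e2 where "e2 = v + h"
  have u1: "u = h + e1" using part_add_part[of ?P u] by (simp add: h_def e1_def add.commute)
  have V1: "od ?V \<inter> sq V1 = od V1" "od ?V \<inter> sq V2 = od V2" by (auto simp: od_def sq_def)
  have uX: "ch q ?XX u" using u by (simp add: ch_subtopology)
  have "ch q (subtopology ?XX (od ?V)) e1" unfolding e1_def using uX by (auto simp: ch_subtopology ch_part)
  moreover have "ch q (subtopology ?XX (sq V1)) e1" unfolding e1_def using u by (rule ch_part)
  ultimately have e1: "ch q (subtopology ?XX (od V1)) e1" using ch_subtopology_Int V1(1) by metis
  have hV1: "ch q (subtopology ?XX (sq V1)) h" unfolding h_def using u by (rule ch_part)
  have "f ` standard_simplex q \<subseteq> sq V2" if f: "f \<in> Poly_Mapping.keys h" for f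
  proof -
    have f1: "f \<in> Poly_Mapping.keys u" "\<not> ?P f" using f by (auto simp: h_def)
    then have "f \<notin> Poly_Mapping.keys (u + v)" using uv by (auto simp: ch_subtopology)
    then have "f \<in> Poly_Mapping.keys v" using f1(1) by (auto simp: keys_add_bit)
    then show ?thesis using v by (auto simp: ch_subtopology)
  qed
  then have hV2: "ch q (subtopology ?XX (sq V2)) h" using hV1 by (auto simp: ch_subtopology)
  have h: "ch q (subtopology ?XX (sq (V1 \<inter> V2))) h" using ch_subtopology_Int[OF hV1 hV2] by (simp add: sq_Int)
  have "e2 = (u + v) + e1" by (simp add: e2_def u1 ac_simps)
  moreover have "od V1 \<subseteq> od ?V" by (auto simp: od_def)
  ultimately have "ch q (subtopology ?XX (od ?V)) e2" using uv ch_mono[OF e1] by auto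
  moreover have "ch q (subtopology ?XX (sq V2)) e2" unfolding e2_def using v hV2 by auto
  ultimately have e2: "ch q (subtopology ?XX (od V2)) e2" using ch_subtopology_Int V1(2) by metis
  have "v = h + e2" by (simp add: e2_def ac_simps)
  from that[OF u1 this h e1 e2] show thesis .
qed

lemma relnull_subdivision:
  assumes sd: "subdivision T H" and z: "relcyc p X P Q z"
  shows "relnull p X P Q (z + T p z)"
proof -
  note TH = subdivisionD[OF sd]
  have zP: "ch p (subtopology X P) z" and zQ: "ch (p - Suc 0) (subtopology X Q) (bd p z)" using z by (auto simp: relcyc_def)
  have "ch p (subtopology X Q) (H (p - Suc 0) (bd p z))" using TH(6)[OF zQ] TH(4) by (cases p) auto
  moreover have "z + T p z = bd (Suc p) (H p z) + H (p - Suc 0) (bd p z)" using TH(7)[OF zP] by (simp add: ac_simps)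
  ultimately show ?thesis unfolding relnull_def using TH(6)[OF zP] by blast
qed

text \<open>The boundaries of the two pieces agree, up to chains off the diagonal, in a relative
  cycle \<open>h\<close> of the overlap. It bounds by assumption, and adding the bounding chain
  \<open>w\<close> to both pieces closes them.\<close>

lemma mayer_vietoris_split:
  assumes X: "Hausdorff_space X" and V: "openin X V1" "openin X V2"
    and low_null: "\<And>z. j > 0 \<Longrightarrow> rcV X (V1 \<inter> V2) (j - 1) z \<Longrightarrow> rnV X (V1 \<inter> V2) (j - 1) z"
    and z: "rcV X (V1 \<union> V2) j z"
  obtains z1 z2 where "rcV X V1 j z1" "rcV X V2 j z2" "rnV X (V1 \<union> V2) j (z + (z1 + z2))"
proof -
  let ?XX = "prod_topology X X" and ?V = "V1 \<union> V2"
  have zV: "ch j (subtopology ?XX (sq ?V)) z" and bz: "ch (j - Suc 0) (subtopology ?XX (od ?V)) (bd j z)"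
    using z by (auto simp: relcyc_def)
  obtain T H a1 a2 e where sd: "subdivision T H" and Tz: "T j z = a1 + a2 + e"
    and a1: "ch j (subtopology ?XX (sq V1)) a1" and a2: "ch j (subtopology ?XX (sq V2)) a2"
    and e: "ch j (subtopology ?XX (od ?V)) e"
    using small_split[OF X V zV] by metis
  note TH = subdivisionD[OF sd]
  have nT: "rnV X ?V j (z + T j z)" by (rule relnull_subdivision[OF sd z])
  have ne: "rnV X ?V j (z + (a1 + a2))"
    using relnull_add[OF nT relnull_sub[OF e]] by (simp add: Tz ac_simps)
  show thesis
  proof (cases "j = 0")
    case True
    then show thesis using that[OF _ _ ne] a1 a2 by (simp add: relcyc_def)
  next
    case False
    then obtain q where q: "j = Suc q" by (cases j) auto
    have "T q (bd j z) = bd j a1 + bd j a2 + bd j e"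
      using TH(8)[OF zV] unfolding Tz by (simp add: bd_add q)
    then have "bd j a1 + bd j a2 = T q (bd j z) + bd j e" by (simp add: add.assoc)
    moreover have "ch q (subtopology ?XX (od ?V)) (T q (bd j z) + bd j e)"
      using TH(5)[OF bz] ch_bd[OF e] q by auto
    ultimately have "ch q (subtopology ?XX (od ?V)) (bd j a1 + bd j a2)" by simp
    with ch_bd[OF a1] ch_bd[OF a2]
    obtain h e1 e2 where h: "bd j a1 = h + e1" "bd j a2 = h + e2" "ch q (subtopology ?XX (sq (V1 \<inter> V2))) h"
      "ch q (subtopology ?XX (od V1)) e1" "ch q (subtopology ?XX (od V2)) e2"
      using overlap[of q X V1 "bd j a1" V2 "bd j a2"] q by auto
    have "bd q (h + e1) = 0" using bd_bd[OF a1] q by (simp add: h(1)[symmetric])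
    then have "bd q h = bd q e1" by (simp add: bd_add chain2_eq_iff[of "bd q h"])
    then have "ch (q - Suc 0) (subtopology ?XX (od V1)) (bd q h)" using ch_bd[OF h(4)] by simp
    from ch_subtopology_Int[OF this ch_bd[OF h(3)]]
    have "rcV X (V1 \<inter> V2) q h" using h(3) by (simp add: relcyc_def od_sq Int_absorb1 inf.assoc[symmetric])
    then have "rnV X (V1 \<inter> V2) q h" using low_null[of h] q by simp
    then obtain w e' where w: "ch j (subtopology ?XX (sq (V1 \<inter> V2))) w" "ch q (subtopology ?XX (od (V1 \<inter> V2))) e'"
      and hw: "h = bd j w + e'" unfolding relnull_def q by blast
    have sub: "sq (V1 \<inter> V2) \<subseteq> sq V1" "sq (V1 \<inter> V2) \<subseteq> sq V2" "od (V1 \<inter> V2) \<subseteq> od V1" "od (V1 \<inter> V2) \<subseteq> od V2"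
      by (auto simp: sq_def od_def)
    have "bd j (a1 + w) = e1 + e'" "bd j (a2 + w) = e2 + e'" by (simp_all add: bd_add h hw ac_simps)
    then have "rcV X V1 j (a1 + w)" "rcV X V2 j (a2 + w)"
      unfolding relcyc_def using a1 a2 ch_mono[OF w(1) sub(1)] ch_mono[OF w(1) sub(2)] h(4,5)
        ch_mono[OF w(2) sub(3)] ch_mono[OF w(2) sub(4)] q by auto
    moreover have "rnV X ?V j (z + ((a1 + w) + (a2 + w)))" using ne by (simp add: ac_simps)
    ultimately show thesis by (rule that)
  qed
qed

text \<open>Exactness at the direct sum: a bounding chain is subdivided, its part in each square
  modifies the cycle there, and \<open>overlap\<close> extracts the common cycle.\<close>

lemma mayer_vietoris_overlap:
  assumes X: "Hausdorff_space X" and V: "openin X V1" "openin X V2"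
    and z: "rcV X V1 j z1" "rcV X V2 j z2" and null: "rnV X (V1 \<union> V2) j (z1 + z2)"
  obtains k where "rcV X (V1 \<inter> V2) j k" "rnV X V1 j (z1 + k)" "rnV X V2 j (z2 + k)"
proof -
  let ?XX = "prod_topology X X" and ?V = "V1 \<union> V2"
  obtain d e where d: "ch (Suc j) (subtopology ?XX (sq ?V)) d" and e: "ch j (subtopology ?XX (od ?V)) e"
    and eq: "z1 + z2 = bd (Suc j) d + e" using null unfolding relnull_def by blast
  obtain T H d1 d2 d3 where sd: "subdivision T H" and Td: "T (Suc j) d = d1 + d2 + d3"
    and d1: "ch (Suc j) (subtopology ?XX (sq V1)) d1" and d2: "ch (Suc j) (subtopology ?XX (sq V2)) d2"
    and d3: "ch (Suc j) (subtopology ?XX (od ?V)) d3"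
    using small_split[OF X V d] by metis
  note TH = subdivisionD[OF sd]
  have z1: "ch j (subtopology ?XX (sq V1)) z1" "ch (j - Suc 0) (subtopology ?XX (od V1)) (bd j z1)"
    and z2: "ch j (subtopology ?XX (sq V2)) z2" using z by (auto simp: relcyc_def)
  define u where "u = T j z1 + bd (Suc j) d1"
  define v where "v = T j z2 + bd (Suc j) d2"
  have uV: "ch j (subtopology ?XX (sq V1)) u" unfolding u_def using TH(5)[OF z1(1)] ch_bd_Suc[OF d1] by auto
  have vV: "ch j (subtopology ?XX (sq V2)) v" unfolding v_def using TH(5)[OF z2] ch_bd_Suc[OF d2] by auto
  have "T j (z1 + z2) = bd (Suc j) (d1 + d2 + d3) + T j e"
    using TH(8)[OF d] by (simp add: eq TH(1) Td)
  then have E: "T j z1 + T j z2 = bd (Suc j) d1 + bd (Suc j) d2 + (bd (Suc j) d3 + T j e)"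
    by (simp add: TH(1) bd_add ac_simps)
  have "u + v = (T j z1 + T j z2) + (bd (Suc j) d1 + bd (Suc j) d2)"
    unfolding u_def v_def by (simp add: ac_simps)
  also have "\<dots> = bd (Suc j) d3 + T j e" unfolding E by (simp add: ac_simps)
  finally have "ch j (subtopology ?XX (od ?V)) (u + v)" using ch_bd_Suc[OF d3] TH(5)[OF e] by auto
  from overlap[OF uV vV this]
  obtain h e1 e2 where h: "u = h + e1" "v = h + e2" "ch j (subtopology ?XX (sq (V1 \<inter> V2))) h"
    "ch j (subtopology ?XX (od V1)) e1" "ch j (subtopology ?XX (od V2)) e2" by metis
  have "bd j u = T (j - Suc 0) (bd j z1)" unfolding u_def by (simp add: bd_add bd_bd_Suc[OF d1] TH(8)[OF z1(1)])
  then have "ch (j - Suc 0) (subtopology ?XX (od V1)) (bd j u)" using TH(5)[OF z1(2)] by simp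
  moreover have "bd j h = bd j u + bd j e1" by (simp add: h(1) bd_add ac_simps)
  ultimately have "ch (j - Suc 0) (subtopology ?XX (od V1)) (bd j h)" using ch_bd[OF h(4)] by auto
  from ch_subtopology_Int[OF this ch_bd[OF h(3)]]
  have "rcV X (V1 \<inter> V2) j h" using h(3) by (simp add: relcyc_def od_sq inf.assoc[symmetric])
  moreover have "rnV X V1 j (z1 + h)"
  proof -
    have "T j z1 + h = bd (Suc j) d1 + e1" using h(1) unfolding u_def by (rule chain2_swap)
    then have "rnV X V1 j (T j z1 + h)" unfolding relnull_def using d1 h(4) by blast
    from relnull_add[OF relnull_subdivision[OF sd z(1)] this] show ?thesis by (simp add: ac_simps)
  qed
  moreover have "rnV X V2 j (z2 + h)"
  proof -
    have "T j z2 + h = bd (Suc j) d2 + e2" using h(2) unfolding v_def by (rule chain2_swap)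
    then have "rnV X V2 j (T j z2 + h)" unfolding relnull_def using d2 h(5) by blast
    from relnull_add[OF relnull_subdivision[OF sd z(2)] this] show ?thesis by (simp add: ac_simps)
  qed
  ultimately show thesis by (rule that)
qed

lemma low_null_union:
  assumes X: "Hausdorff_space X" and V: "openin X V1" "openin X V2"
    and low_null: "low_null n X V1" "low_null n X V2" "low_null n X (V1 \<inter> V2)"
  shows "low_null n X (V1 \<union> V2)"
  unfolding low_null_def
proof (intro allI impI)
  fix j z assume j: "j < n" and z: "rcV X (V1 \<union> V2) j z"
  have "rnV X (V1 \<inter> V2) (j - 1) z" if "rcV X (V1 \<inter> V2) (j - 1) z" for z
    using low_null(3) that j unfolding low_null_def by auto
  then obtain z1 z2 where z12: "rcV X V1 j z1" "rcV X V2 j z2" "rnV X (V1 \<union> V2) j (z + (z1 + z2))"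
    using mayer_vietoris_split[OF X V _ z] by metis
  then have "rnV X V1 j z1" "rnV X V2 j z2" using low_null j unfolding low_null_def by auto
  then have "rnV X (V1 \<union> V2) j (z1 + z2)" by (intro relnull_add) (rule rnV_mono[OF _ Un_upper1], assumption, rule rnV_mono[OF _ Un_upper2], assumption)
  then show "rnV X (V1 \<union> V2) j z" using z12(3) relnull_cancel by blast
qed

lemma split_dg:
  assumes X: "Hausdorff_space X" and V: "openin X V1" "openin X V2" and n: "n \<ge> 1"
    and gen: "thom_exists n X V1" "thom_exists n X V2" and low_null: "low_null n X (V1 \<inter> V2)" and z: "rcV X (V1 \<union> V2) n z"
  obtains z1 b1 z2 b2 where "dg n X V1 z1 b1" "dg n X V2 z2 b2" "rnV X (V1 \<union> V2) n (z + (z1 + z2))"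
proof -
  have "rnV X (V1 \<inter> V2) (n - 1) z" if "rcV X (V1 \<inter> V2) (n - 1) z" for z
    using low_null that n unfolding low_null_def by auto
  then obtain z1 z2 where z12: "rcV X V1 n z1" "rcV X V2 n z2" "rnV X (V1 \<union> V2) n (z + (z1 + z2))"
    using mayer_vietoris_split[OF X V _ z] by metis
  then show thesis using gen that unfolding thom_exists_def by metis
qed

lemma thom_exists_union:
  assumes X: "Hausdorff_space X" and V: "openin X V1" "openin X V2" and n: "n \<ge> 1"
    and gen: "thom_exists n X V1" "thom_exists n X V2" and low_null: "low_null n X (V1 \<inter> V2)"
  shows "thom_exists n X (V1 \<union> V2)"
  unfolding thom_exists_def
proof (intro allI impI)
  fix z assume z: "rcV X (V1 \<union> V2) n z"
  obtain z1 b1 z2 b2 where "dg n X V1 z1 b1" "dg n X V2 z2 b2" "rnV X (V1 \<union> V2) n (z + (z1 + z2))"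
    using split_dg[OF assms z] .
  then have "dg n X (V1 \<union> V2) (z1 + z2) (b1 + b2)" "rnV X (V1 \<union> V2) n ((z1 + z2) + z)"
    using dg_add dg_mono by (metis Un_upper1 Un_upper2, metis add.commute)
  then show "\<exists>b. dg n X (V1 \<union> V2) z b" using dg_relnull by blast
qed

text \<open>Derivations of a value over the union are first decomposed into derivations over
  \<open>V1\<close> and \<open>V2\<close>; \<open>loc\<close> serves good sets that lie in neither.
  If the cycle is null, both parts are homologous to one cycle of the overlap, so their values agree
  and the sum is 0.\<close>

lemma thom_unique_union:
  assumes X: "Hausdorff_space X" and V: "openin X V1" "openin X V2" and n: "n \<ge> 1"
    and thom_unique: "thom_unique n X V1" "thom_unique n X V2" and gen: "thom_exists n X (V1 \<inter> V2)"
    and loc: "\<And>W V'. good n X W \<Longrightarrow> openin X V' \<Longrightarrow> V' \<subseteq> W \<Longrightarrow> low_null n X V' \<and> thom_exists n X V'"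
  shows "thom_unique n X (V1 \<union> V2)"
proof -
  have dec: "\<exists>z1 b1 z2 b2. dg n X V1 z1 b1 \<and> dg n X V2 z2 b2 \<and> b = b1 + b2 \<and> rnV X (V1 \<union> V2) n (z + (z1 + z2))"
    if "dg n X (V1 \<union> V2) z b" for z b
    using that
  proof (induction rule: dg.induct)
    case (dg_null z)
    then show ?case using dg.dg_null[OF relnull_0] by (intro exI[of _ 0]) (auto intro: dg.dg_null)
  next
    case (dg_good W z)
    have Wo: "openin X W" using good_open[OF dg_good(1)] .
    have o: "openin X (W \<inter> V1)" "openin X (W \<inter> V2)" "openin X ((W \<inter> V1) \<inter> (W \<inter> V2))" using Wo V by auto
    have W: "W = (W \<inter> V1) \<union> (W \<inter> V2)" using dg_good(2) by blast
    obtain z1 b1 z2 b2 where z12: "dg n X (W \<inter> V1) z1 b1" "dg n X (W \<inter> V2) z2 b2" "rnV X W n (z + (z1 + z2))"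
      using split_dg[OF X o(1,2) n, of z] loc[OF dg_good(1)] o W dg_good(3) by (metis inf_le1 le_infI1)
    have "dg n X W (z1 + z2) (b1 + b2)" using dg_add[OF dg_mono[OF z12(1)] dg_mono[OF z12(2)]] by auto
    moreover have "dg n X W z (if rnV X W n z then 0 else 1)" using dg.dg_good[OF dg_good(1) _ dg_good(3)] by auto
    ultimately have "(if rnV X W n z then 0 else 1) = b1 + b2"
      using dg_unique[OF good_thom_unique[OF dg_good(1) n]] z12(3) by blast
    moreover have "dg n X V1 z1 b1" "dg n X V2 z2 b2" using dg_mono z12 by blast+
    moreover have "rnV X (V1 \<union> V2) n (z + (z1 + z2))" using rnV_mono[OF z12(3) dg_good(2)] .
    ultimately show ?case by blast
  next
    case (dg_add z b z' b')
    then obtain z1 b1 z2 b2 z1' b1' z2' b2' where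
      "dg n X V1 z1 b1" "dg n X V2 z2 b2" "b = b1 + b2" "rnV X (V1 \<union> V2) n (z + (z1 + z2))"
      "dg n X V1 z1' b1'" "dg n X V2 z2' b2'" "b' = b1' + b2'" "rnV X (V1 \<union> V2) n (z' + (z1' + z2'))" by metis
    note S = this
    have "dg n X V1 (z1 + z1') (b1 + b1')" "dg n X V2 (z2 + z2') (b2 + b2')"
      by (rule dg.dg_add[OF S(1,5)], rule dg.dg_add[OF S(2,6)])
    moreover have "b + b' = (b1 + b1') + (b2 + b2')" unfolding S(3,7) by (simp only: ac_simps)
    moreover have "rnV X (V1 \<union> V2) n ((z + z') + ((z1 + z1') + (z2 + z2')))"
      using relnull_add[OF S(4,8)] by (simp only: ac_simps)
    ultimately show ?case by blast
  qed
  show ?thesis unfolding thom_unique_def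
  proof (intro allI impI notI)
    fix z assume "dg n X (V1 \<union> V2) z 1" and null: "rnV X (V1 \<union> V2) n z"
    then obtain z1 b1 z2 b2 where z: "dg n X V1 z1 b1" "dg n X V2 z2 b2" "1 = b1 + b2" "rnV X (V1 \<union> V2) n (z + (z1 + z2))"
      using dec by blast
    have "rnV X (V1 \<union> V2) n (z1 + z2)" using relnull_cancel[of n _ _ _ "z1 + z2" z] z(4) null by (simp add: add.commute)
    then obtain k where k: "rcV X (V1 \<inter> V2) n k" "rnV X V1 n (z1 + k)" "rnV X V2 n (z2 + k)"
      using mayer_vietoris_overlap[OF X V dg_rcV[OF z(1)] dg_rcV[OF z(2)]] by blast
    then obtain b where "dg n X (V1 \<inter> V2) k b" using gen unfolding thom_exists_def by blast
    then have "dg n X V1 k b" "dg n X V2 k b" using dg_mono by (metis inf_le1, metis inf_le2)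
    then have "b1 = b" "b2 = b" using dg_unique thom_unique z k by blast+
    then show False using z(3) by simp
  qed
qed

section \<open>From boxes in one chart to finite unions of good sets\<close>

lemma compactin_singular_simplex: "singular_simplex p Y f \<Longrightarrow> compactin Y (f ` standard_simplex p)"
  unfolding singular_simplex_def
  using image_compactin[of "subtopology (powertop_real UNIV) (standard_simplex p)" "standard_simplex p" Y f]
  by (simp add: compactin_subtopology compactin_standard_simplex)

text \<open>A chain has finitely many simplices with compact images. Finitely many members of
  \<open>F\<close> cover both projections of these images, and the square of their union carries the
  chain.\<close>

lemma compact_support:
  assumes z: "rcV X Q p z" and F: "\<And>C. C \<in> F \<Longrightarrow> openin X C" "Q = \<Union>F"
  obtains F' where "finite F'" "F' \<subseteq> F" "rcV X (\<Union>F') p z"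
proof -
  let ?XX = "prod_topology X X"
  have zQ: "ch p (subtopology ?XX (sq Q)) z" and bz: "ch (p - Suc 0) (subtopology ?XX (od Q)) (bd p z)"
    using z by (auto simp: relcyc_def)
  define K where "K = (\<Union>f\<in>Poly_Mapping.keys z. fst ` f ` standard_simplex p \<union> snd ` f ` standard_simplex p)"
  have "compactin X K" unfolding K_def
  proof (intro compactin_Union)
    fix C assume "C \<in> (\<lambda>f. fst ` f ` standard_simplex p \<union> snd ` f ` standard_simplex p) ` Poly_Mapping.keys z"
    then obtain f where f: "f \<in> Poly_Mapping.keys z" and C: "C = fst ` f ` standard_simplex p \<union> snd ` f ` standard_simplex p" by blast
    have "compactin ?XX (f ` standard_simplex p)"
      using zQ f by (intro compactin_singular_simplex) (auto simp: ch_subtopology dest: ch_keys)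
    then show "compactin X C" unfolding C
      by (intro compactin_Un image_compactin[OF _ continuous_map_fst] image_compactin[OF _ continuous_map_snd])
  qed auto
  moreover have "K \<subseteq> \<Union>F" using zQ F by (fastforce simp: K_def ch_subtopology sq_def)
  ultimately obtain F' where F': "finite F'" "F' \<subseteq> F" "K \<subseteq> \<Union>F'"
    using F(1) unfolding compactin_def by metis
  have "f ` standard_simplex p \<subseteq> sq (\<Union>F')" if "f \<in> Poly_Mapping.keys z" for f
  proof
    fix y assume "y \<in> f ` standard_simplex p"
    then have "fst y \<in> K" "snd y \<in> K" using that unfolding K_def by blast+
    then show "y \<in> sq (\<Union>F')" using F'(3) unfolding sq_def by (cases y) auto
  qed
  then have 1: "ch p (subtopology ?XX (sq (\<Union>F'))) z" using zQ by (auto simp: ch_subtopology)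
  have "od Q \<inter> sq (\<Union>F') = od (\<Union>F')" using F F'(2) by (auto simp: od_def sq_def)
  then have "ch (p - Suc 0) (subtopology ?XX (od (\<Union>F'))) (bd p z)"
    using ch_subtopology_Int[OF bz ch_bd[OF 1]] by simp
  then show thesis using that[OF F'(1,2)] 1 by (simp add: relcyc_def)
qed

lemma empty_chain: "ch p (subtopology X {}) z \<Longrightarrow> z = 0"
proof (rule ccontr)
  assume "ch p (subtopology X {}) z" "z \<noteq> 0"
  then obtain f where "singular_simplex p (subtopology X {}) f" by (metis all_not_in_conv keys_eq_empty ch_keys)
  then show False using singular_simplex_empty[of "subtopology X {}" p f] by simp
qed

lemma empty_rcV: "rcV X {} p z \<Longrightarrow> z = 0"
  using empty_chain by (auto simp: relcyc_def sq_def)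

lemma empty_low_null: "low_null n X {}" "thom_exists n X {}"
  using empty_rcV dg_null[OF relnull_0] unfolding low_null_def thom_exists_def by (metis relnull_0)+

definition boxes :: "nat \<Rightarrow> 'a set \<Rightarrow> ('a \<Rightarrow> nat \<Rightarrow> real) \<Rightarrow> 'a set set" where
  "boxes n U \<phi> = {C. \<exists>a b. hbox n a b \<subseteq> \<phi> ` U \<and> C = {p \<in> U. \<phi> p \<in> hbox n a b}}"

lemma boxes_good:
  assumes "is_chart n X (U, \<phi>)" "C \<in> boxes n U \<phi>"
  shows "C = {} \<or> good n X C" "openin X C"
proof -
  obtain a b where C: "hbox n a b \<subseteq> \<phi> ` U" "C = {p \<in> U. \<phi> p \<in> hbox n a b}" using assms(2) by (auto simp: boxes_def)
  show "C = {} \<or> good n X C"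
  proof (cases "hbox n a b = {}")
    case False
    then show ?thesis using chart_box_of[OF assms(1) C(1)] C(2) unfolding good_def by blast
  qed (use C in auto)
  then show "openin X C" using good_open by auto
qed

lemma boxes_Int: "C \<in> boxes n U \<phi> \<Longrightarrow> D \<in> boxes n U \<phi> \<Longrightarrow> C \<inter> D \<in> boxes n U \<phi>"
proof -
  assume "C \<in> boxes n U \<phi>" "D \<in> boxes n U \<phi>"
  then obtain a b c d where C: "hbox n a b \<subseteq> \<phi> ` U" "C = {p \<in> U. \<phi> p \<in> hbox n a b}"
    and D: "D = {p \<in> U. \<phi> p \<in> hbox n c d}" unfolding boxes_def by blast
  have "hbox n a b \<inter> hbox n c d \<subseteq> \<phi> ` U" using C by blast
  moreover have "C \<inter> D = {p \<in> U. \<phi> p \<in> hbox n a b \<inter> hbox n c d}" using C D by blast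
  ultimately show ?thesis unfolding boxes_def box_Int by blast
qed

text \<open>Boxes of one chart are closed under intersection. The overlap of \<open>r\<close> boxes
  with one further box is a union of at most \<open>r\<close> boxes, so induction on the number of
  boxes controls the overlap as well.\<close>

lemma finite_boxes:
  assumes X: "Hausdorff_space X" and c: "is_chart n X (U, \<phi>)" and n: "n \<ge> 1"
  shows "finite F \<Longrightarrow> card F \<le> r \<Longrightarrow> F \<subseteq> boxes n U \<phi> \<Longrightarrow> low_null n X (\<Union>F) \<and> thom_exists n X (\<Union>F)"
proof (induction r arbitrary: F)
  case 0
  then show ?case using empty_low_null by auto
next
  case (Suc r)
  show ?case
  proof (cases "F = {}")
    case False
    then obtain C F' where F: "F = insert C F'" "C \<notin> F'" by (meson ex_in_conv mk_disjoint_insert)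
    have F': "finite F'" "card F' \<le> r" "F' \<subseteq> boxes n U \<phi>" and C: "C \<in> boxes n U \<phi>" using Suc.prems F by auto
    let ?G = "(\<lambda>D. D \<inter> C) ` F'"
    have "card ?G \<le> r" using card_image_le[OF F'(1)] F'(2) le_trans by blast
    moreover have "?G \<subseteq> boxes n U \<phi>" using boxes_Int C F'(3) by blast
    ultimately have G: "low_null n X (\<Union>?G) \<and> thom_exists n X (\<Union>?G)" using Suc.IH[of ?G] F'(1) by blast
    have I: "\<Union>F' \<inter> C = \<Union>?G" by blast
    have vC: "low_null n X C" "thom_exists n X C" using boxes_good(1)[OF c C] good_low_null[OF _ n] good_thom_exists empty_low_null by blast+
    have o: "openin X (\<Union>F')" "openin X C" using boxes_good(2)[OF c] F'(3) C by blast+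
    have F'v: "low_null n X (\<Union>F')" "thom_exists n X (\<Union>F')" using Suc.IH[OF F'] by auto
    have U: "\<Union>F = \<Union>F' \<union> C" using F by blast
    have "low_null n X (\<Union>F' \<inter> C)" unfolding I using G by blast
    then show ?thesis unfolding U
      using low_null_union[OF X o F'v(1) vC(1)] thom_exists_union[OF X o n F'v(2) vC(2)] by blast
  qed (use empty_low_null in auto)
qed

text \<open>Infinitely many boxes may be needed to fill \<open>Q\<close>, but a single cycle lives
  on finitely many of them.\<close>

lemma open_in_chart:
  assumes X: "Hausdorff_space X" and c: "is_chart n X (U, \<phi>)" and n: "n \<ge> 1" and Q: "openin X Q" "Q \<subseteq> U"
  shows "low_null n X Q" "thom_exists n X Q"
proof -
  define F where "F = {C \<in> boxes n U \<phi>. C \<subseteq> Q}"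
  note D = is_chartD[OF c]
  have "p \<in> \<Union>F" if p: "p \<in> Q" for p
  proof -
    obtain e where e: "hbox n (\<lambda>i. \<phi> p i - e) (\<lambda>i. \<phi> p i + e) \<subseteq> \<phi> ` Q"
      "\<phi> p \<in> hbox n (\<lambda>i. \<phi> p i - e) (\<lambda>i. \<phi> p i + e)"
      using half_space_box[OF D(7)[OF Q], of "\<phi> p"] p by blast
    let ?C = "{q \<in> U. \<phi> q \<in> hbox n (\<lambda>i. \<phi> p i - e) (\<lambda>i. \<phi> p i + e)}"
    have "?C \<subseteq> Q"
    proof
      fix q assume q: "q \<in> ?C"
      then obtain q' where "q' \<in> Q" "\<phi> q = \<phi> q'" using e(1) by blast
      then show "q \<in> Q" using D(2) q Q(2) by (metis (mono_tags, lifting) inj_onD mem_Collect_eq subsetD)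
    qed
    moreover have "?C \<in> boxes n U \<phi>" unfolding boxes_def using e(1) Q(2) by blast
    ultimately show ?thesis using e(2) p Q(2) unfolding F_def by blast
  qed
  then have QF: "Q = \<Union>F" by (auto simp: F_def)
  have Fo: "\<And>C. C \<in> F \<Longrightarrow> openin X C" using boxes_good(2)[OF c] by (auto simp: F_def)
  have fin: "low_null n X (\<Union>F') \<and> thom_exists n X (\<Union>F')" "\<Union>F' \<subseteq> Q" if "finite F'" "F' \<subseteq> F" for F'
    using finite_boxes[OF X c n that(1) order_refl] that(2) by (auto simp: F_def)
  show "low_null n X Q" unfolding low_null_def
  proof (intro allI impI)
    fix j z assume j: "j < n" and z: "rcV X Q j z"
    obtain F' where F': "finite F'" "F' \<subseteq> F" "rcV X (\<Union>F') j z" using compact_support[OF z Fo QF] .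
    then have "rnV X (\<Union>F') j z" using fin(1)[OF F'(1,2)] j unfolding low_null_def by blast
    then show "rnV X Q j z" using rnV_mono fin(2)[OF F'(1,2)] by blast
  qed
  show "thom_exists n X Q" unfolding thom_exists_def
  proof (intro allI impI)
    fix z assume z: "rcV X Q n z"
    obtain F' where F': "finite F'" "F' \<subseteq> F" "rcV X (\<Union>F') n z" using compact_support[OF z Fo QF] .
    then obtain b where "dg n X (\<Union>F') z b" using fin(1)[OF F'(1,2)] unfolding thom_exists_def by blast
    then show "\<exists>b. dg n X Q z b" using dg_mono fin(2)[OF F'(1,2)] by blast
  qed
qed

lemma open_in_good:
  assumes X: "Hausdorff_space X" and W: "good n X W" and n: "n \<ge> 1" and Q: "openin X Q" "Q \<subseteq> W"
  shows "low_null n X Q \<and> thom_exists n X Q"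
proof -
  obtain U \<phi> a b where "chart_box n X U \<phi> W a b" using W unfolding good_def by blast
  note D = chart_boxD[OF this]
  show ?thesis using open_in_chart[OF X D(1) n Q(1)] Q(2) D(2) by blast
qed

text \<open>When a good set \<open>W\<close> is added, its overlap with the earlier union is an open
  subset of \<open>W\<close> but in general no box; \<open>open_in_good\<close> provides what is
  needed about it.\<close>

theorem thom_class:
  assumes X: "Hausdorff_space X" and n: "n \<ge> 1" and F: "finite F" "\<And>W. W \<in> F \<Longrightarrow> good n X W"
  shows "thom_exists n X (\<Union>F)" "thom_unique n X (\<Union>F)"
proof -
  have "thom_exists n X (\<Union>F) \<and> thom_unique n X (\<Union>F)" using F
  proof (induction F rule: finite_induct)
    case empty
    have "b = 0" if "dg n X {} z b" for z b
      using that
    proof (induction rule: dg.induct)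
      case (dg_good W z)
      then have "rnV X W n z" using empty_rcV[of n X z] by auto
      then show ?case by simp
    qed auto
    then show ?case using empty_low_null(2) by (auto simp: thom_unique_def)
  next
    case (insert W F)
    have W: "good n X W" and F: "\<And>W'. W' \<in> F \<Longrightarrow> good n X W'" using insert.prems by auto
    have o: "openin X (\<Union>F)" "openin X W" using good_open W F by blast+
    have I: "low_null n X (\<Union>F \<inter> W)" "thom_exists n X (\<Union>F \<inter> W)"
      using open_in_good[OF X W n, of "\<Union>F \<inter> W"] o by auto
    have "thom_exists n X (\<Union>F \<union> W)"
      using thom_exists_union[OF X o n _ good_thom_exists[OF W] I(1)] insert.IH F by blast
    moreover have "thom_unique n X (\<Union>F \<union> W)"
      using thom_unique_union[OF X o n _ good_thom_unique[OF W n] I(2)] insert.IH F open_in_good[OF X _ n] by blast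
    ultimately show ?case by (simp add: Un_commute)
  qed
  then show "thom_exists n X (\<Union>F)" "thom_unique n X (\<Union>F)" by auto
qed

lemma continuous_map_swap_prod: "continuous_map (prod_topology X X) (prod_topology X X) prod.swap"
proof -
  have "continuous_map (prod_topology X X) (prod_topology X X) (\<lambda>z. (snd z, fst z))"
    by (intro continuous_map_pairedI continuous_map_fst continuous_map_snd)
  then show ?thesis by (rule continuous_map_eq) (auto simp: prod.swap_def)
qed

lemma swap_rcV: "rcV X V p z \<Longrightarrow> rcV X V p (cmap p prod.swap z)"
  by (rule relcyc_cmap) (auto simp: continuous_map_from_subtopology continuous_map_swap_prod sq_def od_def)

lemma swap_rnV: "rnV X V p z \<Longrightarrow> rnV X V p (cmap p prod.swap z)"
  by (rule relnull_cmap) (auto simp: continuous_map_from_subtopology continuous_map_swap_prod sq_def od_def)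

lemma swap_swap_chain: "ch p X z \<Longrightarrow> cmap p prod.swap (cmap p prod.swap z) = z"
  unfolding cmap_cmap by (rule cmap_id) auto

lemma swap_rnV_iff: "rcV X V p z \<Longrightarrow> rnV X V p (cmap p prod.swap z) \<longleftrightarrow> rnV X V p z"
  using swap_rnV swap_swap_chain unfolding relcyc_def by metis

lemma dg_swap: "dg n X V z b \<Longrightarrow> dg n X V (cmap n prod.swap z) b"
proof (induction rule: dg.induct)
  case (dg_good W z)
  then show ?case using dg.dg_good[OF dg_good(1,2) swap_rcV[OF dg_good(3)]] swap_rnV_iff[OF dg_good(3)] by simp
next
  case (dg_add z b z' b')
  show ?case unfolding cmap_add using dg_add(3,4) by (rule dg.dg_add)
qed (blast intro: dg.dg_null swap_rnV)

section \<open>The Thom class as a function on relative cycles\<close>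

definition theta :: "nat \<Rightarrow> 'a topology \<Rightarrow> 'a set \<Rightarrow> ('a \<times> 'a) chain2 \<Rightarrow> bit" where
  "theta n X V z = (THE b. dg n X V z b)"

lemma thetaI: "thom_unique n X V \<Longrightarrow> dg n X V z b \<Longrightarrow> theta n X V z = b"
  unfolding theta_def
  by (intro the_equality) (assumption, erule dg_unique, assumption, assumption, simp)

lemma theta_dg: "thom_unique n X V \<Longrightarrow> thom_exists n X V \<Longrightarrow> rcV X V n z \<Longrightarrow> dg n X V z (theta n X V z)"
  using thetaI unfolding thom_exists_def by metis

lemma theta_add:
  assumes "thom_unique n X V" "thom_exists n X V" "rcV X V n z" "rcV X V n z'"
  shows "theta n X V (z + z') = theta n X V z + theta n X V z'"
  using assms by (intro thetaI dg_add theta_dg)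

lemma theta_null: "thom_unique n X V \<Longrightarrow> rnV X V n z \<Longrightarrow> theta n X V z = 0"
  by (intro thetaI dg_null)

lemma theta_sum:
  assumes "thom_unique n X V" "thom_exists n X V" "\<And>i. i \<in> I \<Longrightarrow> rcV X V n (f i)"
  shows "theta n X V (sum f I) = (\<Sum>i\<in>I. theta n X V (f i))"
  using assms(3)
proof (induction I rule: infinite_finite_induct)
  case (insert x F)
  then show ?case using theta_add[OF assms(1,2)] relcyc_sum[of F n _ _ _ f] by auto
qed (auto simp: theta_null[OF assms(1)])

text \<open>Exchanging the factors preserves each rule that generates \<open>dg\<close>. The
  symmetry of the intersection form comes from here.\<close>

lemma theta_swap:
  assumes "thom_unique n X V" "thom_exists n X V" "rcV X V n z"
  shows "theta n X V (cmap n prod.swap z) = theta n X V z"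
  using assms by (intro thetaI dg_swap theta_dg)

lemma theta_homologous:
  assumes "thom_unique n X V" "thom_exists n X V" "rcV X V n z" "rnV X V n (z + z')"
  shows "theta n X V z' = theta n X V z"
  using assms by (intro thetaI dg_relnull[OF theta_dg])

section \<open>A rank estimate\<close>

text \<open>Gaussian elimination without division: equations are cross-multiplied with the pivot, so
  the nonzero solution lies in the domain itself.\<close>

lemma underdetermined_system:
  fixes A :: "'j \<Rightarrow> 'i \<Rightarrow> 'r::idom"
  assumes "finite J" "finite I" "card J < card I"
  shows "\<exists>x. (\<exists>i\<in>I. x i \<noteq> 0) \<and> (\<forall>j\<in>J. (\<Sum>i\<in>I. A j i * x i) = 0)"
  using assms
proof (induction J arbitrary: I A rule: finite_induct)
  case empty
  then show ?case by (intro exI[of _ "\<lambda>_. 1"]) (auto simp: card_gt_0_iff)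
next
  case (insert j J)
  show ?case
  proof (cases "\<forall>i\<in>I. A j i = 0")
    case True
    have "card J < card I" using insert by simp
    then obtain x where "\<exists>i\<in>I. x i \<noteq> 0" "\<forall>j\<in>J. (\<Sum>i\<in>I. A j i * x i) = 0"
      using insert.IH[of I A] insert.prems by blast
    then show ?thesis using True by (intro exI[of _ x]) auto
  next
    case False
    then obtain i0 where i0: "i0 \<in> I" "A j i0 \<noteq> 0" by blast
    define I' where "I' = I - {i0}"
    have I': "finite I'" "card J < card I'" using insert i0 by (auto simp: I'_def)
    define A' where "A' = (\<lambda>j' i. A j i0 * A j' i - A j' i0 * A j i)"
    obtain y where y: "\<exists>i\<in>I'. y i \<noteq> 0" "\<forall>j\<in>J. (\<Sum>i\<in>I'. A' j i * y i) = 0"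
      using insert.IH[of I' A'] I' by blast
    define x where "x = (\<lambda>i. if i = i0 then - (\<Sum>i\<in>I'. A j i * y i) else A j i0 * y i)"
    have sum: "(\<Sum>i\<in>I. A k i * x i) = - A k i0 * (\<Sum>i\<in>I'. A j i * y i) + (\<Sum>i\<in>I'. A k i * (A j i0 * y i))" for k
    proof -
      have "(\<Sum>i\<in>I. A k i * x i) = A k i0 * x i0 + (\<Sum>i\<in>I'. A k i * x i)"
        unfolding I'_def using insert.prems(1) i0(1) by (rule sum.remove)
      also have "(\<Sum>i\<in>I'. A k i * x i) = (\<Sum>i\<in>I'. A k i * (A j i0 * y i))"
        by (rule sum.cong) (auto simp: x_def I'_def)
      finally show ?thesis by (simp add: x_def)
    qed
    have "(\<Sum>i\<in>I. A k i * x i) = 0" if "k \<in> insert j J" for k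
    proof (cases "k = j")
      case True
      then show ?thesis unfolding sum by (simp add: sum_distrib_left algebra_simps sum_negf)
    next
      case False
      then have "(\<Sum>i\<in>I'. A' k i * y i) = 0" using that y(2) by auto
      then show ?thesis unfolding sum A'_def
        by (simp add: sum_distrib_left algebra_simps sum_subtractf sum_negf)
    qed
    moreover have "\<exists>i\<in>I. x i \<noteq> 0" using y(1) i0(2) by (auto simp: x_def I'_def)
    ultimately show ?thesis by blast
  qed
qed

section \<open>Polynomials over the field with two elements\<close>

type_synonym mpoly2 = "(nat \<Rightarrow>\<^sub>0 nat) \<Rightarrow>\<^sub>0 bit"

definition vr :: "nat \<Rightarrow> mpoly2" where
  "vr b = Poly_Mapping.single (Poly_Mapping.single b 1) 1"

lemma square_add: "(x + y) * (x + y) = x * x + y * (y :: mpoly2)"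
proof -
  have "x * y + y * x = 0" by (simp add: mult.commute)
  then show ?thesis by (simp add: algebra_simps)
qed

text \<open>Squaring is additive in characteristic two, so it doubles the exponents of each monomial
  and creates no mixed terms.\<close>

lemma vr_square: "vr b * (x * x) = lext (\<lambda>k. sgl (Poly_Mapping.single b 1 + k + k)) x"
proof (induction x rule: chain2_induct)
  case (single k)
  then show ?case by (simp add: vr_def mult_single add.assoc)
next
  case (add x y)
  then show ?case by (subst square_add) (simp only: lext_add distrib_left)
qed simp

text \<open>All monomials of \<open>vr b * (x b * x b)\<close> have an odd exponent exactly at
  \<open>b\<close>. Terms for different \<open>b\<close> have no monomial in common and cannot
  cancel.\<close>

lemma squares_independent:
  assumes "(\<Sum>b<m. vr b * (x b * x b)) = 0" "b < m"
  shows "x b = 0"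
proof (rule ccontr)
  assume "x b \<noteq> 0"
  then obtain k where k: "k \<in> Poly_Mapping.keys (x b)" by (metis all_not_in_conv keys_eq_empty)
  let ?e = "\<lambda>b k. Poly_Mapping.single b (1::nat) + k + k"
  have inj: "b' = b \<and> k' = k" if "?e b' k' = ?e b k" for b' k'
  proof -
    have lk: "Poly_Mapping.lookup (?e b' k') i = Poly_Mapping.lookup (?e b k) i" for i using that by simp
    have eq: "(if b' = i then 1 else 0) + 2 * Poly_Mapping.lookup k' i = (if b = i then 1 else 0) + 2 * Poly_Mapping.lookup k i" for i
      using lk[of i] by (simp only: lookup_add lookup_single when_def mult_2 add.assoc)
    have "b' = b" using eq[of b] by (auto split: if_splits) presburger
    then have "Poly_Mapping.lookup k' i = Poly_Mapping.lookup k i" for i using eq[of i] by simp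
    then show ?thesis using \<open>b' = b\<close> by (simp add: poly_mapping_eqI)
  qed
  have "Poly_Mapping.lookup (vr b' * (x b' * x b')) (?e b k) = (if b' = b then 1 else 0)" for b'
  proof -
    have "Poly_Mapping.lookup (vr b' * (x b' * x b')) (?e b k)
        = (\<Sum>k'\<in>Poly_Mapping.keys (x b'). Poly_Mapping.lookup (sgl (?e b' k')) (?e b k))"
      by (simp add: vr_square lext_def lookup_sum)
    also have "\<dots> = (\<Sum>k'\<in>Poly_Mapping.keys (x b'). if b' = b \<and> k' = k then 1 else 0)"
    proof (rule sum.cong)
      fix k'
      show "Poly_Mapping.lookup (sgl (?e b' k')) (?e b k) = (if b' = b \<and> k' = k then 1 else (0::bit))"
        using inj[of b' k'] by (auto simp: lookup_single when_def)
    qed simp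
    also have "\<dots> = (if b' = b then 1 else 0)" using k by (cases "b' = b") auto
    finally show ?thesis .
  qed
  then have "Poly_Mapping.lookup (\<Sum>b<m. vr b * (x b * x b)) (?e b k) = 1"
    using assms(2) by (simp add: lookup_sum)
  then show False using assms(1) by simp
qed

definition emb :: "bit \<Rightarrow> mpoly2" where "emb b = (if b = 0 then 0 else 1)"

lemma emb_add: "emb (a + b) = emb a + emb b"
  by (cases a; cases b) (auto simp: emb_def)
lemma emb_mult: "emb (a * b) = emb a * emb b"
  by (cases a; cases b) (auto simp: emb_def)
lemma emb_0 [simp]: "emb 0 = 0" and emb_1 [simp]: "emb 1 = 1"
  by (auto simp: emb_def)
lemma emb_sum: "emb (sum f I) = (\<Sum>i\<in>I. emb (f i))"
  by (rule additive_sum) (auto simp: emb_add)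

lemma symmetric_sum_zero:
  fixes f :: "nat \<Rightarrow> nat \<Rightarrow> mpoly2"
  assumes "\<And>b d. b < m \<Longrightarrow> d < m \<Longrightarrow> f b d = f d b" "\<And>b. b < m \<Longrightarrow> f b b = 0"
  shows "(\<Sum>b<m. \<Sum>d<m. f b d) = 0"
  using assms
proof (induction m)
  case (Suc m)
  have "(\<Sum>b<Suc m. \<Sum>d<Suc m. f b d) = (\<Sum>b<m. \<Sum>d<m. f b d) + ((\<Sum>b<m. f b m) + (\<Sum>d<m. f m d)) + f m m"
    by (simp add: sum.distrib ac_simps)
  also have "(\<Sum>d<m. f m d) = (\<Sum>b<m. f b m)" using Suc.prems(1) by (intro sum.cong) auto
  finally show ?case using Suc by simp
qed simp

text \<open>For each unordered pair exactly one order has \<open>t = 1\<close>, and it contributes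
  both off-diagonal terms of the sum of \<open>vr b * f b * f d\<close>. The diagonal terms have
  weight zero on the left; the last sum accounts for them.\<close>

lemma tournament_sum:
  fixes f :: "nat \<Rightarrow> mpoly2" and t :: "nat \<Rightarrow> nat \<Rightarrow> bit"
  assumes t: "\<And>b d. b < m \<Longrightarrow> d < m \<Longrightarrow> b \<noteq> d \<Longrightarrow> t b d + t d b = 1"
  shows "(\<Sum>b<m. \<Sum>d<m. f b * f d * (vr b + vr d) * emb (t b d)) = 
     (\<Sum>b<m. \<Sum>d<m. vr b * f b * f d) + (\<Sum>b<m. vr b * (f b * f b))"
  using t
proof (induction m)
  case (Suc m)
  let ?g = "\<lambda>b d. f b * f d * (vr b + vr d) * emb (t b d)"
  have "(\<Sum>b<m. ?g b m) + (\<Sum>d<m. ?g m d) = (\<Sum>b<m. f b * f m * (vr b + vr m) * emb (t b m + t m b))"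
    by (simp only: emb_add sum.distrib[symmetric]) (simp add: algebra_simps)
  also have "\<dots> = (\<Sum>b<m. f b * f m * (vr b + vr m))"
    using Suc.prems by (intro sum.cong) auto
  also have "\<dots> = (\<Sum>b<m. vr b * f b * f m) + (\<Sum>d<m. vr m * f m * f d)"
    by (simp add: sum.distrib[symmetric] algebra_simps)
  finally have c: "(\<Sum>b<m. ?g b m) + (\<Sum>d<m. ?g m d) = (\<Sum>b<m. vr b * f b * f m) + (\<Sum>d<m. vr m * f m * f d)" .
  have "(\<Sum>b<Suc m. \<Sum>d<Suc m. ?g b d) = (\<Sum>b<m. \<Sum>d<m. ?g b d) + ((\<Sum>b<m. ?g b m) + (\<Sum>d<m. ?g m d))"
    by (simp add: sum.distrib ac_simps)
  also have "\<dots> = (\<Sum>b<m. \<Sum>d<m. vr b * f b * f d) + (\<Sum>b<m. vr b * (f b * f b))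
      + ((\<Sum>b<m. vr b * f b * f m) + (\<Sum>d<m. vr m * f m * f d))"
    using Suc by (simp add: c)
  also have "\<dots> = (\<Sum>b<Suc m. \<Sum>d<Suc m. vr b * f b * f d) + (\<Sum>b<Suc m. vr b * (f b * f b))"
    by (simp add: sum.distrib ac_simps)
  finally show ?case .
qed simp

theorem rank_estimate:
  fixes B :: "nat \<times> nat \<Rightarrow> nat \<times> nat \<Rightarrow> bit" and s t :: "nat \<Rightarrow> nat \<Rightarrow> bit"
    and p q :: "'l \<Rightarrow> nat \<times> nat \<Rightarrow> bit"
  assumes L: "finite L"
    and sym: "\<And>a b c d. a < m \<Longrightarrow> b < m \<Longrightarrow> c < m \<Longrightarrow> d < m \<Longrightarrow> B (a, b) (c, d) = B (c, d) (a, b)"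
    and off: "\<And>a b c d. a < m \<Longrightarrow> b < m \<Longrightarrow> c < m \<Longrightarrow> d < m \<Longrightarrow> a \<noteq> c \<Longrightarrow> b \<noteq> d \<Longrightarrow> B (a, b) (c, d) = s a c + t b d"
    and t: "\<And>b d. b < m \<Longrightarrow> d < m \<Longrightarrow> b \<noteq> d \<Longrightarrow> t b d + t d b = 1"
    and rank: "\<And>a b c d. a < m \<Longrightarrow> b < m \<Longrightarrow> c < m \<Longrightarrow> d < m \<Longrightarrow> B (a, b) (c, d) = (\<Sum>l\<in>L. p l (a, b) * q l (c, d))"
  shows "m * m \<le> 2 * card L + 2 * m"
proof (rule ccontr)
  assume neg: "\<not> m * m \<le> 2 * card L + 2 * m"
  define I where "I = {..<m} \<times> {..<m}"
  define J :: "('l \<times> bool + nat \<times> bool) set" where "J = (L \<times> UNIV) <+> ({..<m} \<times> UNIV)"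
  \<comment> \<open>Two equations for each \<open>l\<close>, one against \<open>q l\<close> and one
    against \<open>p l\<close> weighted by the variable of the second index; then \<open>m\<close>
    row sums and \<open>m\<close> column sums.\<close>
  define A :: "'l \<times> bool + nat \<times> bool \<Rightarrow> nat \<times> nat \<Rightarrow> mpoly2" where
    "A = case_sum (\<lambda>(l, r) i. if r then emb (q l i) else vr (snd i) * emb (p l i))
           (\<lambda>(c, r) i. if r then (if fst i = c then 1 else 0) else (if snd i = c then 1 else 0))"
  have fin: "finite I" "finite J" using L by (auto simp: I_def J_def)
  have "card I = m * m" by (simp add: I_def)
  moreover have "card J = 2 * card L + 2 * m" using L by (simp add: J_def card_Plus mult.commute)
  ultimately have "card J < card I" using neg by simp
  then obtain x where x0: "\<exists>i\<in>I. x i \<noteq> 0" and x: "\<And>j. j \<in> J \<Longrightarrow> (\<Sum>i\<in>I. A j i * x i) = 0"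
    using underdetermined_system[of J I A] fin by blast
  have sumI: "(\<Sum>i\<in>I. f i) = (\<Sum>a<m. \<Sum>b<m. f (a, b))" for f :: "nat \<times> nat \<Rightarrow> mpoly2"
    by (simp add: I_def sum.cartesian_product)
  have xq: "(\<Sum>i\<in>I. emb (q l i) * x i) = 0" and xp: "(\<Sum>i\<in>I. vr (snd i) * emb (p l i) * x i) = 0" if "l \<in> L" for l
    using x[of "Inl (l, True)"] x[of "Inl (l, False)"] that by (auto simp: A_def J_def)
  have row: "(\<Sum>d<m. x (c, d)) = 0" if "c < m" for c
  proof -
    have "(\<Sum>i\<in>I. (if fst i = c then 1 else 0) * x i) = 0"
    proof -
      have "Inr (c, True) \<in> J" using that unfolding J_def by (intro InrI) simp
      from x[OF this] show ?thesis by (simp add: A_def)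
    qed
    moreover have "(\<Sum>i\<in>I. (if fst i = c then 1 else 0) * x i) = (\<Sum>a<m. if a = c then (\<Sum>d<m. x (c, d)) else 0)"
      unfolding sumI by (intro sum.cong) auto
    ultimately show ?thesis using that by simp
  qed
  have col: "(\<Sum>c<m. x (c, d)) = 0" if "d < m" for d
  proof -
    have "(\<Sum>i\<in>I. (if snd i = d then 1 else 0) * x i) = 0"
    proof -
      have "Inr (d, False) \<in> J" using that unfolding J_def by (intro InrI) simp
      from x[OF this] show ?thesis by (simp add: A_def)
    qed
    moreover have "(\<Sum>i\<in>I. (if snd i = d then 1 else 0) * x i) = (\<Sum>a<m. \<Sum>b<m. if b = d then x (a, d) else 0)"
      unfolding sumI by (intro sum.cong) auto
    ultimately show ?thesis using that by simp
  qed
  \<comment> \<open>For the weight \<open>vr b\<close> the factorisation is used as it stands, for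
    \<open>vr d\<close> after transposing \<open>B\<close>. In both cases the sum over the unknowns
    is one of the imposed equations.\<close>
  have G0: "(\<Sum>c<m. \<Sum>d<m. (vr b + vr d) * emb (B (a, b) (c, d)) * x (c, d)) = 0" if ab: "a < m" "b < m" for a b
  proof -
    have rank': "B (a, b) (c, d) = (\<Sum>l\<in>L. p l (c, d) * q l (a, b))" if "c < m" "d < m" for c d
      using sym[of a b c d] rank[of c d a b] ab that by simp
    have "(\<Sum>c<m. \<Sum>d<m. vr b * emb (B (a, b) (c, d)) * x (c, d))
        = (\<Sum>i\<in>I. \<Sum>l\<in>L. vr b * emb (p l (a, b)) * (emb (q l i) * x i))"
      unfolding sumI using ab
      by (intro sum.cong refl) (simp only: lessThan_iff rank emb_sum emb_mult sum_distrib_left sum_distrib_right ac_simps)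
    also have "\<dots> = (\<Sum>l\<in>L. vr b * emb (p l (a, b)) * (\<Sum>i\<in>I. emb (q l i) * x i))"
      by (subst sum.swap) (simp add: sum_distrib_left)
    finally have 1: "(\<Sum>c<m. \<Sum>d<m. vr b * emb (B (a, b) (c, d)) * x (c, d)) = 0" using xq by simp
    have "(\<Sum>c<m. \<Sum>d<m. vr d * emb (B (a, b) (c, d)) * x (c, d))
        = (\<Sum>i\<in>I. \<Sum>l\<in>L. emb (q l (a, b)) * (vr (snd i) * emb (p l i) * x i))"
      unfolding sumI using ab
      by (intro sum.cong refl) (simp only: lessThan_iff rank' emb_sum emb_mult sum_distrib_left sum_distrib_right ac_simps snd_conv)
    also have "\<dots> = (\<Sum>l\<in>L. emb (q l (a, b)) * (\<Sum>i\<in>I. vr (snd i) * emb (p l i) * x i))"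
      by (subst sum.swap) (simp add: sum_distrib_left)
    finally have 2: "(\<Sum>c<m. \<Sum>d<m. vr d * emb (B (a, b) (c, d)) * x (c, d)) = 0" using xp by simp
    show ?thesis using 1 2 by (simp add: distrib_right sum.distrib)
  qed
  have "x (a, b) = 0" if ab: "a < m" "b < m" for a b
  proof -
    let ?f = "\<lambda>b. x (a, b)"
    have s1: "(\<Sum>b<m. \<Sum>d<m. ?f b * x (c, d) * (vr b + vr d)) = 0" if "c < m" for c
    proof -
      have "(\<Sum>b<m. \<Sum>d<m. ?f b * x (c, d) * (vr b + vr d))
         = (\<Sum>b<m. ?f b * vr b) * (\<Sum>d<m. x (c, d)) + (\<Sum>b<m. ?f b) * (\<Sum>d<m. x (c, d) * vr d)"
        by (simp only: sum_product distrib_left sum.distrib) (simp only: ac_simps)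
      then show ?thesis using row[OF that] row[OF ab(1)] by simp
    qed
    have t1: "(\<Sum>c\<in>{..<m} - {a}. x (c, d)) = x (a, d)" if "d < m" for d
    proof -
      have "x (a, d) + (\<Sum>c\<in>{..<m} - {a}. x (c, d)) = 0"
        using col[OF that] sum.remove[of "{..<m}" a "\<lambda>c. x (c, d)"] ab by simp
      then show ?thesis by (metis add.commute chain2_eq_iff)
    qed
    \<comment> \<open>For \<open>b = d\<close> nothing is known about \<open>B\<close>, but both
      sides carry the weight \<open>vr b + vr b = 0\<close>.\<close>
    have trm: "?f b * ((vr b + vr d) * emb (B (a, b) (c, d)) * x (c, d)) =
        emb (s a c) * (?f b * x (c, d) * (vr b + vr d)) + x (c, d) * (?f b * (vr b + vr d) * emb (t b d))"
      if "b < m" "d < m" "c < m" "c \<noteq> a" for b c d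
    proof (cases "b = d")
      case False
      then have "emb (B (a, b) (c, d)) = emb (s a c) + emb (t b d)"
        using off[of a b c d] that ab False by (metis emb_add)
      then show ?thesis by (simp add: algebra_simps)
    qed simp
    have "0 = (\<Sum>b<m. ?f b * (\<Sum>c<m. \<Sum>d<m. (vr b + vr d) * emb (B (a, b) (c, d)) * x (c, d)))"
      using G0[OF ab(1)] by simp
    also have "\<dots> = (\<Sum>b<m. \<Sum>c<m. \<Sum>d<m. ?f b * ((vr b + vr d) * emb (B (a, b) (c, d)) * x (c, d)))"
      by (simp add: sum_distrib_left)
    also have "\<dots> = (\<Sum>c<m. \<Sum>b<m. \<Sum>d<m. ?f b * ((vr b + vr d) * emb (B (a, b) (c, d)) * x (c, d)))"
      by (rule sum.swap)
    also have "\<dots> = (\<Sum>b<m. \<Sum>d<m. ?f b * ((vr b + vr d) * emb (B (a, b) (a, d)) * x (a, d)))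
        + (\<Sum>c\<in>{..<m} - {a}. \<Sum>b<m. \<Sum>d<m. ?f b * ((vr b + vr d) * emb (B (a, b) (c, d)) * x (c, d)))"
      using ab by (subst sum.remove[of _ a]) auto
    \<comment> \<open>The terms with \<open>c = a\<close> are symmetric in \<open>b\<close> and
      \<open>d\<close> and vanish for \<open>b = d\<close>, hence cancel in pairs.\<close>
    also have "(\<Sum>b<m. \<Sum>d<m. ?f b * ((vr b + vr d) * emb (B (a, b) (a, d)) * x (a, d))) = 0"
      using sym[of a _ a] ab by (intro symmetric_sum_zero) (auto simp: algebra_simps)
    also have "(\<Sum>c\<in>{..<m} - {a}. \<Sum>b<m. \<Sum>d<m. ?f b * ((vr b + vr d) * emb (B (a, b) (c, d)) * x (c, d)))
        = (\<Sum>c\<in>{..<m} - {a}. emb (s a c) * (\<Sum>b<m. \<Sum>d<m. ?f b * x (c, d) * (vr b + vr d))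
            + (\<Sum>b<m. \<Sum>d<m. x (c, d) * (?f b * (vr b + vr d) * emb (t b d))))"
      by (intro sum.cong) (simp_all add: trm sum.distrib sum_distrib_left)
    also have "\<dots> = (\<Sum>c\<in>{..<m} - {a}. \<Sum>b<m. \<Sum>d<m. x (c, d) * (?f b * (vr b + vr d) * emb (t b d)))"
      using s1 by (intro sum.cong) auto
    also have "\<dots> = (\<Sum>b<m. \<Sum>d<m. (\<Sum>c\<in>{..<m} - {a}. x (c, d)) * (?f b * (vr b + vr d) * emb (t b d)))"
      unfolding sum_distrib_right by (subst sum.swap) (intro sum.cong refl sum.swap)
    also have "\<dots> = (\<Sum>b<m. \<Sum>d<m. ?f b * ?f d * (vr b + vr d) * emb (t b d))"
      by (intro sum.cong) (auto simp: t1 algebra_simps)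
    also have "\<dots> = (\<Sum>b<m. \<Sum>d<m. vr b * ?f b * ?f d) + (\<Sum>b<m. vr b * (?f b * ?f b))"
      using t by (rule tournament_sum)
    also have "(\<Sum>b<m. \<Sum>d<m. vr b * ?f b * ?f d) = 0"
      using row[OF ab(1)] by (simp add: sum_distrib_left[symmetric])
    finally have "(\<Sum>b<m. vr b * (?f b * ?f b)) = 0" by simp
    then show ?thesis using squares_independent[of "\<lambda>b. x (a, b)" m b] ab by blast
  qed
  then show False using x0 by (auto simp: I_def)
qed

section \<open>Chains of pairs of simplices\<close>

text \<open>A pair \<open>(l, l')\<close> of vertex lists stands for the cross product of the affine simplices spanned by \<open>l\<close> and
  \<open>l'\<close>; the maps \<open>d1\<close>, \<open>d2\<close> are the augmented partial boundaries.\<close>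

type_synonym 'v pchain = "('v list \<times> 'v list) \<Rightarrow>\<^sub>0 bit"

definition fx :: "'v \<Rightarrow> 'v pchain \<Rightarrow> 'v pchain" where
  "fx v = lext (\<lambda>(l, l'). sgl (v # l, l'))"

definition fy :: "'v \<Rightarrow> 'v pchain \<Rightarrow> 'v pchain" where
  "fy v = lext (\<lambda>(l, l'). sgl (l, v # l'))"

definition d1 :: "'v pchain \<Rightarrow> 'v pchain" where
  "d1 = lext (\<lambda>(l, l'). lext (\<lambda>m. sgl (m, l')) (lbd l))"

definition d2 :: "'v pchain \<Rightarrow> 'v pchain" where
  "d2 = lext (\<lambda>(l, l'). lext (\<lambda>m. sgl (l, m)) (lbd l'))"

definition sw :: "('a \<times> 'a \<Rightarrow>\<^sub>0 bit) \<Rightarrow> ('a \<times> 'a \<Rightarrow>\<^sub>0 bit)" where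
  "sw = lext (\<lambda>z. sgl (prod.swap z))"

lemma pchain_add:
  "fx v (a + b) = fx v a + fx v b" "fy v (a + b) = fy v a + fy v b"
  "d1 (a + b) = d1 a + d1 b" "d2 (a + b) = d2 a + d2 b"
  by (simp_all add: fx_def fy_def d1_def d2_def lext_add)

lemma sw_add: "sw (a + b) = sw a + sw b"
  by (simp add: sw_def lext_add)

lemma pchain_0 [simp]: "fx v 0 = 0" "fy v 0 = 0" "d1 0 = 0" "d2 0 = 0" "sw 0 = 0"
  by (simp_all add: fx_def fy_def d1_def d2_def sw_def)

lemma pchain_sgl [simp]: "fx v (sgl (l, l')) = sgl (v # l, l')" "fy v (sgl (l, l')) = sgl (l, v # l')"
  "sw (sgl (a, b)) = sgl (b, a)"
  by (simp_all add: fx_def fy_def sw_def)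

lemma pchain_lext: "fx v (lext h c) = lext (\<lambda>x. fx v (h x)) c" "fy v (lext h c) = lext (\<lambda>x. fy v (h x)) c"
  "d1 (lext h c) = lext (\<lambda>x. d1 (h x)) c" "d2 (lext h c) = lext (\<lambda>x. d2 (h x)) c" "sw (lext g c) = lext (\<lambda>x. sw (g x)) c"
  by (simp_all add: fx_def fy_def d1_def d2_def sw_def lext_lext)

lemma fx_fy: "fx u (fy v w) = fy v (fx u w)"
  by (simp add: fx_def fy_def lext_lext case_prod_unfold)

lemma d1_fx: "d1 (fx v w) = w + fx v (d1 w)"
proof (induction w rule: chain2_induct)
  case (single x)
  show ?case by (cases x) (simp add: d1_def fx_def lext_add lext_lcone lext_lext)
qed (simp_all add: pchain_add ac_simps)

lemma d1_fy: "d1 (fy v w) = fy v (d1 w)"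
proof (induction w rule: chain2_induct)
  case (single x)
  show ?case by (cases x) (simp add: d1_def fy_def lext_lext)
qed (simp_all add: pchain_add ac_simps)

lemma sw_fx: "sw (fx v w) = fy v (sw w)" "sw (fy v w) = fx v (sw w)"
  by (simp_all add: fx_def fy_def sw_def lext_lext case_prod_unfold)

lemma sw_sw [simp]: "sw (sw w) = w"
  by (simp add: sw_def lext_lext)

lemma lext_sw: "lext g (sw c) = lext (\<lambda>z. g (prod.swap z)) c" for g :: "_ \<Rightarrow> ('b \<Rightarrow>\<^sub>0 bit)"
  by (simp add: sw_def lext_lext)

lemma sw_d1: "sw (d1 w) = d2 (sw w)"
  by (simp add: d1_def d2_def sw_def lext_lext case_prod_unfold)

lemma d2_sw: "d2 w = sw (d1 (sw w))"
  by (simp add: sw_d1)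

lemma d2_fy: "d2 (fy v w) = w + fy v (d2 w)"
  by (simp add: d2_sw sw_fx d1_fx sw_add)

lemma d2_fx: "d2 (fx v w) = fx v (d2 w)"
  by (simp add: d2_sw sw_fx d1_fy)

definition pall :: "('v list \<Rightarrow> 'v list \<Rightarrow> bool) \<Rightarrow> 'v pchain \<Rightarrow> bool" where
  "pall P w \<longleftrightarrow> (\<forall>(l, l')\<in>Poly_Mapping.keys w. P l l')"

lemma pall_0 [simp]: "pall P 0" by (simp add: pall_def)

lemma pall_add: "pall P a \<Longrightarrow> pall P b \<Longrightarrow> pall P (a + b)"
  by (auto simp: pall_def keys_add_bit)

lemma pall_sgl [simp]: "pall P (sgl (l, l')) \<longleftrightarrow> P l l'" by (simp add: pall_def)

lemma pall_sum: "(\<And>i. i \<in> I \<Longrightarrow> pall P (f i)) \<Longrightarrow> pall P (sum f I)"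
  by (induction I rule: infinite_finite_induct) (auto intro: pall_add)

lemma pall_lext: "(\<And>x. x \<in> Poly_Mapping.keys c \<Longrightarrow> pall P (h x)) \<Longrightarrow> pall P (lext h c)"
  unfolding lext_def by (rule pall_sum)

lemma pall_mono: "pall P w \<Longrightarrow> (\<And>l l'. P l l' \<Longrightarrow> Q l l') \<Longrightarrow> pall Q w"
  by (auto simp: pall_def)

lemma pall_fx: "pall (\<lambda>l l'. P (v # l) l') w \<Longrightarrow> pall P (fx v w)"
  unfolding fx_def by (rule pall_lext) (auto simp: pall_def)

lemma pall_fy: "pall (\<lambda>l l'. P l (v # l')) w \<Longrightarrow> pall P (fy v w)"
  unfolding fy_def by (rule pall_lext) (auto simp: pall_def)

text \<open>\<open>vm\<close> restricted to the standard simplex, since singular simplices are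
  extensional functions there.\<close>

definition sx :: "'v list \<Rightarrow> (nat \<Rightarrow> real) \<Rightarrow> 'v \<Rightarrow> real" where
  "sx l = restrict (vm l) (standard_simplex (length l - 1))"

definition pc :: "nat \<Rightarrow> nat \<Rightarrow> 'v pchain \<Rightarrow> (('v \<Rightarrow> real) \<times> ('v \<Rightarrow> real)) chain2" where
  "pc p q = lext (\<lambda>(l, l'). crs p q (sx l) (sx l'))"

lemma pc_add: "pc p q (a + b) = pc p q a + pc p q b"
  by (simp add: pc_def lext_add)

lemma pc_0 [simp]: "pc p q 0 = 0"
  by (simp add: pc_def)

lemma singular_face_sx:
  assumes "length l = Suc (Suc m)" "i \<le> Suc m"
  shows "singular_face (Suc m) i (sx l) = sx (del i l)"
proof -
  have "simplical_face i x \<in> standard_simplex (Suc m)" if "x \<in> standard_simplex m" for x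
    using simplical_face_in_standard_simplex[of "Suc m" i x] that assms by simp
  then show ?thesis using assms
    by (auto simp: singular_face_def sx_def fun_eq_iff restrict_def vm_face)
qed

abbreviation pdim :: "nat \<Rightarrow> nat \<Rightarrow> 'v pchain \<Rightarrow> bool" where
  "pdim p q \<equiv> pall (\<lambda>l l'. length l = Suc p \<and> length l' = Suc q)"

text \<open>For a factor of dimension 0 the augmented boundary leaves an empty list, to which no
  simplex corresponds; that term is dropped.\<close>

lemma bd_pc:
  assumes "pdim p q w"
  shows "bd (p + q) (pc p q w) = (if p = 0 then 0 else pc (p - Suc 0) q (d1 w)) + (if q = 0 then 0 else pc p (q - Suc 0) (d2 w))"
proof (induction w rule: chain2_induct)
  case (single x)
  obtain l l' where x: "x = (l, l')" by (cases x)
  have faces: "lext f (lbd m) = (\<Sum>i\<le>r. f (del i m))" if "length m = Suc r"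
    for f :: "'a list \<Rightarrow> (('a \<Rightarrow> real) \<times> ('a \<Rightarrow> real)) chain2" and m r
    using that by (simp add: lbd_del lext_sum lessThan_Suc_atMost del: sum.lessThan_Suc)
  have l: "length l = Suc p" "length l' = Suc q" using assms single by (auto simp: x pall_def)
  have "(\<Sum>i\<le>p. crs (p - Suc 0) q (singular_face p i (sx l)) (sx l')) = pc (p - Suc 0) q (d1 (sgl x))" if "p \<noteq> 0"
    using that l singular_face_sx[of l "p - Suc 0"]
    by (simp add: x d1_def pc_def lext_lext faces)
  moreover have "(\<Sum>i\<le>q. crs p (q - Suc 0) (sx l) (singular_face q i (sx l'))) = pc p (q - Suc 0) (d2 (sgl x))" if "q \<noteq> 0"
    using that l singular_face_sx[of l' "q - Suc 0"]
    by (simp add: x d2_def pc_def lext_lext faces)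
  ultimately show ?case using bd_crs[of p q "sx l" "sx l'"] by (cases "p = 0"; cases "q = 0") (simp_all add: x pc_def)
qed (auto simp: pc_add pchain_add bd_add ac_simps)

lemma swap_pc: "cmap (p + q) prod.swap (pc p q w) = pc q p (sw w)"
proof (induction w rule: chain2_induct)
  case (single x)
  show ?case using cmap_swap_cross[of p q "sgl (sx (fst x))" "sgl (sx (snd x))"]
    by (cases x) (simp add: pc_def cross_single)
qed (simp_all add: pc_add sw_add cmap_add)

lemma pc_pairs: "pc p q (lext (\<lambda>l. lext (\<lambda>l'. sgl (l, l')) d) c) =
    cross p q (lext (\<lambda>l. sgl (sx l)) c) (lext (\<lambda>l. sgl (sx l)) d)"
  by (simp add: pc_def lext_lext cross_def)

lemma vm_realization:
  assumes "\<sigma> \<in> K" "finite \<sigma>" "set l \<subseteq> \<sigma>" "l \<noteq> []" and u: "u \<in> standard_simplex (length l - 1)"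
  shows "vm l u \<in> geometric_realization K"
proof -
  have u: "0 \<le> u i" "(\<Sum>j<length l. u j) = 1" for i
    using u assms(4) by (auto simp: standard_simplex_def lessThan_Suc_atMost[symmetric] simp del: lessThan_Suc)
  have "(\<Sum>v\<in>\<sigma>. vm l u v) = (\<Sum>j<length l. \<Sum>v\<in>\<sigma>. if l ! j = v then u j else 0)"
    unfolding vm_def by (rule sum.swap)
  also have "\<dots> = (\<Sum>j<length l. u j)"
    using assms(2,3) by (intro sum.cong) (auto simp: subset_iff)
  finally have "(\<Sum>v\<in>\<sigma>. vm l u v) = 1" using u by simp
  moreover have "vm l u v = 0" if "v \<notin> \<sigma>" for v
    unfolding vm_def using that assms(3) nth_mem by (intro sum.neutral) fastforce
  moreover have "0 \<le> vm l u v" for v unfolding vm_def by (rule sum_nonneg) (auto simp: u)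
  ultimately show ?thesis using assms(1) unfolding geometric_realization_def by blast
qed

text \<open>On the vertices of \<open>l\<close> the second point is zero, while the coordinates of
  the first one sum to 1 there.\<close>

lemma vm_disjoint:
  assumes "set l \<inter> set l' = {}" "l \<noteq> []" "u \<in> standard_simplex (length l - 1)" 
  shows "vm l u \<noteq> vm l' u'"
proof
  assume eq: "vm l u = vm l' u'"
  have "vm l' u' v = 0" if "v \<in> set l" for v
    unfolding vm_def using that assms(1) nth_mem by (intro sum.neutral) fastforce
  then have "(\<Sum>v\<in>set l. vm l u v) = 0" unfolding eq by simp
  moreover have "vm l u \<in> geometric_realization {set l}" using assms by (intro vm_realization) auto
  ultimately show False by (simp add: geometric_realization_def)
qed

abbreviation face_in :: "'v set set \<Rightarrow> 'v list \<Rightarrow> bool" where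
  "face_in K l \<equiv> \<exists>\<sigma>\<in>K. finite \<sigma> \<and> set l \<subseteq> \<sigma>"

lemma singular_simplex_sx:
  assumes "face_in K l" "length l = Suc p"
  shows "singular_simplex p (subtopology (powertop_real UNIV) (geometric_realization K)) (sx l)"
proof -
  have l: "l \<noteq> []" "length l - Suc 0 = p" using assms(2) by auto
  have "vm l u \<in> geometric_realization K" if "u \<in> standard_simplex p" for u
    using vm_realization[OF _ _ _ l(1)] assms(1) that l(2) by auto
  moreover have "continuous_map (subtopology (powertop_real UNIV) (standard_simplex p)) (powertop_real UNIV) (sx l)"
    by (rule continuous_map_eq[OF continuous_map_from_subtopology[OF continuous_map_vm[of l]]]) (simp add: sx_def l)
  ultimately show ?thesis
    by (auto simp: singular_simplex_subtopology) (auto simp: singular_simplex_def sx_def l)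
qed

lemma ch_pc:
  assumes "pdim p q w" "pall (\<lambda>l l'. face_in K l \<and> face_in K l') w"
  shows "ch (p + q) (subtopology (prod_topology (powertop_real UNIV) (powertop_real UNIV)) (sq (geometric_realization K))) (pc p q w)"
proof -
  let ?T = "subtopology (powertop_real UNIV) (geometric_realization K)"
  have "ch (p + q) (prod_topology ?T ?T) (crs p q (sx l) (sx l'))" if "(l, l') \<in> Poly_Mapping.keys w" for l l'
  proof -
    have "singular_simplex p ?T (sx l)" "singular_simplex q ?T (sx l')"
      using assms that by (auto simp: pall_def intro!: singular_simplex_sx)
    then show ?thesis using ch_cross[of p ?T "sgl (sx l)" q ?T "sgl (sx l')"] by (simp add: ch_single cross_single)
  qed
  then show ?thesis unfolding pc_def sq_def subtopology_Times by (intro ch_lext) auto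
qed

lemma ch_pc_disjoint:
  assumes "pdim p q w" "pall (\<lambda>l l'. face_in K l \<and> face_in K l') w" "pall (\<lambda>l l'. set l \<inter> set l' = {}) w"
  shows "ch (p + q) (subtopology (prod_topology (powertop_real UNIV) (powertop_real UNIV)) (od (geometric_realization K))) (pc p q w)"
proof -
  let ?TT = "prod_topology (powertop_real UNIV) (powertop_real UNIV) :: (('a \<Rightarrow> real) \<times> ('a \<Rightarrow> real)) topology"
  have "f ` standard_simplex (p + q) \<subseteq> od (geometric_realization K)"
    if "f \<in> Poly_Mapping.keys (pc p q w)" for f
  proof -
    have "f \<in> (\<Union>x\<in>Poly_Mapping.keys w. Poly_Mapping.keys (case x of (l, l') \<Rightarrow> crs p q (sx l) (sx l')))"
      using subsetD[OF keys_lext that[unfolded pc_def]] .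
    then obtain x where x: "x \<in> Poly_Mapping.keys w" "f \<in> Poly_Mapping.keys (case x of (l, l') \<Rightarrow> crs p q (sx l) (sx l'))"
      by (rule UN_E)
    obtain l l' where "x = (l, l')" by (cases x)
    with x have l: "(l, l') \<in> Poly_Mapping.keys w" and f: "f \<in> Poly_Mapping.keys (crs p q (sx l) (sx l'))" by simp_all
    obtain v where v: "v \<in> Poly_Mapping.keys (stair [0..<Suc p] [0..<Suc q])" "f = rz (sx l) (sx l') v"
      using f keys_lext[of "\<lambda>v. sgl (rz (sx l) (sx l') v)"] unfolding crs_def by fastforce
    have len: "length l = Suc p" "length l' = Suc q" and dj: "set l \<inter> set l' = {}" using assms l by (auto simp: pall_def)
    note K = keys_stair_upt[OF v(1)]
    have ne: "l \<noteq> []" using len by auto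
    have "fst (f u) \<noteq> snd (f u)" if u: "u \<in> standard_simplex (p + q)" for u
    proof -
      have "vm (map fst v) u \<in> standard_simplex p" "vm (map snd v) u \<in> standard_simplex q"
        using vm_simplex[OF u, of "map fst v" p] vm_simplex[OF u, of "map snd v" q] K by auto
      then show ?thesis using vm_disjoint[OF dj ne] u len K by (simp add: v(2) rz_def sx_def)
    qed
    moreover have "f ` standard_simplex (p + q) \<subseteq> sq (geometric_realization K)"
      using ch_pc[OF assms(1,2)] that by (auto simp: ch_subtopology)
    ultimately show ?thesis unfolding od_def sq_def by blast
  qed
  then show ?thesis using ch_pc[OF assms(1,2)] by (auto simp: ch_subtopology)
qed


section \<open>The cycles in the product\<close>

text \<open>Vertices of the highest line come first in the lists; the line of a vertex is recorded by the
  length of the remaining list. Each \<open>W\<close> is a matrix modulo two, written as the formal sum of its entries.\<close>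

type_synonym matrix2 = "(nat \<times> nat) \<Rightarrow>\<^sub>0 bit"

primrec zc :: "matrix2 list \<Rightarrow> (nat \<times> nat) pchain" where
  "zc [] = sgl ([], [])"
| "zc (W # Ws) = lext (\<lambda>(a, b). fx (Suc (length Ws), a) (fy (Suc (length Ws), b) (zc Ws))) W"

text \<open>Zero row and column sums modulo two: such a matrix is a sum of tensors of 0-chains of
  even size, and so contributes nothing to either partial boundary.\<close>

definition even_sums :: "matrix2 \<Rightarrow> bool" where
  "even_sums W \<longleftrightarrow> lext (\<lambda>(a, b). sgl a) W = 0 \<and> lext (\<lambda>(a, b). sgl b) W = 0"

lemma even_sums_add: "even_sums A \<Longrightarrow> even_sums B \<Longrightarrow> even_sums (A + B)"
  by (simp add: even_sums_def lext_add)

lemma even_sums_sw: "even_sums (sw W) \<longleftrightarrow> even_sums W"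
  by (auto simp: even_sums_def sw_def lext_lext case_prod_unfold)

lemma zc_add: "zc ((A + B) # Ws) = zc (A # Ws) + zc (B # Ws)" "zc (C # (A + B) # Ws) = zc (C # A # Ws) + zc (C # B # Ws)"
  by (simp_all add: lext_add pchain_add lext_add_fun case_prod_unfold)

lemma sw_zc: "sw (zc Ws) = zc (map sw Ws)"
proof (induction Ws)
  case (Cons W Ws)
  have "sw (zc (W # Ws)) = lext (\<lambda>(a, b). fy (Suc (length Ws), a) (fx (Suc (length Ws), b) (sw (zc Ws)))) W"
    by (simp add: pchain_lext case_prod_unfold sw_fx)
  also have "\<dots> = zc (map sw (W # Ws))"
    by (simp add: Cons lext_sw case_prod_unfold fx_fy)
  finally show ?case .
qed simp

text \<open>Removing the vertex on the highest line leaves a term that depends on the second index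
  alone. Its sum is taken over the projection of \<open>W\<close> to second indices, which is
  zero.\<close>

lemma d1_zc: "(\<And>W. W \<in> set Ws \<Longrightarrow> even_sums W) \<Longrightarrow> d1 (zc Ws) = 0"
proof (induction Ws)
  case (Cons W Ws)
  let ?r = "Suc (length Ws)"
  have "d1 (zc (W # Ws)) = lext (\<lambda>(a, b). fy (?r, b) (zc Ws)) W"
    using Cons by (simp add: pchain_lext case_prod_unfold d1_fx d1_fy)
  also have "\<dots> = lext (\<lambda>b. fy (?r, b) (zc Ws)) (lext (\<lambda>(a, b). sgl b) W)"
    by (simp add: lext_lext case_prod_unfold)
  also have "\<dots> = 0" using Cons.prems[of W] by (simp add: even_sums_def)
  finally show ?case .
qed (simp add: d1_def)

lemma d2_zc: "(\<And>W. W \<in> set Ws \<Longrightarrow> even_sums W) \<Longrightarrow> d2 (zc Ws) = 0"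
  unfolding d2_sw sw_zc by (subst d1_zc) (auto simp: even_sums_sw)

definition lay :: "nat \<Rightarrow> nat \<Rightarrow> (nat \<times> nat) list \<Rightarrow> bool" where
  "lay N r l \<longleftrightarrow> map fst l = rev [1..<Suc r] \<and> snd ` set l \<subseteq> {1..N}"

lemma lay_0 [simp]: "lay N 0 l \<longleftrightarrow> l = []"
  by (auto simp: lay_def)

lemma lay_Suc: "lay N (Suc r) ((i, a) # l) \<longleftrightarrow> i = Suc r \<and> a \<in> {1..N} \<and> lay N r l"
  by (auto simp: lay_def)

lemma lay_length: "lay N r l \<Longrightarrow> length l = r"
  unfolding lay_def by (metis One_nat_def diff_Suc_1 length_map length_rev length_upt)

lemma lay_fst: "lay N r l \<Longrightarrow> fst ` set l = {1..r}"
proof -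
  assume "lay N r l"
  then have "set (map fst l) = set [1..<Suc r]" unfolding lay_def by (metis set_rev)
  then show ?thesis by auto
qed

lemma lay_zc: "(\<And>W. W \<in> set Ws \<Longrightarrow> Poly_Mapping.keys W \<subseteq> {1..N} \<times> {1..N}) \<Longrightarrow>
  pall (\<lambda>l l'. lay N (length Ws) l \<and> lay N (length Ws) l') (zc Ws)"
proof (induction Ws)
  case (Cons W Ws)
  have "pall (\<lambda>l l'. lay N (length Ws) l \<and> lay N (length Ws) l') (zc Ws)" using Cons by simp
  then show ?case using Cons.prems[of W]
    by (auto intro!: pall_lext pall_fx pall_fy simp: lay_Suc elim!: pall_mono)
qed simp

lemma disjoint_zc: "(\<And>W a. W \<in> set Ws \<Longrightarrow> (a, a) \<notin> Poly_Mapping.keys W) \<Longrightarrow>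
  (\<And>W. W \<in> set Ws \<Longrightarrow> Poly_Mapping.keys W \<subseteq> {1..N} \<times> {1..N}) \<Longrightarrow>
  pall (\<lambda>l l'. set l \<inter> set l' = {} \<and> lay N (length Ws) l \<and> lay N (length Ws) l') (zc Ws)"
proof (induction Ws)
  case (Cons W Ws)
  have *: "pall (\<lambda>l l'. set l \<inter> set l' = {} \<and> lay N (length Ws) l \<and> lay N (length Ws) l') (zc Ws)" using Cons by simp
  have "(Suc (length Ws), a) \<notin> set l" if "lay N (length Ws) l" for a l
    using lay_fst[OF that] by (metis atLeastAtMost_iff fst_conv imageI not_less_eq_eq order_refl)
  then show ?case using Cons.prems(2)[of W] Cons.prems(1)[of W]
    by (auto intro!: pall_lext pall_fx pall_fy pall_mono[OF *] simp: lay_Suc)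
qed simp

lemma lay_face:
  assumes "lay N r l" "r \<le> k" "a \<in> {1..N}"
  shows "\<exists>\<sigma>\<in>{\<sigma> \<in> join_power N k. (Suc k, a) \<in> \<sigma>}. finite \<sigma> \<and> set ((Suc k, a) # l) \<subseteq> \<sigma>"
proof -
  \<comment> \<open>Lines without a vertex in the list receive vertex 1; any choice completes the
    list to a face.\<close>
  define b where "b = (\<lambda>i. case map_of ((Suc k, a) # l) i of Some v \<Rightarrow> v | None \<Rightarrow> 1)"
  have d: "distinct (map fst ((Suc k, a) # l))"
  proof -
    have "distinct (map fst l)" using assms(1) unfolding lay_def by (metis distinct_rev distinct_upt)
    then show ?thesis using lay_fst[OF assms(1)] assms(2) by auto
  qed
  have sub: "set ((Suc k, a) # l) \<subseteq> (\<lambda>i. (i, b i)) ` {1..k + 1}"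
  proof
    fix z assume z: "z \<in> set ((Suc k, a) # l)"
    have "b (fst z) = snd z" unfolding b_def using map_of_is_SomeI[OF d, of "fst z" "snd z"] z by simp
    moreover have "fst z \<in> {1..k + 1}"
    proof -
      have "fst z \<in> insert (Suc k) (fst ` set l)" using z by auto
      then show ?thesis using lay_fst[OF assms(1)] assms(2) by auto
    qed
    ultimately show "z \<in> (\<lambda>i. (i, b i)) ` {1..k + 1}" by (intro image_eqI[of _ _ "fst z"]) (auto simp: prod_eq_iff)
  qed
  have "b i \<in> {1..N}" for i
  proof (cases "map_of ((Suc k, a) # l) i")
    case (Some v)
    then have "(i, v) \<in> set ((Suc k, a) # l)" by (rule map_of_SomeD)
    then have "v \<in> {1..N}" using assms(1,3) unfolding lay_def by force
    then show ?thesis using Some by (simp add: b_def)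
  qed (use assms(3) in \<open>auto simp: b_def\<close>)
  then have "(\<lambda>i. (i, b i)) ` {1..k + 1} \<in> join_power N k" unfolding join_power_def by auto
  then show ?thesis using sub by (intro bexI[of _ "(\<lambda>i. (i, b i)) ` {1..k + 1}"]) auto
qed

text \<open>The six ordered pairs of distinct elements of \<open>{a, b, c}\<close> are the edges of
  a hexagon, the deleted join of three points. \<open>half\<close> is the path in it from
  \<open>a\<close> in the first copy to \<open>a\<close> in the second, and its mirror image
  completes the hexagon \<open>hx\<close>.\<close>

definition half :: "nat \<times> nat \<times> nat \<Rightarrow> matrix2" where
  "half = (\<lambda>(a, b, c). sgl (a, b) + sgl (c, b) + sgl (c, a))"

definition hx :: "nat \<times> nat \<times> nat \<Rightarrow> matrix2" where
  "hx t = half t + sw (half t)"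

definition triple :: "nat \<Rightarrow> nat \<times> nat \<times> nat \<Rightarrow> bool" where
  "triple N = (\<lambda>(a, b, c). a \<noteq> b \<and> a \<noteq> c \<and> b \<noteq> c \<and> {a, b, c} \<subseteq> {1..N})"

lemma keys_half: "Poly_Mapping.keys (half (a, b, c)) \<subseteq> {(a, b), (c, b), (c, a)}"
  by (auto simp: half_def keys_add_bit split: if_splits)

lemma hx: "even_sums (hx t)" "sw (hx t) = hx t"
  by (cases t; simp add: hx_def half_def even_sums_def sw_add lext_add ac_simps)+

lemma keys_hx: "Poly_Mapping.keys (hx (a, b, c)) \<subseteq> {(a, b), (c, b), (c, a), (b, a), (b, c), (a, c)}"
  by (auto simp: hx_def half_def sw_add keys_add_bit split: if_splits)

lemma triple_hx:
  assumes "triple N t"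
  shows "Poly_Mapping.keys (hx t) \<subseteq> {1..N} \<times> {1..N}" "(x, x) \<notin> Poly_Mapping.keys (hx t)"
proof -
  obtain a b c where t: "t = (a, b, c)" by (cases t) auto
  show "Poly_Mapping.keys (hx t) \<subseteq> {1..N} \<times> {1..N}" "(x, x) \<notin> Poly_Mapping.keys (hx t)"
    using assms keys_hx[of a b c] by (auto simp: triple_def t)
qed

lemma triple_half:
  assumes "triple N t" "(x, y) \<in> Poly_Mapping.keys (half t)"
  shows "x \<in> {1..N}" "y \<in> {1..N}" "x \<noteq> y"
proof -
  obtain a b c where t: "t = (a, b, c)" by (cases t) auto
  show "x \<in> {1..N}" "y \<in> {1..N}" "x \<noteq> y"
    using assms keys_half[of a b c] by (auto simp: triple_def t)
qed

text \<open>The chains \<open>mO\<close> and \<open>nO\<close> are hemispheres of consecutive dimensions: up to pairs of disjoint simplices the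
  boundary of \<open>nO\<close> is \<open>mO\<close> plus its mirror image, the boundary of \<open>mO\<close> is \<open>zO\<close>, and \<open>nO\<close> plus its mirror image is
  the next \<open>zO\<close>.\<close>

definition zO :: "nat \<times> nat \<Rightarrow> (nat \<times> nat \<times> nat) list \<Rightarrow> (nat \<times> nat) pchain" where
  "zO v ts = fx v (fy v (zc (map hx ts)))"

definition nO :: "nat \<times> nat \<Rightarrow> nat \<times> nat \<times> nat \<Rightarrow> (nat \<times> nat \<times> nat) list \<Rightarrow> (nat \<times> nat) pchain" where
  "nO v t ts = fx v (fy v (zc (half t # map hx ts)))"

definition mO :: "nat \<times> nat \<Rightarrow> nat \<times> nat \<times> nat \<Rightarrow> (nat \<times> nat \<times> nat) list \<Rightarrow> (nat \<times> nat) pchain" where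
  "mO v t ts = fx v (fy v (fx (Suc (length ts), fst t) (zc (map hx ts))))"

lemma sw_hx_list: "sw (zc (map hx ts)) = zc (map hx ts)"
  by (simp add: sw_zc hx(2) o_def)

lemma nO_sw: "nO v t ts + sw (nO v t ts) = zO v (t # ts)"
proof -
  have "zc (hx t # map hx ts) = zc (half t # map hx ts) + zc (sw (half t) # map hx ts)"
    unfolding hx_def[of t] by (rule zc_add)
  also have "zc (sw (half t) # map hx ts) = sw (zc (half t # map hx ts))"
    by (simp only: sw_zc list.map) (simp add: o_def hx(2) del: zc.simps)
  finally show ?thesis by (simp add: nO_def zO_def pchain_add sw_fx fx_fy del: zc.simps)
qed

lemma d_zc_hx: "d1 (zc (map hx ts)) = 0" "d2 (zc (map hx ts)) = 0"
  by (rule d1_zc, use hx in auto)(rule d2_zc, use hx in auto)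

lemma sw_mO: "sw (mO v t ts) = fx v (fy v (fy (Suc (length ts), fst t) (zc (map hx ts))))"
  by (simp add: mO_def sw_fx sw_hx_list fx_fy)

text \<open>The path \<open>half t\<close> starts and ends at \<open>fst t\<close>, once in each
  copy; this vertex appears in \<open>mO\<close>. The other term arises by removing \<open>v\<close>
  from one factor, so it pairs disjoint simplices.\<close>

lemma d_nO:
  "d1 (nO v t ts) = fy v (zc (half t # map hx ts)) + sw (mO v t ts)"
  "d2 (nO v t ts) = fx v (zc (half t # map hx ts)) + mO v t ts"
proof -
  obtain a b c where t: "t = (a, b, c)" by (cases t) auto
  have "d1 (zc (half t # map hx ts)) = fy (Suc (length ts), fst t) (zc (map hx ts))"
    by (simp add: t half_def lext_add pchain_add d1_fx d1_fy d_zc_hx ac_simps)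
  then show "d1 (nO v t ts) = fy v (zc (half t # map hx ts)) + sw (mO v t ts)"
    unfolding nO_def sw_mO by (simp add: d1_fx d1_fy del: zc.simps)
  have "d2 (zc (half t # map hx ts)) = fx (Suc (length ts), fst t) (zc (map hx ts))"
    by (simp add: t half_def lext_add pchain_add d2_fx d2_fy d_zc_hx ac_simps)
  then show "d2 (nO v t ts) = fx v (zc (half t # map hx ts)) + mO v t ts"
    unfolding nO_def mO_def by (simp add: d2_fx d2_fy pchain_add del: zc.simps)
qed

lemma d_mO:
  "d1 (mO v t ts) = fy v (fx (Suc (length ts), fst t) (zc (map hx ts))) + zO v ts"
  "d2 (mO v t ts) = fx v (fx (Suc (length ts), fst t) (zc (map hx ts)))"
  by (simp_all add: mO_def zO_def d1_fx d1_fy d2_fx d2_fy d_zc_hx pchain_add fx_fy)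


section \<open>The local intersection number\<close>

lemma lay_notin: "lay N r l \<Longrightarrow> r < i \<Longrightarrow> (i, a) \<notin> set l"
  using lay_fst by (metis atLeastAtMost_iff fst_conv imageI linorder_not_less)

text \<open>What the degree argument needs: a map from pairs of points in the star \<open>S\<close>
  of \<open>v\<close> to Euclidean \<open>2 * k\<close>-space that is odd under exchange and has no
  zero off the diagonal.\<close>

locale odd_map =
  fixes k N :: nat and v :: "nat \<times> nat" and S :: "(nat \<times> nat \<Rightarrow> real) set"
    and F :: "(nat \<times> nat \<Rightarrow> real) \<times> (nat \<times> nat \<Rightarrow> real) \<Rightarrow> nat \<Rightarrow> real"
  assumes v: "fst v = Suc k" "snd v \<in> {1..N}"
    and S: "S = geometric_realization {\<sigma> \<in> join_power N k. v \<in> \<sigma>}"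
    and cF: "continuous_map (subtopology (prod_topology (powertop_real UNIV) (powertop_real UNIV)) (sq S)) PT F"
    and F: "F ` sq S \<subseteq> En (2 * k)" "F ` od S \<subseteq> Ep (2 * k)"
    and odd: "F (prod.swap z) = (\<lambda>i. - F z i)"
begin

definition Fc :: "nat \<Rightarrow> nat \<Rightarrow> (nat \<times> nat) pchain \<Rightarrow> (nat \<Rightarrow> real) chain2" where
  "Fc p q w = cmap (p + q) F (pc p q w)"

lemma Fc_add: "Fc p q (a + b) = Fc p q a + Fc p q b"
  by (simp add: Fc_def pc_add cmap_add)

lemma ng_Fc: "ng (p + q) (Fc p q w) = Fc q p (sw w)"
proof -
  have "(\<lambda>x i. - x i) \<circ> F = F \<circ> prod.swap" using odd by (simp add: fun_eq_iff)
  then show ?thesis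
    unfolding ng_def Fc_def cmap_cmap by (simp add: cmap_cmap[symmetric] swap_pc add.commute[of q p])
qed

definition face :: "(nat \<times> nat) list \<Rightarrow> bool" where
  "face l \<longleftrightarrow> face_in {\<sigma> \<in> join_power N k. v \<in> \<sigma>} l"

lemma lay_faces:
  assumes "lay N r l" "r \<le> k" shows "face l" "face (v # l)"
proof -
  obtain \<sigma> where "\<sigma> \<in> {\<sigma> \<in> join_power N k. (Suc k, snd v) \<in> \<sigma>}" "finite \<sigma>" "set ((Suc k, snd v) # l) \<subseteq> \<sigma>"
    using lay_face[OF assms v(2)] by blast
  moreover have "v = (Suc k, snd v)" using v(1) by (simp add: prod_eq_iff)
  ultimately have "\<sigma> \<in> {\<sigma> \<in> join_power N k. v \<in> \<sigma>} \<and> finite \<sigma> \<and> set (v # l) \<subseteq> \<sigma>" by metis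
  then show "face l" "face (v # l)" unfolding face_def by auto
qed

lemma Fc_En:
  assumes "pdim p q w" "pall (\<lambda>l l'. face l \<and> face l') w"
  shows "ch (p + q) (subtopology PT (En (2 * k))) (Fc p q w)"
proof -
  have "continuous_map (subtopology (prod_topology (powertop_real UNIV) (powertop_real UNIV)) (sq S)) (subtopology PT (En (2 * k))) F"
    using cF F(1) by (auto simp: continuous_map_in_subtopology)
  then show ?thesis unfolding Fc_def by (rule ch_cmap[rotated]) (use ch_pc[OF assms[unfolded face_def]] S in simp)
qed

lemma Fc_Ep:
  assumes "pdim p q w" "pall (\<lambda>l l'. face l \<and> face l') w" "pall (\<lambda>l l'. set l \<inter> set l' = {}) w"
  shows "ch (p + q) (subtopology PT (Ep (2 * k))) (Fc p q w)"
proof -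
  have "continuous_map (subtopology (prod_topology (powertop_real UNIV) (powertop_real UNIV)) (od S)) (subtopology PT (Ep (2 * k))) F"
    using continuous_map_from_subtopology_mono[OF cF od_subset] F(2) by (auto simp: continuous_map_in_subtopology)
  then show ?thesis unfolding Fc_def by (rule ch_cmap[rotated]) (use ch_pc_disjoint[OF assms[unfolded face_def]] S in simp)
qed

lemma bd_Fc:
  assumes "pdim p q w" "pall (\<lambda>l l'. face l \<and> face l') w" "p > 0"
  shows "bd (p + q) (Fc p q w) = Fc (p - Suc 0) q (d1 w) + (if q = 0 then 0 else Fc p (q - Suc 0) (d2 w))"
proof -
  have "bd (p + q) (Fc p q w) = cmap (p + q - Suc 0) F (bd (p + q) (pc p q w))"
    unfolding Fc_def using ch_pc[OF assms(1,2)[unfolded face_def]] by (rule bd_cmap)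
  moreover have "bd (p + q) (pc p q w) = pc (p - Suc 0) q (d1 w) + (if q = 0 then 0 else pc p (q - Suc 0) (d2 w))"
    using bd_pc[OF assms(1)] assms(3) by simp
  ultimately have "bd (p + q) (Fc p q w) = cmap (p + q - Suc 0) F (pc (p - Suc 0) q (d1 w) + (if q = 0 then 0 else pc p (q - Suc 0) (d2 w)))"
    by simp
  then show ?thesis using assms(3) by (cases "q = 0") (simp_all add: cmap_add Fc_def)
qed

lemma zc_hx:
  assumes "\<forall>t\<in>set ts. triple N t"
  shows "pall (\<lambda>l l'. set l \<inter> set l' = {} \<and> lay N (length ts) l \<and> lay N (length ts) l') (zc (map hx ts))"
proof -
  have W: "(a, a) \<notin> Poly_Mapping.keys W" "Poly_Mapping.keys W \<subseteq> {1..N} \<times> {1..N}" if W: "W \<in> set (map hx ts)" for W a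
  proof -
    obtain t where "W = hx t" "triple N t" using W assms by auto
    then show "(a, a) \<notin> Poly_Mapping.keys W" "Poly_Mapping.keys W \<subseteq> {1..N} \<times> {1..N}" using triple_hx by blast+
  qed
  show ?thesis using disjoint_zc[of "map hx ts" N, OF W] by simp
qed

lemma zc_half:
  assumes "\<forall>t\<in>set (t # ts). triple N t"
  shows "pall (\<lambda>l l'. set l \<inter> set l' = {} \<and> lay N (Suc (length ts)) l \<and> lay N (Suc (length ts)) l') (zc (half t # map hx ts))"
proof -
  have W: "(a, a) \<notin> Poly_Mapping.keys W" "Poly_Mapping.keys W \<subseteq> {1..N} \<times> {1..N}" if W: "W \<in> set (half t # map hx ts)" for W a
  proof -
    consider "W = half t" | t' where "W = hx t'" "triple N t'" using W assms by auto
    then have "(a, a) \<notin> Poly_Mapping.keys W \<and> Poly_Mapping.keys W \<subseteq> {1..N} \<times> {1..N}"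
    proof cases
      case 1
      have "triple N t" using assms by simp
      then show ?thesis using triple_half[of N t] unfolding 1 by fastforce
    next
      case 2
      then show ?thesis using triple_hx by blast
    qed
    then show "(a, a) \<notin> Poly_Mapping.keys W" "Poly_Mapping.keys W \<subseteq> {1..N} \<times> {1..N}" by auto
  qed
  have "length (half t # map hx ts) = Suc (length ts)" by simp
  with disjoint_zc[of "half t # map hx ts" N, OF W] show ?thesis by (simp only:)
qed

text \<open>The members of dimension \<open>2 * length ts\<close> of the hemisphere sequence;
  \<open>odd_part\<close> gives those of dimension \<open>2 * length ts - 1\<close>. The value
  \<open>odd_part []\<close> is only a filler.\<close>

fun even_part :: "(nat \<times> nat \<times> nat) list \<Rightarrow> (nat \<Rightarrow> real) chain2" where
  "even_part [] = pt0"
| "even_part (t # ts) = Fc (Suc (length ts)) (Suc (length ts)) (nO v t ts)"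

fun odd_part :: "(nat \<times> nat \<times> nat) list \<Rightarrow> (nat \<Rightarrow> real) chain2" where
  "odd_part [] = 0"
| "odd_part (t # ts) = Fc (Suc (length ts)) (length ts) (mO v t ts)"

text \<open>For the empty list the only pair is \<open>(v, v)\<close>, which an odd map sends to the
  origin. This supplies the required start \<open>pt0\<close>.\<close>

lemma tr_even_part:
  "tr (2 * length ts) (even_part ts) = Fc (length ts) (length ts) (zO v ts)"
proof (cases ts)
  case Nil
  have z: "F (x, x) = (\<lambda>_. 0)" for x
  proof
    fix i
    have "F (x, x) i = - F (x, x) i" using odd[of "(x, x)"] by (simp add: fun_eq_iff)
    then show "F (x, x) i = 0" by simp
  qed
  have "simplex_map 0 F (rz (sx [v]) (sx [v]) [(0, 0)]) = restrict (\<lambda>_ _. 0) (standard_simplex 0)"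
    by (simp add: simplex_map_def rz_def fun_eq_iff z)
  then have "Fc 0 0 (zO v []) = pt0"
    by (simp add: Fc_def pt0_def zO_def pc_def crs_def)
  then show ?thesis using Nil by (simp add: tr_def)
next
  case (Cons t ts')
  let ?r = "Suc (length ts')"
  have "tr (2 * length ts) (even_part ts) = Fc ?r ?r (nO v t ts') + ng (?r + ?r) (Fc ?r ?r (nO v t ts'))"
    by (simp add: Cons tr_def mult_2)
  then show ?thesis unfolding ng_Fc by (simp add: Cons Fc_add[symmetric] nO_sw)
qed

text \<open>In each error term the vertex \<open>v\<close> is left in only one factor, so its
  simplices are disjoint and \<open>F\<close> sends it off the origin.\<close>

lemma ch_parts:
  assumes "\<forall>t\<in>set ts. triple N t" "length ts \<le> k"
  shows "ch (2 * length ts) (subtopology PT (En (2 * k))) (even_part ts)"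
    "ts \<noteq> [] \<Longrightarrow> ch (2 * length ts - 1) (subtopology PT (En (2 * k))) (odd_part ts)"
    "ts \<noteq> [] \<Longrightarrow> ch (2 * length ts - 1) (subtopology PT (Ep (2 * k)))
       (bd (2 * length ts) (even_part ts) + tr (2 * length ts - 1) (odd_part ts))"
    "ts \<noteq> [] \<Longrightarrow> ch (2 * length ts - 2) (subtopology PT (Ep (2 * k)))
       (bd (2 * length ts - 1) (odd_part ts) + tr (2 * length ts - 2) (even_part (tl ts)))"
proof -
  have "ch (2 * length ts) (subtopology PT (En (2 * k))) (even_part ts) \<and> (ts \<noteq> [] \<longrightarrow>
      ch (2 * length ts - 1) (subtopology PT (En (2 * k))) (odd_part ts) \<and>
      ch (2 * length ts - 1) (subtopology PT (Ep (2 * k))) (bd (2 * length ts) (even_part ts) + tr (2 * length ts - 1) (odd_part ts)) \<and>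
      ch (2 * length ts - 2) (subtopology PT (Ep (2 * k))) (bd (2 * length ts - 1) (odd_part ts) + tr (2 * length ts - 2) (even_part (tl ts))))"
  proof (cases ts)
    case Nil
    then show ?thesis
      by (simp add: pt0_def ch_single singular_simplex_subtopology singular_simplex_def) (simp add: En_def)
  next
    case (Cons t ts')
    let ?r = "length ts'"
    have r: "?r < k" using assms Cons by simp
    have T: "\<forall>t\<in>set (t # ts'). triple N t" "\<forall>t\<in>set ts'. triple N t" using assms Cons by auto
    have vn: "v \<notin> set l" if "lay N s l" "s \<le> k" for s l
      using lay_notin[OF that(1), of "Suc k" "snd v"] that(2) v(1) by (metis le_imp_less_Suc prod.collapse)
    note Z = zc_hx[OF T(2)] and H = zc_half[OF T(1)]
    let ?p = "(Suc ?r, fst t)"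
    have p: "lay N (Suc ?r) (?p # l)" if "lay N ?r l" for l
    proof -
      have "fst t \<in> {1..N}" using T(1) by (cases t) (auto simp: triple_def)
      then show ?thesis using that by (simp add: lay_Suc)
    qed
    have pv: "?p \<noteq> v" using v(1) r by auto
    have L1: "length l = Suc ?r" "face l" "face (v # l)" "v \<notin> set l" if "lay N (Suc ?r) l" for l
      using lay_length[OF that] lay_faces[OF that] vn[OF that] r by simp_all
    have L0: "length l = ?r" "face l" "face (v # l)" "v \<notin> set l" "face (?p # l)" "face (v # ?p # l)" "?p \<notin> set l" if "lay N ?r l" for l
      using lay_length[OF that] lay_faces[OF that] vn[OF that] lay_faces[OF p[OF that]] lay_notin[OF that] r by simp_all
    have n: "pdim (Suc ?r) (Suc ?r) (nO v t ts')" "pall (\<lambda>l l'. face l \<and> face l') (nO v t ts')"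
      by (auto simp: nO_def L1 intro!: pall_fx pall_fy pall_mono[OF H] simp del: zc.simps)
    have m: "pdim (Suc ?r) ?r (mO v t ts')" "pall (\<lambda>l l'. face l \<and> face l') (mO v t ts')"
      by (auto simp: mO_def L0 intro!: pall_fx pall_fy pall_mono[OF Z] simp del: zc.simps)
    have a1: "pdim ?r (Suc ?r) (fy v (zc (half t # map hx ts')))"
      "pall (\<lambda>l l'. face l \<and> face l') (fy v (zc (half t # map hx ts')))"
      "pall (\<lambda>l l'. set l \<inter> set l' = {}) (fy v (zc (half t # map hx ts')))"
      by (intro pall_fx pall_fy pall_mono[OF H]; simp add: L1 del: zc.simps)+
    have a2: "pdim (Suc ?r) ?r (fx v (zc (half t # map hx ts')))"
      "pall (\<lambda>l l'. face l \<and> face l') (fx v (zc (half t # map hx ts')))"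
      "pall (\<lambda>l l'. set l \<inter> set l' = {}) (fx v (zc (half t # map hx ts')))"
      by (intro pall_fx pall_fy pall_mono[OF H]; simp add: L1 del: zc.simps)+
    have b1: "pdim ?r ?r (fy v (fx ?p (zc (map hx ts'))))"
      "pall (\<lambda>l l'. face l \<and> face l') (fy v (fx ?p (zc (map hx ts'))))"
      "pall (\<lambda>l l'. set l \<inter> set l' = {}) (fy v (fx ?p (zc (map hx ts'))))"
      using pv by (intro pall_fx pall_fy pall_mono[OF Z]; simp add: L0 del: zc.simps)+
    have b2: "?r > 0 \<Longrightarrow> pdim (Suc ?r) (?r - 1) (fx v (fx ?p (zc (map hx ts'))))"
      "pall (\<lambda>l l'. face l \<and> face l') (fx v (fx ?p (zc (map hx ts'))))"
      "pall (\<lambda>l l'. set l \<inter> set l' = {}) (fx v (fx ?p (zc (map hx ts'))))"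
      using pv by (intro pall_fx pall_fy pall_mono[OF Z]; simp add: L0 del: zc.simps)+
    have e1: "bd (2 * length ts) (even_part ts) + tr (2 * length ts - 1) (odd_part ts)
        = Fc ?r (Suc ?r) (fy v (zc (half t # map hx ts'))) + Fc (Suc ?r) ?r (fx v (zc (half t # map hx ts')))"
    proof -
      have "bd (Suc ?r + Suc ?r) (Fc (Suc ?r) (Suc ?r) (nO v t ts')) = 
          Fc ?r (Suc ?r) (fy v (zc (half t # map hx ts'))) + Fc ?r (Suc ?r) (sw (mO v t ts'))
          + (Fc (Suc ?r) ?r (fx v (zc (half t # map hx ts'))) + Fc (Suc ?r) ?r (mO v t ts'))"
        by (subst bd_Fc[OF n]) (simp_all add: d_nO Fc_add del: zc.simps)
      moreover have "tr (2 * length ts - 1) (odd_part ts) = Fc (Suc ?r) ?r (mO v t ts') + ng (Suc ?r + ?r) (Fc (Suc ?r) ?r (mO v t ts'))"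
        by (simp add: Cons tr_def mult_2)
      ultimately show ?thesis unfolding ng_Fc by (simp add: Cons mult_2 mult_2_right ac_simps del: zc.simps)
    qed
    have e2: "bd (2 * length ts - 1) (odd_part ts) + tr (2 * length ts - 2) (even_part (tl ts))
        = Fc ?r ?r (fy v (fx ?p (zc (map hx ts')))) + (if ?r = 0 then 0 else Fc (Suc ?r) (?r - 1) (fx v (fx ?p (zc (map hx ts')))))"
    proof -
      have "bd (Suc ?r + ?r) (Fc (Suc ?r) ?r (mO v t ts')) = Fc ?r ?r (fy v (fx ?p (zc (map hx ts')))) + Fc ?r ?r (zO v ts')
          + (if ?r = 0 then 0 else Fc (Suc ?r) (?r - 1) (fx v (fx ?p (zc (map hx ts')))))"
        by (subst bd_Fc[OF m]) (simp_all add: d_mO Fc_add del: zc.simps)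
      then show ?thesis using tr_even_part[of ts'] by (simp add: Cons mult_2 mult_2_right ac_simps del: zc.simps fx_fy)
    qed
    have "ch (2 * length ts) (subtopology PT (En (2 * k))) (even_part ts)"
      using Fc_En[OF n] by (simp add: Cons mult_2)
    moreover have "ch (2 * length ts - 1) (subtopology PT (En (2 * k))) (odd_part ts)"
      using Fc_En[OF m] by (simp add: Cons mult_2)
    moreover have "ch (2 * length ts - 1) (subtopology PT (Ep (2 * k))) (bd (2 * length ts) (even_part ts) + tr (2 * length ts - 1) (odd_part ts))"
      unfolding e1 using Fc_Ep[OF a1] Fc_Ep[OF a2] by (intro ch_add) (simp_all add: Cons mult_2 del: zc.simps)
    moreover have "ch (2 * length ts - 2) (subtopology PT (Ep (2 * k))) (bd (2 * length ts - 1) (odd_part ts) + tr (2 * length ts - 2) (even_part (tl ts)))"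
      unfolding e2 using Fc_Ep[OF b1] Fc_Ep[OF b2] by (intro ch_add) (cases ts'; simp add: Cons mult_2 del: zc.simps)+
    ultimately show ?thesis by blast
  qed
  then show "ch (2 * length ts) (subtopology PT (En (2 * k))) (even_part ts)"
    "ts \<noteq> [] \<Longrightarrow> ch (2 * length ts - 1) (subtopology PT (En (2 * k))) (odd_part ts)"
    "ts \<noteq> [] \<Longrightarrow> ch (2 * length ts - 1) (subtopology PT (Ep (2 * k)))
       (bd (2 * length ts) (even_part ts) + tr (2 * length ts - 1) (odd_part ts))"
    "ts \<noteq> [] \<Longrightarrow> ch (2 * length ts - 2) (subtopology PT (Ep (2 * k)))
       (bd (2 * length ts - 1) (odd_part ts) + tr (2 * length ts - 2) (even_part (tl ts)))"
    by blast+
qed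

theorem local_intersection:
  assumes ts: "\<forall>t\<in>set ts. triple N t" "length ts = k"
  shows "\<not> rnE (2 * k) (2 * k) (Fc k k (zO v ts))"
proof -
  \<comment> \<open>Dimension \<open>i\<close> uses the last \<open>i div 2\<close> triples for even
    \<open>i\<close> and the last \<open>Suc i div 2\<close> for odd \<open>i\<close>, so that
    consecutive members fit together.\<close>
  define a where "a = (\<lambda>i. if even i then even_part (drop (k - i div 2) ts) else odd_part (drop (k - Suc i div 2) ts))"
  have D: "\<forall>t\<in>set (drop (k - r) ts). triple N t" "length (drop (k - r) ts) = r" if "r \<le> k" for r
    using ts that by (auto dest: in_set_dropD)
  have tld: "tl (drop (k - Suc r) ts) = drop (k - r) ts" "drop (k - Suc r) ts \<noteq> []" if "Suc r \<le> k" for r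
    using that ts(2) by (auto simp: tl_drop drop_Suc[symmetric] Suc_diff_Suc drop_tl[symmetric])
  have "hemi (2 * k) a" unfolding hemi_def
  proof (intro conjI allI impI)
    show "a 0 = pt0" using ts(2) by (simp add: a_def)
    fix i
    show "ch i (subtopology PT (En (2 * k))) (a i)" if i: "i \<le> 2 * k"
    proof (cases "even i")
      case True
      then obtain r where "i = 2 * r" by blast
      then show ?thesis using ch_parts(1)[OF D(1), of r] D(2)[of r] i by (simp add: a_def)
    next
      case False
      then obtain r where r: "i = 2 * r + 1" by (rule oddE)
      then show ?thesis using ch_parts(2)[OF D(1), of "Suc r"] D(2)[of "Suc r"] tld(2)[of r] i by (simp add: a_def)
    qed
    show "ch i (subtopology PT (Ep (2 * k))) (bd (Suc i) (a (Suc i)) + tr i (a i))" if i: "i < 2 * k"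
    proof (cases "even i")
      case True
      then obtain r where "i = 2 * r" by blast
      then show ?thesis using ch_parts(4)[OF D(1), of "Suc r"] D(2)[of "Suc r"] tld[of r] i by (simp add: a_def)
    next
      case False
      then obtain r where r: "i = 2 * r + 1" by (rule oddE)
      then show ?thesis using ch_parts(3)[OF D(1), of "Suc r"] D(2)[of "Suc r"] tld(2)[of r] i by (simp add: a_def)
    qed
  qed
  then have "\<not> rnE (2 * k) (2 * k) (tr (2 * k) (a (2 * k)))" by (rule odd_degree)
  then show ?thesis using tr_even_part[of ts] ts(2) by (simp add: a_def)
qed

end

section \<open>The intersection form of an embedded join\<close>

text \<open>The pair \<open>{*, a}\<close> with the base vertex \<open>*\<close> numbered 1. The
  shift lets \<open>a\<close> run from 0 to \<open>N - 2\<close>.\<close>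

definition dipole :: "nat \<Rightarrow> nat \<Rightarrow>\<^sub>0 bit" where
  "dipole a = sgl 1 + sgl (a + 2)"

definition dipole_matrix :: "nat \<Rightarrow> nat \<Rightarrow> matrix2" where
  "dipole_matrix a c = lext (\<lambda>x. lext (\<lambda>y. sgl (x, y)) (dipole c)) (dipole a)"

lemma dipole_matrix_eq: "dipole_matrix a c = sgl (1, 1) + sgl (1, c + 2) + sgl (a + 2, 1) + sgl (a + 2, c + 2)"
  by (simp add: dipole_matrix_def dipole_def lext_add lext_add_fun ac_simps)

lemma sw_dipole_matrix: "sw (dipole_matrix a c) = dipole_matrix c a"
  by (simp add: dipole_matrix_eq sw_add ac_simps)

lemma dipole_matrix_hx: "dipole_matrix b d + dipole_matrix d b = hx (1, b + 2, d + 2)"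
  by (simp add: dipole_matrix_eq hx_def half_def sw_add ac_simps)

definition mat :: "nat \<Rightarrow> matrix2 \<Rightarrow> bool" where
  "mat N W \<longleftrightarrow> even_sums W \<and> Poly_Mapping.keys W \<subseteq> {1..N} \<times> {1..N}"

lemma mat_add: "mat N A \<Longrightarrow> mat N B \<Longrightarrow> mat N (A + B)"
  by (auto simp: mat_def even_sums_add keys_add_bit)

lemma mat_dipole_matrix: "a + 2 \<le> N \<Longrightarrow> c + 2 \<le> N \<Longrightarrow> mat N (dipole_matrix a c)"
  unfolding mat_def dipole_matrix_eq by (auto simp: even_sums_def lext_add keys_add_bit ac_simps split: if_splits)

lemma mat_hx: "triple N t \<Longrightarrow> mat N (hx t)"
  unfolding mat_def using hx(1) triple_hx(1) by blast

text \<open>All these matrices share the entry \<open>(1, 1)\<close>, which cancels in the sum; for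
  \<open>a \<noteq> c\<close> no other entry is diagonal.\<close>

lemma dipole_matrix_diagonal: "a \<noteq> c \<Longrightarrow> (x, x) \<notin> Poly_Mapping.keys (dipole_matrix a c + dipole_matrix 0 1)"
proof -
  assume "a \<noteq> c"
  have "dipole_matrix a c + dipole_matrix 0 1 = sgl (1, c + 2) + sgl (a + 2, 1) + sgl (a + 2, c + 2) + (sgl (1, 3) + sgl (2, 1) + sgl (2, 3))"
    by (simp add: dipole_matrix_eq ac_simps numeral_2_eq_2 numeral_3_eq_3)
  then show ?thesis using \<open>a \<noteq> c\<close> by (auto simp: keys_add_bit split: if_splits)
qed

text \<open>The straight contraction towards the vertex \<open>v\<close>, injective as long as
  \<open>s < 1\<close>.\<close>

definition shrink :: "'v \<Rightarrow> real \<Rightarrow> ('v \<Rightarrow> real) \<Rightarrow> 'v \<Rightarrow> real" where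
  "shrink v s x = (\<lambda>u. (1 - s) * x u + s * (if u = v then 1 else 0))"

lemma shrink_star:
  assumes x: "x \<in> geometric_realization {\<sigma> \<in> K. v \<in> \<sigma>}" and s: "0 \<le> s" "s \<le> 1"
    and fin: "\<And>\<sigma>. \<sigma> \<in> K \<Longrightarrow> finite \<sigma>"
  shows "shrink v s x \<in> geometric_realization {\<sigma> \<in> K. v \<in> \<sigma>}"
proof -
  obtain \<sigma> where \<sigma>: "\<sigma> \<in> K" "v \<in> \<sigma>" "\<forall>u\<in>\<sigma>. 0 \<le> x u" "\<forall>u. u \<notin> \<sigma> \<longrightarrow> x u = 0" "(\<Sum>u\<in>\<sigma>. x u) = 1"
    using x unfolding geometric_realization_def by blast
  have "(\<Sum>u\<in>\<sigma>. shrink v s x u) = (1 - s) * (\<Sum>u\<in>\<sigma>. x u) + s * (\<Sum>u\<in>\<sigma>. if u = v then 1 else 0)"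
    unfolding shrink_def by (simp add: sum.distrib sum_distrib_left)
  also have "\<dots> = 1" using \<sigma> fin by simp
  finally have "(\<Sum>u\<in>\<sigma>. shrink v s x u) = 1" .
  moreover have "\<forall>u\<in>\<sigma>. 0 \<le> shrink v s x u" "\<forall>u. u \<notin> \<sigma> \<longrightarrow> shrink v s x u = 0"
    using \<sigma> s by (auto simp: shrink_def)
  ultimately show ?thesis using \<sigma>(1,2) unfolding geometric_realization_def by blast
qed

lemma shrink_inj: "s < 1 \<Longrightarrow> shrink v s x = shrink v s y \<Longrightarrow> x = y"
  by (auto simp: shrink_def fun_eq_iff)

lemma realization_bounds:
  assumes "x \<in> geometric_realization K" "\<And>\<sigma>. \<sigma> \<in> K \<Longrightarrow> finite \<sigma>"
  shows "0 \<le> x u" "x u \<le> 1"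
proof -
  obtain \<sigma> where \<sigma>: "\<sigma> \<in> K" "\<forall>u\<in>\<sigma>. 0 \<le> x u" "\<forall>u. u \<notin> \<sigma> \<longrightarrow> x u = 0" "(\<Sum>u\<in>\<sigma>. x u) = 1"
    using assms(1) unfolding geometric_realization_def by blast
  show "0 \<le> x u" using \<sigma> by (cases "u \<in> \<sigma>") auto
  show "x u \<le> 1"
  proof (cases "u \<in> \<sigma>")
    case True
    then show ?thesis using member_le_sum[of u \<sigma> x] \<sigma> assms(2) by simp
  qed (use \<sigma> in auto)
qed

lemma join_power_finite: "\<sigma> \<in> join_power N k \<Longrightarrow> finite \<sigma>"
  unfolding join_power_def using finite_subset by fastforce

lemma realization_mono: "K \<subseteq> K' \<Longrightarrow> geometric_realization K \<subseteq> geometric_realization K'"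
  unfolding geometric_realization_def by blast

lemma continuous_map_map_prod:
  "continuous_map X Y f \<Longrightarrow> continuous_map (prod_topology X X) (prod_topology Y Y) (map_prod f f)"
  unfolding map_prod_def continuous_map_prod_top by simp

text \<open>\<open>V\<close> is to be a finite union of good sets, and \<open>W\<close> a good set
  around the image of vertex 1 of the top line, where the local number is evaluated.\<close>

locale embedded_join =
  fixes k N :: nat and X :: "'a topology" and f :: "(nat \<times> nat \<Rightarrow> real) \<Rightarrow> 'a" and V :: "'a set" and W :: "'a set"
  assumes k: "k \<ge> 1" and N: "N \<ge> 3"
    and V: "thom_unique (2 * k) X V" "thom_exists (2 * k) X V"
    and cont: "continuous_map (subtopology (powertop_real UNIV) (geometric_realization (join_power N k))) X f"
    and inj: "inj_on f (geometric_realization (join_power N k))"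
    and fV: "f ` geometric_realization (join_power N k) \<subseteq> V"
    and W: "good (2 * k) X W" "W \<subseteq> V" "f (\<lambda>u. if u = (Suc k, 1) then 1 else 0) \<in> W"
begin

abbreviation R where "R \<equiv> geometric_realization (join_power N k)"
abbreviation PP :: "((nat \<times> nat \<Rightarrow> real) \<times> (nat \<times> nat \<Rightarrow> real)) topology" where
  "PP \<equiv> prod_topology (powertop_real UNIV) (powertop_real UNIV)"

definition im :: "(nat \<times> nat) pchain \<Rightarrow> ('a \<times> 'a) chain2" where
  "im w = cmap (2 * k) (map_prod f f) (pc k k w)"

definition thom :: "(nat \<times> nat) pchain \<Rightarrow> bit" where
  "thom w = theta (2 * k) X V (im w)"

lemma pair_map: "continuous_map (subtopology PP (sq R)) (prod_topology X X) (map_prod f f)"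
  "map_prod f f ` sq R \<subseteq> sq V" "map_prod f f ` od R \<subseteq> od V"
proof -
  show "continuous_map (subtopology PP (sq R)) (prod_topology X X) (map_prod f f)"
    unfolding sq_def subtopology_Times using cont by (rule continuous_map_map_prod)
  show "map_prod f f ` sq R \<subseteq> sq V" using fV by (auto simp: sq_def)
  show "map_prod f f ` od R \<subseteq> od V" 
  proof
    fix p assume "p \<in> map_prod f f ` od R"
    then obtain x y where xy: "x \<in> R" "y \<in> R" "x \<noteq> y" "p = (f x, f y)" unfolding od_def by force
    then have "f x \<noteq> f y" using inj by (meson inj_onD)
    then show "p \<in> od V" using fV xy by (auto simp: od_def)
  qed
qed

definition cyc :: "(nat \<times> nat) pchain \<Rightarrow> bool" where
  "cyc w \<longleftrightarrow> pdim k k w \<and> pall (\<lambda>l l'. face_in (join_power N k) l \<and> face_in (join_power N k) l') w \<and> d1 w = 0 \<and> d2 w = 0"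

lemma im_add: "im (a + b) = im a + im b"
  by (simp add: im_def pc_add cmap_add)

lemma cyc_rcV: "cyc w \<Longrightarrow> rcV X V (2 * k) (im w)"
  unfolding im_def
proof (rule relcyc_cmap[OF _ pair_map od_subset])
  assume "cyc w"
  then have w: "pdim k k w" "pall (\<lambda>l l'. face_in (join_power N k) l \<and> face_in (join_power N k) l') w" "d1 w = 0" "d2 w = 0"
    by (simp_all add: cyc_def)
  show "relcyc (2 * k) PP (sq R) (od R) (pc k k w)"
    unfolding relcyc_def using ch_pc[OF w(1,2)] bd_pc[OF w(1)] w(3,4) by (simp add: mult_2)
qed

lemma thom_add: "cyc a \<Longrightarrow> cyc b \<Longrightarrow> thom (a + b) = thom a + thom b"
  unfolding thom_def im_add by (intro theta_add V cyc_rcV)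

lemma im_disjoint:
  assumes "pdim k k w" "pall (\<lambda>l l'. face_in (join_power N k) l \<and> face_in (join_power N k) l') w" "pall (\<lambda>l l'. set l \<inter> set l' = {}) w"
  shows "rnV X V (2 * k) (im w)"
  unfolding im_def
proof (rule relnull_cmap[OF _ pair_map od_subset])
  show "relnull (2 * k) PP (sq R) (od R) (pc k k w)"
    using ch_pc_disjoint[OF assms] by (intro relnull_sub) (simp add: mult_2)
qed

lemma thom_sw: "cyc w \<Longrightarrow> thom (sw w) = thom w"
proof -
  assume w: "cyc w"
  have "map_prod f f \<circ> prod.swap = prod.swap \<circ> map_prod f f" by (simp add: fun_eq_iff prod.swap_def)
  then have "im (sw w) = cmap (2 * k) prod.swap (im w)"
    unfolding im_def by (simp add: swap_pc[symmetric] cmap_cmap mult_2)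
  then show ?thesis unfolding thom_def using theta_swap[OF V cyc_rcV[OF w]] by simp
qed

lemma lay_top_face:
  assumes "lay N (Suc k) l" shows "face_in (join_power N k) l" "length l = Suc k"
proof -
  show len: "length l = Suc k" using lay_length[OF assms] .
  then obtain i a l' where l: "l = (i, a) # l'" by (cases l) auto
  then have "lay N k l'" "i = Suc k" "a \<in> {1..N}" using assms by (auto simp: lay_Suc)
  then show "face_in (join_power N k) l" using lay_face[of N k l' k a] unfolding l by auto
qed

lemma zc_cyc:
  assumes "length Ws = Suc k" "\<And>A. A \<in> set Ws \<Longrightarrow> mat N A"
  shows "cyc (zc Ws)"
proof -
  have "pall (\<lambda>l l'. lay N (Suc k) l \<and> lay N (Suc k) l') (zc Ws)"
    using lay_zc[of Ws N] assms by (auto simp: mat_def)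
  then have "pdim k k (zc Ws)" "pall (\<lambda>l l'. face_in (join_power N k) l \<and> face_in (join_power N k) l') (zc Ws)"
    by (auto elim!: pall_mono intro: lay_top_face)
  moreover have "d1 (zc Ws) = 0" "d2 (zc Ws) = 0"
    by (rule d1_zc d2_zc, use assms mat_def in blast)+
  ultimately show ?thesis by (simp add: cyc_def)
qed

lemma zc_disjoint:
  assumes "length Ws = Suc k" "\<And>A. A \<in> set Ws \<Longrightarrow> Poly_Mapping.keys A \<subseteq> {1..N} \<times> {1..N}" "\<And>A x. A \<in> set Ws \<Longrightarrow> (x, x) \<notin> Poly_Mapping.keys A"
  shows "rnV X V (2 * k) (im (zc Ws))"
proof -
  have *: "pall (\<lambda>l l'. set l \<inter> set l' = {} \<and> lay N (Suc k) l \<and> lay N (Suc k) l') (zc Ws)"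
    using disjoint_zc[of Ws N] assms by auto
  show ?thesis
    by (rule im_disjoint; rule pall_mono[OF *]) (auto intro: lay_top_face)
qed

section \<open>The contribution of pairs that share the vertex \<open>v0\<close>\<close>

abbreviation v0 :: "nat \<times> nat" where "v0 \<equiv> (Suc k, 1)"
abbreviation S0 where "S0 \<equiv> geometric_realization {\<sigma> \<in> join_power N k. v0 \<in> \<sigma>}"

lemma S0_R: "S0 \<subseteq> R" by (rule realization_mono) blast

lemma v0_in: "(\<lambda>u. if u = v0 then 1 else 0) \<in> S0"
proof -
  obtain \<sigma> where \<sigma>: "\<sigma> \<in> join_power N k" "v0 \<in> \<sigma>" "finite \<sigma>"
    using lay_face[of N 0 "[]" k 1] N by auto
  then show ?thesis unfolding geometric_realization_def by (auto intro!: exI[of _ \<sigma>])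
qed

definition shrink_pair :: "real \<Rightarrow> ((nat \<times> nat \<Rightarrow> real) \<times> (nat \<times> nat \<Rightarrow> real)) \<times> real \<Rightarrow> 'a \<times> 'a" where
  "shrink_pair s = (\<lambda>(z, t). (f (shrink v0 (t * s) (fst z)), f (shrink v0 (t * s) (snd z))))"

lemma shrink_S0: "x \<in> S0 \<Longrightarrow> 0 \<le> s \<Longrightarrow> s \<le> 1 \<Longrightarrow> shrink v0 s x \<in> S0"
  using shrink_star[of x "join_power N k" v0 s] join_power_finite by blast

lemma continuous_shrink_pair:
  assumes "0 \<le> s" "s < 1"
  shows "continuous_map (prod_topology (subtopology PP (sq S0)) (top_of_set {0..1})) (prod_topology X X) (shrink_pair s)"
proof -
  let ?T = "prod_topology (subtopology PP (sq S0)) (top_of_set {0..1::real})"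
  have ct: "continuous_map ?T euclideanreal snd"
    using continuous_map_snd[of "subtopology PP (sq S0)" "top_of_set {0..1::real}"]
    by (auto simp: continuous_map_in_subtopology)
  have pr: "continuous_map PP (powertop_real UNIV) fst" "continuous_map PP (powertop_real UNIV) snd"
    by (rule continuous_map_fst continuous_map_snd)+
  have cf: "continuous_map ?T euclideanreal (\<lambda>zt. g (fst zt) u)" if g: "continuous_map PP (powertop_real UNIV) g"
    for g :: "_ \<Rightarrow> (nat \<times> nat \<Rightarrow> real)" and u
  proof -
    have "continuous_map PP euclideanreal (\<lambda>z. g z u)"
      using continuous_map_compose[OF g continuous_map_product_projection[of u UNIV "\<lambda>_. euclideanreal"]] by (simp add: o_def)
    then show ?thesis
      using continuous_map_compose[OF continuous_map_fst continuous_map_from_subtopology] by (auto simp: o_def)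
  qed
  have ts: "0 \<le> t * s" "t * s \<le> 1" if "0 \<le> t" "t \<le> 1" for t
    using assms that by (auto simp: mult_le_one)
  have c: "continuous_map ?T X (\<lambda>zt. f (shrink v0 (snd zt * s) (g (fst zt))))"
    if g: "continuous_map PP (powertop_real UNIV) g" "g ` sq S0 \<subseteq> S0" for g
  proof -
    have "continuous_map ?T (powertop_real UNIV) (\<lambda>zt. shrink v0 (snd zt * s) (g (fst zt)))"
      unfolding continuous_map_componentwise_UNIV shrink_def using ct cf[OF g(1)] by (auto intro!: continuous_intros)
    moreover have "shrink v0 (snd zt * s) (g (fst zt)) \<in> R" if "zt \<in> topspace ?T" for zt
      using that g(2) shrink_S0 ts S0_R by (auto simp: image_subset_iff)
    ultimately have "continuous_map ?T (subtopology (powertop_real UNIV) R) (\<lambda>zt. shrink v0 (snd zt * s) (g (fst zt)))"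
      by (auto simp: continuous_map_in_subtopology)
    from continuous_map_compose[OF this cont] show ?thesis by (simp add: o_def)
  qed
  have "fst ` sq S0 \<subseteq> S0" "snd ` sq S0 \<subseteq> S0" by (auto simp: sq_def)
  then show ?thesis unfolding shrink_pair_def case_prod_unfold
    by (intro continuous_map_pairedI c pr)
qed

lemma relcyc_zO:
  assumes ts: "\<forall>t\<in>set ts. triple N t" "length ts = k"
  shows "relcyc (2 * k) PP (sq S0) (od S0) (pc k k (zO v0 ts))"
proof -
  let ?face = "face_in {\<sigma> \<in> join_power N k. v0 \<in> \<sigma>}"
  have "pall (\<lambda>l l'. set l \<inter> set l' = {} \<and> lay N k l \<and> lay N k l') (zc (map hx ts))"
  proof -
    have M: "(a, a) \<notin> Poly_Mapping.keys A" "Poly_Mapping.keys A \<subseteq> {1..N} \<times> {1..N}" if A: "A \<in> set (map hx ts)" for A a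
    proof -
      obtain t where "A = hx t" "triple N t" using A ts by auto
      then show "(a, a) \<notin> Poly_Mapping.keys A" "Poly_Mapping.keys A \<subseteq> {1..N} \<times> {1..N}" using triple_hx by blast+
    qed
    show ?thesis using disjoint_zc[of "map hx ts" N, OF M] ts(2) by simp
  qed
  note Z = this
  have L: "length l = k" "?face l" "?face (v0 # l)" "v0 \<notin> set l" if "lay N k l" for l
    using lay_length[OF that] lay_face[OF that, of k 1] lay_notin[OF that] N by auto
  have z: "pdim k k (zO v0 ts)" "pall (\<lambda>l l'. ?face l \<and> ?face l') (zO v0 ts)"
    unfolding zO_def by (intro pall_fx pall_fy pall_mono[OF Z]; use L in simp)+
  have d: "d1 (zO v0 ts) = fy v0 (zc (map hx ts))" "d2 (zO v0 ts) = fx v0 (zc (map hx ts))"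
    by (simp_all add: zO_def d1_fx d1_fy d2_fx d2_fy d_zc_hx pchain_add)
  have a: "pdim (k - Suc 0) k (d1 (zO v0 ts))" "pall (\<lambda>l l'. ?face l \<and> ?face l') (d1 (zO v0 ts))" "pall (\<lambda>l l'. set l \<inter> set l' = {}) (d1 (zO v0 ts))"
    unfolding d using k by (intro pall_fx pall_fy pall_mono[OF Z]; use L in simp)+
  have b: "pdim k (k - Suc 0) (d2 (zO v0 ts))" "pall (\<lambda>l l'. ?face l \<and> ?face l') (d2 (zO v0 ts))" "pall (\<lambda>l l'. set l \<inter> set l' = {}) (d2 (zO v0 ts))"
    unfolding d using k by (intro pall_fx pall_fy pall_mono[OF Z]; use L in simp)+
  have "k - Suc 0 + k = 2 * k - Suc 0" "k + (k - Suc 0) = 2 * k - Suc 0" using k by auto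
  then have "ch (2 * k - Suc 0) (subtopology PP (od S0)) (bd (2 * k) (pc k k (zO v0 ts)))"
    using bd_pc[OF z(1)] ch_pc_disjoint[OF a] ch_pc_disjoint[OF b] k by (simp add: mult_2 ch_add)
  then show ?thesis unfolding relcyc_def using ch_pc[OF z] by (simp add: mult_2)
qed

text \<open>The star of \<open>v0\<close> is contracted until its image lies in \<open>W\<close>.
  There the difference of chart coordinates is an odd map and \<open>local_intersection\<close>
  applies. The contraction stops short of \<open>v0\<close>, so distinct points stay distinct
  throughout.\<close>

lemma theta_zO:
  assumes ts: "\<forall>t\<in>set ts. triple N t" "length ts = k"
  shows "theta (2 * k) X V (im (zO v0 ts)) = 1"
proof -
  let ?o = "\<lambda>u. if u = v0 then 1 else (0::real)"
  obtain U \<phi> a b where box: "chart_box (2 * k) X U \<phi> W a b" using W(1) unfolding good_def by blast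
  have "openin (subtopology (powertop_real UNIV) R) {x \<in> topspace (subtopology (powertop_real UNIV) R). f x \<in> W}"
    using good_open[OF W(1)] by (rule openin_continuous_map_preimage[OF cont])
  then obtain T where T: "openin (powertop_real UNIV) T" "{x \<in> R. f x \<in> W} = T \<inter> R" unfolding openin_subtopology by auto
  have "?o \<in> {x \<in> R. f x \<in> W}" using W(3) v0_in S0_R by auto
  then have "?o \<in> T" using T(2) by blast
  then obtain e where e: "e > 0" "\<And>y. (\<And>i. \<bar>y i - ?o i\<bar> < e) \<Longrightarrow> y \<in> T" using PT_neighbourhood[OF T(1)] by blast
  \<comment> \<open>Coordinates of points in the star differ from those of \<open>v0\<close> by at
    most 1, after contraction by at most \<open>1 - s < e\<close>; the bound \<open>1 / 2\<close>
    keeps \<open>s\<close> nonnegative.\<close>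
  define s where "s = 1 - min (e / 2) (1 / 2)"
  have s: "0 \<le> s" "s < 1" "1 - s < e" using e(1) by (auto simp: s_def)
  have toW: "f (shrink v0 s x) \<in> W" if x: "x \<in> S0" for x
  proof -
    have "\<bar>shrink v0 s x i - ?o i\<bar> < e" for i
    proof -
      have "0 \<le> x i" "x i \<le> 1" using realization_bounds[of x "{\<sigma> \<in> join_power N k. v0 \<in> \<sigma>}" i] x join_power_finite by auto
      then have le: "\<bar>x i - ?o i\<bar> \<le> 1" by auto
      have "shrink v0 s x i - ?o i = (1 - s) * (x i - ?o i)" by (simp add: shrink_def algebra_simps)
      then have "\<bar>shrink v0 s x i - ?o i\<bar> = (1 - s) * \<bar>x i - ?o i\<bar>" using s(2) by (simp only: abs_mult)
      also have "\<dots> \<le> (1 - s) * 1" using le s(2) by (intro mult_left_mono) auto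
      also have "\<dots> < e" using s(3) by simp
      finally show ?thesis .
    qed
    then have "shrink v0 s x \<in> T \<inter> R" using e(2) shrink_S0[OF x s(1)] s(2) S0_R by fastforce
    then show ?thesis using T(2) by blast
  qed
  have ts1: "0 \<le> t * s" "t * s < 1" if "0 \<le> t" "t \<le> 1" for t
  proof -
    show "0 \<le> t * s" using s that by simp
    have "t * s \<le> 1 * s" using s that by (intro mult_right_mono) auto
    then show "t * s < 1" using s by simp
  qed
  have hV: "shrink_pair s (z, t) \<in> sq V" "z \<in> od S0 \<Longrightarrow> shrink_pair s (z, t) \<in> od V" if z: "z \<in> sq S0" and t: "0 \<le> t" "t \<le> 1" for z t
  proof -
    have r: "shrink v0 (t * s) (fst z) \<in> R" "shrink v0 (t * s) (snd z) \<in> R"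
      using z shrink_S0[of _ "t * s"] ts1[OF t] S0_R by (auto simp: sq_def)
    then show sqV: "shrink_pair s (z, t) \<in> sq V" using fV by (auto simp: shrink_pair_def sq_def)
    assume "z \<in> od S0"
    then have "fst z \<noteq> snd z" by (simp add: od_def)
    then have "shrink v0 (t * s) (fst z) \<noteq> shrink v0 (t * s) (snd z)" using shrink_inj ts1(2)[OF t] by metis
    then have "fst (shrink_pair s (z, t)) \<noteq> snd (shrink_pair s (z, t))" using r inj by (auto simp: shrink_pair_def inj_on_def)
    then show "shrink_pair s (z, t) \<in> od V" using sqV by (auto simp: od_def sq_def)
  qed
  let ?z = "pc k k (zO v0 ts)" and ?g = "\<lambda>z. shrink_pair s (z, 1)"
  note rz = relcyc_zO[OF ts]
  have hod: "shrink_pair s (z, t) \<in> od V" if "z \<in> od S0" "0 \<le> t" "t \<le> 1" for z t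
    using hV(2)[OF subsetD[OF od_subset that(1)]] that by blast
  have "rnV X V (2 * k) (cmap (2 * k) (\<lambda>z. shrink_pair s (z, 0)) ?z + cmap (2 * k) ?g ?z)"
    by (rule homotopy_relnull[OF continuous_shrink_pair[OF s(1,2)] rz od_subset _ hV(1) hod]) simp_all
  moreover have "(\<lambda>z. shrink_pair s (z, 0)) = map_prod f f"
    by (simp add: fun_eq_iff shrink_pair_def shrink_def)
  ultimately have null: "rnV X V (2 * k) (cmap (2 * k) ?g ?z + im (zO v0 ts))" by (simp add: im_def add.commute)
  have cg: "continuous_map (subtopology PP (sq S0)) (prod_topology X X) ?g"
  proof -
    have "continuous_map (subtopology PP (sq S0)) (prod_topology (subtopology PP (sq S0)) (top_of_set {0..1::real})) (\<lambda>z. (z, 1))"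
      by (intro continuous_map_pairedI) (auto simp: continuous_map_const)
    from continuous_map_compose[OF this continuous_shrink_pair[OF s(1,2)]] show ?thesis by (simp add: o_def)
  qed
  have gW: "?g ` sq S0 \<subseteq> sq W" "?g ` od S0 \<subseteq> od W"
  proof -
    show "?g ` sq S0 \<subseteq> sq W" using toW by (auto simp: shrink_pair_def sq_def)
    then show "?g ` od S0 \<subseteq> od W" using hV(2)[of _ 1] od_subset by (fastforce simp: od_def sq_def)
  qed
  have rc: "rcV X W (2 * k) (cmap (2 * k) ?g ?z)" using rz cg gW od_subset by (rule relcyc_cmap)
  interpret odd_map k N v0 S0 "dl \<phi> \<circ> ?g"
  proof
    have "continuous_map (subtopology PP (sq S0)) (subtopology (prod_topology X X) (sq W)) ?g"
      using cg gW(1) by (auto simp: continuous_map_in_subtopology)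
    from continuous_map_compose[OF this continuous_map_dl[OF chart_boxD(7)[OF box]]]
    show "continuous_map (subtopology PP (sq S0)) PT (dl \<phi> \<circ> ?g)" .
    show "(dl \<phi> \<circ> ?g) ` sq S0 \<subseteq> En (2 * k)" "(dl \<phi> \<circ> ?g) ` od S0 \<subseteq> Ep (2 * k)"
      using gW dl_in[OF box] by fastforce+
    show "(dl \<phi> \<circ> ?g) (prod.swap z) = (\<lambda>i. - (dl \<phi> \<circ> ?g) z i)" for z
      by (cases z) (simp add: dl_def shrink_pair_def)
  qed (use N in auto)
  have "\<not> rnV X W (2 * k) (cmap (2 * k) ?g ?z)"
  proof
    assume "rnV X W (2 * k) (cmap (2 * k) ?g ?z)"
    from cmap_dl(1)[OF box this] local_intersection[OF ts] show False
      by (simp add: Fc_def cmap_cmap mult_2)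
  qed
  then have "dg (2 * k) X V (cmap (2 * k) ?g ?z) 1" using dg_good[OF W(1,2) rc] by simp
  then have "dg (2 * k) X V (im (zO v0 ts)) 1" using null by (rule dg_relnull)
  then show ?thesis using V(1) by (intro thetaI)
qed

text \<open>Only the entry \<open>(1, 1)\<close> of \<open>dipole_matrix 0 1\<close> lets two
  simplices meet, and then exactly in \<open>v0\<close>. All other pairs are disjoint and contribute
  nothing.\<close>

lemma thom_one:
  assumes ts: "\<forall>t\<in>set ts. triple N t" "length ts = k"
  shows "thom (zc (dipole_matrix 0 1 # map hx ts)) = 1"
proof -
  define C :: matrix2 where "C = sgl (1, 3) + sgl (2, 1) + sgl (2, 3)"
  have "dipole_matrix 0 1 = sgl (1, 1) + C" by (simp add: dipole_matrix_eq C_def ac_simps numeral_2_eq_2 numeral_3_eq_3)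
  then have eq: "zc (dipole_matrix 0 1 # map hx ts) = zO v0 ts + zc (C # map hx ts)"
    by (simp only: zc_add(1)) (simp add: zO_def ts(2))
  have C: "Poly_Mapping.keys C \<subseteq> {1..N} \<times> {1..N}" "(x, x) \<notin> Poly_Mapping.keys C" for x
    using N by (auto simp: C_def keys_add_bit split: if_splits)
  have M: "Poly_Mapping.keys A \<subseteq> {1..N} \<times> {1..N}" "(x, x) \<notin> Poly_Mapping.keys A" if A: "A \<in> set (C # map hx ts)" for A x
  proof -
    consider "A = C" | t where "A = hx t" "triple N t" using A ts by auto
    then have "Poly_Mapping.keys A \<subseteq> {1..N} \<times> {1..N} \<and> (x, x) \<notin> Poly_Mapping.keys A"
      by cases (use C triple_hx in blast)+
    then show "Poly_Mapping.keys A \<subseteq> {1..N} \<times> {1..N}" "(x, x) \<notin> Poly_Mapping.keys A" by auto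
  qed
  have null: "rnV X V (2 * k) (im (zc (C # map hx ts)))" using ts(2) by (intro zc_disjoint M) simp
  have "cyc (zc (dipole_matrix 0 1 # map hx ts))"
  proof (rule zc_cyc)
    fix A assume "A \<in> set (dipole_matrix 0 1 # map hx ts)"
    then show "mat N A" using mat_dipole_matrix[of 0 N 1] mat_hx ts N by auto
  qed (use ts in simp)
  from theta_homologous[OF V cyc_rcV[OF this], of "im (zO v0 ts)"] null
  show ?thesis using theta_zO[OF ts] unfolding thom_def eq im_add by (simp add: ac_simps)
qed


subsection \<open>The form on pairs of matrices\<close>

definition hxs :: "matrix2 list" where
  "hxs = map hx (replicate (k - 1) (1, 2, 3))"

lemma triple_123: "triple N (1, 2, 3)"
  using N by (simp add: triple_def)

lemma mat_hxs: "A \<in> set hxs \<Longrightarrow> mat N A"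
  using mat_hx[OF triple_123] by (auto simp: hxs_def)

lemma cyc_pair: "mat N A \<Longrightarrow> mat N B \<Longrightarrow> cyc (zc (A # B # hxs))"
  using k mat_hxs by (intro zc_cyc) (auto simp: hxs_def)

definition matrix_form :: "matrix2 \<Rightarrow> matrix2 \<Rightarrow> bit" where
  "matrix_form A B = thom (zc (A # B # hxs))"

lemma matrix_form_add:
  assumes "mat N A" "mat N A'" "mat N B"
  shows "matrix_form (A + A') B = matrix_form A B + matrix_form A' B" "matrix_form B (A + A') = matrix_form B A + matrix_form B A'"
  unfolding matrix_form_def zc_add using assms by (intro thom_add cyc_pair; simp)+

lemma matrix_form_sw:
  assumes "mat N A" "mat N B" shows "matrix_form (sw A) (sw B) = matrix_form A B"
proof -
  have "map sw hxs = hxs" by (simp add: hxs_def hx(2))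
  then have "zc (sw A # sw B # hxs) = sw (zc (A # B # hxs))" by (simp only: sw_zc list.map)
  then show ?thesis unfolding matrix_form_def using thom_sw[OF cyc_pair[OF assms]] by simp
qed

lemma matrix_form_zero:
  assumes "mat N A" "mat N B" "\<And>x. (x, x) \<notin> Poly_Mapping.keys A" "\<And>x. (x, x) \<notin> Poly_Mapping.keys B"
  shows "matrix_form A B = 0"
proof -
  have M: "Poly_Mapping.keys C \<subseteq> {1..N} \<times> {1..N} \<and> (x, x) \<notin> Poly_Mapping.keys C" if C: "C \<in> set (A # B # hxs)" for C x
  proof -
    consider "C = A" | "C = B" | "C = hx (1, 2, 3)" using C by (auto simp: hxs_def)
    then show ?thesis by cases (use assms triple_hx[OF triple_123] in \<open>auto simp: mat_def\<close>)
  qed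
  have "rnV X V (2 * k) (im (zc (A # B # hxs)))"
    using M k by (intro zc_disjoint) (auto simp: hxs_def)
  then show ?thesis unfolding matrix_form_def thom_def by (rule theta_null[OF V(1)])
qed

text \<open>After adding \<open>dipole_matrix 0 1\<close> to both arguments all simplices are
  disjoint and the form is zero. Expanding bilinearly leaves a function of \<open>a\<close>,
  \<open>c\<close> plus a function of \<open>b\<close>, \<open>d\<close>.\<close>

lemma matrix_form_off:
  assumes "a + 2 \<le> N" "b + 2 \<le> N" "c + 2 \<le> N" "d + 2 \<le> N" "a \<noteq> c" "b \<noteq> d"
  shows "matrix_form (dipole_matrix a c) (dipole_matrix b d) = (matrix_form (dipole_matrix a c) (dipole_matrix 0 1) + matrix_form (dipole_matrix 0 1) (dipole_matrix 0 1)) + matrix_form (dipole_matrix 0 1) (dipole_matrix b d)"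
proof -
  have m: "mat N (dipole_matrix a c)" "mat N (dipole_matrix b d)" "mat N (dipole_matrix 0 1)" using assms N by (auto intro: mat_dipole_matrix)
  have "matrix_form (dipole_matrix a c + dipole_matrix 0 1) (dipole_matrix b d + dipole_matrix 0 1) = 0"
    by (intro matrix_form_zero mat_add m dipole_matrix_diagonal assms)
  then have "(matrix_form (dipole_matrix a c) (dipole_matrix b d) + matrix_form (dipole_matrix a c) (dipole_matrix 0 1)) + (matrix_form (dipole_matrix 0 1) (dipole_matrix b d) + matrix_form (dipole_matrix 0 1) (dipole_matrix 0 1)) = 0"
    using m by (simp only: matrix_form_add mat_add ac_simps)
  then show ?thesis
    by (cases "matrix_form (dipole_matrix a c) (dipole_matrix b d)"; cases "matrix_form (dipole_matrix a c) (dipole_matrix 0 1)"; cases "matrix_form (dipole_matrix 0 1) (dipole_matrix b d)"; cases "matrix_form (dipole_matrix 0 1) (dipole_matrix 0 1)") simp_all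
qed

text \<open>The symmetrised tensor is the hexagon on \<open>1\<close>, \<open>b + 2\<close>,
  \<open>d + 2\<close> by \<open>dipole_matrix_hx\<close>, so \<open>thom_one\<close> applies with
  this triple on line \<open>k\<close>.\<close>

lemma matrix_form_one:
  assumes "b + 2 \<le> N" "d + 2 \<le> N" "b \<noteq> d"
  shows "matrix_form (dipole_matrix 0 1) (dipole_matrix b d) + matrix_form (dipole_matrix 0 1) (dipole_matrix d b) = 1"
proof -
  have m: "mat N (dipole_matrix b d)" "mat N (dipole_matrix d b)" "mat N (dipole_matrix 0 1)" using assms N by (auto intro: mat_dipole_matrix)
  have "matrix_form (dipole_matrix 0 1) (dipole_matrix b d) + matrix_form (dipole_matrix 0 1) (dipole_matrix d b) = matrix_form (dipole_matrix 0 1) (hx (1, b + 2, d + 2))"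
    using matrix_form_add(2)[OF m] by (simp only: dipole_matrix_hx)
  also have "\<dots> = thom (zc (dipole_matrix 0 1 # map hx ((1, b + 2, d + 2) # replicate (k - 1) (1, 2, 3))))"
    by (simp only: matrix_form_def hxs_def list.map)
  also have "\<dots> = 1"
  proof (rule thom_one)
    have "triple N (1, b + 2, d + 2)" using assms by (simp add: triple_def)
    then show "\<forall>t\<in>set ((1, b + 2, d + 2) # replicate (k - 1) (1, 2, 3)). triple N t" using triple_123 by simp
  qed (use k in simp)
  finally show ?thesis .
qed

end

subsection \<open>Decomposition into products of cycles\<close>

text \<open>The fundamental cycle of a cross-polytope sphere, the join of the vertex pairs
  \<open>{1, a + 2}\<close>, one pair for each line.\<close>

primrec join_cycle :: "nat list \<Rightarrow> (nat \<times> nat) list \<Rightarrow>\<^sub>0 bit" where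
  "join_cycle [] = sgl []"
| "join_cycle (a # as) = lcone (Suc (length as), 1) (join_cycle as) + lcone (Suc (length as), a + 2) (join_cycle as)"

lemma lbd_join_cycle: "lext lbd (join_cycle as) = 0"
  by (induction as) (simp_all add: lext_add lbd_lcone ac_simps)

lemma lay_join_cycle: "(\<And>a. a \<in> set as \<Longrightarrow> a + 2 \<le> N) \<Longrightarrow> l \<in> Poly_Mapping.keys (join_cycle as) \<Longrightarrow> lay N (length as) l"
proof (induction as arbitrary: l)
  case (Cons a as)
  have "\<exists>l'\<in>Poly_Mapping.keys (join_cycle as). \<exists>b. b \<in> {1..N} \<and> l = (Suc (length as), b) # l'"
  proof -
    have "1 \<in> {1..N}" "a + 2 \<in> {1..N}" using Cons.prems(1)[of a] by auto
    moreover have "Poly_Mapping.keys (lcone v c) \<subseteq> (\<Union>x\<in>Poly_Mapping.keys c. {v # x})" for v :: "nat \<times> nat" and c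
      using keys_lext[of "\<lambda>l. sgl (v # l)" c] by (simp add: lcone_def)
    ultimately show ?thesis using Cons.prems(2) by (fastforce simp: keys_add_bit)
  qed
  then show ?case using Cons by (auto simp: lay_Suc)
qed simp

definition tens :: "('v list \<Rightarrow>\<^sub>0 bit) \<Rightarrow> ('v list \<Rightarrow>\<^sub>0 bit) \<Rightarrow> 'v pchain" where
  "tens c d = lext (\<lambda>l. lext (\<lambda>l'. sgl (l, l')) d) c"

lemma tens_add: "tens (a + b) d = tens a d + tens b d" "tens c (a + b) = tens c a + tens c b"
  by (simp_all add: tens_def lext_add lext_add_fun)

lemma tens_lcone: "tens (lcone v c) d = fx v (tens c d)" "tens c (lcone v d) = fy v (tens c d)"
  by (simp_all add: tens_def pchain_lext lext_lcone)

lemma zc_dipole_matrix: "length as = length bs \<Longrightarrow> zc (map2 dipole_matrix as bs) = tens (join_cycle as) (join_cycle bs)"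
proof (induction as bs rule: list_induct2)
  case (Cons a as b bs)
  then show ?case
    by (simp add: dipole_matrix_eq lext_add tens_add tens_lcone pchain_add fx_fy ac_simps)
qed (simp add: tens_def)

definition nb :: "bool \<Rightarrow> nat" where "nb b = (if b then 1 else 0)"

text \<open>Each \<open>hx (1, 2, 3)\<close> is a product tensor plus the one with its factors
  exchanged. The booleans record the choice on each line; applied to \<open>k - 1\<close> lines,
  this produces the factor \<open>2 ^ (k - 1)\<close>.\<close>

lemma zc_hx_sum: "zc (replicate j (hx (1, 2, 3))) =
   (\<Sum>bs\<in>{bs. length bs = j}. zc (map2 dipole_matrix (map nb bs) (map (\<lambda>b. nb (\<not> b)) bs)))"
proof (induction j)
  case (Suc j)
  let ?z = "\<lambda>bs. zc (map2 dipole_matrix (map nb bs) (map (\<lambda>b. nb (\<not> b)) bs))"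
  have hx: "hx (1, 2, 3) = dipole_matrix 0 1 + dipole_matrix 1 0" using dipole_matrix_hx[of 0 1] by (simp add: numeral_2_eq_2 numeral_3_eq_3)
  have lin: "zc (A # replicate j (hx (1, 2, 3))) = (\<Sum>bs\<in>{bs. length bs = j}. zc (A # map2 dipole_matrix (map nb bs) (map (\<lambda>b. nb (\<not> b)) bs)))" for A
  proof -
    define g where "g = (\<lambda>w. lext (\<lambda>(a, b). fx (Suc j, a) (fy (Suc j, b) w)) A)"
    have "g (sum h I) = (\<Sum>i\<in>I. g (h i))" for h :: "bool list \<Rightarrow> _" and I
      by (rule additive_sum) (simp_all add: g_def pchain_add lext_add_fun case_prod_unfold)
    then show ?thesis using Suc by (simp add: g_def[symmetric]) (simp add: g_def)
  qed
  have "{bs::bool list. length bs = Suc j} = (#) False ` {bs. length bs = j} \<union> (#) True ` {bs. length bs = j}"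
    by (auto simp: length_Suc_conv)
  then have "(\<Sum>bs\<in>{bs. length bs = Suc j}. ?z bs) = (\<Sum>bs\<in>(#) False ` {bs. length bs = j}. ?z bs) + (\<Sum>bs\<in>(#) True ` {bs. length bs = j}. ?z bs)"
    using finite_lists_length_eq[of "UNIV :: bool set" j] by (simp only:) (rule sum.union_disjoint, auto)
  also have "\<dots> = zc (dipole_matrix 0 1 # replicate j (hx (1, 2, 3))) + zc (dipole_matrix 1 0 # replicate j (hx (1, 2, 3)))"
    unfolding lin by (subst sum.reindex, simp, subst sum.reindex, simp) (simp add: nb_def del: zc.simps)
  also have "\<dots> = zc (replicate (Suc j) (hx (1, 2, 3)))"
    by (simp only: replicate_Suc hx zc_add(1)[symmetric])
  finally show ?case ..
qed (simp add: zc_dipole_matrix tens_def)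

lemma bd_sx:
  assumes "\<And>l. l \<in> Poly_Mapping.keys c \<Longrightarrow> length l = Suc (Suc m)"
  shows "bd (Suc m) (lext (\<lambda>l. sgl (sx l)) c) = lext (\<lambda>l. sgl (sx l)) (lext lbd c)"
proof -
  have "bd (Suc m) (lext (\<lambda>l. sgl (sx l)) c) = lext (\<lambda>l. \<Sum>i\<le>Suc m. sgl (singular_face (Suc m) i (sx l))) c"
    by (simp add: bd_lext lext_lext del: sum.atMost_Suc)
  also have "\<dots> = lext (\<lambda>l. \<Sum>i\<le>Suc m. sgl (sx (del i l))) c"
    by (intro lext_cong sum.cong) (auto simp: singular_face_sx assms)
  also have "\<dots> = lext (\<lambda>l. lext (\<lambda>l. sgl (sx l)) (lbd l)) c"
    by (intro lext_cong) (simp add: lbd_del lext_sum assms lessThan_Suc_atMost del: sum.atMost_Suc sum.lessThan_Suc)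
  finally show ?thesis by (simp add: lext_lext)
qed

definition join_image :: "((nat \<times> nat \<Rightarrow> real) \<Rightarrow> 'a) \<Rightarrow> nat list \<Rightarrow> 'a chain2" where
  "join_image f as = cmap (length as - 1) f (lext (\<lambda>l. sgl (sx l)) (join_cycle as))"

lemma join_image_cycle:
  assumes f: "continuous_map (subtopology (powertop_real UNIV) (geometric_realization (join_power N k))) X f"
    and as: "length as = Suc k" "\<And>a. a \<in> set as \<Longrightarrow> a + 2 \<le> N" and k: "k \<ge> 1"
  shows "join_image f as \<in> cycles2 k X"
proof -
  have face: "face_in (join_power N k) l \<and> length l = Suc k" if l: "l \<in> Poly_Mapping.keys (join_cycle as)" for l
  proof -
    have "lay N (Suc k) l" using lay_join_cycle[OF as(2) l] as(1) by simp
    moreover from this obtain a l' where "l = (Suc k, a) # l'" using lay_length[of N "Suc k" l] by (cases l) (auto simp: lay_Suc)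
    ultimately have "lay N k l'" "a \<in> {1..N}" "l = (Suc k, a) # l'" by (auto simp: lay_Suc)
    then show ?thesis using lay_face[of N k l' k a] lay_length[of N k l'] by auto
  qed
  let ?c = "lext (\<lambda>l. sgl (sx l)) (join_cycle as)"
  have "ch k (subtopology (powertop_real UNIV) (geometric_realization (join_power N k))) ?c"
    using singular_simplex_sx[OF conjunct1[OF face] conjunct2[OF face]] by (intro ch_lext) (simp add: ch_single)
  note c = this
  obtain m where m: "k = Suc m" using k by (cases k) auto
  have "bd k ?c = 0" using bd_sx[of "join_cycle as" m] face lbd_join_cycle m by simp
  then have "bd k (cmap k f ?c) = 0" using bd_cmap[OF c, of f] by simp
  then show ?thesis using ch_cmap[OF c f] as(1) by (simp add: cycles2_def join_image_def)
qed

context embedded_join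
begin

text \<open>After the expansion each summand is the cross product of a cycle depending on
  \<open>a\<close>, \<open>b\<close> and one depending on \<open>c\<close>, \<open>d\<close>. This
  is the source of the factorisation in \<open>rank_estimate\<close>.\<close>

lemma matrix_form_dipole:
  assumes "a + 2 \<le> N" "b + 2 \<le> N" "c + 2 \<le> N" "d + 2 \<le> N"
  shows "matrix_form (dipole_matrix a c) (dipole_matrix b d) = (\<Sum>bs\<in>{bs. length bs = k - 1}.
     theta (2 * k) X V (cross k k (join_image f (a # b # map nb bs)) (join_image f (c # d # map (\<lambda>b. nb (\<not> b)) bs))))"
proof -
  let ?Z = "\<lambda>bs. map2 dipole_matrix (a # b # map nb bs) (c # d # map (\<lambda>b. nb (\<not> b)) bs)"
  \<comment> \<open>Joining on the two top lines is additive in the chain below, so the expansion of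
    the lower lines passes through it.\<close>
  define g where "g = (\<lambda>w. lext (\<lambda>(x, y). fx (Suc k, x) (fy (Suc k, y) (lext (\<lambda>(x, y). fx (k, x) (fy (k, y) w)) (dipole_matrix b d)))) (dipole_matrix a c))"
  have g: "g (sum h I) = (\<Sum>i\<in>I. g (h i))" for h :: "bool list \<Rightarrow> _" and I
    by (rule additive_sum) (simp_all add: g_def pchain_add lext_add_fun case_prod_unfold)
  have "hxs = replicate (k - 1) (hx (1, 2, 3))" by (simp add: hxs_def)
  then have "zc (dipole_matrix a c # dipole_matrix b d # hxs) = g (zc (replicate (k - 1) (hx (1, 2, 3))))" using k by (simp add: g_def)
  also have "\<dots> = (\<Sum>bs\<in>{bs. length bs = k - 1}. zc (?Z bs))"
    unfolding zc_hx_sum g using k by (intro sum.cong refl) (simp add: g_def)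
  finally have eq: "zc (dipole_matrix a c # dipole_matrix b d # hxs) = (\<Sum>bs\<in>{bs. length bs = k - 1}. zc (?Z bs))" .
  have im_sum: "im (sum h I) = (\<Sum>i\<in>I. im (h i))" for h :: "bool list \<Rightarrow> _" and I
    by (rule additive_sum[of im], rule im_add) (simp add: im_def)
  have "cyc (zc (?Z bs))" if "length bs = k - 1" for bs
  proof (rule zc_cyc)
    fix A assume "A \<in> set (?Z bs)"
    then have "A \<in> (\<lambda>(x, y). dipole_matrix x y) ` set (zip (a # b # map nb bs) (c # d # map (\<lambda>b. nb (\<not> b)) bs))"
      by (simp only: set_map)
    then obtain x y where xy: "A = dipole_matrix x y" "(x, y) \<in> set (zip (a # b # map nb bs) (c # d # map (\<lambda>b. nb (\<not> b)) bs))"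
      by (elim imageE) (simp only: case_prod_unfold, metis prod.collapse)
    note xy = xy(1) set_zip_leftD[OF xy(2)] set_zip_rightD[OF xy(2)]
    then have "x + 2 \<le> N" "y + 2 \<le> N" using assms N by (auto simp: nb_def)
    then show "mat N A" unfolding xy(1) by (rule mat_dipole_matrix)
  qed (use that k in simp)
  then have "matrix_form (dipole_matrix a c) (dipole_matrix b d) = (\<Sum>bs\<in>{bs. length bs = k - 1}. theta (2 * k) X V (im (zc (?Z bs))))"
    unfolding matrix_form_def thom_def eq im_sum by (intro theta_sum V cyc_rcV) auto
  also have "\<dots> = (\<Sum>bs\<in>{bs. length bs = k - 1}.
     theta (2 * k) X V (cross k k (join_image f (a # b # map nb bs)) (join_image f (c # d # map (\<lambda>b. nb (\<not> b)) bs))))"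
  proof (intro sum.cong refl)
    fix bs :: "bool list" assume "bs \<in> {bs. length bs = k - 1}"
    then have len: "Suc (length bs) = k" using k by simp
    have "zc (?Z bs) = tens (join_cycle (a # b # map nb bs)) (join_cycle (c # d # map (\<lambda>b. nb (\<not> b)) bs))"
      by (rule zc_dipole_matrix) simp
    then have "im (zc (?Z bs)) = cross k k (join_image f (a # b # map nb bs)) (join_image f (c # d # map (\<lambda>b. nb (\<not> b)) bs))"
      unfolding im_def join_image_def tens_def using len by (simp only:) (simp only: pc_pairs cross_cmap[symmetric] mult_2 length_Cons length_map diff_Suc_1)
    then show "theta (2 * k) X V (im (zc (?Z bs))) = theta (2 * k) X V (cross k k (join_image f (a # b # map nb bs)) (join_image f (c # d # map (\<lambda>b. nb (\<not> b)) bs)))"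
      by simp
  qed
  finally show ?thesis .
qed

end

section \<open>The Betti number\<close>

lemma scale2_simps [simp]: "scale2 0 c = 0" "scale2 1 c = c"
  by (rule poly_mapping_eqI, simp add: scale2_def Poly_Mapping.map.rep_eq when_def)+

text \<open>A maximal independent subset of \<open>C\<close> works. The chains \<open>E\<close> are
  kept explicitly, because the set carrying the Thom class must later contain them.\<close>

lemma independent_spanning:
  assumes C: "finite C" "C \<subseteq> cycles2 k X"
  obtains S where "S \<subseteq> C" "homology_independent2 k X S"
    "\<forall>c\<in>C. \<exists>p E. ch (Suc k) X E \<and> c = (\<Sum>s\<in>S. scale2 (p s) s) + bd (Suc k) E"
proof -
  let ?I = "{S. S \<subseteq> C \<and> homology_independent2 k X S}"
  have "{} \<in> ?I" by (simp add: homology_independent2_def)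
  moreover have "\<forall>S'. S' \<in> ?I \<longrightarrow> card S' < Suc (card C)" using C(1) by (auto simp: less_Suc_eq_le intro: card_mono)
  ultimately have "\<exists>S. S \<in> ?I \<and> (\<forall>S'. S' \<in> ?I \<longrightarrow> card S' \<le> card S)" by (rule ex_has_greatest_nat)
  then obtain S where S: "S \<in> ?I" "\<And>S'. S' \<in> ?I \<Longrightarrow> card S' \<le> card S" by blast
  have fS: "finite S" using S(1) C(1) finite_subset by blast
  have "\<exists>p E. ch (Suc k) X E \<and> c = (\<Sum>s\<in>S. scale2 (p s) s) + bd (Suc k) E" if c: "c \<in> C" for c
  proof (cases "c \<in> S")
    case True
    have "(\<Sum>s\<in>S. scale2 (if s = c then 1 else 0) s) = (\<Sum>s\<in>S. if s = c then c else 0)"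
      by (intro sum.cong) auto
    also have "\<dots> = c" using True fS by simp
    finally show ?thesis by (intro exI[of _ "\<lambda>s. if s = c then 1 else 0"] exI[of _ 0]) simp
  next
    case False
    then have "card (insert c S) > card S" using fS by simp
    then have "insert c S \<notin> ?I" using S(2)[of "insert c S"] by (metis not_le)
    then have "\<not> homology_independent2 k X (insert c S)" using S(1) c by blast
    then obtain u where u: "(\<Sum>s\<in>insert c S. scale2 (u s) s) \<in> boundaries2 k X" "\<exists>s\<in>insert c S. u s \<noteq> 0"
    proof -
      have "insert c S \<subseteq> cycles2 k X" using C(2) c S(1) by blast
      then have "\<exists>u. (\<Sum>s\<in>insert c S. scale2 (u s) s) \<in> boundaries2 k X \<and> \<not> (\<forall>s\<in>insert c S. u s = 0)"
        using \<open>\<not> homology_independent2 k X (insert c S)\<close> unfolding homology_independent2_def by meson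
      then show thesis using that by meson
    qed
    have u': "scale2 (u c) c + (\<Sum>s\<in>S. scale2 (u s) s) \<in> boundaries2 k X" using u(1) False fS by simp
    have "u c \<noteq> 0"
    proof
      assume "u c = 0"
      then have "(\<Sum>s\<in>S. scale2 (u s) s) \<in> boundaries2 k X" using u' by simp
      then have "\<forall>s\<in>S. u s = 0" using S(1) unfolding homology_independent2_def by blast
      then show False using u(2) \<open>u c = 0\<close> by blast
    qed
    then have "c + (\<Sum>s\<in>S. scale2 (u s) s) \<in> boundaries2 k X" using u' by simp
    then obtain E where E: "ch (Suc k) X E" "c + (\<Sum>s\<in>S. scale2 (u s) s) = bd (Suc k) E" by (auto simp: boundaries2_def)
    have "c = (\<Sum>s\<in>S. scale2 (u s) s) + bd (Suc k) E" unfolding E(2)[symmetric] by (simp add: ac_simps)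
    with E(1) show ?thesis by blast
  qed
  with S(1) show thesis by (intro that[of S]) simp_all
qed

lemma cross_cycles:
  assumes c: "c \<in> cycles2 k (subtopology X V)" and d: "d \<in> cycles2 k (subtopology X V)"
  shows "rcV X V (2 * k) (cross k k c d)"
proof -
  have "ch (k + k) (prod_topology (subtopology X V) (subtopology X V)) (cross k k c d)"
    using c d by (intro ch_cross) (auto simp: cycles2_def)
  moreover have "bd (k + k) (cross k k c d) = 0" using c d by (simp add: bd_cross cycles2_def)
  ultimately show ?thesis by (simp add: relcyc_def mult_2 sq_def subtopology_Times)
qed

lemma cross_boundary:
  assumes E: "ch (Suc k) (subtopology X V) E" and d: "d \<in> cycles2 k (subtopology X V)"
  shows "rnV X V (2 * k) (cross k k (bd (Suc k) E) d)"
proof -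
  have "ch (Suc k + k) (prod_topology (subtopology X V) (subtopology X V)) (cross (Suc k) k E d)"
    using E d by (intro ch_cross) (auto simp: cycles2_def)
  moreover have "bd (Suc k + k) (cross (Suc k) k E d) = cross k k (bd (Suc k) E) d"
    using d bd_cross[of "Suc k" k E d] by (simp add: cycles2_def)
  ultimately show ?thesis
    using relnull_bd[of "k + k" "prod_topology X X" "sq V" "cross (Suc k) k E d"]
    by (simp add: mult_2 sq_def subtopology_Times)
qed

lemma theta_combination:
  assumes V: "thom_unique (2 * k) X V" "thom_exists (2 * k) X V" and S: "\<And>s. s \<in> S \<Longrightarrow> s \<in> cycles2 k (subtopology X V)"
    and d: "d \<in> cycles2 k (subtopology X V)" and E: "ch (Suc k) (subtopology X V) E"
  shows "theta (2 * k) X V (cross k k ((\<Sum>s\<in>S. scale2 (p s) s) + bd (Suc k) E) d)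
      = (\<Sum>s\<in>S. p s * theta (2 * k) X V (cross k k s d))"
proof -
  have sc: "theta (2 * k) X V (cross k k (scale2 b s) d) = b * theta (2 * k) X V (cross k k s d)" for b s
    using theta_null[OF V(1) relnull_0] by (cases b) simp_all
  have rc: "rcV X V (2 * k) (cross k k (scale2 b s) d)" if "s \<in> S" for b s
    using cross_cycles[OF S[OF that] d] by (cases b) simp_all
  have eq: "cross k k ((\<Sum>s\<in>S. scale2 (p s) s) + bd (Suc k) E) d
      = (\<Sum>s\<in>S. cross k k (scale2 (p s) s) d) + cross k k (bd (Suc k) E) d"
    by (simp add: cross_add1 cross_sum1)
  have "theta (2 * k) X V (cross k k ((\<Sum>s\<in>S. scale2 (p s) s) + bd (Suc k) E) d)
      = theta (2 * k) X V (\<Sum>s\<in>S. cross k k (scale2 (p s) s) d)"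
    unfolding eq using V
  proof (rule theta_homologous)
    show "rcV X V (2 * k) (\<Sum>s\<in>S. cross k k (scale2 (p s) s) d)" using rc by (rule relcyc_sum)
    show "rnV X V (2 * k) ((\<Sum>s\<in>S. cross k k (scale2 (p s) s) d) + ((\<Sum>s\<in>S. cross k k (scale2 (p s) s) d) + cross k k (bd (Suc k) E) d))"
      using cross_boundary[OF E d] by (simp only: chain2_add_self_left)
  qed
  also have "\<dots> = (\<Sum>s\<in>S. theta (2 * k) X V (cross k k (scale2 (p s) s) d))"
    using V rc by (intro theta_sum)
  finally show ?thesis by (simp add: sc)
qed

section \<open>Covering compact sets by good sets, and the final estimate\<close>

lemma good_neighbourhood:
  assumes X: "PL_manifold n X \<A>" and p: "p \<in> topspace X"
  obtains W where "good n X W" "p \<in> W"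
proof -
  obtain U \<phi> where U: "(U, \<phi>) \<in> \<A>" "p \<in> U" using X p unfolding PL_manifold_def by blast
  then have c: "is_chart n X (U, \<phi>)" using X unfolding PL_manifold_def by blast
  obtain e where e: "hbox n (\<lambda>i. \<phi> p i - e) (\<lambda>i. \<phi> p i + e) \<subseteq> \<phi> ` U" "\<phi> p \<in> hbox n (\<lambda>i. \<phi> p i - e) (\<lambda>i. \<phi> p i + e)"
    using half_space_box[OF is_chartD(4)[OF c], of "\<phi> p"] U(2) by blast
  then have "chart_box n X U \<phi> {q \<in> U. \<phi> q \<in> hbox n (\<lambda>i. \<phi> p i - e) (\<lambda>i. \<phi> p i + e)} (\<lambda>i. \<phi> p i - e) (\<lambda>i. \<phi> p i + e)"
    using chart_box_of[OF c] by blast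
  then show thesis using that U(2) e(2) unfolding good_def by blast
qed

lemma good_cover:
  assumes X: "PL_manifold n X \<A>" and K: "compactin X K"
  obtains F where "finite F" "\<And>W. W \<in> F \<Longrightarrow> good n X W" "K \<subseteq> \<Union>F"
proof -
  have o: "\<forall>W\<in>{W. good n X W}. openin X W" using good_open by blast
  have "K \<subseteq> \<Union>{W. good n X W}"
    using compactin_subset_topspace[OF K] good_neighbourhood[OF X] by blast
  with o K obtain F where "finite F" "F \<subseteq> {W. good n X W}" "K \<subseteq> \<Union>F" unfolding compactin_def by metis
  then show thesis using that by blast
qed

lemma compactin_realization:
  "compactin (powertop_real UNIV) (geometric_realization (join_power N k))"
proof -
  let ?L = "{l. set l \<subseteq> {1..k + 1} \<times> {1..N} \<and> length l = k + 1} \<inter> {l. face_in (join_power N k) l}"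
  have eq: "geometric_realization (join_power N k) = (\<Union>l\<in>?L. sx l ` standard_simplex k)"
  proof (intro equalityI subsetI)
    fix x assume "x \<in> geometric_realization (join_power N k)"
    then obtain \<sigma> where \<sigma>: "\<sigma> \<in> join_power N k" "\<forall>v\<in>\<sigma>. 0 \<le> x v" "\<forall>v. v \<notin> \<sigma> \<longrightarrow> x v = 0" "(\<Sum>v\<in>\<sigma>. x v) = 1"
      unfolding geometric_realization_def by blast
    then obtain a where a: "a \<in> {1..k + 1} \<rightarrow> {1..N}" "\<sigma> \<subseteq> (\<lambda>i. (i, a i)) ` {1..k + 1}" unfolding join_power_def by blast
    define l where "l = map (\<lambda>i. (i, a i)) [1..<k + 2]"
    define u where "u = (\<lambda>j. if j \<le> k then x (Suc j, a (Suc j)) else 0)"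
    have setl: "set l = (\<lambda>i. (i, a i)) ` {1..k + 1}"
      unfolding l_def set_map set_upt by (intro image_cong) auto
    have len: "length l = k + 1" by (simp add: l_def)
    have nth: "l ! j = (Suc j, a (Suc j))" if "j \<le> k" for j using that by (simp add: l_def nth_append del: upt_Suc)
    have face: "(\<lambda>i. (i, a i)) ` {1..k + 1} \<in> join_power N k" unfolding join_power_def using a(1) by auto
    have x01: "0 \<le> x v" "x v \<le> 1" for v
      using realization_bounds[of x "join_power N k" v] \<open>x \<in> _\<close> join_power_finite by auto
    have "(\<Sum>v\<in>(\<lambda>i. (i, a i)) ` {1..k + 1}. x v) = (\<Sum>v\<in>\<sigma>. x v)"
      using a(2) \<sigma>(3) by (intro sum.mono_neutral_right) auto
    then have "(\<Sum>i\<in>{1..k + 1}. x (i, a i)) = 1" using \<sigma>(4) by (subst (asm) sum.reindex) (auto simp: inj_on_def)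
    then have "(\<Sum>j\<le>k. u j) = 1" unfolding u_def using sum.shift_bounds_cl_Suc_ivl[of "\<lambda>i. x (i, a i)" 0 k]
      by (simp add: atMost_atLeast0)
    then have u: "u \<in> standard_simplex k" using x01 by (auto simp: standard_simplex_def u_def)
    have "vm l u = x"
    proof
      fix v
      show "vm l u v = x v"
      proof (cases "v \<in> set l")
        case True
        then obtain i where i: "i \<le> k" "v = (Suc i, a (Suc i))" unfolding setl by (auto simp: Suc_le_eq gr0_conv_Suc)
        have "vm l u v = (\<Sum>j<k + 1. if j = i then u j else 0)"
          unfolding vm_def len by (intro sum.cong) (auto simp: nth i)
        then show ?thesis using i by (simp add: u_def)
      next
        case False
        then have "vm l u v = 0" unfolding vm_def by (intro sum.neutral) (use nth_mem in force)
        then show ?thesis using False \<sigma>(3) a(2) unfolding setl by (metis subsetD)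
      qed
    qed
    then have "x \<in> sx l ` standard_simplex k" using u len by (intro image_eqI[of _ _ u]) (auto simp: sx_def)
    moreover have "l \<in> ?L" using a(1) face setl len by (auto intro!: bexI[of _ "(\<lambda>i. (i, a i)) ` {1..k + 1}"])
    ultimately show "x \<in> (\<Union>l\<in>?L. sx l ` standard_simplex k)" by blast
  next
    fix x assume "x \<in> (\<Union>l\<in>?L. sx l ` standard_simplex k)"
    then obtain l where "face_in (join_power N k) l" "length l = Suc k" "x \<in> sx l ` standard_simplex k" by auto
    then show "x \<in> geometric_realization (join_power N k)"
      using singular_simplex_sx[of "join_power N k" l k] by (auto simp: singular_simplex_subtopology)
  qed
  have "finite ?L" using finite_lists_length_eq[of "{1..k + 1} \<times> {1..N}" "k + 1"] by simp
  moreover have "compactin (powertop_real UNIV) (sx l ` standard_simplex k)" if "l \<in> ?L" for l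
    using that singular_simplex_sx[of "join_power N k" l k]
    by (intro compactin_singular_simplex) (simp add: singular_simplex_subtopology)
  ultimately show ?thesis unfolding eq by (intro compactin_Union) blast+
qed

text \<open>The classes of the embedded spheres span a space of dimension \<open>card S\<close> in
  the homology of \<open>X\<close>. Factoring the form through this span bounds its rank, and
  \<open>rank_estimate\<close> with \<open>m = N - 1\<close> gives the inequality.\<close>

theorem independent_cycles:
  assumes X: "PL_manifold (2 * k) X \<A>" and emb: "PL_embeds (join_power N k) X \<A>" and k: "k \<ge> 1" and N: "N \<ge> 3"
  obtains S where "finite S" "homology_independent2 k X S" "(N - 1) * (N - 1) \<le> 2 ^ k * card S + 2 * (N - 1)"
proof -
  let ?K = "subtopology (powertop_real UNIV) (geometric_realization (join_power N k))"
  obtain f where f: "embedding_map ?K X f" using emb unfolding PL_embeds_def PL_embedding_def by blast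
  then have hm: "homeomorphic_map ?K (subtopology X (f ` topspace ?K)) f" by (simp add: embedding_map_def)
  have cont: "continuous_map ?K X f"
    using homeomorphic_imp_continuous_map[OF hm] by (simp add: continuous_map_in_subtopology)
  have inj: "inj_on f (geometric_realization (join_power N k))"
    using homeomorphic_imp_injective_map[OF hm] by simp
  define C where "C = join_image f ` {as. set as \<subseteq> {..N - 2} \<and> length as = Suc k}"
  have fC: "finite C" unfolding C_def by (intro finite_imageI finite_lists_length_eq) simp
  have cyc: "c \<in> cycles2 k Y" if c: "c \<in> C" and Y: "continuous_map ?K Y f" for c Y
  proof -
    obtain as where as: "c = join_image f as" "set as \<subseteq> {..N - 2}" "length as = Suc k" using c by (auto simp: C_def)
    have "a + 2 \<le> N" if "a \<in> set as" for a using as(2) that N by fastforce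
    then show ?thesis unfolding as(1) using join_image_cycle[OF Y as(3)] k by blast
  qed
  then have CX: "C \<subseteq> cycles2 k X" using cont by blast
  obtain S where S: "S \<subseteq> C" "homology_independent2 k X S"
    and span: "\<forall>c\<in>C. \<exists>p E. ch (Suc k) X E \<and> c = (\<Sum>s\<in>S. scale2 (p s) s) + bd (Suc k) E"
    by (rule independent_spanning[OF fC CX])
  have fS: "finite S" using S(1) fC finite_subset by blast
  have "\<forall>c\<in>C. \<exists>g. ch (Suc k) X (snd g) \<and> c = (\<Sum>s\<in>S. scale2 (fst g s) s) + bd (Suc k) (snd g)"
    using span by simp
  then obtain g where g: "\<forall>c\<in>C. ch (Suc k) X (snd (g c)) \<and> c = (\<Sum>s\<in>S. scale2 (fst (g c) s) s) + bd (Suc k) (snd (g c))"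
    by (rule bchoice[THEN exE])
  define pp where "pp = (\<lambda>c. fst (g c))"
  define EE where "EE = (\<lambda>c. snd (g c))"
  have EX: "ch (Suc k) X (EE c)" and pE: "c = (\<Sum>s\<in>S. scale2 (pp c s) s) + bd (Suc k) (EE c)" if "c \<in> C" for c
    using g that unfolding pp_def EE_def by blast+
  \<comment> \<open>The supports of the chains \<open>EE c\<close> are included because relations
    that hold in \<open>X\<close> must persist in \<open>V\<close>, whose homology may be
    different.\<close>
  define K where "K = f ` geometric_realization (join_power N k) \<union>
     (\<Union>c\<in>C. \<Union>t\<in>Poly_Mapping.keys (EE c). t ` standard_simplex (Suc k))"
  have "compactin X K" unfolding K_def
  proof (rule compactin_Un)
    have "compactin ?K (geometric_realization (join_power N k))"
      using compactin_realization by (simp add: compactin_subtopology)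
    then show "compactin X (f ` geometric_realization (join_power N k))" using cont by (rule image_compactin)
    have "compactin X (t ` standard_simplex (Suc k))" if "c \<in> C" "t \<in> Poly_Mapping.keys (EE c)" for c t
      using compactin_singular_simplex[OF ch_keys[OF EX[OF that(1)] that(2)]] .
    then show "compactin X (\<Union>c\<in>C. \<Union>t\<in>Poly_Mapping.keys (EE c). t ` standard_simplex (Suc k))"
      using fC by (auto intro!: compactin_Union)
  qed
  then obtain F where F: "finite F" "\<And>W. W \<in> F \<Longrightarrow> good (2 * k) X W" "K \<subseteq> \<Union>F" by (rule good_cover[OF X]) blast
  define V where "V = \<Union>F"
  have "Hausdorff_space X" using X by (simp add: PL_manifold_def)
  then have V: "thom_exists (2 * k) X V" "thom_unique (2 * k) X V" unfolding V_def using thom_class[of X "2 * k" F] F k by auto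
  have fV: "f ` geometric_realization (join_power N k) \<subseteq> V" using F(3) by (auto simp: K_def V_def)
  let ?o = "\<lambda>u. if u = (Suc k, 1::nat) then 1 else (0::real)"
  have "?o \<in> geometric_realization (join_power N k)"
  proof -
    obtain \<sigma> where "\<sigma> \<in> join_power N k" "(Suc k, 1) \<in> \<sigma>" "finite \<sigma>" using lay_face[of N 0 "[]" k 1] N by auto
    then show ?thesis unfolding geometric_realization_def by (auto intro!: bexI[of _ \<sigma>])
  qed
  then have "f ?o \<in> V" using fV by blast
  then obtain W where W: "W \<in> F" "f ?o \<in> W" by (auto simp: V_def)
  interpret embedded_join k N X f V W
    using k N V cont inj fV W F(2) by unfold_locales (auto simp: V_def)
  have cV: "c \<in> cycles2 k (subtopology X V)" if "c \<in> C" for c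
    using that by (rule cyc) (use cont fV in \<open>auto simp: continuous_map_in_subtopology\<close>)
  have EV: "ch (Suc k) (subtopology X V) (EE c)" if "c \<in> C" for c
  proof -
    have "t ` standard_simplex (Suc k) \<subseteq> V" if "t \<in> Poly_Mapping.keys (EE c)" for t
    proof -
      have "t ` standard_simplex (Suc k) \<subseteq> K" using that \<open>c \<in> C\<close> unfolding K_def by blast
      then show ?thesis using F(3) unfolding V_def by blast
    qed
    then show ?thesis using EX[OF that] by (simp add: ch_subtopology)
  qed
  have comb: "theta (2 * k) X V (cross k k c d) = (\<Sum>s\<in>S. pp c s * theta (2 * k) X V (cross k k s d))" if "c \<in> C" "d \<in> C" for c d
  proof -
    have "s \<in> cycles2 k (subtopology X V)" if "s \<in> S" for s using that S(1) cV by blast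
    from theta_combination[OF V this cV[OF that(2)] EV[OF that(1)], of S "pp c"]
    show ?thesis unfolding pE[OF that(1), symmetric] .
  qed
  define B where "B = (\<lambda>(a, b) (c, d). matrix_form (dipole_matrix a c) (dipole_matrix b d))"
  \<comment> \<open>\<open>bs\<close> selects a term in the expansion of the symmetric tensors and
    \<open>s\<close> a basis class for the first factor, so \<open>L\<close> has
    \<open>2 ^ (k - 1) * card S\<close> elements.\<close>
  define L where "L = {bs::bool list. length bs = k - 1} \<times> S"
  define p where "p = (\<lambda>(bs, s) (a, b). pp (join_image f (a # b # map nb bs)) s)"
  define q where "q = (\<lambda>(bs, s) (c, d). theta (2 * k) X V (cross k k s (join_image f (c # d # map (\<lambda>b. nb (\<not> b)) bs))))"
  have le: "a + 2 \<le> N" if "a < N - 1" for a using that by simp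
  have inC: "join_image f (a # b # map g bs) \<in> C" if "a < N - 1" "b < N - 1" "length bs = k - 1" "\<And>x. g x \<le> 1" for a b g and bs :: "bool list"
  proof -
    have "g x \<le> N - 2" for x using that(4)[of x] N by linarith
    then have "set (a # b # map g bs) \<subseteq> {..N - 2}" "length (a # b # map g bs) = Suc k" using that k N by auto
    then show ?thesis unfolding C_def by blast
  qed
  have "(N - 1) * (N - 1) \<le> 2 * card L + 2 * (N - 1)"
  proof (rule rank_estimate[of L "N - 1" B "\<lambda>a c. matrix_form (dipole_matrix a c) (dipole_matrix 0 1) + matrix_form (dipole_matrix 0 1) (dipole_matrix 0 1)" "\<lambda>b d. matrix_form (dipole_matrix 0 1) (dipole_matrix b d)" p q])
    show "finite L" using finite_lists_length_eq[of "UNIV :: bool set" "k - 1"] fS by (simp add: L_def)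
    show "B (a, b) (c, d) = B (c, d) (a, b)" if "a < N - 1" "b < N - 1" "c < N - 1" "d < N - 1" for a b c d
      using matrix_form_sw[OF mat_dipole_matrix mat_dipole_matrix, of a c b d] le that by (simp add: B_def sw_dipole_matrix)
    show "B (a, b) (c, d) = matrix_form (dipole_matrix a c) (dipole_matrix 0 1) + matrix_form (dipole_matrix 0 1) (dipole_matrix 0 1) + matrix_form (dipole_matrix 0 1) (dipole_matrix b d)"
      if "a < N - 1" "b < N - 1" "c < N - 1" "d < N - 1" "a \<noteq> c" "b \<noteq> d" for a b c d
      unfolding B_def case_prod_conv using that by (intro matrix_form_off le)
    show "matrix_form (dipole_matrix 0 1) (dipole_matrix b d) + matrix_form (dipole_matrix 0 1) (dipole_matrix d b) = 1" if "b < N - 1" "d < N - 1" "b \<noteq> d" for b d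
      using that by (intro matrix_form_one le)
    show "B (a, b) (c, d) = (\<Sum>l\<in>L. p l (a, b) * q l (c, d))" if abcd: "a < N - 1" "b < N - 1" "c < N - 1" "d < N - 1" for a b c d
    proof -
      have "B (a, b) (c, d) = (\<Sum>bs\<in>{bs. length bs = k - 1}.
         theta (2 * k) X V (cross k k (join_image f (a # b # map nb bs)) (join_image f (c # d # map (\<lambda>b. nb (\<not> b)) bs))))"
        unfolding B_def case_prod_conv using abcd by (intro matrix_form_dipole le)
      also have "\<dots> = (\<Sum>bs\<in>{bs. length bs = k - 1}. \<Sum>s\<in>S. p (bs, s) (a, b) * q (bs, s) (c, d))"
        unfolding p_def q_def case_prod_conv
        by (intro sum.cong refl comb inC abcd) (auto simp: nb_def)
      also have "\<dots> = (\<Sum>l\<in>L. p l (a, b) * q l (c, d))"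
        unfolding L_def sum.cartesian_product by (intro sum.cong refl) auto
      finally show ?thesis .
    qed
  qed
  moreover have "2 * card L = 2 ^ k * card S"
  proof -
    have "card {bs::bool list. length bs = k - 1} = 2 ^ (k - 1)"
      using card_lists_length_eq[of "UNIV :: bool set" "k - 1"] by simp
    moreover have "(2::nat) ^ k = 2 * 2 ^ (k - 1)" using k by (cases k) auto
    ultimately show ?thesis by (simp add: L_def card_cartesian_product)
  qed
  ultimately show thesis using that[OF fS S(2)] by simp
qed

theorem betti_bound:
  assumes X: "PL_manifold (2 * k) X \<A>" "PL_embeds (join_power n k) X \<A>" and k: "k \<ge> 1" and n: "n \<ge> 4"
  shows "ereal ((real n - 3)\<^sup>2 / 2 ^ k) \<le> ereal_of_enat (betti2 k X)"
proof -
  obtain S where S: "finite S" "homology_independent2 k X S" "(n - 1) * (n - 1) \<le> 2 ^ k * card S + 2 * (n - 1)"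
    using independent_cycles[OF X k] n by auto
  have "real ((n - 1) * (n - 1)) \<le> real (2 ^ k * card S + 2 * (n - 1))" using S(3) by (simp only: of_nat_le_iff)
  then have "(real n - 1) * (real n - 1) \<le> 2 ^ k * real (card S) + 2 * (real n - 1)" using n by (simp add: of_nat_diff)
  \<comment> \<open>What is given away against \<open>(n - 1) * (n - 3)\<close> is
    \<open>2 * (n - 3)\<close>, which is nonnegative.\<close>
  moreover have "(real n - 3)\<^sup>2 = (real n - 1) * (real n - 1) - 2 * (real n - 1) - 2 * (real n - 3)"
    by (simp add: power2_eq_square algebra_simps)
  ultimately have "(real n - 3)\<^sup>2 \<le> 2 ^ k * real (card S)" using n by simp
  then have "(real n - 3)\<^sup>2 / 2 ^ k \<le> real (card S)" by (simp add: divide_le_eq mult.commute)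
  then have "ereal ((real n - 3)\<^sup>2 / 2 ^ k) \<le> ereal_of_enat (enat (card S))" by simp
  also have "\<dots> \<le> ereal_of_enat (betti2 k X)"
    unfolding ereal_of_enat_le_iff betti2_def using S(1,2) by (intro SUP_upper) auto
  finally show ?thesis .
qed

theorem theorem1p2:
  fixes k :: nat
  assumes "k \<ge> 1"
  shows "(\<forall>n\<ge>4. \<forall>(X :: 'a topology) \<A>.
            PL_manifold (2 * k) X \<A> \<and> PL_embeds (join_power n k) X \<A> \<longrightarrow>
            ereal_of_enat (betti2 k X) \<ge> ereal ((real n - 3)\<^sup>2 / 2 ^ k))
       \<and> (\<forall>\<epsilon>>0. \<forall>\<^sub>F n in sequentially. \<forall>(X :: 'a topology) \<A>.
            PL_manifold (2 * k) X \<A> \<and> PL_embeds (join_power n k) X \<A> \<longrightarrow>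
            ereal_of_enat (betti2 k X) \<ge> ereal ((1 - \<epsilon>) * ((real n)\<^sup>2 / 2 ^ k)))"
proof (intro conjI allI impI)
  fix n :: nat and X :: "'a topology" and \<A> assume "4 \<le> n" "PL_manifold (2 * k) X \<A> \<and> PL_embeds (join_power n k) X \<A>"
  then show "ereal ((real n - 3)\<^sup>2 / 2 ^ k) \<le> ereal_of_enat (betti2 k X)" using betti_bound assms by blast
next
  fix \<epsilon> :: real assume \<epsilon>: "\<epsilon> > 0"
  \<comment> \<open>The square of \<open>n - 3\<close> is at least \<open>n * n - 6 * n\<close>, and
    \<open>6 * n\<close> is at most \<open>\<epsilon> * n * n\<close> from
    \<open>6 / \<epsilon>\<close> on, for all \<open>X\<close> alike.\<close>
  have "\<forall>\<^sub>F n in sequentially. n \<ge> max 4 (nat \<lceil>6 / \<epsilon>\<rceil>)" by (rule eventually_ge_at_top)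
  then show "\<forall>\<^sub>F n in sequentially. \<forall>(X :: 'a topology) \<A>.
            PL_manifold (2 * k) X \<A> \<and> PL_embeds (join_power n k) X \<A> \<longrightarrow>
            ereal_of_enat (betti2 k X) \<ge> ereal ((1 - \<epsilon>) * ((real n)\<^sup>2 / 2 ^ k))"
  proof eventually_elim
    case (elim n)
    then have "6 / \<epsilon> \<le> real n" by linarith
    then have "6 \<le> \<epsilon> * real n" using \<epsilon> by (simp add: divide_le_eq mult.commute)
    then have "6 * real n \<le> (\<epsilon> * real n) * real n" by (intro mult_right_mono) auto
    then have "(1 - \<epsilon>) * (real n)\<^sup>2 \<le> (real n - 3)\<^sup>2" by (simp add: power2_eq_square algebra_simps)
    then have "(1 - \<epsilon>) * ((real n)\<^sup>2 / 2 ^ k) \<le> (real n - 3)\<^sup>2 / 2 ^ k" by (simp add: divide_right_mono)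
    then have le: "ereal ((1 - \<epsilon>) * ((real n)\<^sup>2 / 2 ^ k)) \<le> ereal ((real n - 3)\<^sup>2 / 2 ^ k)" by simp
    show ?case
    proof (intro allI impI)
      fix X :: "'a topology" and \<A> assume "PL_manifold (2 * k) X \<A> \<and> PL_embeds (join_power n k) X \<A>"
      then show "ereal ((1 - \<epsilon>) * ((real n)\<^sup>2 / 2 ^ k)) \<le> ereal_of_enat (betti2 k X)"
        using order_trans[OF le betti_bound] assms elim by auto
    qed
  qed
qed

end
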